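(* Let $V(B)$ be the Vervaat transform of standard Brownian motion $B=(B_t;0\le t\le1)$ started at $0$. For all $t\in[0,1]$, $$\mathbb{E}[V(B)_t]=\sqrt{\frac{8}{\pi}}\, (\sqrt{t}+\sqrt{1-t}-1)$$ and $$\mathbb{E}[V(B)_t^2]=3t+\frac{4-8t}{\pi} \arcsin\sqrt{t}-\frac{4}{\pi}\sqrt{t(1-t)}.$$
   Context: For a continuous $f:[0,1]\to\mathbb{R}$ with $f(0)=0$, let $\tau(f)$ be the first time at which the minimum of $f$ on $[0,1]$ is attained. The Vervaat transform of $f$ is $V(f)(t):=f(\tau(f)+t \bmod 1)+f(1)1_{\{t+\tau(f) \geq 1\}}-f(\tau(f))$, $t\in[0,1]$. *)

theory Defs
  imports "HOL-Probability.Probability"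
begin

(* Standard Brownian motion on [0,1] started at 0.  Start and path continuity are required on all
   of the sample space, so that every path lies in the domain of the Vervaat transform.
   Values B t with t outside [0,1] are unconstrained and never used.  The second parameter of
   normal_density is the standard deviation, so increments over [s,t] have variance t - s. *)
locale standard_brownian_motion = prob_space M for M :: "'a measure" +
  fixes B :: "real \<Rightarrow> 'a \<Rightarrow> real"
  assumes random_variable_B: "t \<in> {0..1} \<Longrightarrow> B t \<in> borel_measurable M"
    and start_at_0: "\<omega> \<in> space M \<Longrightarrow> B 0 \<omega> = 0"
    and normal_increments:
      "\<lbrakk>0 \<le> s; s < t; t \<le> 1\<rbrakk> \<Longrightarrow>
        distributed M lborel (\<lambda>\<omega>. B t \<omega> - B s \<omega>) (normal_density 0 (sqrt (t - s)))"
    and independent_increments: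
      "\<And>(n::nat) u. \<lbrakk>u ` {..n} \<subseteq> {0..1}; mono_on {..n} u\<rbrakk> \<Longrightarrow>
        indep_vars (\<lambda>_. borel) (\<lambda>i \<omega>. B (u (Suc i)) \<omega> - B (u i) \<omega>) {..<n}"
    and continuous_paths: "\<omega> \<in> space M \<Longrightarrow> continuous_on {0..1} (\<lambda>t. B t \<omega>)"

(* For f continuous on [0,1] the set of minimisers is nonempty and compact, so LEAST is attained. *)
definition first_argmin :: "(real \<Rightarrow> real) \<Rightarrow> real" where
  "first_argmin f = (LEAST t. t \<in> {0..1} \<and> (\<forall>s\<in>{0..1}. f t \<le> f s))"

definition vervaat :: "(real \<Rightarrow> real) \<Rightarrow> real \<Rightarrow> real" where
  "vervaat f t =
     f (frac (first_argmin f + t)) + f 1 * of_bool (t + first_argmin f \<ge> 1) - f (first_argmin f)"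

end

theory Submission imports Defs begin

text \<open>
  The Vervaat transform of a Brownian path is a limit of Vervaat transforms of Gaussian random walks, and
  for a walk both moments can be computed in closed form.  Let \<open>S\<close> be the walk obtained by sampling
  \<open>B\<close> at the times \<open>i / n\<close> and multiplying by \<open>sqrt n\<close>.  Almost surely the minimum of \<open>B\<close> is attained only
  once, the position of the minimum of \<open>S\<close> then converges to \<open>first_argmin\<close> after division by \<open>n\<close>, and
  \<open>vervaat B t\<close> is the limit of \<open>walk_vervaat n k S / sqrt n\<close> with \<open>k\<close> close to \<open>n * t\<close>: the sum of \<open>k\<close>
  consecutive steps of the walk, read cyclically from the position \<open>i\<close> of the minimum
  (\<open>walk_vervaat_tendsto\<close>).

  The walk has its minimum at \<open>i\<close> exactly when the walk after \<open>i\<close> and the time-reversed walk before \<open>i\<close>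
  both stay nonnegative, and these two are independent.  So everything reduces to expectations of a walk
  that stays nonnegative, that is, to iterates of the kernel \<open>half_step\<close>, one Gaussian step killed below
  zero (\<open>cone_integral\<close>).  Differentiation commutes with \<open>half_step\<close> up to a boundary term, the value at
  \<open>0\<close> times the Gaussian density.  Iterating this gives \<open>iter_ident_mult\<close>, which turns multiplication by
  the position of the walk into a finite sum over the numbers \<open>exc d\<close> (the density at \<open>0\<close> of the position at
  time \<open>d\<close>, on the event that the walk is nonnegative until then) and \<open>surv n\<close> (the probability that the walk is
  nonnegative up to time \<open>n\<close>).  In the sum over \<open>i\<close> the
  factors \<open>surv\<close> disappear, because \<open>surv i * surv (n - i)\<close> is the distribution of the position of the
  minimum and has total mass one.  What is left is a single sum over \<open>exc d\<close> for the mean and a double sum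
  over \<open>exc c * exc d\<close> for the second moment (\<open>sum_window_mean\<close>, \<open>sum_window_mean2_pairs\<close>).

  The numbers \<open>exc d\<close> are explicit: the expected depth of the walk is the sum of \<open>d * exc d\<close>, and rotating
  the steps cyclically shows that its \<open>d\<close>-th increment is the density \<open>1 / sqrt (2 * pi * d)\<close>
  (\<open>exc_Suc\<close>).  Hence \<open>exc d\<close> is \<open>d\<close> to the power \<open>- 3 / 2\<close> up to a constant, the sums are Riemann sums, and
  the two limits are integrals with elementary antiderivatives (\<open>walk_mean_limit\<close>,
  \<open>walk_second_moment_limit\<close>, \<open>pair_integrand_integral\<close>).

  Two facts about Brownian motion allow the passage to the limit.  The argmin is unique
  (\<open>AE_unique_argmin\<close>), because the difference of the minima over two separated intervals is the sum of the
  increment between the intervals and a variable independent of it, and a Gaussian increment has no atoms.  And the square of the supremum of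
  \<open>\<bar>B\<bar>\<close> is integrable (\<open>dominating_square\<close>), because the walk satisfies a bound of the right order,
  \<open>nn_integral_max_abs_le\<close>, which passes to the supremum along dyadic grids.  At \<open>t = 0\<close> and \<open>t = 1\<close> the
  transform is \<open>0\<close> and, almost surely, \<open>B 1\<close>.
\<close>

section \<open>One Gaussian step killed below zero\<close>

text \<open>
  A class of functions closed under everything that is done to them below, in particular under
  integration against Gaussian densities.
\<close>
definition exp_growth :: "(real \<Rightarrow> real) \<Rightarrow> bool" where
  "exp_growth f \<longleftrightarrow> f \<in> borel_measurable borel \<and> (\<exists>C a. \<forall>x. \<bar>f x\<bar> \<le> C * exp (a * \<bar>x\<bar>))"

lemma exp_growthI:
  assumes "f \<in> borel_measurable borel" "\<And>x. \<bar>f x\<bar> \<le> C * exp (a * \<bar>x\<bar>)"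
  shows "exp_growth f"
  using assms unfolding exp_growth_def by blast

lemma exp_growthE:
  assumes "exp_growth f"
  obtains C a where "f \<in> borel_measurable borel" "C \<ge> 0" "a \<ge> 0"
    "\<And>x. \<bar>f x\<bar> \<le> C * exp (a * \<bar>x\<bar>)"
proof -
  from assms obtain C a where f: "f \<in> borel_measurable borel"
    and *: "\<And>x. \<bar>f x\<bar> \<le> C * exp (a * \<bar>x\<bar>)" unfolding exp_growth_def by blast
  have "\<bar>f x\<bar> \<le> \<bar>C\<bar> * exp (\<bar>a\<bar> * \<bar>x\<bar>)" for x
  proof -
    have "C * exp (a * \<bar>x\<bar>) \<le> \<bar>C\<bar> * exp (\<bar>a\<bar> * \<bar>x\<bar>)"
      by (intro mult_mono) (auto intro!: mult_right_mono)
    with *[of x] show ?thesis by linarith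
  qed
  with f show thesis by (intro that[of "\<bar>C\<bar>" "\<bar>a\<bar>"]) auto
qed

lemma exp_growth_measurable[measurable_dest]: "exp_growth f \<Longrightarrow> f \<in> borel_measurable borel"
  by (simp add: exp_growth_def)

lemma exp_growth_const[simp, intro]: "exp_growth (\<lambda>_. c)"
  by (rule exp_growthI[where C="\<bar>c\<bar>" and a=0]) auto

lemma exp_growth_id[simp, intro]: "exp_growth (\<lambda>y. y)"
proof (rule exp_growthI[where C=1 and a=1])
  show "\<bar>x\<bar> \<le> 1 * exp (1 * \<bar>x\<bar>)" for x :: real
    using exp_ge_add_one_self[of "\<bar>x\<bar>"] unfolding mult_1 by linarith
qed auto

lemma exp_growth_add[intro]:
  assumes "exp_growth f" "exp_growth g" shows "exp_growth (\<lambda>y. f y + g y)"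
proof -
  obtain C a where f: "f \<in> borel_measurable borel" "C \<ge> 0" "a \<ge> 0" "\<And>x. \<bar>f x\<bar> \<le> C * exp (a * \<bar>x\<bar>)"
    using assms(1) by (rule exp_growthE) blast
  obtain D b where g: "g \<in> borel_measurable borel" "D \<ge> 0" "b \<ge> 0" "\<And>x. \<bar>g x\<bar> \<le> D * exp (b * \<bar>x\<bar>)"
    using assms(2) by (rule exp_growthE) blast
  show ?thesis
  proof (rule exp_growthI[where C="C+D" and a="a+b"])
    fix x
    have "C * exp (a * \<bar>x\<bar>) \<le> C * exp ((a+b) * \<bar>x\<bar>)" "D * exp (b * \<bar>x\<bar>) \<le> D * exp ((a+b) * \<bar>x\<bar>)"
      using f g by (auto intro!: mult_left_mono mult_right_mono)
    with f(4)[of x] g(4)[of x] show "\<bar>f x + g x\<bar> \<le> (C + D) * exp ((a + b) * \<bar>x\<bar>)"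
      unfolding distrib_right[of C D] by linarith
  qed (use f g in measurable)
qed

lemma exp_growth_mult[intro]:
  assumes "exp_growth f" "exp_growth g" shows "exp_growth (\<lambda>y. f y * g y)"
proof -
  obtain C a where f: "f \<in> borel_measurable borel" "C \<ge> 0" "a \<ge> 0" "\<And>x. \<bar>f x\<bar> \<le> C * exp (a * \<bar>x\<bar>)"
    using assms(1) by (rule exp_growthE) blast
  obtain D b where g: "g \<in> borel_measurable borel" "D \<ge> 0" "b \<ge> 0" "\<And>x. \<bar>g x\<bar> \<le> D * exp (b * \<bar>x\<bar>)"
    using assms(2) by (rule exp_growthE) blast
  show ?thesis
  proof (rule exp_growthI[where C="C*D" and a="a+b"])
    fix x
    have "\<bar>f x\<bar> * \<bar>g x\<bar> \<le> (C * exp (a * \<bar>x\<bar>)) * (D * exp (b * \<bar>x\<bar>))"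
      using f g by (intro mult_mono) auto
    then show "\<bar>f x * g x\<bar> \<le> (C * D) * exp ((a + b) * \<bar>x\<bar>)"
      by (simp add: distrib_right exp_add abs_mult mult.assoc mult.left_commute)
  qed (use f g in measurable)
qed

lemma exp_growth_sum[intro]:
  "(\<And>i. i \<in> I \<Longrightarrow> exp_growth (f i)) \<Longrightarrow> exp_growth (\<lambda>y. \<Sum>i\<in>I. f i y)"
  by (induction I rule: infinite_finite_induct) auto

lemma exp_growth_uminus[intro]: "exp_growth f \<Longrightarrow> exp_growth (\<lambda>y. - f y)"
  using exp_growth_mult[of "\<lambda>_. -1" f] by simp

lemma exp_growth_normal[simp, intro]: "exp_growth std_normal_density"
proof (rule exp_growthI[where C=1 and a=0])
  show "\<bar>std_normal_density x\<bar> \<le> 1 * exp (0 * \<bar>x\<bar>)" for x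
  proof -
    have "sqrt 1 \<le> sqrt (2 * pi)" using pi_gt3 by (intro real_sqrt_le_mono) simp
    then have "1 / sqrt (2 * pi) \<le> 1" by simp
    moreover have "exp (- x\<^sup>2 / 2) \<le> 1" by simp
    ultimately have "1 / sqrt (2 * pi) * exp (- x\<^sup>2 / 2) \<le> 1 * 1" by (intro mult_mono) auto
    then show ?thesis by (simp add: std_normal_density_def abs_mult)
  qed
qed measurable

text \<open>
  Doubling the standard deviation absorbs a shift of the mean by at most one, a linear factor and an
  exponential factor.  The bound is uniform in \<open>\<xi>\<close>, as needed for differentiation under the integral.
\<close>
lemma normal_density_exp_bound:
  assumes a: "a \<ge> 0" and d: "\<bar>\<xi> - x\<bar> \<le> 1"
  shows "(1 + \<bar>y - \<xi>\<bar>) * std_normal_density (y - \<xi>) * exp (a * \<bar>y\<bar>)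
    \<le> 2 * exp (2 * (a + 1)\<^sup>2 + 3/2) * exp (a * \<bar>x\<bar>) * normal_density x 2 y"
proof -
  define \<eta> where "\<eta> = y - x"
  have 1: "1 + \<bar>y - \<xi>\<bar> \<le> exp (\<bar>\<eta>\<bar> + 1)"
  proof -
    have "1 + \<bar>y - \<xi>\<bar> \<le> 1 + (\<bar>\<eta>\<bar> + 1)" using d unfolding \<eta>_def by linarith
    also have "\<dots> \<le> exp (\<bar>\<eta>\<bar> + 1)" by (rule exp_ge_add_one_self)
    finally show ?thesis .
  qed
  have sq: "\<eta>\<^sup>2 \<le> 2 * (y - \<xi>)\<^sup>2 + 2"
  proof -
    have "(\<xi> - x)\<^sup>2 \<le> 1" using d abs_square_le_1 by blast
    moreover have "\<eta>\<^sup>2 = 2 * (y - \<xi>)\<^sup>2 + 2 * (\<xi> - x)\<^sup>2 - ((y - \<xi>) - (\<xi> - x))\<^sup>2"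
      unfolding \<eta>_def by (simp add: power2_eq_square algebra_simps)
    ultimately show ?thesis using zero_le_power2[of "(y - \<xi>) - (\<xi> - x)"] by linarith
  qed
  have 2: "exp (- (y - \<xi>)\<^sup>2 / 2) \<le> exp (- \<eta>\<^sup>2 / 4 + 1/2)" using sq by simp
  have "\<bar>y\<bar> \<le> \<bar>x\<bar> + \<bar>\<eta>\<bar>" unfolding \<eta>_def by linarith
  then have 3: "exp (a * \<bar>y\<bar>) \<le> exp (a * (\<bar>x\<bar> + \<bar>\<eta>\<bar>))" using a by (simp add: mult_left_mono)
  (* complete the square in |eta|: half of the quadratic decay pays for the linear term *)
  have 4: "- \<eta>\<^sup>2 / 4 + (a + 1) * \<bar>\<eta>\<bar> \<le> 2 * (a + 1)\<^sup>2 - \<eta>\<^sup>2 / 8"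
  proof -
    have "0 \<le> (\<bar>\<eta>\<bar> - 4 * (a + 1))\<^sup>2" by simp
    then show ?thesis by (simp add: power2_eq_square algebra_simps)
  qed
  have "(1 + \<bar>y - \<xi>\<bar>) * exp (- (y - \<xi>)\<^sup>2 / 2) * exp (a * \<bar>y\<bar>)
      \<le> exp (\<bar>\<eta>\<bar> + 1) * exp (- \<eta>\<^sup>2 / 4 + 1/2) * exp (a * (\<bar>x\<bar> + \<bar>\<eta>\<bar>))"
    by (intro mult_mono 1 2 3) auto
  also have "\<dots> = exp ((- \<eta>\<^sup>2 / 4 + (a + 1) * \<bar>\<eta>\<bar>) + 3/2 + a * \<bar>x\<bar>)"
    by (simp add: exp_add[symmetric] algebra_simps)
  also have "\<dots> \<le> exp ((2 * (a + 1)\<^sup>2 - \<eta>\<^sup>2 / 8) + 3/2 + a * \<bar>x\<bar>)"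
    using 4 by simp
  also have "\<dots> = exp (2 * (a + 1)\<^sup>2 + 3/2) * exp (a * \<bar>x\<bar>) * exp (- \<eta>\<^sup>2 / 8)"
    by (simp add: exp_add[symmetric] algebra_simps)
  finally have "(1 + \<bar>y - \<xi>\<bar>) * exp (- (y - \<xi>)\<^sup>2 / 2) * exp (a * \<bar>y\<bar>) / sqrt (2 * pi)
     \<le> exp (2 * (a + 1)\<^sup>2 + 3/2) * exp (a * \<bar>x\<bar>) * exp (- \<eta>\<^sup>2 / 8) / sqrt (2 * pi)"
    by (intro divide_right_mono) auto
  moreover have "normal_density x 2 y = exp (- \<eta>\<^sup>2 / 8) / (2 * sqrt (2 * pi))"
    using real_sqrt_mult[of 4 "2 * pi"] by (simp add: normal_density_def \<eta>_def)
  ultimately show ?thesis by (simp add: std_normal_density_def)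
qed

text \<open>
  For a standard normal \<open>Z\<close>, the expectation of \<open>f (x + Z)\<close> on the event \<open>0 \<le> x + Z\<close>.  Hence
  \<open>(half_step ^^ n) f x\<close> is the expectation of \<open>f\<close> at the position after \<open>n\<close> steps of the Gaussian walk
  from \<open>x\<close>, on the event that none of these positions is negative.
\<close>
definition half_step :: "(real \<Rightarrow> real) \<Rightarrow> real \<Rightarrow> real" where
  "half_step f x = (\<integral>y. indicator {0..} y * (std_normal_density (y - x) * f y) \<partial>lborel)"

text \<open>
  The result of differentiating the kernel of \<open>half_step\<close> in the starting point.
\<close>
definition half_step' :: "(real \<Rightarrow> real) \<Rightarrow> real \<Rightarrow> real" where
  "half_step' f x = (\<integral>y. indicator {0..} y * ((y - x) * std_normal_density (y - x) * f y) \<partial>lborel)"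

lemma exp_growth_normal_dominated:
  assumes "\<And>x. \<bar>f x\<bar> \<le> C * exp (a * \<bar>x\<bar>)" "C \<ge> 0" "a \<ge> 0" "\<bar>\<xi> - x\<bar> \<le> 1"
  shows "(1 + \<bar>y - \<xi>\<bar>) * std_normal_density (y - \<xi>) * \<bar>f y\<bar>
    \<le> C * (2 * exp (2 * (a + 1)\<^sup>2 + 3/2)) * exp (a * \<bar>x\<bar>) * normal_density x 2 y"
proof -
  have "(1 + \<bar>y - \<xi>\<bar>) * std_normal_density (y - \<xi>) * \<bar>f y\<bar>
    \<le> (1 + \<bar>y - \<xi>\<bar>) * std_normal_density (y - \<xi>) * (C * exp (a * \<bar>y\<bar>))"
    by (intro mult_left_mono assms) auto
  also have "\<dots> = C * ((1 + \<bar>y - \<xi>\<bar>) * std_normal_density (y - \<xi>) * exp (a * \<bar>y\<bar>))"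
    by simp
  also have "\<dots> \<le> C * (2 * exp (2 * (a + 1)\<^sup>2 + 3/2) * exp (a * \<bar>x\<bar>) * normal_density x 2 y)"
    by (intro mult_left_mono normal_density_exp_bound assms)
  finally show ?thesis by simp
qed

text \<open>
  One integrable majorant of the integrands of \<open>half_step f\<close> and of its derivative that serves all starting
  points \<open>\<xi>\<close> within distance one of \<open>x\<close>.  Its integral again grows at most exponentially in \<open>x\<close>.
\<close>
lemma exp_growth_domination:
  assumes "exp_growth f"
  obtains w C a where "C \<ge> 0" "a \<ge> 0" "\<And>x. integrable lborel (w x)" "\<And>x y. 0 \<le> w x y"
    "\<And>x. (\<integral>y. w x y \<partial>lborel) = C * exp (a * \<bar>x\<bar>)"
    "\<And>x \<xi> y. \<bar>\<xi> - x\<bar> \<le> 1 \<Longrightarrow> \<bar>std_normal_density (y - \<xi>) * f y\<bar> \<le> w x y"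
    "\<And>x \<xi> y. \<bar>\<xi> - x\<bar> \<le> 1 \<Longrightarrow> \<bar>(y - \<xi>) * std_normal_density (y - \<xi>) * f y\<bar> \<le> w x y"
    "\<And>x. filterlim (w x) (nhds 0) at_top"
proof -
  obtain C a where f: "f \<in> borel_measurable borel" "C \<ge> 0" "a \<ge> 0" "\<And>x. \<bar>f x\<bar> \<le> C * exp (a * \<bar>x\<bar>)"
    using assms by (rule exp_growthE) blast
  define K where "K = C * (2 * exp (2 * (a + 1)\<^sup>2 + 3/2))"
  define w where "w x y = K * exp (a * \<bar>x\<bar>) * normal_density x 2 y" for x y
  have K: "K \<ge> 0" using f by (simp add: K_def)
  have b: "(1 + \<bar>y - \<xi>\<bar>) * std_normal_density (y - \<xi>) * \<bar>f y\<bar> \<le> w x y" if "\<bar>\<xi> - x\<bar> \<le> 1" for x y \<xi>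
    using exp_growth_normal_dominated[OF f(4,2,3) that] by (simp add: w_def K_def)
  show thesis
  proof (rule that[of K a w])
    fix x \<xi> y :: real assume d: "\<bar>\<xi> - x\<bar> \<le> 1"
    have "0 \<le> std_normal_density (y - \<xi>) * \<bar>f y\<bar>" "0 \<le> \<bar>y - \<xi>\<bar> * std_normal_density (y - \<xi>) * \<bar>f y\<bar>"
      by (simp_all)
    with b[OF d, of y] show "\<bar>std_normal_density (y - \<xi>) * f y\<bar> \<le> w x y"
      "\<bar>(y - \<xi>) * std_normal_density (y - \<xi>) * f y\<bar> \<le> w x y"
      unfolding distrib_right abs_mult mult_1 by (simp_all only: abs_of_nonneg[OF normal_density_nonneg])
  next
    fix x :: real
    have "((\<lambda>y. exp (- (y - x)\<^sup>2 / 8)) \<longlongrightarrow> 0) at_top"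
    proof (rule filterlim_compose[OF exp_at_bot])
      have "filterlim (\<lambda>y. (y - x)) at_top at_top"
        using filterlim_tendsto_add_at_top[OF tendsto_const filterlim_ident, of "-x"] by simp
      then have "filterlim (\<lambda>y. (y - x)\<^sup>2) at_top at_top"
        by (intro filterlim_pow_at_top) auto
      then have "filterlim (\<lambda>y. - ((1/8) * (y - x)\<^sup>2)) at_bot at_top"
        unfolding filterlim_uminus_at_bot
          by (simp only: minus_minus) (rule filterlim_tendsto_pos_mult_at_top[OF tendsto_const], auto)
      then show "filterlim (\<lambda>y. - (y - x)\<^sup>2 / 8) at_bot at_top" by simp
    qed
    then have "((\<lambda>y. K * exp (a * \<bar>x\<bar>) * (1 / sqrt (2 * pi * 2\<^sup>2) * exp (- (y - x)\<^sup>2 / 8))) \<longlongrightarrow> K * exp (a * \<bar>x\<bar>) * (1 / sqrt (2 * pi * 2\<^sup>2) * 0)) at_top"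
      by (intro tendsto_intros)
    then show "(w x \<longlongrightarrow> 0) at_top"
      by (simp add: normal_density_def w_def[abs_def])
  qed (use f K in \<open>simp_all add: w_def[abs_def]\<close>)
qed

lemma
  assumes "exp_growth f"
  shows integrable_half_step:
      "integrable lborel (\<lambda>y. indicator {0..} y * (std_normal_density (y - x) * f y))" (is ?A)
    and integrable_half_step':
      "integrable lborel (\<lambda>y. indicator {0..} y * ((y - x) * std_normal_density (y - x) * f y))" (is ?B)
proof -
  obtain w C a where C: "C \<ge> 0" "a \<ge> 0" and w: "\<And>x. integrable lborel (w x)" "\<And>x y. 0 \<le> w x y"
    "\<And>x. (\<integral>y. w x y \<partial>lborel) = C * exp (a * \<bar>x\<bar>)"
    "\<And>x \<xi> y. \<bar>\<xi> - x\<bar> \<le> 1 \<Longrightarrow> \<bar>std_normal_density (y - \<xi>) * f y\<bar> \<le> w x y"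
    "\<And>x \<xi> y. \<bar>\<xi> - x\<bar> \<le> 1 \<Longrightarrow> \<bar>(y - \<xi>) * std_normal_density (y - \<xi>) * f y\<bar> \<le> w x y"
    "\<And>x. (w x \<longlongrightarrow> 0) at_top"
    using that by (rule exp_growth_domination[OF assms])
  note [measurable] = exp_growth_measurable[OF assms]
  show ?A by (rule Bochner_Integration.integrable_bound[OF w(1)[of x]])
      (use w(2)[of x] w(4)[of x x] in \<open>auto simp: indicator_def\<close>)
  show ?B by (rule Bochner_Integration.integrable_bound[OF w(1)[of x]])
      (use w(2)[of x] w(5)[of x x] in \<open>auto simp: indicator_def\<close>)
qed

lemma
  assumes "exp_growth f"
  shows exp_growth_half_step[intro]: "exp_growth (half_step f)"
    and exp_growth_half_step'[intro]: "exp_growth (half_step' f)"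
proof -
  obtain w C a where C: "C \<ge> 0" "a \<ge> 0" and w: "\<And>x. integrable lborel (w x)" "\<And>x y. 0 \<le> w x y"
    "\<And>x. (\<integral>y. w x y \<partial>lborel) = C * exp (a * \<bar>x\<bar>)"
    "\<And>x \<xi> y. \<bar>\<xi> - x\<bar> \<le> 1 \<Longrightarrow> \<bar>std_normal_density (y - \<xi>) * f y\<bar> \<le> w x y"
    "\<And>x \<xi> y. \<bar>\<xi> - x\<bar> \<le> 1 \<Longrightarrow> \<bar>(y - \<xi>) * std_normal_density (y - \<xi>) * f y\<bar> \<le> w x y"
    "\<And>x. (w x \<longlongrightarrow> 0) at_top"
    using that by (rule exp_growth_domination[OF assms])
  note [measurable] = exp_growth_measurable[OF assms]
  have m: "half_step f \<in> borel_measurable borel" "half_step' f \<in> borel_measurable borel"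
    unfolding half_step_def[abs_def] half_step'_def[abs_def] by measurable
  show "exp_growth (half_step f)"
  proof (rule exp_growthI[OF m(1)])
    fix x
    have "\<bar>half_step f x\<bar> \<le> (\<integral>y. \<bar>indicator {0..} y * (std_normal_density (y - x) * f y)\<bar> \<partial>lborel)"
      unfolding half_step_def by (rule integral_abs_bound)
    also have "\<dots> \<le> (\<integral>y. w x y \<partial>lborel)"
      by (intro integral_mono integrable_abs integrable_half_step assms w)
        (use w(2)[of x] w(4)[of x x] in \<open>auto simp: indicator_def\<close>)
    finally show "\<bar>half_step f x\<bar> \<le> C * exp (a * \<bar>x\<bar>)" using w(3) by simp
  qed
  show "exp_growth (half_step' f)"
  proof (rule exp_growthI[OF m(2)])
    fix x
    have "\<bar>half_step' f x\<bar> \<le> (\<integral>y. \<bar>indicator {0..} y * ((y - x) * std_normal_density (y - x) * f y)\<bar> \<partial>lborel)"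
      unfolding half_step'_def by (rule integral_abs_bound)
    also have "\<dots> \<le> (\<integral>y. w x y \<partial>lborel)"
      by (intro integral_mono integrable_abs integrable_half_step' assms w)
        (use w(2)[of x] w(5)[of x x] in \<open>auto simp: indicator_def\<close>)
    finally show "\<bar>half_step' f x\<bar> \<le> C * exp (a * \<bar>x\<bar>)" using w(3) by simp
  qed
qed

lemma half_step_add: "exp_growth f \<Longrightarrow> exp_growth g \<Longrightarrow>
    half_step (\<lambda>y. f y + g y) = (\<lambda>x. half_step f x + half_step g x)"
  unfolding half_step_def
  by (intro ext) (simp only: distrib_left Bochner_Integration.integral_add[OF integrable_half_step integrable_half_step])

lemma half_step_cmult: "half_step (\<lambda>y. c * f y) = (\<lambda>x. c * half_step f x)"
proof
  fix x
  have "half_step (\<lambda>y. c * f y) x = (\<integral>y. c * (indicator {0..} y * (std_normal_density (y - x) * f y)) \<partial>lborel)"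
    unfolding half_step_def by (intro Bochner_Integration.integral_cong) auto
  then show "half_step (\<lambda>y. c * f y) x = c * half_step f x"
    unfolding half_step_def by simp
qed

lemma half_step_sum: "finite I \<Longrightarrow> (\<And>i. i \<in> I \<Longrightarrow> exp_growth (f i)) \<Longrightarrow>
    half_step (\<lambda>y. \<Sum>i\<in>I. f i y) = (\<lambda>x. \<Sum>i\<in>I. half_step (f i) x)"
proof (induction I rule: finite_induct)
  case empty
  show ?case by (simp add: half_step_def)
next
  case (insert i I)
  then show ?case by (simp add: half_step_add exp_growth_sum)
qed

text \<open>
  Write \<open>y = x + (y - x)\<close> under the integral; the second part is the derivative of the kernel.
\<close>
lemma half_step_ident_mult:
  assumes "exp_growth f"
  shows "half_step (\<lambda>y. y * f y) = (\<lambda>x. x * half_step f x + half_step' f x)"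
proof
  fix x
  have "x * half_step f x + half_step' f x =
     (\<integral>y. x * (indicator {0..} y * (std_normal_density (y - x) * f y)) +
           indicator {0..} y * ((y - x) * std_normal_density (y - x) * f y) \<partial>lborel)"
    unfolding half_step_def half_step'_def
    by (simp add: integrable_half_step integrable_half_step' assms)
  also have "\<dots> = half_step (\<lambda>y. y * f y) x"
    unfolding half_step_def by (intro Bochner_Integration.integral_cong) (auto simp: algebra_simps)
  finally show "half_step (\<lambda>y. y * f y) x = x * half_step f x + half_step' f x" by simp
qed

lemma DERIV_std_normal: "(std_normal_density has_real_derivative - x * std_normal_density x) (at x)"
proof -
  have "((\<lambda>x. 1 / sqrt (2 * pi) * exp (- x\<^sup>2 / 2)) has_real_derivative
      1 / sqrt (2 * pi) * (exp (- x\<^sup>2 / 2) * (- x))) (at x)"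
    by (intro DERIV_cmult) (auto intro!: derivative_eq_intros)
  moreover have "(\<lambda>x. 1 / sqrt (2 * pi) * exp (- x\<^sup>2 / 2)) = std_normal_density"
    by (simp add: fun_eq_iff std_normal_density_def)
  moreover have "1 / sqrt (2 * pi) * (exp (- x\<^sup>2 / 2) * (- x)) = - x * std_normal_density x"
    unfolding std_normal_density_def by (simp only: mult_ac)
  ultimately show ?thesis by metis
qed

lemma DERIV_std_normal_diff:
  "((\<lambda>x. std_normal_density (y - x)) has_real_derivative (y - x) * std_normal_density (y - x)) (at x)"
proof -
  have "((\<lambda>x. y - x) has_real_derivative - 1) (at x)" by (auto intro!: derivative_eq_intros)
  from DERIV_chain2[OF DERIV_std_normal this] show ?thesis by (simp add: algebra_simps)
qed

text \<open>
  Differentiation under the integral: by the mean value theorem a difference quotient of the Gaussian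
  density is its derivative at a point within distance one, so \<open>exp_growth_domination\<close> applies.
\<close>
lemma DERIV_half_step:
  assumes "exp_growth f"
  shows "(half_step f has_real_derivative half_step' f x) (at x)"
proof -
  obtain w C a where C: "C \<ge> 0" "a \<ge> 0" and w: "\<And>x. integrable lborel (w x)" "\<And>x y. 0 \<le> w x y"
    "\<And>x. (\<integral>y. w x y \<partial>lborel) = C * exp (a * \<bar>x\<bar>)"
    "\<And>x \<xi> y. \<bar>\<xi> - x\<bar> \<le> 1 \<Longrightarrow> \<bar>std_normal_density (y - \<xi>) * f y\<bar> \<le> w x y"
    "\<And>x \<xi> y. \<bar>\<xi> - x\<bar> \<le> 1 \<Longrightarrow> \<bar>(y - \<xi>) * std_normal_density (y - \<xi>) * f y\<bar> \<le> w x y"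
    "\<And>x. (w x \<longlongrightarrow> 0) at_top"
    using that by (rule exp_growth_domination[OF assms])
  note [measurable] = exp_growth_measurable[OF assms]
  have "((\<lambda>h. (half_step f (x + h) - half_step f x) / h) \<longlongrightarrow> half_step' f x) (at 0)"
    unfolding tendsto_at_iff_sequentially comp_def
  proof (intro allI impI)
    fix h :: "nat \<Rightarrow> real" assume h: "\<forall>i. h i \<in> UNIV - {0}" "h \<longlonglongrightarrow> 0"
    have "eventually (\<lambda>n. \<bar>h n\<bar> < 1) sequentially"
      using order_tendstoD(2)[OF tendsto_rabs_zero[OF h(2)], of 1] by simp
    then obtain N where N: "\<And>n. n \<ge> N \<Longrightarrow> \<bar>h n\<bar> < 1" unfolding eventually_sequentially by blast
    define h' where "h' n = h (n + N)" for n
    have h': "h' \<longlonglongrightarrow> 0" "\<And>n. h' n \<noteq> 0" "\<And>n. \<bar>h' n\<bar> < 1"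
      unfolding h'_def using h N by (auto intro: LIMSEQ_ignore_initial_segment)
    let ?d = "\<lambda>n y. (std_normal_density (y - (x + h' n)) - std_normal_density (y - x)) / h' n"
    have "(\<lambda>n. \<integral>y. indicator {0..} y * (?d n y * f y) \<partial>lborel) \<longlonglongrightarrow> half_step' f x"
      unfolding half_step'_def
    proof (rule integral_dominated_convergence[where w = "w x"])
      show "AE y in lborel. (\<lambda>n. indicator {0..} y * (?d n y * f y))
          \<longlonglongrightarrow> indicator {0..} y * ((y - x) * std_normal_density (y - x) * f y)"
      proof (rule AE_I2, intro tendsto_intros)
        fix y
        have "((\<lambda>h. (std_normal_density (y - (x + h)) - std_normal_density (y - x)) / h) \<longlongrightarrow> (y - x) * std_normal_density (y - x)) (at 0)"
          using DERIV_std_normal_diff[of y x] by (simp add: DERIV_def)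
        then show "(\<lambda>n. ?d n y) \<longlonglongrightarrow> (y - x) * std_normal_density (y - x)"
          using h' unfolding tendsto_at_iff_sequentially comp_def by auto
      qed
      show "AE y in lborel. norm (indicator {0..} y * (?d n y * f y)) \<le> w x y" for n
      proof (rule AE_I2)
        fix y
        have "\<exists>\<xi>. \<bar>\<xi> - x\<bar> \<le> 1 \<and> ?d n y = (y - \<xi>) * std_normal_density (y - \<xi>)"
        proof (cases "h' n > 0")
          case True
          obtain \<xi> where "x < \<xi>" "\<xi> < x + h' n" and
            "std_normal_density (y - (x + h' n)) - std_normal_density (y - x) = (x + h' n - x) * ((y - \<xi>) * std_normal_density (y - \<xi>))"
            using MVT2[of x "x + h' n" "\<lambda>x. std_normal_density (y - x)" "\<lambda>x. (y - x) * std_normal_density (y - x)"]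
              DERIV_std_normal_diff True by auto
          then show ?thesis using h'(3)[of n] True by (intro exI[of _ \<xi>]) auto
        next
          case False
          then have neg: "h' n < 0" using h'(2)[of n] by auto
          obtain \<xi> where "x + h' n < \<xi>" "\<xi> < x" and
            "std_normal_density (y - x) - std_normal_density (y - (x + h' n)) = (x - (x + h' n)) * ((y - \<xi>) * std_normal_density (y - \<xi>))"
            using MVT2[of "x + h' n" x "\<lambda>x. std_normal_density (y - x)" "\<lambda>x. (y - x) * std_normal_density (y - x)"]
              DERIV_std_normal_diff neg by auto
          then show ?thesis using h'(3)[of n] neg by (intro exI[of _ \<xi>]) (auto simp: field_simps)
        qed
        then obtain \<xi> where xi: "\<bar>\<xi> - x\<bar> \<le> 1" and d: "?d n y = (y - \<xi>) * std_normal_density (y - \<xi>)" by blast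
        have "\<bar>?d n y * f y\<bar> \<le> w x y" unfolding d using w(5)[OF xi] .
        then show "norm (indicator {0..} y * (?d n y * f y)) \<le> w x y"
          using w(2)[of x y] by (auto simp: indicator_def)
      qed
    qed (use w in auto)
    moreover have "(\<integral>y. indicator {0..} y * (?d n y * f y) \<partial>lborel) = (half_step f (x + h' n) - half_step f x) / h' n" for n
    proof -
      have "(half_step f (x + h' n) - half_step f x) / h' n =
        (\<integral>y. (indicator {0..} y * (std_normal_density (y - (x + h' n)) * f y) - indicator {0..} y * (std_normal_density (y - x) * f y)) / h' n \<partial>lborel)"
        unfolding half_step_def by (simp add: integrable_half_step assms)
      also have "\<dots> = (\<integral>y. indicator {0..} y * (?d n y * f y) \<partial>lborel)"
        by (intro Bochner_Integration.integral_cong) (auto simp: field_simps)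
      finally show ?thesis by (rule sym)
    qed
    ultimately have "(\<lambda>n. (half_step f (x + h' n) - half_step f x) / h' n) \<longlonglongrightarrow> half_step' f x" by (simp only:)
    then show "(\<lambda>n. (half_step f (x + h n) - half_step f x) / h n) \<longlonglongrightarrow> half_step' f x"
      unfolding h'_def by (rule LIMSEQ_offset)
  qed
  then show ?thesis by (simp add: DERIV_def)
qed

lemma continuous_half_step: "exp_growth f \<Longrightarrow> isCont (half_step f) x"
  using DERIV_half_step DERIV_isCont by blast

text \<open>
  Integration by parts.  Killing at zero leaves the boundary term \<open>f 0 * std_normal_density x\<close>; all the
  combinatorics below comes from iterating this term.
\<close>
lemma half_step'_eq:
  assumes f: "exp_growth f" and f': "exp_growth f'" and D: "\<And>x. (f has_real_derivative f' x) (at x)"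
    and c: "\<And>x. isCont f' x"
  shows "half_step' f x = half_step f' x + f 0 * std_normal_density x"
proof -
  obtain w C a where C: "C \<ge> 0" "a \<ge> 0" and w: "\<And>x. integrable lborel (w x)" "\<And>x y. 0 \<le> w x y"
    "\<And>x. (\<integral>y. w x y \<partial>lborel) = C * exp (a * \<bar>x\<bar>)"
    "\<And>x \<xi> y. \<bar>\<xi> - x\<bar> \<le> 1 \<Longrightarrow> \<bar>std_normal_density (y - \<xi>) * f y\<bar> \<le> w x y"
    "\<And>x \<xi> y. \<bar>\<xi> - x\<bar> \<le> 1 \<Longrightarrow> \<bar>(y - \<xi>) * std_normal_density (y - \<xi>) * f y\<bar> \<le> w x y"
    "\<And>x. (w x \<longlongrightarrow> 0) at_top"
    using that by (rule exp_growth_domination[OF f])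
  let ?F = "\<lambda>y. std_normal_density (y - x) * f y"
  let ?f = "\<lambda>y. std_normal_density (y - x) * f' y - (y - x) * std_normal_density (y - x) * f y"
  note [measurable] = exp_growth_measurable[OF f] exp_growth_measurable[OF f']
  have DN: "((\<lambda>y. std_normal_density (y - x)) has_real_derivative - (y - x) * std_normal_density (y - x)) (at y)" for y
    using DERIV_chain2[OF DERIV_std_normal, of "\<lambda>y. y - x" 1 y UNIV]
    by (simp add: DERIV_diff[OF DERIV_ident DERIV_const, simplified])
  note contn = DERIV_isCont[OF DN]
  have "(LBINT y=0..\<infinity>. ?f y) = 0 - ?F 0"
  proof (rule interval_integral_FTC_integrable)
    fix y
    from DERIV_mult[OF DN D]
    show "(?F has_vector_derivative ?f y) (at y)"
      unfolding has_real_derivative_iff_has_vector_derivative[symmetric]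
      by (rule DERIV_cong) (simp add: algebra_simps)
    show "isCont ?f y"
      by (intro continuous_intros contn c DERIV_isCont[OF D])
  next
    have "integrable lborel (\<lambda>y. indicator {0..} y * (std_normal_density (y - x) * f' y) - indicator {0..} y * ((y - x) * std_normal_density (y - x) * f y))"
      by (intro Bochner_Integration.integrable_diff integrable_half_step integrable_half_step' f f')
    then have "set_integrable lborel {0..} ?f"
      unfolding set_integrable_def by (simp add: algebra_simps)
    then show "set_integrable lborel (einterval 0 \<infinity>) ?f"
      by (rule set_integrable_subset) (auto simp: einterval_def zero_ereal_def)
  next
    have "isCont ?F 0" by (intro continuous_intros contn DERIV_isCont[OF D])
    then have "(?F \<longlongrightarrow> ?F 0) (at_right 0)"
      by (simp add: isCont_def filterlim_at_split)
    then show "((?F \<circ> real_of_ereal) \<longlongrightarrow> ?F 0) (at_right 0)"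
      unfolding zero_ereal_def by (simp add: ereal_tendsto_simps)
  next
    have "(?F \<longlongrightarrow> 0) at_top"
      by (rule Lim_null_comparison[OF _ w(6)[of x]]) (use w(4)[of x x] in auto)
    then show "((?F \<circ> real_of_ereal) \<longlongrightarrow> 0) (at_left \<infinity>)"
      by (simp add: ereal_tendsto_simps)
  qed simp
  moreover have "(LBINT y=0..\<infinity>. ?f y) = half_step f' x - half_step' f x"
  proof -
    have "(LBINT y=0..\<infinity>. ?f y) = (\<integral>y. indicator {0<..} y * ?f y \<partial>lborel)"
    proof -
      have "einterval 0 \<infinity> = {0<..}" by (auto simp: einterval_def zero_ereal_def)
      moreover have "(0::ereal) \<le> \<infinity>" by simp
      ultimately show ?thesis
        unfolding interval_lebesgue_integral_def set_lebesgue_integral_def by (simp only: if_True real_scaleR_def)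
    qed
    also have "\<dots> = (\<integral>y. indicator {0..} y * ?f y \<partial>lborel)"
    proof (rule integral_cong_AE)
      show "AE y in lborel. indicator {0<..} y * ?f y = indicator {0..} y * ?f y"
        using AE_lborel_singleton[of "0::real"] by eventually_elim (auto simp: indicator_def)
    qed measurable
    also have "\<dots> = (\<integral>y. indicator {0..} y * (std_normal_density (y - x) * f' y) - indicator {0..} y * ((y - x) * std_normal_density (y - x) * f y) \<partial>lborel)"
      by (intro Bochner_Integration.integral_cong) (auto simp only: right_diff_distrib)
    also have "\<dots> = half_step f' x - half_step' f x"
      unfolding half_step_def half_step'_def
      by (intro Bochner_Integration.integral_diff integrable_half_step integrable_half_step' f f')
    finally show ?thesis .
  qed
  moreover have "std_normal_density (0 - x) = std_normal_density x"
    by (simp add: std_normal_density_def)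
  ultimately show ?thesis by (simp add: mult.commute)
qed

lemmas exp_growth_intros = exp_growth_add exp_growth_mult exp_growth_uminus exp_growth_const
  exp_growth_id exp_growth_normal exp_growth_sum

section \<open>Moments of walks that stay nonnegative\<close>

text \<open>
  A function together with a derivative to which integration by parts applies.
\<close>
definition C1_growth :: "(real \<Rightarrow> real) \<Rightarrow> (real \<Rightarrow> real) \<Rightarrow> bool" where
  "C1_growth f f' \<longleftrightarrow> exp_growth f \<and> exp_growth f' \<and>
     (\<forall>x. (f has_real_derivative f' x) (at x)) \<and> (\<forall>x. isCont f' x)"

lemma C1_growthD:
  assumes "C1_growth f f'"
  shows "exp_growth f" "exp_growth f'" "(f has_real_derivative f' x) (at x)" "isCont f' x" "isCont f x"
  using assms DERIV_isCont unfolding C1_growth_def by blast+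

lemma C1_growth_const: "C1_growth (\<lambda>_. c) (\<lambda>_. 0)"
  unfolding C1_growth_def by auto

lemma C1_growth_ident: "C1_growth (\<lambda>y. y) (\<lambda>_. 1)"
  unfolding C1_growth_def by auto

lemma C1_growth_normal: "C1_growth std_normal_density (\<lambda>y. - (y * std_normal_density y))"
proof -
  have "isCont (\<lambda>y. - (y * std_normal_density y)) x" for x
    by (intro continuous_intros DERIV_isCont[OF DERIV_std_normal])
  moreover have "exp_growth (\<lambda>y. - (y * std_normal_density y))"
    by (intro exp_growth_intros)
  ultimately show ?thesis
    unfolding C1_growth_def using DERIV_std_normal by auto
qed

lemma C1_growth_ident_mult:
  assumes "C1_growth f f'"
  shows "C1_growth (\<lambda>y. y * f y) (\<lambda>y. f y + y * f' y)"
proof -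
  have "((\<lambda>y. y * f y) has_real_derivative f x + x * f' x) (at x)" for x
    using DERIV_mult[OF DERIV_ident C1_growthD(3)[OF assms]] by (simp add: algebra_simps)
  moreover have "isCont (\<lambda>y. f y + y * f' y) x" for x
    by (intro continuous_intros C1_growthD(4,5)[OF assms])
  moreover have "exp_growth (\<lambda>y. y * f y)" "exp_growth (\<lambda>y. f y + y * f' y)"
    by (intro exp_growth_intros C1_growthD[OF assms])+
  ultimately show ?thesis
    unfolding C1_growth_def by blast
qed

lemma C1_growth_half_step:
  assumes "C1_growth f f'"
  shows "C1_growth (half_step f) (\<lambda>x. half_step f' x + f 0 * std_normal_density x)"
proof -
  note f = C1_growthD[OF assms]
  have "(half_step f has_real_derivative half_step f' x + f 0 * std_normal_density x) (at x)" for x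
    using DERIV_half_step[OF f(1)] half_step'_eq[OF f(1,2,3,4)] by simp
  moreover have "isCont (\<lambda>x. half_step f' x + f 0 * std_normal_density x) x" for x
    by (intro continuous_intros continuous_half_step[OF f(2)] DERIV_isCont[OF DERIV_std_normal])
  moreover have "exp_growth (\<lambda>x. half_step f' x + f 0 * std_normal_density x)"
    by (intro exp_growth_intros exp_growth_half_step f)
  ultimately show ?thesis
    using f(1,2) unfolding C1_growth_def by blast
qed

lemma exp_growth_iter[intro]: "exp_growth f \<Longrightarrow> exp_growth ((half_step ^^ k) f)"
  by (induction k) auto

lemma iter_add: "exp_growth f \<Longrightarrow> exp_growth g \<Longrightarrow>
    (half_step ^^ k) (\<lambda>y. f y + g y) = (\<lambda>x. (half_step ^^ k) f x + (half_step ^^ k) g x)"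
  by (induction k) (auto simp: half_step_add exp_growth_iter)

lemma iter_cmult: "(half_step ^^ k) (\<lambda>y. c * f y) = (\<lambda>x. c * (half_step ^^ k) f x)"
  by (induction k) (auto simp: half_step_cmult)

lemma iter_sum: "finite I \<Longrightarrow> (\<And>i. i \<in> I \<Longrightarrow> exp_growth (f i)) \<Longrightarrow>
    (half_step ^^ k) (\<lambda>y. \<Sum>i\<in>I. f i y) = (\<lambda>x. \<Sum>i\<in>I. (half_step ^^ k) (f i) x)"
  by (induction k) (auto simp: half_step_sum exp_growth_iter)

lemma iter_iter: "(half_step ^^ k) ((half_step ^^ r) f) = (half_step ^^ (k + r)) f"
  by (simp add: funpow_add)

lemma iter_zero: "(half_step ^^ k) (\<lambda>_. 0) = (\<lambda>_. 0)"
  using iter_cmult[of k 0 "\<lambda>_. 0"] by simp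

text \<open>
  \<open>exc_fun d x\<close> is the density at \<open>0\<close> of the position after \<open>d\<close> steps of the walk started at \<open>x\<close>, on the
  event that the first \<open>d - 1\<close> positions are nonnegative; it is meaningful for \<open>d \<ge> 1\<close>.
\<close>
abbreviation exc_fun :: "nat \<Rightarrow> real \<Rightarrow> real" where
  "exc_fun d \<equiv> (half_step ^^ (d - 1)) std_normal_density"

lemma half_step_exc_fun: "d \<ge> 1 \<Longrightarrow> half_step (exc_fun d) = exc_fun (Suc d)"
  by (cases d) auto

lemma iter_exc_fun: "d \<ge> 1 \<Longrightarrow> (half_step ^^ k) (exc_fun d) = exc_fun (k + d)"
  by (simp add: iter_iter Nat.add_diff_assoc)

lemma sum_first_return_Suc:
  fixes c :: "nat \<Rightarrow> real"
  shows "(\<Sum>d\<in>{1..Suc k}. c (Suc k - d) * exc_fun d x)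
    = c k * std_normal_density x + (\<Sum>d\<in>{1..k}. c (k - d) * exc_fun (Suc d) x)"
proof -
  have "(\<Sum>d\<in>{1..Suc k}. c (Suc k - d) * exc_fun d x)
    = c k * std_normal_density x + (\<Sum>d\<in>{Suc 1..Suc k}. c (Suc k - d) * exc_fun d x)"
    by (subst sum.atLeast_Suc_atMost) auto
  also have "(\<Sum>d\<in>{Suc 1..Suc k}. c (Suc k - d) * exc_fun d x) = (\<Sum>d\<in>{1..k}. c (k - d) * exc_fun (Suc d) x)"
    by (subst sum.shift_bounds_cl_Suc_ivl) simp
  finally show ?thesis .
qed

text \<open>
  Every application of \<open>half_step\<close> creates a boundary term, and the remaining applications move it on:
  the term created after \<open>k - d\<close> steps has become \<open>exc_fun d\<close> after \<open>k\<close> steps.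
\<close>
lemma C1_growth_iter:
  assumes "C1_growth f f'"
  shows "C1_growth ((half_step ^^ k) f)
    (\<lambda>x. (half_step ^^ k) f' x + (\<Sum>d\<in>{1..k}. (half_step ^^ (k - d)) f 0 * exc_fun d x))"
proof (induction k)
  case 0
  then show ?case using assms by simp
next
  case (Suc k)
  note f = C1_growthD[OF assms]
  let ?c = "\<lambda>j. (half_step ^^ j) f 0"
  have "half_step (\<lambda>x. (half_step ^^ k) f' x + (\<Sum>d\<in>{1..k}. ?c (k - d) * exc_fun d x))
    = (\<lambda>x. (half_step ^^ Suc k) f' x + (\<Sum>d\<in>{1..k}. ?c (k - d) * exc_fun (Suc d) x))"
  proof
    fix x
    have "half_step (\<lambda>x. (half_step ^^ k) f' x + (\<Sum>d\<in>{1..k}. ?c (k - d) * exc_fun d x)) x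
      = half_step ((half_step ^^ k) f') x + half_step (\<lambda>x. \<Sum>d\<in>{1..k}. ?c (k - d) * exc_fun d x) x"
      by (subst half_step_add) (intro exp_growth_intros exp_growth_iter f refl)+
    also have "half_step (\<lambda>x. \<Sum>d\<in>{1..k}. ?c (k - d) * exc_fun d x) x
      = (\<Sum>d\<in>{1..k}. half_step (\<lambda>x. ?c (k - d) * exc_fun d x) x)"
      by (subst half_step_sum) (intro exp_growth_intros exp_growth_iter finite_atLeastAtMost refl)+
    also have "\<dots> = (\<Sum>d\<in>{1..k}. ?c (k - d) * exc_fun (Suc d) x)"
      by (intro sum.cong refl) (simp only: half_step_cmult half_step_exc_fun atLeastAtMost_iff)
    finally show "half_step (\<lambda>x. (half_step ^^ k) f' x + (\<Sum>d\<in>{1..k}. ?c (k - d) * exc_fun d x)) x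
      = (half_step ^^ Suc k) f' x + (\<Sum>d\<in>{1..k}. ?c (k - d) * exc_fun (Suc d) x)"
      by simp
  qed
  then show ?case
    using C1_growth_half_step[OF Suc.IH] sum_first_return_Suc[of ?c k]
    by (simp add: algebra_simps)
qed

text \<open>
  The main identity: it removes a factor \<open>y\<close> in front of \<open>f\<close> at the price of a derivative of \<open>f\<close> and a sum
  of values at \<open>0\<close>.  In each step \<open>half_step_ident_mult\<close> adds one derivative of \<open>(half_step ^^ k) f\<close>, which
  \<open>C1_growth_iter\<close> expands; the boundary term with index \<open>d\<close> is thereby counted \<open>d\<close> times.
\<close>
lemma iter_ident_mult:
  assumes "C1_growth f f'"
  shows "(half_step ^^ k) (\<lambda>y. y * f y) x = x * (half_step ^^ k) f x + k * (half_step ^^ k) f' x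
    + (\<Sum>d\<in>{1..k}. d * (half_step ^^ (k - d)) f 0 * exc_fun d x)"
proof (induction k arbitrary: x)
  case 0
  then show ?case by simp
next
  case (Suc k)
  note f = C1_growthD[OF assms]
  let ?c = "\<lambda>j. (half_step ^^ j) f 0"
  let ?g = "(half_step ^^ k) f"
  have IH: "(half_step ^^ k) (\<lambda>y. y * f y) = (\<lambda>x. (x * ?g x + k * (half_step ^^ k) f' x)
    + (\<Sum>d\<in>{1..k}. (d * ?c (k - d)) * exc_fun d x))"
    using Suc.IH by auto
  have 1: "half_step (\<lambda>x. x * ?g x) x = x * (half_step ^^ Suc k) f x + half_step' ?g x"
    by (subst half_step_ident_mult) (auto intro: exp_growth_iter f)
  (* two expressions for the derivative of the same function *)
  have 2: "half_step' ?g x = (half_step ^^ Suc k) f' x + (\<Sum>d\<in>{1..Suc k}. ?c (Suc k - d) * exc_fun d x)"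
  proof -
    have "(half_step ?g has_real_derivative half_step' ?g x) (at x)"
      by (intro DERIV_half_step exp_growth_iter f)
    moreover have "(half_step ?g has_real_derivative
        (half_step ^^ Suc k) f' x + (\<Sum>d\<in>{1..Suc k}. ?c (Suc k - d) * exc_fun d x)) (at x)"
      using C1_growthD(3)[OF C1_growth_iter[OF assms, of "Suc k"], of x] by simp
    ultimately show ?thesis by (rule DERIV_unique)
  qed
  have "(half_step ^^ Suc k) (\<lambda>y. y * f y) x = half_step ((half_step ^^ k) (\<lambda>y. y * f y)) x"
    by simp
  also have "\<dots> = half_step (\<lambda>x. x * ?g x + k * (half_step ^^ k) f' x) x
      + half_step (\<lambda>x. \<Sum>d\<in>{1..k}. (d * ?c (k - d)) * exc_fun d x) x"
    unfolding IH by (subst half_step_add) (intro exp_growth_intros exp_growth_iter f refl)+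
  also have "half_step (\<lambda>x. x * ?g x + k * (half_step ^^ k) f' x) x
      = half_step (\<lambda>x. x * ?g x) x + k * (half_step ^^ Suc k) f' x"
    by (subst half_step_add) (auto intro!: exp_growth_intros exp_growth_iter f simp: half_step_cmult)
  also have "half_step (\<lambda>x. \<Sum>d\<in>{1..k}. (d * ?c (k - d)) * exc_fun d x) x
      = (\<Sum>d\<in>{1..k}. half_step (\<lambda>x. (d * ?c (k - d)) * exc_fun d x) x)"
    by (subst half_step_sum) (intro exp_growth_intros exp_growth_iter finite_atLeastAtMost refl)+
  also have "\<dots> = (\<Sum>d\<in>{1..k}. (d * ?c (k - d)) * exc_fun (Suc d) x)"
    by (intro sum.cong refl) (simp only: half_step_cmult half_step_exc_fun atLeastAtMost_iff)
  finally have "(half_step ^^ Suc k) (\<lambda>y. y * f y) x = x * (half_step ^^ Suc k) f x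
    + Suc k * (half_step ^^ Suc k) f' x + ((\<Sum>d\<in>{1..Suc k}. ?c (Suc k - d) * exc_fun d x)
    + (\<Sum>d\<in>{1..k}. (d * ?c (k - d)) * exc_fun (Suc d) x))"
    unfolding 1 2 by (simp add: algebra_simps)
  also have "(\<Sum>d\<in>{1..Suc k}. ?c (Suc k - d) * exc_fun d x)
    + (\<Sum>d\<in>{1..k}. (d * ?c (k - d)) * exc_fun (Suc d) x)
    = (\<Sum>d\<in>{1..Suc k}. d * ?c (Suc k - d) * exc_fun d x)"
  proof -
    have "(\<Sum>d\<in>{1..Suc k}. d * ?c (Suc k - d) * exc_fun d x) - (\<Sum>d\<in>{1..Suc k}. ?c (Suc k - d) * exc_fun d x)
      = (\<Sum>d\<in>{1..Suc k}. real (d - 1) * ?c (Suc k - d) * exc_fun d x)"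
      by (subst sum_subtractf[symmetric], intro sum.cong refl) (auto simp: of_nat_diff algebra_simps)
    also have "\<dots> = (\<Sum>d\<in>{Suc 1..Suc k}. real (d - 1) * ?c (Suc k - d) * exc_fun d x)"
      by (subst sum.atLeast_Suc_atMost) auto
    also have "\<dots> = (\<Sum>d\<in>{1..k}. (d * ?c (k - d)) * exc_fun (Suc d) x)"
      by (subst sum.shift_bounds_cl_Suc_ivl) simp
    finally show ?thesis by simp
  qed
  finally show ?case .
qed

text \<open>
  For the walk \<open>S\<close> from \<open>0\<close>: the probability that \<open>S\<close> is nonnegative up to time \<open>n\<close>; the density at \<open>0\<close> of
  \<open>S\<close> at time \<open>d\<close> on the event of staying nonnegative; the expectation of the position at time \<open>k\<close> against
  that density; and the first and second moments of the position at time \<open>k\<close> on the event of staying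
  nonnegative up to time \<open>p\<close>.
\<close>
definition surv :: "nat \<Rightarrow> real" where
  "surv n = (half_step ^^ n) (\<lambda>_. 1) 0"

definition exc :: "nat \<Rightarrow> real" where
  "exc d = exc_fun d 0"

definition exc_mean :: "nat \<Rightarrow> nat \<Rightarrow> real" where
  "exc_mean k d = (half_step ^^ k) (\<lambda>y. y * exc_fun (d - k) y) 0"

definition mean1 :: "nat \<Rightarrow> nat \<Rightarrow> real" where
  "mean1 k p = (half_step ^^ k) (\<lambda>y. y * (half_step ^^ (p - k)) (\<lambda>_. 1) y) 0"

definition mean2 :: "nat \<Rightarrow> nat \<Rightarrow> real" where
  "mean2 k p = (half_step ^^ k) (\<lambda>y. y * (y * (half_step ^^ (p - k)) (\<lambda>_. 1) y)) 0"

lemma surv_0[simp]: "surv 0 = 1"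
  by (simp add: surv_def)

lemma C1_growth_surv: "C1_growth ((half_step ^^ r) (\<lambda>_. 1)) (\<lambda>x. \<Sum>d\<in>{1..r}. surv (r - d) * exc_fun d x)"
  using C1_growth_iter[OF C1_growth_const[of 1], of r] by (simp add: iter_zero surv_def)

lemma sum_split_min:
  fixes c :: "nat \<Rightarrow> real"
  assumes "k \<le> p"
  shows "k * (\<Sum>d\<in>{1..p - k}. c (k + d)) + (\<Sum>d\<in>{1..k}. d * c d) = (\<Sum>d\<in>{1..p}. min k d * c d)"
proof -
  have "(\<Sum>d\<in>{1..p}. min k d * c d) = (\<Sum>d\<in>{1..k}. min k d * c d) + (\<Sum>d\<in>{Suc k..p}. min k d * c d)"
    using assms by (subst sum.union_disjoint[symmetric]) (auto intro!: sum.cong)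
  also have "(\<Sum>d\<in>{1..k}. min k d * c d) = (\<Sum>d\<in>{1..k}. d * c d)"
    by (intro sum.cong) auto
  also have "(\<Sum>d\<in>{Suc k..p}. min k d * c d) = (\<Sum>d\<in>{1..p - k}. k * c (k + d))"
    using assms by (intro sum.reindex_bij_witness[where i="\<lambda>d. k + d" and j="\<lambda>d. d - k"]) auto
  finally show ?thesis by (simp add: sum_distrib_left of_nat_min add.commute)
qed

text \<open>
  Apply \<open>iter_ident_mult\<close> to \<open>surv\<close> as a function of the starting point, whose derivative is a sum of
  \<open>exc_fun d\<close>.  Derivative and boundary terms contribute the ranges \<open>d > k\<close> and \<open>d \<le> k\<close>.
\<close>
lemma mean1_eq:
  assumes "k \<le> p"
  shows "mean1 k p = (\<Sum>d\<in>{1..p}. min k d * (surv (p - d) * exc d))"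
proof -
  let ?f = "(half_step ^^ (p - k)) (\<lambda>_. 1)"
  let ?f' = "\<lambda>x. \<Sum>d\<in>{1..p - k}. surv (p - k - d) * exc_fun d x"
  have "(half_step ^^ k) ?f' 0 = (\<Sum>d\<in>{1..p - k}. (half_step ^^ k) (\<lambda>x. surv (p - k - d) * exc_fun d x) 0)"
    by (subst iter_sum) (intro exp_growth_intros exp_growth_iter finite_atLeastAtMost refl)+
  also have "\<dots> = (\<Sum>d\<in>{1..p - k}. surv (p - (k + d)) * exc (k + d))"
    by (intro sum.cong refl) (simp add: iter_cmult iter_exc_fun exc_def del: One_nat_def)
  finally have 1: "(half_step ^^ k) ?f' 0 = (\<Sum>d\<in>{1..p - k}. surv (p - (k + d)) * exc (k + d))" .
  have "mean1 k p = k * (half_step ^^ k) ?f' 0 + (\<Sum>d\<in>{1..k}. d * (half_step ^^ (k - d)) ?f 0 * exc_fun d 0)"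
    unfolding mean1_def iter_ident_mult[OF C1_growth_surv] by simp
  also have "(\<Sum>d\<in>{1..k}. d * (half_step ^^ (k - d)) ?f 0 * exc_fun d 0) = (\<Sum>d\<in>{1..k}. d * (surv (p - d) * exc d))"
    by (intro sum.cong refl) (use assms in \<open>simp add: iter_iter surv_def exc_def\<close>)
  finally show ?thesis
    unfolding 1 using sum_split_min[OF assms, of "\<lambda>d. surv (p - d) * exc d"] by simp
qed

text \<open>
  As for \<open>mean1_eq\<close>, except that the derivative of the Gaussian density leaves a term which is not a
  combination of values of \<open>exc\<close>.  Up to its factor \<open>k\<close> this term is independent of \<open>k\<close>.
\<close>
lemma exc_mean_eq_aux:
  assumes "k < d"
  shows "exc_mean k d = k * (half_step ^^ (d - 1)) (\<lambda>y. - (y * std_normal_density y)) 0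
    + (\<Sum>l\<in>{1..d - 1}. min k l * (exc l * exc (d - l)))"
proof -
  define r where "r = d - k - 1"
  have d: "d = k + r + 1" using assms by (simp add: r_def)
  let ?f = "exc_fun (d - k)"
  let ?n' = "\<lambda>y. - (y * std_normal_density y)"
  let ?f' = "\<lambda>x. (half_step ^^ r) ?n' x + (\<Sum>c\<in>{1..r}. exc (Suc r - c) * exc_fun c x)"
  have C: "C1_growth ?f ?f'"
  proof -
    have "(\<Sum>c\<in>{1..r}. (half_step ^^ (r - c)) std_normal_density 0 * exc_fun c x) = (\<Sum>c\<in>{1..r}. exc (Suc r - c) * exc_fun c x)" for x
      by (intro sum.cong refl) (simp add: exc_def Suc_diff_le)
    with C1_growth_iter[OF C1_growth_normal, of r] show ?thesis by (simp add: d)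
  qed
  have "(half_step ^^ k) ?f' 0 = (half_step ^^ k) ((half_step ^^ r) ?n') 0
      + (half_step ^^ k) (\<lambda>x. \<Sum>c\<in>{1..r}. exc (Suc r - c) * exc_fun c x) 0"
    by (subst iter_add) (intro exp_growth_intros exp_growth_iter finite_atLeastAtMost refl)+
  also have "(half_step ^^ k) (\<lambda>x. \<Sum>c\<in>{1..r}. exc (Suc r - c) * exc_fun c x) 0
    = (\<Sum>c\<in>{1..r}. (half_step ^^ k) (\<lambda>x. exc (Suc r - c) * exc_fun c x) 0)"
    by (subst iter_sum) (intro exp_growth_intros exp_growth_iter finite_atLeastAtMost refl)+
  also have "\<dots> = (\<Sum>c\<in>{1..r}. exc (k + c) * exc (d - (k + c)))"
    by (intro sum.cong refl) (simp add: iter_cmult iter_exc_fun exc_def d del: One_nat_def)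
  finally have 1: "(half_step ^^ k) ?f' 0 = (half_step ^^ (d - 1)) ?n' 0
      + (\<Sum>c\<in>{1..(d - 1) - k}. exc (k + c) * exc (d - (k + c)))"
    by (simp add: iter_iter d)
  have "exc_mean k d = k * (half_step ^^ k) ?f' 0 + (\<Sum>c\<in>{1..k}. c * (half_step ^^ (k - c)) ?f 0 * exc_fun c 0)"
    unfolding exc_mean_def iter_ident_mult[OF C] by simp
  also have "(\<Sum>c\<in>{1..k}. c * (half_step ^^ (k - c)) ?f 0 * exc_fun c 0) = (\<Sum>c\<in>{1..k}. c * (exc c * exc (d - c)))"
    by (intro sum.cong refl) (use assms in \<open>simp add: iter_iter exc_def algebra_simps\<close>)
  finally show ?thesis
    unfolding 1 using sum_split_min[of k "d - 1" "\<lambda>l. exc l * exc (d - l)"] assms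
    by (simp add: algebra_simps)
qed

lemma sum_swap_sym:
  fixes g :: "nat \<Rightarrow> real"
  assumes "\<And>l. l \<in> {1..d - 1} \<Longrightarrow> g (d - l) = g l"
  shows "(\<Sum>l\<in>{1..d - 1}. l * g l) = d / 2 * (\<Sum>l\<in>{1..d - 1}. g l)"
proof -
  have "(\<Sum>l\<in>{1..d - 1}. l * g l) = (\<Sum>l\<in>{1..d - 1}. (d - l) * g l)"
    by (intro sum.reindex_bij_witness[where i="\<lambda>l. d - l" and j="\<lambda>l. d - l"]) (auto simp: assms)
  also have "\<dots> = d * (\<Sum>l\<in>{1..d - 1}. g l) - (\<Sum>l\<in>{1..d - 1}. l * g l)"
    unfolding sum_distrib_left
    by (subst sum_subtractf[symmetric], intro sum.cong) (auto simp: of_nat_diff algebra_simps)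
  finally show ?thesis by simp
qed

text \<open>
  The unknown term \<open>\<eta>\<close> of \<open>exc_mean_eq_aux\<close> is found by taking \<open>k = d - 1\<close>: there the left-hand side is
  \<open>- \<eta>\<close> by definition, and the equation can be solved for \<open>\<eta>\<close>.
\<close>
lemma exc_mean_eq:
  assumes "k < d"
  shows "exc_mean k d = (\<Sum>l\<in>{1..d - 1}. (min k l - k / 2) * (exc l * exc (d - l)))"
proof -
  let ?n' = "\<lambda>y. - (y * std_normal_density y)"
  let ?E = "\<Sum>l\<in>{1..d - 1}. exc l * exc (d - l)"
  define \<eta> where "\<eta> = (half_step ^^ (d - 1)) ?n' 0"
  have d: "real (d - 1) = real d - 1" using assms by (simp add: of_nat_diff)
  have "exc_mean (d - 1) d = (half_step ^^ (d - 1)) (\<lambda>y. (- 1) * ?n' y) 0"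
    using assms by (simp add: exc_mean_def)
  also have "\<dots> = - \<eta>" unfolding iter_cmult \<eta>_def by simp
  finally have neg: "exc_mean (d - 1) d = - \<eta>" .
  have "(\<Sum>l\<in>{1..d - 1}. min (real (d - 1)) (real l) * (exc l * exc (d - l))) = (\<Sum>l\<in>{1..d - 1}. l * (exc l * exc (d - l)))"
  proof (intro sum.cong refl)
    fix l assume "l \<in> {1..d - 1}"
    then have "real l \<le> real (d - 1)" by simp
    then show "min (real (d - 1)) (real l) * (exc l * exc (d - l)) = l * (exc l * exc (d - l))"
      by (simp only: min_absorb2)
  qed
  moreover have "exc_mean (d - 1) d = real (d - 1) * \<eta> + (\<Sum>l\<in>{1..d - 1}. min (real (d - 1)) (real l) * (exc l * exc (d - l)))"
    unfolding \<eta>_def by (rule exc_mean_eq_aux) (use assms in simp)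
  ultimately have "- \<eta> = (real d - 1) * \<eta> + (\<Sum>l\<in>{1..d - 1}. l * (exc l * exc (d - l)))"
    using neg d by (simp only:)
  also have "(\<Sum>l\<in>{1..d - 1}. l * (exc l * exc (d - l))) = d / 2 * ?E"
    by (rule sum_swap_sym) (auto simp: mult.commute)
  finally have "d * (\<eta> + ?E / 2) = 0" by (simp add: algebra_simps)
  then have eta: "\<eta> = - ?E / 2" using assms by simp
  show ?thesis
    unfolding exc_mean_eq_aux[OF assms] \<eta>_def[symmetric] eta left_diff_distrib sum_subtractf
    by (simp add: sum_distrib_left algebra_simps)
qed

text \<open>
  The expectation of the product of the positions at times \<open>k\<close> and \<open>p\<close>, on the event of staying nonnegative
  up to time \<open>p\<close>.
\<close>
definition cross_mean :: "nat \<Rightarrow> nat \<Rightarrow> real" where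
  "cross_mean k p = (half_step ^^ k) (\<lambda>y. y * (half_step ^^ (p - k)) (\<lambda>z. z) y) 0"

text \<open>
  \<open>iter_ident_mult\<close> for \<open>y\<close> times \<open>surv\<close>.  The derivative of the product produces the term \<open>k * surv p\<close>, the
  variance of a free walk, and the terms with \<open>exc_mean\<close>.
\<close>
lemma mean2_eq:
  assumes "k \<le> p"
  shows "mean2 k p = k * surv p + k * (\<Sum>d\<in>{k+1..p}. surv (p - d) * exc_mean k d)
    + (\<Sum>d\<in>{1..k}. d * exc d * mean1 (k - d) (p - d))"
proof -
  let ?u = "(half_step ^^ (p - k)) (\<lambda>_. 1)"
  let ?u' = "\<lambda>x. \<Sum>d\<in>{1..p - k}. surv (p - k - d) * exc_fun d x"
  let ?f' = "\<lambda>y. ?u y + y * ?u' y"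
  note C = C1_growth_ident_mult[OF C1_growth_surv[of "p - k"]]
  have 0: "(half_step ^^ k) ?f' 0 = (half_step ^^ k) ?u 0 + (half_step ^^ k) (\<lambda>y. y * ?u' y) 0"
    by (subst iter_add) (intro exp_growth_intros exp_growth_iter finite_atLeastAtMost refl)+
  have A: "(\<lambda>y. y * ?u' y) = (\<lambda>y. \<Sum>d\<in>{1..p - k}. surv (p - k - d) * (y * exc_fun d y))"
    by (simp add: sum_distrib_left mult_ac)
  have "(half_step ^^ k) (\<lambda>y. y * ?u' y) 0 = (\<Sum>d\<in>{1..p - k}. (half_step ^^ k) (\<lambda>y. surv (p - k - d) * (y * exc_fun d y)) 0)"
    unfolding A by (subst iter_sum) (intro exp_growth_intros exp_growth_iter finite_atLeastAtMost refl)+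
  also have "\<dots> = (\<Sum>d\<in>{1..p - k}. surv (p - k - d) * exc_mean k (k + d))"
    by (intro sum.cong refl) (simp only: iter_cmult exc_mean_def add_diff_cancel_left')
  also have "\<dots> = (\<Sum>d\<in>{k+1..p}. surv (p - d) * exc_mean k d)"
    using assms by (intro sum.reindex_bij_witness[where i="\<lambda>d. d - k" and j="\<lambda>d. k + d"]) auto
  finally have 00: "(half_step ^^ k) (\<lambda>y. y * ?u' y) 0 = (\<Sum>d\<in>{k+1..p}. surv (p - d) * exc_mean k d)" .
  have "(half_step ^^ k) ?u 0 = surv p" using assms by (simp add: iter_iter surv_def)
  then have 1: "(half_step ^^ k) ?f' 0 = surv p + (\<Sum>d\<in>{k+1..p}. surv (p - d) * exc_mean k d)"
    unfolding 0 00 by (simp only:)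
  have "mean2 k p = k * (half_step ^^ k) ?f' 0
      + (\<Sum>d\<in>{1..k}. d * (half_step ^^ (k - d)) (\<lambda>y. y * ?u y) 0 * exc_fun d 0)"
    unfolding mean2_def iter_ident_mult[OF C] by simp
  also have "(\<Sum>d\<in>{1..k}. d * (half_step ^^ (k - d)) (\<lambda>y. y * ?u y) 0 * exc_fun d 0)
     = (\<Sum>d\<in>{1..k}. d * exc d * mean1 (k - d) (p - d))"
    by (intro sum.cong refl) (use assms in \<open>simp add: mean1_def exc_def\<close>)
  finally show ?thesis unfolding 1 by (simp add: algebra_simps)
qed

text \<open>
  The second moment of the increment between the times \<open>j\<close> and \<open>p\<close>.  Expanding the last \<open>p - j\<close> steps
  expresses \<open>mean2 p p\<close> through \<open>cross_mean j p\<close> and \<open>cross_mean j p\<close> through \<open>mean2 j p\<close>, so that in the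
  combination only differences of the correction terms remain.
\<close>
lemma spread_eq:
  assumes "j \<le> p"
  shows "mean2 p p - 2 * cross_mean j p + mean2 j p = real (p - j) * surv p
    + (\<Sum>d\<in>{j+1..p}. real (d - j) * (mean1 (p - d) (p - d) * exc d - surv (p - d) * exc_mean j d))"
proof -
  define r where "r = p - j"
  have p: "p = j + r" using assms by (simp add: r_def)
  let ?u = "(half_step ^^ r) (\<lambda>_. 1)"
  let ?w = "\<lambda>y. \<Sum>d\<in>{1..r}. d * surv (r - d) * exc_fun d y"
  have z: "(half_step ^^ r) (\<lambda>y. y) = (\<lambda>y. y * ?u y + ?w y)"
    using iter_ident_mult[OF C1_growth_const[of 1], of r] by (auto simp: iter_zero surv_def)
  have z2: "(half_step ^^ r) (\<lambda>y. y * y) = (\<lambda>y. (y * (half_step ^^ r) (\<lambda>y. y) y + r * ?u y)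
      + (\<Sum>d\<in>{1..r}. d * mean1 (r - d) (r - d) * exc_fun d y))"
    using iter_ident_mult[OF C1_growth_ident, of r] by (auto simp: mean1_def)
  have "mean2 p p = (half_step ^^ j) ((half_step ^^ r) (\<lambda>y. y * y)) 0"
    by (simp add: mean2_def iter_iter p)
  also have "\<dots> = (half_step ^^ j) (\<lambda>y. y * (half_step ^^ r) (\<lambda>y. y) y + r * ?u y) 0
     + (half_step ^^ j) (\<lambda>y. \<Sum>d\<in>{1..r}. d * mean1 (r - d) (r - d) * exc_fun d y) 0"
    unfolding z2 by (subst iter_add) (intro exp_growth_intros exp_growth_iter finite_atLeastAtMost refl)+
  also have "(half_step ^^ j) (\<lambda>y. y * (half_step ^^ r) (\<lambda>y. y) y + r * ?u y) 0 = cross_mean j p + r * surv p"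
    by (subst iter_add) (auto intro!: exp_growth_intros exp_growth_iter simp: iter_cmult cross_mean_def surv_def iter_iter p)
  also have "(half_step ^^ j) (\<lambda>y. \<Sum>d\<in>{1..r}. d * mean1 (r - d) (r - d) * exc_fun d y) 0
     = (\<Sum>d\<in>{1..r}. (half_step ^^ j) (\<lambda>y. d * mean1 (r - d) (r - d) * exc_fun d y) 0)"
    by (subst iter_sum) (intro exp_growth_intros exp_growth_iter finite_atLeastAtMost refl)+
  also have "\<dots> = (\<Sum>d\<in>{1..r}. d * mean1 (r - d) (r - d) * exc (j + d))"
    by (intro sum.cong refl) (simp add: iter_cmult iter_exc_fun exc_def del: One_nat_def)
  also have "\<dots> = (\<Sum>d\<in>{j+1..p}. real (d - j) * mean1 (p - d) (p - d) * exc d)"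
    by (intro sum.reindex_bij_witness[where i="\<lambda>d. d - j" and j="\<lambda>d. j + d"]) (auto simp: p of_nat_diff)
  finally have 1: "mean2 p p = cross_mean j p + r * surv p + (\<Sum>d\<in>{j+1..p}. real (d - j) * mean1 (p - d) (p - d) * exc d)" .
  have "cross_mean j p = (half_step ^^ j) (\<lambda>y. y * (y * ?u y) + y * ?w y) 0"
    by (simp add: cross_mean_def p z distrib_left)
  also have "\<dots> = mean2 j p + (half_step ^^ j) (\<lambda>y. y * ?w y) 0"
    by (subst iter_add) (auto intro!: exp_growth_intros exp_growth_iter simp: mean2_def p)
  also have "(\<lambda>y. y * ?w y) = (\<lambda>y. \<Sum>d\<in>{1..r}. d * surv (r - d) * (y * exc_fun d y))"
    by (simp add: sum_distrib_left mult_ac)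
  also have "(half_step ^^ j) \<dots> 0 = (\<Sum>d\<in>{1..r}. (half_step ^^ j) (\<lambda>y. d * surv (r - d) * (y * exc_fun d y)) 0)"
    by (subst iter_sum) (intro exp_growth_intros exp_growth_iter finite_atLeastAtMost refl)+
  also have "\<dots> = (\<Sum>d\<in>{1..r}. d * surv (r - d) * exc_mean j (j + d))"
    by (intro sum.cong refl) (simp only: iter_cmult exc_mean_def add_diff_cancel_left')
  also have "\<dots> = (\<Sum>d\<in>{j+1..p}. real (d - j) * surv (p - d) * exc_mean j d)"
    by (intro sum.reindex_bij_witness[where i="\<lambda>d. d - j" and j="\<lambda>d. j + d"]) (auto simp: p of_nat_diff)
  finally have 2: "cross_mean j p = mean2 j p + (\<Sum>d\<in>{j+1..p}. real (d - j) * surv (p - d) * exc_mean j d)" .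
  have 3: "(\<Sum>d\<in>{j+1..p}. real (d - j) * (mean1 (p - d) (p - d) * exc d - surv (p - d) * exc_mean j d))
    = (\<Sum>d\<in>{j+1..p}. real (d - j) * mean1 (p - d) (p - d) * exc d) - (\<Sum>d\<in>{j+1..p}. real (d - j) * surv (p - d) * exc_mean j d)"
    unfolding sum_subtractf[symmetric] by (intro sum.cong refl) (simp only: right_diff_distrib mult.assoc)
  have "real (p - j) = real r" using p by simp
  then show ?thesis
    unfolding 3 using 1 2 by simp
qed

section \<open>The Gaussian random walk and its minimum\<close>

definition std_normal :: "real measure" where
  "std_normal = density lborel (\<lambda>x. ennreal (std_normal_density x))"

definition gauss :: "nat \<Rightarrow> (nat \<Rightarrow> real) measure" where
  "gauss n = PiM {..<n} (\<lambda>_. std_normal)"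

definition psum :: "(nat \<Rightarrow> real) \<Rightarrow> nat \<Rightarrow> real" where
  "psum x j = (\<Sum>l<j. x l)"

lemma psum_0[simp]: "psum x 0 = 0"
  by (simp add: psum_def)

lemma sets_std_normal[measurable_cong, simp]: "sets std_normal = sets borel"
  by (simp add: std_normal_def)

lemma space_std_normal[simp]: "space std_normal = UNIV"
  by (simp add: std_normal_def)

lemma prob_space_std_normal: "prob_space std_normal"
  unfolding std_normal_def by (rule prob_space_normal_density) simp

interpretation std_normal: prob_space std_normal
  by (rule prob_space_std_normal)

interpretation gauss_product: product_prob_space "\<lambda>_::nat. std_normal" UNIV
  by unfold_locales

lemma prob_space_gauss: "prob_space (gauss n)"
  unfolding gauss_def by (intro prob_space_PiM prob_space_std_normal)

interpretation gauss: prob_space "gauss n" for n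
  by (rule prob_space_gauss)

lemma measurable_coord_gauss: "l < n \<Longrightarrow> (\<lambda>x. x l) \<in> borel_measurable (gauss n)"
  unfolding gauss_def by (rule measurable_component_singleton[of l "{..<n}" "\<lambda>_. std_normal", THEN measurable_cong_sets[THEN equalityD1, THEN subsetD, rotated -1]]) auto

lemma measurable_psum[measurable]: "j \<le> n \<Longrightarrow> (\<lambda>x. psum x j) \<in> borel_measurable (gauss n)"
  unfolding psum_def by (intro borel_measurable_sum measurable_coord_gauss) auto

lemma nn_integral_gauss_Suc:
  assumes "f \<in> borel_measurable (gauss (Suc q))"
  shows "(\<integral>\<^sup>+x. f x \<partial>gauss (Suc q)) = (\<integral>\<^sup>+x. \<integral>\<^sup>+y. f (x(q := y)) \<partial>std_normal \<partial>gauss q)"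
proof -
  have *: "{..<Suc q} = insert q {..<q}" by auto
  show ?thesis
    using assms unfolding gauss_def *
    by (intro gauss_product.product_nn_integral_insert) auto
qed

lemma psum_upd[simp]: "psum (x(q := y)) (Suc q) = psum x q + y" "i \<le> q \<Longrightarrow> psum (x(q := y)) i = psum x i"
  unfolding psum_def by (auto intro!: sum.cong)

lemma half_step_nonneg:
  assumes "\<And>y. y \<ge> 0 \<Longrightarrow> 0 \<le> f y" shows "0 \<le> half_step f x"
  unfolding half_step_def by (intro Bochner_Integration.integral_nonneg) (auto simp: indicator_def assms)

lemma iter_nonneg:
  assumes "\<And>y. y \<ge> 0 \<Longrightarrow> 0 \<le> f y" "0 \<le> x" shows "0 \<le> (half_step ^^ k) f x"
  using assms(2)
proof (induction k arbitrary: x)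
  case (Suc k)
  then show ?case by (auto intro: half_step_nonneg)
qed (simp add: assms(1))

lemma nn_integral_half_step:
  assumes f: "exp_growth f" "\<And>y. y \<ge> 0 \<Longrightarrow> 0 \<le> f y"
  shows "(\<integral>\<^sup>+y. ennreal (f (s + y)) * indicator {0..} (s + y) \<partial>std_normal) = ennreal (half_step f s)"
proof -
  note [measurable] = exp_growth_measurable[OF f(1)]
  have "(\<integral>\<^sup>+y. ennreal (f (s + y)) * indicator {0..} (s + y) \<partial>std_normal)
    = (\<integral>\<^sup>+y. ennreal (std_normal_density y) * (ennreal (f (s + y)) * indicator {0..} (s + y)) \<partial>lborel)"
    unfolding std_normal_def by (subst nn_integral_density) auto
  also have "\<dots> = (\<integral>\<^sup>+y. ennreal (std_normal_density (y - s)) * (ennreal (f y) * indicator {0..} y) \<partial>lborel)"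
    by (subst nn_integral_real_affine[where c=1 and t="-s"]) auto
  also have "\<dots> = (\<integral>\<^sup>+y. ennreal (indicator {0..} y * (std_normal_density (y - s) * f y)) \<partial>lborel)"
    by (intro nn_integral_cong) (auto simp: indicator_def f(2) ennreal_mult)
  also have "\<dots> = ennreal (half_step f s)"
    unfolding half_step_def
    by (intro nn_integral_eq_integral integrable_half_step f AE_I2) (auto simp: indicator_def f(2))
  finally show ?thesis .
qed

definition above :: "(nat \<Rightarrow> real) \<Rightarrow> nat \<Rightarrow> nat \<Rightarrow> bool" where
  "above x i p \<longleftrightarrow> (\<forall>r\<le>p. psum x i \<le> psum x (i + r))"

lemma above_Suc: "above x i (Suc p) \<longleftrightarrow> above x i p \<and> psum x i \<le> psum x (i + Suc p)"
  unfolding above_def le_Suc_eq by auto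

lemma above_upd[simp]: "i + p \<le> q \<Longrightarrow> above (x(q := y)) i p = above x i p"
  unfolding above_def by (auto)

lemma measurable_above[measurable]:
  assumes "i + p \<le> n" shows "Measurable.pred (gauss n) (\<lambda>x. above x i p)"
proof -
  have "Measurable.pred (gauss n) (\<lambda>x. \<forall>r\<in>{..p}. psum x i \<le> psum x (i + r))"
  proof (intro pred_intros_finite)
    fix r assume "r \<in> {..p}"
    with assms show "Measurable.pred (gauss n) (\<lambda>x. psum x i \<le> psum x (i + r))"
      unfolding pred_def by (intro borel_measurable_le measurable_psum) auto
  qed auto
  moreover have "(\<lambda>x. above x i p) = (\<lambda>x. \<forall>r\<in>{..p}. psum x i \<le> psum x (i + r))"
    by (auto simp: above_def fun_eq_iff)
  ultimately show ?thesis by (simp only:)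
qed

text \<open>
  Integrating out the last step replaces the test function \<open>f\<close> by \<open>half_step f\<close>; the rest \<open>H'\<close> of the
  integrand must not see that step.
\<close>
lemma peel_last_step:
  assumes f: "exp_growth f" "\<And>y. y \<ge> 0 \<Longrightarrow> 0 \<le> f y" and i: "i \<le> q"
    and H: "H \<in> borel_measurable (gauss q)"
    and H': "H' \<in> borel_measurable (gauss (Suc q))"
    and HH: "\<And>x y. x \<in> space (gauss q) \<Longrightarrow> H' (x(q := y)) = H x"
  shows "(\<integral>\<^sup>+x. H' x * (ennreal (f (psum x (Suc q) - psum x i)) * indicator {0..} (psum x (Suc q) - psum x i)) \<partial>gauss (Suc q))
    = (\<integral>\<^sup>+x. H x * ennreal (half_step f (psum x q - psum x i)) \<partial>gauss q)"
proof -
  note [measurable] = exp_growth_measurable[OF f(1)] H H' measurable_psum[of i "Suc q", OF le_SucI[OF i]] measurable_psum[OF order_refl]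
  have "(\<integral>\<^sup>+x. H' x * (ennreal (f (psum x (Suc q) - psum x i)) * indicator {0..} (psum x (Suc q) - psum x i)) \<partial>gauss (Suc q))
    = (\<integral>\<^sup>+x. \<integral>\<^sup>+y. H' (x(q := y)) * (ennreal (f (psum (x(q := y)) (Suc q) - psum (x(q := y)) i)) * indicator {0..} (psum (x(q := y)) (Suc q) - psum (x(q := y)) i)) \<partial>std_normal \<partial>gauss q)"
    by (rule nn_integral_gauss_Suc) measurable
  also have "\<dots> = (\<integral>\<^sup>+x. H x * ennreal (half_step f (psum x q - psum x i)) \<partial>gauss q)"
  proof (intro nn_integral_cong)
    fix x assume x: "x \<in> space (gauss q)"
    have "(\<integral>\<^sup>+y. H' (x(q := y)) * (ennreal (f (psum (x(q := y)) (Suc q) - psum (x(q := y)) i)) * indicator {0..} (psum (x(q := y)) (Suc q) - psum (x(q := y)) i)) \<partial>std_normal)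
      = (\<integral>\<^sup>+y. H x * (ennreal (f ((psum x q - psum x i) + y)) * indicator {0..} ((psum x q - psum x i) + y)) \<partial>std_normal)"
      using i by (intro nn_integral_cong) (simp only: HH[OF x] psum_upd, simp add: algebra_simps)
    also have "\<dots> = H x * (\<integral>\<^sup>+y. ennreal (f ((psum x q - psum x i) + y)) * indicator {0..} ((psum x q - psum x i) + y) \<partial>std_normal)"
      by (rule nn_integral_cmult) measurable
    finally show "(\<integral>\<^sup>+y. H' (x(q := y)) * (ennreal (f (psum (x(q := y)) (Suc q) - psum (x(q := y)) i)) * indicator {0..} (psum (x(q := y)) (Suc q) - psum (x(q := y)) i)) \<partial>std_normal)
      = H x * ennreal (half_step f (psum x q - psum x i))"
      by (simp only: nn_integral_half_step[OF f])
  qed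
  finally show ?thesis .
qed

text \<open>
  The factor \<open>G\<close> depends on the first \<open>i\<close> steps only, so it splits off once all later steps have been
  peeled off.
\<close>
lemma forward_walk_one:
  assumes G: "G \<in> borel_measurable (gauss i)"
    and f: "exp_growth f" "\<And>y. y \<ge> 0 \<Longrightarrow> 0 \<le> f y"
  shows "(\<integral>\<^sup>+x. G (restrict x {..<i}) * of_bool (above x i p) * ennreal (f (psum x (i + p) - psum x i)) \<partial>gauss (i + p))
    = (\<integral>\<^sup>+x. G x \<partial>gauss i) * ennreal ((half_step ^^ p) f 0)"
  using f
proof (induction p arbitrary: f)
  case 0
  have "(\<integral>\<^sup>+x. G (restrict x {..<i}) * of_bool (above x i 0) * ennreal (f (psum x (i + 0) - psum x i)) \<partial>gauss (i + 0))
    = (\<integral>\<^sup>+x. G x * ennreal (f 0) \<partial>gauss i)"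
    by (simp, intro nn_integral_cong) (auto simp: gauss_def space_PiM above_def)
  also have "\<dots> = (\<integral>\<^sup>+x. G x \<partial>gauss i) * ennreal (f 0)"
    using G by (rule nn_integral_multc)
  finally show ?case by (simp only: funpow_0)
next
  case (Suc p)
  have [measurable]: "(\<lambda>x. G (restrict x {..<i})) \<in> borel_measurable (gauss n)" if "i \<le> n" for n
    using that by (intro measurable_compose[OF _ G]) (auto simp: gauss_def intro!: measurable_restrict_subset)
  let ?H = "\<lambda>x. G (restrict x {..<i}) * of_bool (above x i p)"
  have H[measurable]: "?H \<in> borel_measurable (gauss n)" if "i + p \<le> n" for n
  proof -
    have [measurable]: "Measurable.pred (gauss n) (\<lambda>x. above x i p)" "(\<lambda>x. G (restrict x {..<i})) \<in> borel_measurable (gauss n)"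
      using that by (auto intro!: measurable_above)
    show ?thesis by measurable
  qed
  have "(\<integral>\<^sup>+x. G (restrict x {..<i}) * of_bool (above x i (Suc p)) * ennreal (f (psum x (i + Suc p) - psum x i)) \<partial>gauss (i + Suc p))
    = (\<integral>\<^sup>+x. ?H x * (ennreal (f (psum x (Suc (i + p)) - psum x i)) * indicator {0..} (psum x (Suc (i + p)) - psum x i)) \<partial>gauss (Suc (i + p)))"
    unfolding add_Suc_right by (intro nn_integral_cong) (auto simp: above_Suc indicator_def)
  also have "\<dots> = (\<integral>\<^sup>+x. ?H x * ennreal (half_step f (psum x (i + p) - psum x i)) \<partial>gauss (i + p))"
    using Suc.prems by (intro peel_last_step H) (auto simp: restrict_upd)
  also have "\<dots> = (\<integral>\<^sup>+x. G x \<partial>gauss i) * ennreal ((half_step ^^ p) (half_step f) 0)"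
    by (intro Suc.IH exp_growth_half_step Suc.prems half_step_nonneg)
  finally show ?case by (simp only: funpow_Suc_right o_apply)
qed

text \<open>
  Peel off the last \<open>r\<close> steps; the intermediate position enters through \<open>forward_walk_one\<close> applied to the
  test function \<open>h * (half_step ^^ r) f\<close>.
\<close>
lemma forward_walk_two:
  assumes G: "G \<in> borel_measurable (gauss i)"
    and f: "exp_growth f" "\<And>y. y \<ge> 0 \<Longrightarrow> 0 \<le> f y"
    and h: "exp_growth h" "\<And>y. y \<ge> 0 \<Longrightarrow> 0 \<le> h y"
  shows "(\<integral>\<^sup>+x. G (restrict x {..<i}) * of_bool (above x i (j + r))
        * ennreal (h (psum x (i + j) - psum x i) * f (psum x (i + j + r) - psum x i)) \<partial>gauss (i + j + r))
    = (\<integral>\<^sup>+x. G x \<partial>gauss i) * ennreal ((half_step ^^ j) (\<lambda>y. h y * (half_step ^^ r) f y) 0)"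
  using f
proof (induction r arbitrary: f)
  case 0
  have "0 \<le> y \<Longrightarrow> 0 \<le> h y * f y" for y using 0 h by simp
  from forward_walk_one[OF G exp_growth_mult[OF h(1) 0(1)] this, of j]
  show ?case by (simp only: add_0_right funpow_0)
next
  case (Suc r)
  note [measurable] = exp_growth_measurable[OF h(1)]
  have [measurable]: "(\<lambda>x. G (restrict x {..<i})) \<in> borel_measurable (gauss n)" if "i \<le> n" for n
    using that by (intro measurable_compose[OF _ G]) (auto simp: gauss_def intro!: measurable_restrict_subset)
  let ?H = "\<lambda>x. G (restrict x {..<i}) * of_bool (above x i (j + r)) * ennreal (h (psum x (i + j) - psum x i))"
  have H[measurable]: "?H \<in> borel_measurable (gauss n)" if "i + j + r \<le> n" for n
  proof -
    have [measurable]: "Measurable.pred (gauss n) (\<lambda>x. above x i (j + r))" "(\<lambda>x. psum x (i + j)) \<in> borel_measurable (gauss n)"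
      "(\<lambda>x. psum x i) \<in> borel_measurable (gauss n)" "(\<lambda>x. G (restrict x {..<i})) \<in> borel_measurable (gauss n)"
      using that by (auto intro!: measurable_above measurable_psum)
    show ?thesis by measurable
  qed
  have "(\<integral>\<^sup>+x. G (restrict x {..<i}) * of_bool (above x i (j + Suc r))
        * ennreal (h (psum x (i + j) - psum x i) * f (psum x (i + j + Suc r) - psum x i)) \<partial>gauss (i + j + Suc r))
    = (\<integral>\<^sup>+x. ?H x * (ennreal (f (psum x (Suc (i + j + r)) - psum x i)) * indicator {0..} (psum x (Suc (i + j + r)) - psum x i)) \<partial>gauss (Suc (i + j + r)))"
    unfolding add_Suc_right
    by (intro nn_integral_cong) (auto simp: above_Suc indicator_def ennreal_mult'' Suc.prems(2) mult.assoc add.assoc)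
  also have "\<dots> = (\<integral>\<^sup>+x. ?H x * ennreal (half_step f (psum x (i + j + r) - psum x i)) \<partial>gauss (i + j + r))"
    using Suc.prems by (intro peel_last_step H) (auto simp: restrict_upd add.assoc)
  also have "\<dots> = (\<integral>\<^sup>+x. G (restrict x {..<i}) * of_bool (above x i (j + r))
        * ennreal (h (psum x (i + j) - psum x i) * half_step f (psum x (i + j + r) - psum x i)) \<partial>gauss (i + j + r))"
    by (simp add: ennreal_mult'' half_step_nonneg Suc.prems mult.assoc)
  also have "\<dots> = (\<integral>\<^sup>+x. G x \<partial>gauss i) * ennreal ((half_step ^^ j) (\<lambda>y. h y * (half_step ^^ r) (half_step f) y) 0)"
    by (intro Suc.IH exp_growth_half_step Suc.prems half_step_nonneg)
  finally show ?case by (simp only: funpow_Suc_right o_apply)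
qed

lemma emeasure_std_normal_uminus:
  assumes "A \<in> sets borel" shows "emeasure std_normal ((\<lambda>z. - z) -` A) = emeasure std_normal A"
proof -
  have [measurable]: "A \<in> sets borel" "(\<lambda>z::real. - z) -` A \<in> sets borel"
    using assms measurable_sets[of "\<lambda>z::real. - z" borel borel A] by auto
  have "emeasure std_normal A = (\<integral>\<^sup>+x. ennreal (std_normal_density x) * indicator A x \<partial>lborel)"
    unfolding std_normal_def by (intro emeasure_density) auto
  also have "\<dots> = (\<integral>\<^sup>+x. ennreal (std_normal_density (- x)) * indicator A (- x) \<partial>lborel)"
    by (subst nn_integral_real_affine[where c="-1" and t=0]) auto
  also have "\<dots> = (\<integral>\<^sup>+x. ennreal (std_normal_density x) * indicator ((\<lambda>z. - z) -` A) x \<partial>lborel)"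
    by (simp add: std_normal_density_def indicator_def)
  also have "\<dots> = emeasure std_normal ((\<lambda>z. - z) -` A)"
    unfolding std_normal_def by (intro emeasure_density[symmetric]) auto
  finally show ?thesis by simp
qed

text \<open>
  The steps are exchangeable and symmetric.  This gives time reversal, cyclic rotation and reflection.
\<close>
lemma distr_gauss_permute:
  assumes \<pi>: "bij_betw \<pi> {..<n} {..<n}" and \<sigma>: "\<sigma> = 1 \<or> \<sigma> = (-1::real)"
  shows "distr (gauss n) (gauss n) (\<lambda>x. \<lambda>l\<in>{..<n}. \<sigma> * x (\<pi> l)) = gauss n"
    and "(\<lambda>x. \<lambda>l\<in>{..<n}. \<sigma> * x (\<pi> l)) \<in> measurable (gauss n) (gauss n)"
proof -
  let ?T = "\<lambda>x. \<lambda>l\<in>{..<n}. \<sigma> * x (\<pi> l)"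
  have pi: "\<pi> l < n" if "l < n" for l using \<pi> that by (auto simp: bij_betw_def)
  have m: "(\<lambda>x. \<sigma> * x (\<pi> l)) \<in> measurable (gauss n) std_normal" if "l < n" for l
  proof -
    have "(\<lambda>x. \<sigma> * x (\<pi> l)) \<in> borel_measurable (gauss n)"
      using measurable_coord_gauss[OF pi[OF that]] by simp
    then show ?thesis by (subst measurable_cong_sets[OF refl sets_std_normal])
  qed
  have T: "?T \<in> measurable (gauss n) (PiM {..<n} (\<lambda>_. std_normal))"
    by (intro measurable_restrict m) auto
  then show T': "?T \<in> measurable (gauss n) (gauss n)" by (simp only: gauss_def)
  show "distr (gauss n) (gauss n) ?T = gauss n"
    unfolding gauss_def[of n, unfolded gauss_def]
  proof (subst (3) gauss_def, rule gauss_product.PiM_eqI)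
    fix A :: "nat \<Rightarrow> real set" assume A: "\<And>i. i \<in> {..<n} \<Longrightarrow> A i \<in> sets std_normal"
    let ?\<rho> = "the_inv_into {..<n} \<pi>"
    have inj: "inj_on \<pi> {..<n}" using \<pi> by (simp add: bij_betw_def)
    have rho: "?\<rho> (\<pi> l) = l" if "l < n" for l
      using the_inv_into_f_f[OF inj] that by auto
    have rho2: "?\<rho> l < n" "\<pi> (?\<rho> l) = l" if "l < n" for l
      using the_inv_into_into[OF inj, of l "{..<n}"] f_the_inv_into_f[OF inj, of l] \<pi> that by (auto simp: bij_betw_def)
    have AS: "Pi\<^sub>E {..<n} A \<in> sets (gauss n)"
      unfolding gauss_def using A by (intro sets_PiM_I_finite) auto
    have B: "((*) \<sigma>) -` A i \<in> sets std_normal" if "i < n" for i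
      using measurable_sets[of "(*) \<sigma>" borel borel "A i"] A that by auto
    have "emeasure (distr (gauss n) (gauss n) ?T) (Pi\<^sub>E {..<n} A) = emeasure (gauss n) (?T -` (Pi\<^sub>E {..<n} A) \<inter> space (gauss n))"
      by (rule emeasure_distr[OF T' AS])
    also have "?T -` (Pi\<^sub>E {..<n} A) \<inter> space (gauss n) = Pi\<^sub>E {..<n} (\<lambda>l. ((*) \<sigma>) -` A (?\<rho> l))"
    proof (intro set_eqI iffI)
      fix x assume x: "x \<in> ?T -` (Pi\<^sub>E {..<n} A) \<inter> space (gauss n)"
      have "\<sigma> * x l \<in> A (?\<rho> l)" if "l < n" for l
      proof -
        have "?T x (?\<rho> l) \<in> A (?\<rho> l)" using x rho2(1)[OF that] unfolding vimage_def by blast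
        then show ?thesis using rho2[OF that] by simp
      qed
      then show "x \<in> Pi\<^sub>E {..<n} (\<lambda>l. ((*) \<sigma>) -` A (?\<rho> l))"
        using x by (auto simp: gauss_def space_PiM PiE_iff)
    next
      fix x assume x: "x \<in> Pi\<^sub>E {..<n} (\<lambda>l. ((*) \<sigma>) -` A (?\<rho> l))"
      have "\<sigma> * x (\<pi> l) \<in> A l" if "l < n" for l
        using x pi[OF that] rho[OF that] by (auto simp: PiE_iff dest!: bspec[of _ _ "\<pi> l"])
      then show "x \<in> ?T -` (Pi\<^sub>E {..<n} A) \<inter> space (gauss n)"
        using x by (auto simp: gauss_def space_PiM PiE_iff)
    qed
    also have "emeasure (gauss n) (Pi\<^sub>E {..<n} (\<lambda>l. ((*) \<sigma>) -` A (?\<rho> l))) = (\<Prod>l<n. emeasure std_normal (((*) \<sigma>) -` A (?\<rho> l)))"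
      unfolding gauss_def using B rho2 by (intro gauss_product.emeasure_PiM) auto
    also have "\<dots> = (\<Prod>l<n. emeasure std_normal (A (?\<rho> l)))"
    proof (intro prod.cong refl)
      fix l assume l: "l \<in> {..<n}"
      have "A (?\<rho> l) \<in> sets borel" using A rho2 l by auto
      moreover have "(*) (1::real) = (\<lambda>z. z)" "(*) (- 1 :: real) = (\<lambda>z. - z)" by auto
      ultimately show "emeasure std_normal (((*) \<sigma>) -` A (?\<rho> l)) = emeasure std_normal (A (?\<rho> l))"
        using \<sigma> emeasure_std_normal_uminus by (elim disjE) (simp_all only: vimage_ident)
    qed
    also have "\<dots> = (\<Prod>l<n. emeasure std_normal (A l))"
      using rho rho2 pi by (intro prod.reindex_bij_witness[where i=\<pi> and j="?\<rho>"]) auto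
    finally show "emeasure (distr (gauss n) (gauss n) ?T) (Pi\<^sub>E {..<n} A) = (\<Prod>i\<in>{..<n}. emeasure std_normal (A i))" .
  qed (auto simp: gauss_def)
qed

text \<open>
  The walk seen backwards from time \<open>i\<close>: its position at time \<open>j\<close> is that of the original walk at time
  \<open>i - j\<close>, relative to time \<open>i\<close>.
\<close>
definition reflect :: "nat \<Rightarrow> (nat \<Rightarrow> real) \<Rightarrow> nat \<Rightarrow> real" where
  "reflect i x = (\<lambda>l\<in>{..<i}. (- 1) * x (i - 1 - l))"

lemma psum_reflect: "j \<le> i \<Longrightarrow> psum (reflect i x) j = psum x (i - j) - psum x i"
proof (induction j)
  case (Suc j)
  then have "i - j = Suc (i - Suc j)" by auto
  then have "psum x (i - j) = psum x (i - Suc j) + x (i - Suc j)"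
    by (simp only: psum_def sum.lessThan_Suc)
  moreover have "psum (reflect i x) (Suc j) = psum (reflect i x) j - x (i - Suc j)"
    using Suc.prems by (simp add: psum_def reflect_def)
  ultimately show ?case using Suc by simp
qed simp

lemma bij_betw_reverse: "bij_betw (\<lambda>l. i - 1 - l) {..<i} {..<i::nat}"
  by (rule bij_betw_byWitness[where f'="\<lambda>l. i - 1 - l"]) auto

lemma
  shows distr_reflect: "distr (gauss i) (gauss i) (reflect i) = gauss i"
    and measurable_reflect[measurable]: "reflect i \<in> measurable (gauss i) (gauss i)"
  unfolding reflect_def[abs_def]
  by (rule distr_gauss_permute[OF bij_betw_reverse]; simp)+

lemma reflect_restrict: "reflect i (restrict x {..<i}) = reflect i x"
  by (auto simp: reflect_def fun_eq_iff)

definition is_min :: "nat \<Rightarrow> (nat \<Rightarrow> real) \<Rightarrow> nat \<Rightarrow> bool" where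
  "is_min n x i \<longleftrightarrow> (\<forall>r\<le>n. psum x i \<le> psum x r)"

text \<open>
  The minimum is at \<open>i\<close> when the walk stays above its value at \<open>i\<close> both backwards and forwards.  The two
  conditions involve disjoint sets of steps.
\<close>
lemma is_min_iff:
  assumes "i \<le> n"
  shows "is_min n x i \<longleftrightarrow> above (reflect i x) 0 i \<and> above x i (n - i)"
proof
  assume "is_min n x i"
  then show "above (reflect i x) 0 i \<and> above x i (n - i)"
    using assms by (auto simp: is_min_def above_def psum_reflect)
next
  assume *: "above (reflect i x) 0 i \<and> above x i (n - i)"
  show "is_min n x i"
    unfolding is_min_def
  proof (intro allI impI)
    fix r assume "r \<le> n"
    show "psum x i \<le> psum x r"
    proof (cases "r \<le> i")
      case True
      with * have "0 \<le> psum (reflect i x) (i - r)" by (auto simp: above_def)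
      then show ?thesis using True by (simp add: psum_reflect)
    next
      case False
      with * \<open>r \<le> n\<close> show ?thesis
        by (auto simp: above_def dest!: spec[of _ "r - i"])
    qed
  qed
qed

definition nonneg_test :: "(real \<Rightarrow> real) \<Rightarrow> bool" where
  "nonneg_test f \<longleftrightarrow> exp_growth f \<and> (\<forall>y\<ge>0. 0 \<le> f y)"

lemma nonneg_test_intros: "nonneg_test (\<lambda>_. 1)" "nonneg_test (\<lambda>y. y)" "nonneg_test (\<lambda>y. y * y)"
  unfolding nonneg_test_def by (auto intro: exp_growth_mult)

text \<open>
  Given the minimum at \<open>i\<close>, the reversed past and the future are independent walks that stay nonnegative.
  Each of them is tested at an intermediate and at the final time.
\<close>
lemma nn_integral_cone:
  assumes i: "i \<le> n" and j: "j \<le> n - i" and j': "j' \<le> i"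
    and f: "nonneg_test f" and h: "nonneg_test h" and f': "nonneg_test f'" and h': "nonneg_test h'"
  shows "(\<integral>\<^sup>+x. of_bool (is_min n x i)
      * (ennreal (h' (psum x (i - j') - psum x i) * f' (- psum x i))
      * ennreal (h (psum x (i + j) - psum x i) * f (psum x n - psum x i))) \<partial>gauss n)
    = ennreal ((half_step ^^ j') (\<lambda>y. h' y * (half_step ^^ (i - j')) f' y) 0)
      * ennreal ((half_step ^^ j) (\<lambda>y. h y * (half_step ^^ (n - i - j)) f y) 0)"
proof -
  note [measurable] = exp_growth_measurable[OF f'[unfolded nonneg_test_def, THEN conjunct1]]
    exp_growth_measurable[OF h'[unfolded nonneg_test_def, THEN conjunct1]]
  define G0 where "G0 x = of_bool (above x 0 i) * ennreal (h' (psum x j') * f' (psum x i))" for x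
  have G0: "G0 \<in> borel_measurable (gauss i)"
  proof -
    have [measurable]: "Measurable.pred (gauss i) (\<lambda>x. above x 0 i)" "(\<lambda>x. psum x j') \<in> borel_measurable (gauss i)"
      "(\<lambda>x. psum x i) \<in> borel_measurable (gauss i)"
      using j' by (auto intro!: measurable_above measurable_psum)
    show ?thesis unfolding G0_def[abs_def] by measurable
  qed
  define G where "G x = G0 (reflect i x)" for x
  have G: "G \<in> borel_measurable (gauss i)"
    unfolding G_def[abs_def] by (rule measurable_compose[OF measurable_reflect G0])
  have "(\<integral>\<^sup>+x. G x \<partial>gauss i) = (\<integral>\<^sup>+x. G0 x \<partial>distr (gauss i) (gauss i) (reflect i))"
    unfolding G_def by (rule nn_integral_distr[symmetric]) (auto simp: G0)
  also have "\<dots> = (\<integral>\<^sup>+x. G0 x \<partial>gauss i)" by (simp only: distr_reflect)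
  also have "\<dots> = ennreal ((half_step ^^ j') (\<lambda>y. h' y * (half_step ^^ (i - j')) f' y) 0)"
    using forward_walk_two[of "\<lambda>_. 1" 0 f' h' j' "i - j'"] j' f' h'
    by (simp add: G0_def nonneg_test_def gauss.emeasure_space_1)
  finally have GI: "(\<integral>\<^sup>+x. G x \<partial>gauss i) = ennreal ((half_step ^^ j') (\<lambda>y. h' y * (half_step ^^ (i - j')) f' y) 0)" .
  have n: "i + j + (n - i - j) = n" "j + (n - i - j) = n - i" using i j by auto
  have "(\<integral>\<^sup>+x. of_bool (is_min n x i)
      * (ennreal (h' (psum x (i - j') - psum x i) * f' (- psum x i))
      * ennreal (h (psum x (i + j) - psum x i) * f (psum x n - psum x i))) \<partial>gauss n)
    = (\<integral>\<^sup>+x. G (restrict x {..<i}) * of_bool (above x i (j + (n - i - j)))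
        * ennreal (h (psum x (i + j) - psum x i) * f (psum x (i + j + (n - i - j)) - psum x i)) \<partial>gauss (i + j + (n - i - j)))"
    unfolding n G_def G0_def reflect_restrict is_min_iff[OF i] psum_reflect[OF j'] psum_reflect[OF order_refl]
    by (intro nn_integral_cong) (auto simp: of_bool_def)
  also have "\<dots> = (\<integral>\<^sup>+x. G x \<partial>gauss i) * ennreal ((half_step ^^ j) (\<lambda>y. h y * (half_step ^^ (n - i - j)) f y) 0)"
    using f h by (intro forward_walk_two G) (auto simp: nonneg_test_def)
  finally show ?thesis by (simp only: GI)
qed

lemma measurable_is_min[measurable]:
  assumes "i \<le> n" shows "Measurable.pred (gauss n) (\<lambda>x. is_min n x i)"
proof -
  have "Measurable.pred (gauss n) (\<lambda>x. \<forall>r\<in>{..n}. psum x i \<le> psum x r)"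
  proof (intro pred_intros_finite)
    fix r assume "r \<in> {..n}"
    with assms show "Measurable.pred (gauss n) (\<lambda>x. psum x i \<le> psum x r)"
      unfolding pred_def by (intro borel_measurable_le measurable_psum) auto
  qed auto
  moreover have "(\<lambda>x. is_min n x i) = (\<lambda>x. \<forall>r\<in>{..n}. psum x i \<le> psum x r)"
    by (auto simp: is_min_def fun_eq_iff)
  ultimately show ?thesis by (simp only:)
qed

lemma cone_integral:
  assumes i: "i \<le> n" and j: "j \<le> n - i" and j': "j' \<le> i"
    and f: "nonneg_test f" and h: "nonneg_test h" and f': "nonneg_test f'" and h': "nonneg_test h'"
  shows "has_bochner_integral (gauss n) (\<lambda>x. of_bool (is_min n x i)
      * (h' (psum x (i - j') - psum x i) * f' (- psum x i))
      * (h (psum x (i + j) - psum x i) * f (psum x n - psum x i)))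
    ((half_step ^^ j') (\<lambda>y. h' y * (half_step ^^ (i - j')) f' y) 0
      * (half_step ^^ j) (\<lambda>y. h y * (half_step ^^ (n - i - j)) f y) 0)"
proof (rule has_bochner_integral_nn_integral)
  have [measurable]: "f \<in> borel_measurable borel" "h \<in> borel_measurable borel" "f' \<in> borel_measurable borel" "h' \<in> borel_measurable borel"
    using f h f' h' by (auto simp: nonneg_test_def exp_growth_def)
  have [measurable]: "Measurable.pred (gauss n) (\<lambda>x. is_min n x i)" "(\<lambda>x. psum x i) \<in> borel_measurable (gauss n)"
    "(\<lambda>x. psum x n) \<in> borel_measurable (gauss n)" "(\<lambda>x. psum x (i + j)) \<in> borel_measurable (gauss n)"
    "(\<lambda>x. psum x (i - j')) \<in> borel_measurable (gauss n)"
    using i j j' by (auto intro!: measurable_is_min measurable_psum)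
  show "(\<lambda>x. of_bool (is_min n x i)
      * (h' (psum x (i - j') - psum x i) * f' (- psum x i))
      * (h (psum x (i + j) - psum x i) * f (psum x n - psum x i))) \<in> borel_measurable (gauss n)"
    by measurable
  have nn: "0 \<le> h' (psum x (i - j') - psum x i)" "0 \<le> f' (- psum x i)" "0 \<le> h (psum x (i + j) - psum x i)" "0 \<le> f (psum x n - psum x i)"
    if "is_min n x i" for x
  proof -
    have "psum x i \<le> psum x (i - j')" "psum x i \<le> psum x 0" "psum x i \<le> psum x (i + j)" "psum x i \<le> psum x n"
      using that i j j' unfolding is_min_def by auto
    then show "0 \<le> h' (psum x (i - j') - psum x i)" "0 \<le> f' (- psum x i)" "0 \<le> h (psum x (i + j) - psum x i)" "0 \<le> f (psum x n - psum x i)"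
      using f h f' h' by (auto simp: nonneg_test_def)
  qed
  then show "AE x in gauss n. 0 \<le> of_bool (is_min n x i)
      * (h' (psum x (i - j') - psum x i) * f' (- psum x i))
      * (h (psum x (i + j) - psum x i) * f (psum x n - psum x i))"
    by (intro AE_I2) (auto simp: of_bool_def)
  have 0: "0 \<le> (half_step ^^ j') (\<lambda>y. h' y * (half_step ^^ (i - j')) f' y) 0" "0 \<le> (half_step ^^ j) (\<lambda>y. h y * (half_step ^^ (n - i - j)) f y) 0"
    using f h f' h' by (auto intro!: iter_nonneg mult_nonneg_nonneg simp: nonneg_test_def)
  then show "0 \<le> (half_step ^^ j') (\<lambda>y. h' y * (half_step ^^ (i - j')) f' y) 0 * (half_step ^^ j) (\<lambda>y. h y * (half_step ^^ (n - i - j)) f y) 0"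
    by simp
  have "(\<integral>\<^sup>+x. ennreal (of_bool (is_min n x i)
      * (h' (psum x (i - j') - psum x i) * f' (- psum x i))
      * (h (psum x (i + j) - psum x i) * f (psum x n - psum x i))) \<partial>gauss n)
    = (\<integral>\<^sup>+x. of_bool (is_min n x i)
      * (ennreal (h' (psum x (i - j') - psum x i) * f' (- psum x i))
      * ennreal (h (psum x (i + j) - psum x i) * f (psum x n - psum x i))) \<partial>gauss n)"
    by (intro nn_integral_cong) (auto simp: of_bool_def ennreal_mult nn)
  also have "\<dots> = ennreal ((half_step ^^ j') (\<lambda>y. h' y * (half_step ^^ (i - j')) f' y) 0
      * (half_step ^^ j) (\<lambda>y. h y * (half_step ^^ (n - i - j)) f y) 0)"
    unfolding nn_integral_cone[OF assms] using 0 by (simp add: ennreal_mult)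
  finally show "(\<integral>\<^sup>+x. ennreal (of_bool (is_min n x i)
      * (h' (psum x (i - j') - psum x i) * f' (- psum x i))
      * (h (psum x (i + j) - psum x i) * f (psum x n - psum x i))) \<partial>gauss n)
    = ennreal ((half_step ^^ j') (\<lambda>y. h' y * (half_step ^^ (i - j')) f' y) 0
      * (half_step ^^ j) (\<lambda>y. h y * (half_step ^^ (n - i - j)) f y) 0)" .
qed

lemma nn_integral_gauss_drop:
  assumes "F \<in> borel_measurable (gauss q)"
  shows "(\<integral>\<^sup>+x. F (restrict x {..<q}) \<partial>gauss (q + r)) = (\<integral>\<^sup>+x. F x \<partial>gauss q)"
proof (induction r)
  case 0
  show ?case
    by (simp only: add_0_right, intro nn_integral_cong) (simp add: gauss_def space_PiM PiE_restrict)
next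
  case (Suc r)
  have m: "(\<lambda>x. F (restrict x {..<q})) \<in> borel_measurable (gauss (Suc (q + r)))"
    by (intro measurable_compose[OF _ assms]) (auto simp: gauss_def intro!: measurable_restrict_subset)
  have "(\<integral>\<^sup>+x. F (restrict x {..<q}) \<partial>gauss (Suc (q + r)))
    = (\<integral>\<^sup>+x. \<integral>\<^sup>+y. F (restrict (x(q + r := y)) {..<q}) \<partial>std_normal \<partial>gauss (q + r))"
    by (rule nn_integral_gauss_Suc[OF m])
  also have "\<dots> = (\<integral>\<^sup>+x. F (restrict x {..<q}) \<partial>gauss (q + r))"
    by (intro nn_integral_cong) (simp add: restrict_upd std_normal.emeasure_space_1[simplified])
  finally show ?case unfolding add_Suc_right using Suc.IH by (rule trans)
qed

lemma psum_restrict: "i \<le> q \<Longrightarrow> psum (restrict x {..<q}) i = psum x i"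
  unfolding psum_def by (intro sum.cong) auto

text \<open>
  Conditionally on the other steps, equality fixes the value of the last step.
\<close>
lemma AE_psum_neq:
  assumes "i < i'" "i' \<le> n"
  shows "AE x in gauss n. psum x i \<noteq> psum x i'"
proof -
  obtain q where q: "i' = Suc q" "i \<le> q" using assms(1) by (cases i') auto
  have m: "Measurable.pred (gauss i') (\<lambda>x. psum x i = psum x i')"
    unfolding pred_def using assms by (intro borel_measurable_eq measurable_psum) auto
  then have m': "(\<lambda>x. of_bool (psum x i = psum x i') :: ennreal) \<in> borel_measurable (gauss i')" by measurable
  have mn: "Measurable.pred (gauss n) (\<lambda>x. psum x i = psum x i')"
    unfolding pred_def using assms by (intro borel_measurable_eq measurable_psum) auto
  have "(\<integral>\<^sup>+x. of_bool (psum x i = psum x i') \<partial>gauss n) = (\<integral>\<^sup>+x. of_bool (psum x i = psum x i') \<partial>gauss i')"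
    using nn_integral_gauss_drop[OF m', of "n - i'"] assms by (simp add: psum_restrict)
  also have "\<dots> = (\<integral>\<^sup>+x. \<integral>\<^sup>+y. of_bool (psum (x(q := y)) i = psum (x(q := y)) (Suc q)) \<partial>std_normal \<partial>gauss q)"
    unfolding q(1) using m' unfolding q(1) by (rule nn_integral_gauss_Suc)
  also have "\<dots> = (\<integral>\<^sup>+x. \<integral>\<^sup>+y. indicator {psum x i - psum x q} y \<partial>std_normal \<partial>gauss q)"
    using q by (intro nn_integral_cong) (auto simp: indicator_def)
  also have "\<dots> = (\<integral>\<^sup>+x. 0 \<partial>gauss q)"
  proof (intro nn_integral_cong)
    fix c :: real
    have "emeasure std_normal {c} = (\<integral>\<^sup>+y. ennreal (std_normal_density y) * indicator {c} y \<partial>lborel)"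
      unfolding std_normal_def by (rule emeasure_density) auto
    also have "\<dots> = nn_integral lborel (\<lambda>y::real. 0)"
    proof (rule nn_integral_cong_AE)
      show "AE y in lborel. ennreal (std_normal_density y) * indicator {c} y = 0"
        using AE_lborel_singleton[of c] by eventually_elim (auto simp: indicator_def)
    qed
    finally have "emeasure std_normal {c} = 0" by simp
    then show "(\<integral>\<^sup>+y. indicator {c} y \<partial>std_normal) = 0" by simp
  qed
  finally have "(\<integral>\<^sup>+x. of_bool (psum x i = psum x i') \<partial>gauss n) = 0" by simp
  then have "AE x in gauss n. of_bool (psum x i = psum x i') = (0::ennreal)"
    using mn by (subst (asm) nn_integral_0_iff_AE) auto
  then show ?thesis by eventually_elim (auto simp: of_bool_def split: if_splits)
qed

lemma ex_is_min: "\<exists>i\<le>n. is_min n x i"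
proof -
  have "Min (psum x ` {..n}) \<in> psum x ` {..n}" by (intro Min_in) auto
  then obtain i where i: "Min (psum x ` {..n}) = psum x i" "i \<in> {..n}" by (rule imageE)
  have "psum x i \<le> psum x r" if "r \<le> n" for r
    unfolding i(1)[symmetric] using that by (intro Min_le) auto
  with i(2) show ?thesis unfolding is_min_def by (intro exI[of _ i]) auto
qed

lemma AE_unique_min: "AE x in gauss n. \<exists>i\<le>n. \<forall>i'\<le>n. is_min n x i' \<longleftrightarrow> i' = i"
proof -
  have "AE x in gauss n. \<forall>i\<in>{..n}. \<forall>i'\<in>{..n}. i < i' \<longrightarrow> psum x i \<noteq> psum x i'"
  proof (intro AE_finite_allI)
    fix i i' assume "i \<in> {..n}" "i' \<in> {..n}"
    then show "AE x in gauss n. i < i' \<longrightarrow> psum x i \<noteq> psum x i'"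
      using AE_psum_neq[of i i' n] by (cases "i < i'") auto
  qed auto
  then show ?thesis
  proof eventually_elim
    case (elim x)
    obtain i where i: "i \<le> n" "is_min n x i" using ex_is_min by blast
    have "i' = i" if "i' \<le> n" "is_min n x i'" for i'
    proof -
      have "psum x i' = psum x i" using i that unfolding is_min_def by (meson order_antisym)
      then show ?thesis using elim i that by (metis atMost_iff linorder_neqE_nat)
    qed
    with i show ?case by blast
  qed
qed

section \<open>The moments of the Vervaat transform of the walk\<close>

text \<open>
  The sum of \<open>k\<close> consecutive steps starting after time \<open>i\<close>, where the steps of the walk are repeated
  periodically with period \<open>n\<close>.
\<close>
definition window :: "nat \<Rightarrow> nat \<Rightarrow> nat \<Rightarrow> (nat \<Rightarrow> real) \<Rightarrow> real" where
  "window n k i x = (if i + k \<le> n then psum x (i + k) - psum x i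
     else psum x (i + k - n) + psum x n - psum x i)"

text \<open>
  The window that starts at the minimum, written as a sum over all possible positions so that each term
  can be integrated separately.  The minimum is almost surely unique.
\<close>
definition walk_vervaat :: "nat \<Rightarrow> nat \<Rightarrow> (nat \<Rightarrow> real) \<Rightarrow> real" where
  "walk_vervaat n k x = (\<Sum>i\<le>n. of_bool (is_min n x i) * window n k i x)"

lemma sum_is_min:
  assumes "i \<le> n" "\<forall>i'\<le>n. is_min n x i' \<longleftrightarrow> i' = i"
  shows "(\<Sum>i'\<le>n. of_bool (is_min n x i') * g i') = (g i :: real)"
proof -
  have "(\<Sum>i'\<le>n. of_bool (is_min n x i') * g i') = (\<Sum>i'\<le>n. if i' = i then g i' else 0)"
    using assms by (intro sum.cong) auto
  then show ?thesis using assms(1) by simp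
qed

lemma
  assumes i: "i \<le> n"
  shows surv_cone: "has_bochner_integral (gauss n) (\<lambda>x. of_bool (is_min n x i)) (surv i * surv (n - i))"
    and depth_cone: "has_bochner_integral (gauss n) (\<lambda>x. of_bool (is_min n x i) * (- psum x i)) (mean1 i i * surv (n - i))"
proof -
  show "has_bochner_integral (gauss n) (\<lambda>x. of_bool (is_min n x i)) (surv i * surv (n - i))"
    using cone_integral[OF i, of 0 0 "\<lambda>_. 1" "\<lambda>_. 1" "\<lambda>_. 1" "\<lambda>_. 1"] nonneg_test_intros
    by (simp add: surv_def)
  show "has_bochner_integral (gauss n) (\<lambda>x. of_bool (is_min n x i) * (- psum x i)) (mean1 i i * surv (n - i))"
    using cone_integral[OF i, of 0 i "\<lambda>_. 1" "\<lambda>_. 1" "\<lambda>_. 1" "\<lambda>y. y"] nonneg_test_intros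
    by (simp add: surv_def mean1_def)
qed

text \<open>
  The expectations of the window and of its square on the event that the minimum is at \<open>i\<close>.  A window that
  runs past \<open>n\<close> consists of the future of \<open>i\<close> and of an initial piece of the walk, which is the increment of
  the reversed past between the times \<open>n - k\<close> and \<open>i\<close>, with its sign changed.
\<close>
definition window_mean :: "nat \<Rightarrow> nat \<Rightarrow> nat \<Rightarrow> real" where
  "window_mean n k i = (if i + k \<le> n then surv i * mean1 k (n - i)
     else surv i * mean1 (n - i) (n - i) + surv (n - i) * (mean1 (n - k) i - mean1 i i))"

definition window_mean2 :: "nat \<Rightarrow> nat \<Rightarrow> nat \<Rightarrow> real" where
  "window_mean2 n k i = (if i + k \<le> n then surv i * mean2 k (n - i)
     else surv i * mean2 (n - i) (n - i)
       + surv (n - i) * (mean2 i i - 2 * cross_mean (n - k) i + mean2 (n - k) i)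
       + 2 * (mean1 (n - i) (n - i) * (mean1 (n - k) i - mean1 i i)))"

lemma
  assumes i: "i \<le> n" and k: "k \<le> n"
  shows window_integral: "has_bochner_integral (gauss n) (\<lambda>x. of_bool (is_min n x i) * window n k i x) (window_mean n k i)"
    and window_integral2: "has_bochner_integral (gauss n) (\<lambda>x. of_bool (is_min n x i) * (window n k i x)\<^sup>2) (window_mean2 n k i)"
proof -
  note t = nonneg_test_intros
  have "has_bochner_integral (gauss n) (\<lambda>x. of_bool (is_min n x i) * window n k i x) (window_mean n k i) \<and>
    has_bochner_integral (gauss n) (\<lambda>x. of_bool (is_min n x i) * (window n k i x)\<^sup>2) (window_mean2 n k i)"
  proof (cases "i + k \<le> n")
    case True
    then have kn: "k \<le> n - i" by simp
    have 1: "has_bochner_integral (gauss n) (\<lambda>x. of_bool (is_min n x i) * (psum x (i + k) - psum x i)) (surv i * mean1 k (n - i))"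
      using cone_integral[OF i kn, of 0 "\<lambda>_. 1" "\<lambda>y. y" "\<lambda>_. 1" "\<lambda>_. 1"] t by (simp add: surv_def mean1_def)
    have 2: "has_bochner_integral (gauss n) (\<lambda>x. of_bool (is_min n x i) * ((psum x (i + k) - psum x i) * (psum x (i + k) - psum x i))) (surv i * mean2 k (n - i))"
      using cone_integral[OF i kn, of 0 "\<lambda>_. 1" "\<lambda>y. y * y" "\<lambda>_. 1" "\<lambda>_. 1"] t by (simp add: surv_def mean2_def mult.assoc)
    from 1 2 True show ?thesis by (simp add: window_def window_mean_def window_mean2_def power2_eq_square)
  next
    case False
    define j where "j = n - k"
    define m where "m = n - i"
    have ji: "j \<le> i" "0 \<le> i" "i \<le> i" "m \<le> n - i" "0 \<le> n - i" using False by (auto simp: j_def m_def)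
    have im: "i + m = n" "i + k - n = i - j" using i k False by (auto simp: m_def j_def)
    let ?I = "\<lambda>x. of_bool (is_min n x i)"
    let ?S = "\<lambda>x. psum x n - psum x i" and ?R = "\<lambda>x. psum x (i - j) - psum x i" and ?L = "\<lambda>x. - psum x i"
    have S: "has_bochner_integral (gauss n) (\<lambda>x. ?I x * ?S x) (surv i * mean1 m m)"
      using cone_integral[OF i ji(4,2), of "\<lambda>_. 1" "\<lambda>y. y" "\<lambda>_. 1" "\<lambda>_. 1"] t im by (simp add: surv_def mean1_def m_def)
    have R: "has_bochner_integral (gauss n) (\<lambda>x. ?I x * ?R x) (mean1 j i * surv m)"
      using cone_integral[OF i ji(5,1), of "\<lambda>_. 1" "\<lambda>_. 1" "\<lambda>_. 1" "\<lambda>y. y"] t im by (simp add: surv_def mean1_def m_def)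
    have L: "has_bochner_integral (gauss n) (\<lambda>x. ?I x * ?L x) (mean1 i i * surv m)"
      using depth_cone[OF i] by (simp add: m_def)
    have SS: "has_bochner_integral (gauss n) (\<lambda>x. ?I x * (?S x * ?S x)) (surv i * mean2 m m)"
      using cone_integral[OF i ji(4,2), of "\<lambda>_. 1" "\<lambda>y. y * y" "\<lambda>_. 1" "\<lambda>_. 1"] t im by (simp add: surv_def mean2_def m_def mult.assoc)
    have RR: "has_bochner_integral (gauss n) (\<lambda>x. ?I x * (?R x * ?R x)) (mean2 j i * surv m)"
      using cone_integral[OF i ji(5,1), of "\<lambda>_. 1" "\<lambda>_. 1" "\<lambda>_. 1" "\<lambda>y. y * y"] t im by (simp add: surv_def mean2_def m_def mult.assoc)
    have LL: "has_bochner_integral (gauss n) (\<lambda>x. ?I x * (?L x * ?L x)) (mean2 i i * surv m)"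
      using cone_integral[OF i ji(5,3), of "\<lambda>_. 1" "\<lambda>_. 1" "\<lambda>_. 1" "\<lambda>y. y * y"] t im by (simp add: surv_def mean2_def m_def mult.assoc)
    have RL: "has_bochner_integral (gauss n) (\<lambda>x. ?I x * (?R x * ?L x)) (cross_mean j i * surv m)"
      using cone_integral[OF i ji(5,1), of "\<lambda>_. 1" "\<lambda>_. 1" "\<lambda>y. y" "\<lambda>y. y"] t im by (simp add: surv_def cross_mean_def m_def mult.assoc)
    have RS: "has_bochner_integral (gauss n) (\<lambda>x. ?I x * (?R x * ?S x)) (mean1 j i * mean1 m m)"
      using cone_integral[OF i ji(4,1), of "\<lambda>_. 1" "\<lambda>y. y" "\<lambda>_. 1" "\<lambda>y. y"] t im by (simp add: mean1_def m_def mult.assoc)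
    have LS: "has_bochner_integral (gauss n) (\<lambda>x. ?I x * (?L x * ?S x)) (mean1 i i * mean1 m m)"
      using cone_integral[OF i ji(4,3), of "\<lambda>_. 1" "\<lambda>y. y" "\<lambda>_. 1" "\<lambda>y. y"] t im by (simp add: mean1_def m_def mult.assoc)
    (* S is the final value of the future, R and L are the values of the reversed past at n - k and i *)
    have w: "window n k i x = (?S x + ?R x) - ?L x" for x
      using False im by (simp add: window_def)
    have "has_bochner_integral (gauss n) (\<lambda>x. ?I x * ?S x + ?I x * ?R x - ?I x * ?L x)
        (surv i * mean1 m m + mean1 j i * surv m - mean1 i i * surv m)"
      by (intro has_bochner_integral_add has_bochner_integral_diff S R L)
    moreover have "?I x * ?S x + ?I x * ?R x - ?I x * ?L x = ?I x * window n k i x" for x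
      unfolding w by (simp add: algebra_simps)
    moreover have "surv i * mean1 m m + mean1 j i * surv m - mean1 i i * surv m = window_mean n k i"
      using False by (simp add: window_mean_def m_def j_def algebra_simps)
    ultimately have A: "has_bochner_integral (gauss n) (\<lambda>x. ?I x * window n k i x) (window_mean n k i)" by (simp only:)
    have "has_bochner_integral (gauss n) (\<lambda>x. ?I x * (?S x * ?S x) + ?I x * (?R x * ?R x) + ?I x * (?L x * ?L x)
        + 2 * (?I x * (?R x * ?S x)) - 2 * (?I x * (?R x * ?L x)) - 2 * (?I x * (?L x * ?S x)))
        (surv i * mean2 m m + mean2 j i * surv m + mean2 i i * surv m
         + 2 * (mean1 j i * mean1 m m) - 2 * (cross_mean j i * surv m) - 2 * (mean1 i i * mean1 m m))"
      by (intro has_bochner_integral_add has_bochner_integral_diff has_bochner_integral_mult_right SS RR LL RS RL LS)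
    moreover have "?I x * (?S x * ?S x) + ?I x * (?R x * ?R x) + ?I x * (?L x * ?L x)
        + 2 * (?I x * (?R x * ?S x)) - 2 * (?I x * (?R x * ?L x)) - 2 * (?I x * (?L x * ?S x)) = ?I x * (window n k i x)\<^sup>2" for x
      unfolding w by (simp add: power2_eq_square algebra_simps)
    moreover have "surv i * mean2 m m + mean2 j i * surv m + mean2 i i * surv m
         + 2 * (mean1 j i * mean1 m m) - 2 * (cross_mean j i * surv m) - 2 * (mean1 i i * mean1 m m) = window_mean2 n k i"
      using False by (simp add: window_mean2_def m_def j_def algebra_simps)
    ultimately have B: "has_bochner_integral (gauss n) (\<lambda>x. ?I x * (window n k i x)\<^sup>2) (window_mean2 n k i)" by (simp only:)
    from A B show ?thesis by blast
  qed
  then show "has_bochner_integral (gauss n) (\<lambda>x. of_bool (is_min n x i) * window n k i x) (window_mean n k i)"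
    "has_bochner_integral (gauss n) (\<lambda>x. of_bool (is_min n x i) * (window n k i x)\<^sup>2) (window_mean2 n k i)" by blast+
qed

lemma measurable_walk_vervaat: "k \<le> n \<Longrightarrow> walk_vervaat n k \<in> borel_measurable (gauss n)"
  unfolding walk_vervaat_def[abs_def]
  by (intro borel_measurable_sum borel_measurable_has_bochner_integral[OF window_integral]) auto

lemma walk_vervaat_integral:
  assumes "k \<le> n"
  shows "has_bochner_integral (gauss n) (walk_vervaat n k) (\<Sum>i\<le>n. window_mean n k i)"
  unfolding walk_vervaat_def[abs_def]
  using assms by (intro has_bochner_integral_sum window_integral) auto

lemma walk_vervaat_integral2:
  assumes k: "k \<le> n"
  shows "has_bochner_integral (gauss n) (\<lambda>x. (walk_vervaat n k x)\<^sup>2) (\<Sum>i\<le>n. window_mean2 n k i)"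
proof -
  have "has_bochner_integral (gauss n) (\<lambda>x. \<Sum>i\<le>n. of_bool (is_min n x i) * (window n k i x)\<^sup>2) (\<Sum>i\<le>n. window_mean2 n k i)"
    using assms by (intro has_bochner_integral_sum window_integral2) auto
  moreover have "AE x in gauss n. (\<Sum>i\<le>n. of_bool (is_min n x i) * (window n k i x)\<^sup>2) = (walk_vervaat n k x)\<^sup>2"
    using AE_unique_min[of n]
  proof eventually_elim
    case (elim x)
    then obtain i where i: "i \<le> n" "\<forall>i'\<le>n. is_min n x i' \<longleftrightarrow> i' = i" by blast
    show ?case unfolding walk_vervaat_def sum_is_min[OF i] by (rule refl)
  qed
  moreover have "(\<lambda>x. (walk_vervaat n k x)\<^sup>2) \<in> borel_measurable (gauss n)"
    using measurable_walk_vervaat[OF k] by measurable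
  ultimately show ?thesis
    by (subst has_bochner_integral_cong_AE[symmetric]) (auto dest: borel_measurable_has_bochner_integral)
qed

text \<open>
  The distribution of the position of the minimum has total mass one.
\<close>
lemma sum_surv: "(\<Sum>i\<le>n. surv i * surv (n - i)) = 1"
proof -
  have h: "has_bochner_integral (gauss n) (\<lambda>x. \<Sum>i\<le>n. of_bool (is_min n x i)) (\<Sum>i\<le>n. surv i * surv (n - i))"
    by (intro has_bochner_integral_sum surv_cone) auto
  have "(\<Sum>i\<le>n. surv i * surv (n - i)) = (\<integral>x. (\<Sum>i\<le>n. of_bool (is_min n x i)) \<partial>gauss n)"
    by (rule has_bochner_integral_integral_eq[OF h, symmetric])
  also have "\<dots> = (\<integral>x. 1 \<partial>gauss n)"
  proof (rule integral_cong_AE)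
    show "AE x in gauss n. (\<Sum>i\<le>n. of_bool (is_min n x i)) = (1::real)"
      using AE_unique_min[of n]
    proof eventually_elim
      case (elim x)
      then obtain i where i: "i \<le> n" "\<forall>i'\<le>n. is_min n x i' \<longleftrightarrow> i' = i" by blast
      show ?case using sum_is_min[OF i, of "\<lambda>_. 1"] by simp
    qed
  qed (use borel_measurable_has_bochner_integral[OF h] in auto)
  also have "\<dots> = 1" by (simp add: gauss.prob_space)
  finally show ?thesis .
qed

lemma sum_triangle:
  fixes F :: "nat \<Rightarrow> nat \<Rightarrow> real"
  shows "(\<Sum>i\<le>n. \<Sum>d\<in>{1..n - i}. F i d) = (\<Sum>d\<in>{1..n}. \<Sum>i\<le>n - d. F i d)"
proof -
  have "(\<Sum>i\<le>n. \<Sum>d\<in>{1..n - i}. F i d) = (\<Sum>(i, d)\<in>Sigma {..n} (\<lambda>i. {1..n - i}). F i d)"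
    by (simp add: sum.Sigma)
  also have "\<dots> = (\<Sum>(d, i)\<in>Sigma {1..n} (\<lambda>d. {..n - d}). F i d)"
    by (intro sum.reindex_bij_witness[where i="\<lambda>(d, i). (i, d)" and j="\<lambda>(i, d). (d, i)"]) auto
  also have "\<dots> = (\<Sum>d\<in>{1..n}. \<Sum>i\<le>n - d. F i d)"
    by (simp add: sum.Sigma)
  finally show ?thesis .
qed

lemma sum_reverse: "(\<Sum>i\<le>n. F i) = (\<Sum>i\<le>n. F (n - i :: nat))"
  by (rule sum.reindex_bij_witness[where i="\<lambda>i. n - i" and j="\<lambda>i. n - i"]) auto

text \<open>
  Summing over the position of the minimum removes all factors \<open>surv\<close>.
\<close>
lemma sum_surv_convolution:
  "(\<Sum>i\<le>n. surv i * (\<Sum>d\<in>{1..n - i}. surv (n - i - d) * c d)) = (\<Sum>d\<in>{1..n}. c d)"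
proof -
  have "(\<Sum>i\<le>n. surv i * (\<Sum>d\<in>{1..n - i}. surv (n - i - d) * c d))
    = (\<Sum>d\<in>{1..n}. \<Sum>i\<le>n - d. surv i * (surv (n - i - d) * c d))"
    unfolding sum_distrib_left by (rule sum_triangle)
  also have "\<dots> = (\<Sum>d\<in>{1..n}. c d * (\<Sum>i\<le>n - d. surv i * surv (n - d - i)))"
    unfolding sum_distrib_left by (intro sum.cong refl) (simp add: diff_commute mult_ac add.commute)
  also have "\<dots> = (\<Sum>d\<in>{1..n}. c d)" by (simp only: sum_surv mult_1_right)
  finally show ?thesis .
qed

lemma sum_surv_mean1:
  "(\<Sum>i\<le>n. surv i * mean1 (min k (n - i)) (n - i)) = (\<Sum>d\<in>{1..n}. min k d * exc d)"
proof -
  have "mean1 (min k (n - i)) (n - i) = (\<Sum>d\<in>{1..n - i}. surv (n - i - d) * (min k d * exc d))" for i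
    by (subst mean1_eq) (auto intro!: sum.cong)
  then show ?thesis using sum_surv_convolution[of n "\<lambda>d. min k d * exc d"] by (simp add: of_nat_min)
qed

lemma mean1_diff:
  assumes "j \<le> i"
  shows "mean1 j i - mean1 i i = - (\<Sum>d\<in>{1..i}. surv (i - d) * (real (d - j) * exc d))"
  unfolding mean1_eq[OF assms] mean1_eq[OF order_refl] sum_subtractf[symmetric] sum_negf[symmetric]
  by (intro sum.cong refl) (auto simp: min_def of_nat_diff algebra_simps)

text \<open>
  In the range \<open>d \<le> n - k\<close> the truncated difference \<open>d - (n - k)\<close> vanishes, so the two cases in
  \<open>window_mean\<close> are given by one formula to which the convolution identity applies.
\<close>
lemma sum_window_mean:
  assumes k: "k \<le> n"
  shows "(\<Sum>i\<le>n. window_mean n k i) = (\<Sum>d\<in>{1..n}. min k d * exc d) - (\<Sum>d\<in>{1..n}. real (d - (n - k)) * exc d)"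
proof -
  let ?j = "n - k"
  let ?c = "\<lambda>d. real (d - ?j) * exc d"
  have "window_mean n k i = surv i * mean1 (min k (n - i)) (n - i)
      - surv (n - i) * (\<Sum>d\<in>{1..i}. surv (i - d) * ?c d)" if i: "i \<le> n" for i
  proof (cases "i + k \<le> n")
    case True
    then have "d - ?j = 0" if "d \<in> {1..i}" for d using that k by auto
    then have "(\<Sum>d\<in>{1..i}. surv (i - d) * ?c d) = 0" by (intro sum.neutral) auto
    with True show ?thesis by (simp add: window_mean_def min_absorb1)
  next
    case False
    then have "mean1 ?j i - mean1 i i = - (\<Sum>d\<in>{1..i}. surv (i - d) * ?c d)"
      by (intro mean1_diff) auto
    moreover have "min k (n - i) = n - i" using False by auto
    ultimately show ?thesis using False unfolding window_mean_def by simp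
  qed
  then have "(\<Sum>i\<le>n. window_mean n k i) = (\<Sum>i\<le>n. surv i * mean1 (min k (n - i)) (n - i))
    - (\<Sum>i\<le>n. surv (n - i) * (\<Sum>d\<in>{1..i}. surv (i - d) * ?c d))"
    by (simp add: sum_subtractf)
  also have "(\<Sum>i\<le>n. surv (n - i) * (\<Sum>d\<in>{1..i}. surv (i - d) * ?c d)) = (\<Sum>i\<le>n. surv i * (\<Sum>d\<in>{1..n - i}. surv (n - i - d) * ?c d))"
    by (subst sum_reverse) (intro sum.cong, auto)
  finally show ?thesis by (simp only: sum_surv_convolution sum_surv_mean1)
qed

text \<open>
  As for the mean, with one more term: the product of the mean of the future and of the mean of the past
  piece.  In its sum over \<open>i\<close> the mean of the future combines with the factors \<open>surv\<close> of the past to expected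
  depths of shorter walks.
\<close>
lemma sum_window_mean2:
  assumes k: "k \<le> n"
  shows "(\<Sum>i\<le>n. window_mean2 n k i) = k
    + (\<Sum>d\<in>{1..n}. if k < d then k * exc_mean k d else 0)
    - (\<Sum>d\<in>{1..n}. if n - k < d then real (d - (n - k)) * exc_mean (n - k) d else 0)
    + (\<Sum>d\<in>{1..n}. \<Sum>c\<in>{1..n - d}. (if d \<le> k then real d * real (min (k - d) c) else 0) * (exc c * exc d))
    - (\<Sum>d\<in>{1..n}. \<Sum>c\<in>{1..n - d}. real (d - (n - k)) * real c * (exc c * exc d))"
proof -
  define j where "j = n - k"
  let ?x = "\<lambda>d. if k < d then k * exc_mean k d else 0"
  let ?y = "\<lambda>d. if j < d then real (d - j) * exc_mean j d else 0"
  let ?e = "\<lambda>d. if d \<le> k then d * exc d else 0"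
  let ?c = "\<lambda>d. real (d - j) * exc d"
  (* A is the variance of k free steps; X and D come from the future, Y and E from the past piece, and H is
     the product of the two means.  Summed over i, E and H agree, which leaves -H from E - 2 H. *)
  define A where "A i = k * (surv i * surv (n - i))" for i
  define X where "X i = surv i * (\<Sum>d\<in>{1..n - i}. surv (n - i - d) * ?x d)" for i
  define D where "D i = surv i * (\<Sum>d\<in>{1..n - i}. ?e d * mean1 (min (k - d) (n - i - d)) (n - i - d))" for i
  define Y where "Y i = surv (n - i) * (\<Sum>d\<in>{1..i}. surv (i - d) * ?y d)" for i
  define E where "E i = surv (n - i) * (\<Sum>d\<in>{1..i}. ?c d * mean1 (i - d) (i - d))" for i
  define H where "H i = mean1 (n - i) (n - i) * (\<Sum>d\<in>{1..i}. surv (i - d) * ?c d)" for i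
  have "window_mean2 n k i = A i + X i + D i - Y i + E i - 2 * H i" if i: "i \<le> n" for i
  proof (cases "i + k \<le> n")
    case True
    then have "d - j = 0" "\<not> j < d" if "d \<in> {1..i}" for d using that k by (auto simp: j_def)
    then have z: "Y i = 0" "E i = 0" "H i = 0" by (auto simp: Y_def E_def H_def intro!: sum.neutral)
    have ki: "k \<le> n - i" using True by simp
    have 1: "(\<Sum>d\<in>{1..n - i}. surv (n - i - d) * ?x d) = k * (\<Sum>d\<in>{k+1..n - i}. surv (n - i - d) * exc_mean k d)"
      unfolding sum_distrib_left by (intro sum.mono_neutral_cong_right) auto
    have 2: "(\<Sum>d\<in>{1..n - i}. ?e d * mean1 (min (k - d) (n - i - d)) (n - i - d))
      = (\<Sum>d\<in>{1..k}. d * exc d * mean1 (k - d) (n - i - d))"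
      using ki by (intro sum.mono_neutral_cong_right) (auto simp: min_absorb1 diff_le_mono)
    show ?thesis
      using True unfolding window_mean2_def mean2_eq[OF ki] z A_def X_def D_def 1 2
      by (simp add: algebra_simps)
  next
    case False
    then have ji: "j \<le> i" and mk: "n - i < k" using i k by (auto simp: j_def)
    have z: "X i = 0" using mk by (auto simp: X_def intro!: sum.neutral)
    have 1: "mean2 (n - i) (n - i) = (n - i) * surv (n - i) + (\<Sum>d\<in>{1..n - i}. ?e d * mean1 (min (k - d) (n - i - d)) (n - i - d))"
      unfolding mean2_eq[OF order_refl] using mk by (auto intro!: sum.cong simp: min_absorb2)
    have 2: "mean2 i i - 2 * cross_mean j i + mean2 j i
      = real (i - j) * surv i + (\<Sum>d\<in>{1..i}. ?c d * mean1 (i - d) (i - d)) - (\<Sum>d\<in>{1..i}. surv (i - d) * ?y d)"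
    proof -
      have "(\<Sum>d\<in>{j+1..i}. real (d - j) * (mean1 (i - d) (i - d) * exc d - surv (i - d) * exc_mean j d))
        = (\<Sum>d\<in>{1..i}. ?c d * mean1 (i - d) (i - d) - surv (i - d) * ?y d)"
        by (rule sum.mono_neutral_cong_left) (auto simp: algebra_simps)
      then show ?thesis unfolding spread_eq[OF ji] by (simp add: sum_subtractf)
    qed
    have 3: "mean1 j i - mean1 i i = - (\<Sum>d\<in>{1..i}. surv (i - d) * ?c d)"
      by (rule mean1_diff[OF ji])
    have kk: "real (n - i) + real (i - j) = real k" using i ji k by (auto simp: j_def of_nat_diff)
    have "window_mean2 n k i = surv i * mean2 (n - i) (n - i)
       + surv (n - i) * (mean2 i i - 2 * cross_mean j i + mean2 j i)
       + 2 * (mean1 (n - i) (n - i) * (mean1 j i - mean1 i i))"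
      using False by (simp add: window_mean2_def j_def)
    also have "\<dots> = (real (n - i) + real (i - j)) * (surv i * surv (n - i)) + D i + E i - Y i - 2 * H i"
      unfolding 1 2 3 D_def E_def Y_def H_def by (simp add: algebra_simps)
    finally show ?thesis unfolding kk z A_def by simp
  qed
  then have "(\<Sum>i\<le>n. window_mean2 n k i) = (\<Sum>i\<le>n. A i + X i + D i - Y i + E i - 2 * H i)"
    by (intro sum.cong) auto
  also have "\<dots> = (\<Sum>i\<le>n. A i) + (\<Sum>i\<le>n. X i) + (\<Sum>i\<le>n. D i) - (\<Sum>i\<le>n. Y i) + ((\<Sum>i\<le>n. E i) - 2 * (\<Sum>i\<le>n. H i))"
    by (simp add: sum.distrib sum_subtractf sum_distrib_left)
  also have "(\<Sum>i\<le>n. A i) = k"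
    unfolding A_def sum_distrib_left[symmetric] sum_surv by simp
  also have "(\<Sum>i\<le>n. X i) = (\<Sum>d\<in>{1..n}. ?x d)"
    unfolding X_def by (rule sum_surv_convolution)
  also have "(\<Sum>i\<le>n. D i) = (\<Sum>d\<in>{1..n}. \<Sum>c\<in>{1..n - d}. (if d \<le> k then real d * real (min (k - d) c) else 0) * (exc c * exc d))"
  proof -
    have "(\<Sum>i\<le>n. D i) = (\<Sum>d\<in>{1..n}. \<Sum>i\<le>n - d. surv i * (?e d * mean1 (min (k - d) (n - i - d)) (n - i - d)))"
      unfolding D_def sum_distrib_left by (rule sum_triangle)
    also have "\<dots> = (\<Sum>d\<in>{1..n}. ?e d * (\<Sum>i\<le>n - d. surv i * mean1 (min (k - d) (n - d - i)) (n - d - i)))"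
      unfolding sum_distrib_left by (intro sum.cong refl) (simp add: diff_commute mult_ac add.commute)
    also have "\<dots> = (\<Sum>d\<in>{1..n}. \<Sum>c\<in>{1..n - d}. (if d \<le> k then real d * real (min (k - d) c) else 0) * (exc c * exc d))"
      unfolding sum_surv_mean1 sum_distrib_left by (intro sum.cong refl) auto
    finally show ?thesis .
  qed
  also have "(\<Sum>i\<le>n. Y i) = (\<Sum>d\<in>{1..n}. ?y d)"
  proof -
    have "(\<Sum>i\<le>n. Y i) = (\<Sum>i\<le>n. surv i * (\<Sum>d\<in>{1..n - i}. surv (n - i - d) * ?y d))"
      unfolding Y_def by (subst sum_reverse) (intro sum.cong, auto)
    then show ?thesis by (simp only: sum_surv_convolution)
  qed
  also have "(\<Sum>i\<le>n. E i) - 2 * (\<Sum>i\<le>n. H i) = - (\<Sum>d\<in>{1..n}. \<Sum>c\<in>{1..n - d}. real (d - j) * real c * (exc c * exc d))"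
  proof -
    define mu where "mu N = (\<Sum>i\<le>N. surv i * mean1 (N - i) (N - i))" for N
    have mu: "mu N = (\<Sum>c\<in>{1..N}. c * exc c)" for N
    proof -
      have "mu N = (\<Sum>c\<in>{1..N}. min N c * exc c)"
        using sum_surv_mean1[of N N] by (simp add: mu_def min_absorb2)
      then show ?thesis by (simp add: min_absorb2)
    qed
    have "(\<Sum>i\<le>n. E i) = (\<Sum>i\<le>n. surv i * (\<Sum>d\<in>{1..n - i}. ?c d * mean1 (n - i - d) (n - i - d)))"
      unfolding E_def by (subst sum_reverse) (intro sum.cong, auto)
    also have "\<dots> = (\<Sum>d\<in>{1..n}. \<Sum>i\<le>n - d. surv i * (?c d * mean1 (n - i - d) (n - i - d)))"
      unfolding sum_distrib_left by (rule sum_triangle)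
    also have "\<dots> = (\<Sum>d\<in>{1..n}. ?c d * mu (n - d))"
      unfolding mu_def sum_distrib_left by (intro sum.cong refl) (simp add: diff_commute mult_ac add.commute)
    finally have E: "(\<Sum>i\<le>n. E i) = (\<Sum>d\<in>{1..n}. ?c d * mu (n - d))" .
    have "(\<Sum>i\<le>n. H i) = (\<Sum>i\<le>n. mean1 i i * (\<Sum>d\<in>{1..n - i}. surv (n - i - d) * ?c d))"
      unfolding H_def by (subst sum_reverse) (intro sum.cong, auto)
    also have "\<dots> = (\<Sum>d\<in>{1..n}. \<Sum>i\<le>n - d. mean1 i i * (surv (n - i - d) * ?c d))"
      unfolding sum_distrib_left by (rule sum_triangle)
    also have "\<dots> = (\<Sum>d\<in>{1..n}. ?c d * (\<Sum>i\<le>n - d. surv (n - d - i) * mean1 i i))"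
      unfolding sum_distrib_left by (intro sum.cong refl) (simp add: diff_commute mult_ac add.commute)
    also have "\<dots> = (\<Sum>d\<in>{1..n}. ?c d * mu (n - d))"
    proof -
      have "(\<Sum>i\<le>N. surv (N - i) * mean1 i i) = mu N" for N
        unfolding mu_def by (subst sum_reverse) (intro sum.cong, auto)
      then show ?thesis by (simp only:)
    qed
    finally have H: "(\<Sum>i\<le>n. H i) = (\<Sum>d\<in>{1..n}. ?c d * mu (n - d))" .
    have "(\<Sum>i\<le>n. E i) - 2 * (\<Sum>i\<le>n. H i) = - (\<Sum>d\<in>{1..n}. ?c d * mu (n - d))"
      unfolding E H by simp
    also have "(\<Sum>d\<in>{1..n}. ?c d * mu (n - d)) = (\<Sum>d\<in>{1..n}. \<Sum>c\<in>{1..n - d}. real (d - j) * real c * (exc c * exc d))"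
      unfolding mu sum_distrib_left by (intro sum.cong refl) (simp add: mult_ac)
    finally show ?thesis .
  qed
  finally show ?thesis unfolding j_def by simp
qed

section \<open>The excursion weights\<close>

definition depth :: "nat \<Rightarrow> (nat \<Rightarrow> real) \<Rightarrow> real" where
  "depth n x = Max ((\<lambda>r. - psum x r) ` {..n})"

lemma depth_ge: "r \<le> n \<Longrightarrow> - psum x r \<le> depth n x"
  unfolding depth_def by (intro Max_ge) auto

lemma depth_nonneg: "0 \<le> depth n x"
  using depth_ge[of 0 n x] by simp

lemma depth_eqI:
  assumes "i \<le> n" "\<And>r. r \<le> n \<Longrightarrow> - psum x r \<le> a" "a = - psum x i"
  shows "depth n x = a"
  unfolding depth_def using assms by (intro Max_eqI) auto

lemma depth_attained: obtains i where "i \<le> n" "depth n x = - psum x i"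
proof -
  have "depth n x \<in> (\<lambda>r. - psum x r) ` {..n}"
    unfolding depth_def by (intro Max_in) auto
  then show thesis using that by auto
qed

lemma measurable_depth: "n \<le> q \<Longrightarrow> depth n \<in> borel_measurable (gauss q)"
  unfolding depth_def[abs_def]
  by (intro borel_measurable_Max borel_measurable_uminus measurable_psum) auto

text \<open>
  Split according to the position of the minimum, then use \<open>sum_surv_mean1\<close>.
\<close>
lemma depth_integral: "has_bochner_integral (gauss n) (depth n) (\<Sum>d\<in>{1..n}. d * exc d)"
proof -
  have h: "has_bochner_integral (gauss n) (\<lambda>x. \<Sum>i\<le>n. of_bool (is_min n x i) * (- psum x i)) (\<Sum>i\<le>n. mean1 i i * surv (n - i))"
    by (intro has_bochner_integral_sum depth_cone) auto
  have "AE x in gauss n. (\<Sum>i\<le>n. of_bool (is_min n x i) * (- psum x i)) = depth n x"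
    using AE_unique_min[of n]
  proof eventually_elim
    case (elim x)
    then obtain i where i: "i \<le> n" "\<forall>i'\<le>n. is_min n x i' \<longleftrightarrow> i' = i" by blast
    then have "is_min n x i" by blast
    then have "depth n x = - psum x i" using i(1) by (intro depth_eqI) (auto simp: is_min_def)
    then show ?case using sum_is_min[OF i, of "\<lambda>i. - psum x i"] by (simp only:)
  qed
  with h have "has_bochner_integral (gauss n) (depth n) (\<Sum>i\<le>n. mean1 i i * surv (n - i))"
    by (subst has_bochner_integral_cong_AE[symmetric])
      (auto dest: borel_measurable_has_bochner_integral simp: measurable_depth)
  moreover have "(\<Sum>i\<le>n. mean1 i i * surv (n - i)) = (\<Sum>i\<le>n. surv i * mean1 (min n (n - i)) (n - i))"
    by (subst sum_reverse) (intro sum.cong, auto simp: min_absorb2)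
  moreover have "(\<Sum>d\<in>{1..n}. min n d * exc d) = (\<Sum>d\<in>{1..n}. d * exc d)"
    by (intro sum.cong) auto
  ultimately show ?thesis using sum_surv_mean1[of n n] by simp
qed

lemma depth_integral_Suc: "has_bochner_integral (gauss (Suc n)) (depth n) (\<Sum>d\<in>{1..n}. d * exc d)"
proof (rule has_bochner_integral_nn_integral)
  have pos: "0 \<le> (\<Sum>d\<in>{1..n}. d * exc d)"
    unfolding has_bochner_integral_integral_eq[OF depth_integral[of n], symmetric]
    by (intro Bochner_Integration.integral_nonneg depth_nonneg)
  show "0 \<le> (\<Sum>d\<in>{1..n}. d * exc d)" by (rule pos)
  have r: "depth n (restrict x {..<n}) = depth n x" for x
    unfolding depth_def by (intro arg_cong[where f=Max] image_cong) (auto simp: psum_restrict)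
  have "(\<integral>\<^sup>+x. ennreal (depth n (restrict x {..<n})) \<partial>gauss (n + 1)) = (\<integral>\<^sup>+x. ennreal (depth n x) \<partial>gauss n)"
    by (rule nn_integral_gauss_drop) (intro measurable_compose[OF measurable_depth measurable_ennreal] order_refl)
  also have "\<dots> = ennreal (\<Sum>d\<in>{1..n}. d * exc d)"
    using depth_integral[of n] by (subst nn_integral_eq_integral) (auto simp: has_bochner_integral_iff depth_nonneg)
  finally show "(\<integral>\<^sup>+x. ennreal (depth n x) \<partial>gauss (Suc n)) = ennreal (\<Sum>d\<in>{1..n}. d * exc d)"
    by (simp add: r)
qed (auto simp: measurable_depth depth_nonneg)

text \<open>
  The first step is moved to the end.  The factor \<open>1\<close> gives the shape to which \<open>distr_gauss_permute\<close>
  applies.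
\<close>
definition rotate_steps :: "nat \<Rightarrow> (nat \<Rightarrow> real) \<Rightarrow> nat \<Rightarrow> real" where
  "rotate_steps n x = (\<lambda>l\<in>{..<n}. 1 * x (Suc l mod n))"

lemma bij_betw_rotate: "bij_betw (\<lambda>l. Suc l mod n) {..<n} {..<n}"
proof (rule bij_betw_imageI)
  show "inj_on (\<lambda>l. Suc l mod n) {..<n}"
    by (auto simp: inj_on_def mod_Suc split: if_splits)
  then show "(\<lambda>l. Suc l mod n) ` {..<n} = {..<n}"
    by (intro card_subset_eq) (auto simp: card_image)
qed

lemma psum_rotate:
  assumes "r \<le> n" shows "psum (rotate_steps (Suc n) x) r = psum x (Suc r) - x 0"
proof -
  have "psum (rotate_steps (Suc n) x) r = (\<Sum>l<r. x (Suc l))"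
    unfolding psum_def using assms by (intro sum.cong) (auto simp: rotate_steps_def)
  then show ?thesis unfolding psum_def by (subst sum.lessThan_Suc_shift) simp
qed

lemma psum_permute:
  assumes "bij_betw \<pi> {..<n} {..<n}"
  shows "psum (\<lambda>l\<in>{..<n}. 1 * x (\<pi> l)) n = psum x n"
  unfolding psum_def using sum.reindex_bij_betw[OF assms, of x] by simp

text \<open>
  If the walk ends above its start, its minimum is attained before the last time.  Otherwise it is attained
  after time \<open>0\<close>, and what remains is the walk without its first step, shifted by that step.  Rotation makes the
  latter a function of the first \<open>n\<close> steps, and it preserves the law and the final value.
\<close>
lemma depth_Suc:
  "depth (Suc n) x = of_bool (0 < psum x (Suc n)) * depth n x
    + of_bool (psum x (Suc n) \<le> 0) * depth n (rotate_steps (Suc n) x)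
    + of_bool (psum x (Suc n) \<le> 0) * (- x 0)"
proof (cases "0 < psum x (Suc n)")
  case True
  obtain i where i: "i \<le> n" "depth n x = - psum x i" by (rule depth_attained)
  have "depth (Suc n) x = depth n x"
  proof (rule depth_eqI[OF _ _ i(2)])
    fix r assume "r \<le> Suc n"
    then show "- psum x r \<le> depth n x"
      using depth_ge[of r n x] depth_nonneg[of n x] True by (cases "r = Suc n") auto
  qed (use i in simp)
  then show ?thesis using True by simp
next
  case False
  let ?y = "rotate_steps (Suc n) x"
  obtain i where i: "i \<le> n" "depth n ?y = - psum ?y i" by (rule depth_attained)
  have "depth (Suc n) x = depth n ?y - x 0"
  proof (rule depth_eqI)
    show "Suc i \<le> Suc n" "depth n ?y - x 0 = - psum x (Suc i)" using i psum_rotate[of i n x] by auto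
    fix r assume r: "r \<le> Suc n"
    show "- psum x r \<le> depth n ?y - x 0"
    proof (cases r)
      case 0
      then show ?thesis using depth_ge[of n n ?y] psum_rotate[of n n x] False by auto
    next
      case (Suc r')
      then show ?thesis using depth_ge[of r' n ?y] psum_rotate[of r' n x] r by auto
    qed
  qed
  then show ?thesis using False by simp
qed

text \<open>
  Integration by parts once more, now with \<open>f = 1\<close>.
\<close>
lemma integral_std_normal_tail: "(\<integral>y. of_bool (s + y \<le> 0) * (- y) \<partial>std_normal) = std_normal_density s"
proof -
  have "(\<integral>y. of_bool (s + y \<le> 0) * (- y) \<partial>std_normal)
    = (\<integral>y. std_normal_density y * (of_bool (s + y \<le> 0) * (- y)) \<partial>lborel)"
    unfolding std_normal_def by (subst integral_density) auto
  also have "\<dots> = (\<integral>y. std_normal_density (- s + - 1 * y) * (of_bool (s + (- s + - 1 * y) \<le> 0) * (- (- s + - 1 * y))) \<partial>lborel)"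
    by (subst lborel_integral_real_affine[where c="-1" and t="-s"]) auto
  also have "\<dots> = half_step' (\<lambda>_. 1) (- s)"
    unfolding half_step'_def
    by (intro Bochner_Integration.integral_cong) (auto simp: indicator_def std_normal_density_def power2_eq_square algebra_simps)
  also have "\<dots> = std_normal_density s"
    using half_step'_eq[of "\<lambda>_. 1" "\<lambda>_. 0" "-s"] half_step_cmult[of 0 "\<lambda>_. 0"] by (simp add: std_normal_density_def)
  finally show ?thesis .
qed

text \<open>
  Adding independent Gaussian variables adds variances.
\<close>
lemma nn_integral_normal_density_gauss:
  assumes "v > 0"
  shows "(\<integral>\<^sup>+x. ennreal (normal_density 0 (sqrt v) (psum x n)) \<partial>gauss n) = ennreal (normal_density 0 (sqrt (v + n)) 0)"
  using assms
proof (induction n arbitrary: v)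
  case 0
  then show ?case by (simp add: gauss.emeasure_space_1)
next
  case (Suc n)
  have m: "(\<lambda>x. ennreal (normal_density 0 (sqrt v) (psum x (Suc n)))) \<in> borel_measurable (gauss (Suc n))"
    using measurable_psum[of "Suc n" "Suc n"] by measurable
  have "(\<integral>\<^sup>+x. ennreal (normal_density 0 (sqrt v) (psum x (Suc n))) \<partial>gauss (Suc n))
    = (\<integral>\<^sup>+x. \<integral>\<^sup>+y. ennreal (normal_density 0 (sqrt v) (psum x n + y)) \<partial>std_normal \<partial>gauss n)"
    using nn_integral_gauss_Suc[OF m] by (simp only: psum_upd)
  also have "\<dots> = (\<integral>\<^sup>+x. ennreal (normal_density 0 (sqrt (v + 1)) (psum x n)) \<partial>gauss n)"
  proof (intro nn_integral_cong)
    fix x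
    let ?s = "psum x n"
    have "(\<integral>\<^sup>+y. ennreal (normal_density 0 (sqrt v) (?s + y)) \<partial>std_normal)
      = (\<integral>\<^sup>+y. ennreal (std_normal_density y) * ennreal (normal_density 0 (sqrt v) (?s + y)) \<partial>lborel)"
      unfolding std_normal_def by (subst nn_integral_density) auto
    also have "\<dots> = (\<integral>\<^sup>+y. ennreal (std_normal_density (0 + - 1 * y)) * ennreal (normal_density 0 (sqrt v) (?s + (0 + - 1 * y))) \<partial>lborel)"
      by (subst nn_integral_real_affine[where c="-1" and t=0]) auto
    also have "\<dots> = (\<integral>\<^sup>+y. ennreal (normal_density 0 (sqrt v) (?s - y) * normal_density 0 1 y) \<partial>lborel)"
    proof (intro nn_integral_cong)
      fix y
      have "std_normal_density (0 + - 1 * y) = normal_density 0 1 y" "?s + (0 + - 1 * y) = ?s - y"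
        by (simp_all add: std_normal_density_def)
      then show "ennreal (std_normal_density (0 + - 1 * y)) * ennreal (normal_density 0 (sqrt v) (?s + (0 + - 1 * y)))
        = ennreal (normal_density 0 (sqrt v) (?s - y) * normal_density 0 1 y)"
        by (simp only: ennreal_mult[OF normal_density_nonneg normal_density_nonneg] mult.commute)
    qed
    also have "\<dots> = ennreal (normal_density 0 (sqrt (v + 1)) ?s)"
      using fun_cong[OF conv_normal_density_zero_mean[of "sqrt v" 1], of ?s] Suc.prems by simp
    finally show "(\<integral>\<^sup>+y. ennreal (normal_density 0 (sqrt v) (?s + y)) \<partial>std_normal) = ennreal (normal_density 0 (sqrt (v + 1)) ?s)" .
  qed
  also have "\<dots> = ennreal (normal_density 0 (sqrt (v + Suc n)) 0)"
    using Suc.IH[of "v + 1"] Suc.prems by (simp add: add_ac)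
  finally show ?case .
qed

lemma integrable_std_normal_ident: "integrable std_normal (\<lambda>y. y)"
proof -
  have "integrable lborel (\<lambda>y. std_normal_density y * y)"
    using integrable_std_normal_moment[of 1] by simp
  then show ?thesis unfolding std_normal_def by (subst integrable_density) auto
qed

lemma integral_last_step:
  shows "integrable (gauss (Suc n)) (\<lambda>x. of_bool (psum x (Suc n) \<le> 0) * (- x n))"
    and "(\<integral>x. of_bool (psum x (Suc n) \<le> 0) * (- x n) \<partial>gauss (Suc n)) = normal_density 0 (sqrt (1 + n)) 0"
proof -
  have [measurable]: "(\<lambda>x. x n) \<in> borel_measurable (gauss (Suc n))" "(\<lambda>x. psum x (Suc n)) \<in> borel_measurable (gauss (Suc n))"
    by (auto intro!: measurable_coord_gauss measurable_psum)
  have "(\<integral>\<^sup>+x. ennreal \<bar>x n\<bar> \<partial>gauss (Suc n)) = (\<integral>\<^sup>+x. \<integral>\<^sup>+y. ennreal \<bar>(x(n := y)) n\<bar> \<partial>std_normal \<partial>gauss n)"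
    by (rule nn_integral_gauss_Suc) measurable
  also have "\<dots> = (\<integral>\<^sup>+y. ennreal \<bar>y\<bar> \<partial>std_normal)"
    by (simp add: gauss.emeasure_space_1)
  also have "\<dots> < \<infinity>"
    using integrable_std_normal_ident by (simp add: integrable_iff_bounded)
  finally have "integrable (gauss (Suc n)) (\<lambda>x. x n)"
    by (simp add: integrable_iff_bounded)
  then show int: "integrable (gauss (Suc n)) (\<lambda>x. of_bool (psum x (Suc n) \<le> 0) * (- x n))"
    by (rule Bochner_Integration.integrable_bound) (auto simp: of_bool_def)
  have *: "{..<Suc n} = insert n {..<n}" by auto
  have "(\<integral>x. of_bool (psum x (Suc n) \<le> 0) * (- x n) \<partial>gauss (Suc n))
    = (\<integral>x. \<integral>y. of_bool (psum (x(n := y)) (Suc n) \<le> 0) * (- (x(n := y)) n) \<partial>std_normal \<partial>gauss n)"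
    using int unfolding gauss_def * by (intro gauss_product.product_integral_insert) auto
  also have "\<dots> = (\<integral>x. std_normal_density (psum x n) \<partial>gauss n)"
    by (simp only: psum_upd fun_upd_same integral_std_normal_tail)
  also have "\<dots> = enn2real (\<integral>\<^sup>+x. ennreal (std_normal_density (psum x n)) \<partial>gauss n)"
  proof (rule integral_eq_nn_integral)
    show "(\<lambda>x. std_normal_density (psum x n)) \<in> borel_measurable (gauss n)"
      using measurable_psum[of n n] by measurable
  qed auto
  also have "\<dots> = normal_density 0 (sqrt (1 + n)) 0"
    using nn_integral_normal_density_gauss[of 1 n] by simp
  finally show "(\<integral>x. of_bool (psum x (Suc n) \<le> 0) * (- x n) \<partial>gauss (Suc n)) = normal_density 0 (sqrt (1 + n)) 0" .
qed

lemma has_bochner_integral_measure_preserving: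
  fixes f :: "'b \<Rightarrow> real"
  assumes "distr M M T = M" "T \<in> measurable M M" "has_bochner_integral M f c"
  shows "has_bochner_integral M (\<lambda>x. f (T x)) c"
proof -
  have f: "f \<in> borel_measurable M" using assms(3) by (rule borel_measurable_has_bochner_integral)
  show ?thesis
    using assms(3) integrable_distr_eq[OF assms(2) f] integral_distr[OF assms(2) f]
    unfolding has_bochner_integral_iff assms(1) by simp
qed

text \<open>
  By exchangeability the first step can be replaced by the last one, for which the conditional expectation
  given the other steps is explicit.
\<close>
lemma integral_first_step:
  "has_bochner_integral (gauss (Suc n)) (\<lambda>x. of_bool (psum x (Suc n) \<le> 0) * (- x 0)) (normal_density 0 (sqrt (1 + n)) 0)"
proof -
  define \<pi> where "\<pi> l = (if l = 0 then n else if l = n then 0 else l)" for l :: nat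
  have pi: "bij_betw \<pi> {..<Suc n} {..<Suc n}"
    by (rule bij_betw_byWitness[where f'=\<pi>]) (auto simp: \<pi>_def)
  let ?T = "\<lambda>x. \<lambda>l\<in>{..<Suc n}. 1 * x (\<pi> l)"
  let ?f = "\<lambda>x. of_bool (psum x (Suc n) \<le> 0) * (- x n)"
  have T: "distr (gauss (Suc n)) (gauss (Suc n)) ?T = gauss (Suc n)" "?T \<in> measurable (gauss (Suc n)) (gauss (Suc n))"
    using distr_gauss_permute[OF pi, of 1] by blast+
  have "has_bochner_integral (gauss (Suc n)) ?f (normal_density 0 (sqrt (1 + n)) 0)"
    using integral_last_step[of n] by (simp only: has_bochner_integral_iff)
  from has_bochner_integral_measure_preserving[OF T this]
  have "has_bochner_integral (gauss (Suc n)) (\<lambda>x. ?f (?T x)) (normal_density 0 (sqrt (1 + n)) 0)" .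
  moreover have "?f (?T x) = of_bool (psum x (Suc n) \<le> 0) * (- x 0)" for x
    unfolding psum_permute[OF pi] by (simp add: \<pi>_def)
  ultimately show ?thesis by (simp only:)
qed

text \<open>
  Take expectations in \<open>depth_Suc\<close>.  The first two terms add up to the expected depth of the shorter walk,
  so the increment of the expected depth, which is \<open>Suc n * exc (Suc n)\<close> by \<open>depth_integral\<close>, is the term
  with the first step.
\<close>
lemma exc_Suc: "real (Suc n) * exc (Suc n) = normal_density 0 (sqrt (1 + n)) 0"
proof -
  let ?N = "Suc n"
  let ?R = "rotate_steps ?N"
  have R: "distr (gauss ?N) (gauss ?N) ?R = gauss ?N" "?R \<in> measurable (gauss ?N) (gauss ?N)"
    unfolding rotate_steps_def[abs_def] by (rule distr_gauss_permute[OF bij_betw_rotate]; simp)+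
  have psR: "psum (?R x) ?N = psum x ?N" for x
    unfolding rotate_steps_def by (rule psum_permute[OF bij_betw_rotate])
  have [measurable]: "(\<lambda>x. psum x ?N) \<in> borel_measurable (gauss ?N)" "depth n \<in> borel_measurable (gauss ?N)"
    by (auto intro!: measurable_psum measurable_depth)
  let ?g = "\<lambda>x. of_bool (psum x ?N \<le> 0) * depth n x"
  let ?h = "\<lambda>x. of_bool (0 < psum x ?N) * depth n x"
  have int: "integrable (gauss ?N) (depth n)" using depth_integral_Suc by (simp add: has_bochner_integral_iff)
  have g: "integrable (gauss ?N) ?g" "integrable (gauss ?N) ?h"
    by (rule Bochner_Integration.integrable_bound[OF int]; auto simp: of_bool_def)+
  have gR: "integrable (gauss ?N) (\<lambda>x. ?g (?R x))" "(\<integral>x. ?g (?R x) \<partial>gauss ?N) = (\<integral>x. ?g x \<partial>gauss ?N)"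
    using has_bochner_integral_measure_preserving[OF R has_bochner_integral_integrable[OF g(1)]]
    unfolding has_bochner_integral_iff by blast+
  have "has_bochner_integral (gauss ?N) (\<lambda>x. ?h x + ?g (?R x) + of_bool (psum x ?N \<le> 0) * (- x 0))
     ((\<integral>x. ?h x \<partial>gauss ?N) + (\<integral>x. ?g x \<partial>gauss ?N) + normal_density 0 (sqrt (1 + n)) 0)"
    using g gR by (intro has_bochner_integral_add integral_first_step) (auto simp: has_bochner_integral_iff)
  moreover have "?h x + ?g (?R x) + of_bool (psum x ?N \<le> 0) * (- x 0) = depth ?N x" for x
    unfolding depth_Suc psR by simp
  ultimately have "has_bochner_integral (gauss ?N) (depth ?N)
     ((\<integral>x. ?h x \<partial>gauss ?N) + (\<integral>x. ?g x \<partial>gauss ?N) + normal_density 0 (sqrt (1 + n)) 0)"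
    by (simp only:)
  moreover have "(\<integral>x. ?h x \<partial>gauss ?N) + (\<integral>x. ?g x \<partial>gauss ?N) = (\<Sum>d\<in>{1..n}. d * exc d)"
  proof -
    have "(\<integral>x. ?h x \<partial>gauss ?N) + (\<integral>x. ?g x \<partial>gauss ?N) = (\<integral>x. depth n x \<partial>gauss ?N)"
      by (subst Bochner_Integration.integral_add[symmetric, OF g(2,1)])
        (auto intro!: Bochner_Integration.integral_cong simp: of_bool_def)
    then show ?thesis using depth_integral_Suc[of n] by (simp add: has_bochner_integral_iff)
  qed
  ultimately have "(\<Sum>d\<in>{1..?N}. d * exc d) = (\<Sum>d\<in>{1..n}. d * exc d) + normal_density 0 (sqrt (1 + n)) 0"
    using has_bochner_integral_eq[OF depth_integral[of ?N]] by simp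
  then show ?thesis by simp
qed

lemma exc_eq:
  assumes "d \<ge> 1"
  shows "exc d = 1 / sqrt (2 * pi) * real d powr (- 3 / 2)"
proof -
  obtain n where d: "d = Suc n" using assms by (cases d) auto
  have "real d * exc d = 1 / sqrt (2 * pi * d)"
    unfolding d exc_Suc by (simp add: normal_density_def add.commute)
  also have "\<dots> = 1 / sqrt (2 * pi) * real d powr (- 1 / 2)"
    using assms by (simp add: real_sqrt_mult powr_minus_divide powr_half_sqrt)
  also have "real d powr (- 1 / 2) = real d * real d powr (- 3 / 2)"
    using assms powr_add[of "real d" 1 "- 3 / 2"] by simp
  finally have "real d * exc d = real d * (1 / sqrt (2 * pi) * real d powr (- 3 / 2))" by simp
  then show ?thesis using assms by (simp only: mult_cancel_left) auto
qed

section \<open>The second moment as a sum over pairs\<close>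

text \<open>
  The power \<open>- 3 / 2\<close>: up to a constant, the Levy density of the stable subordinator of index \<open>1 / 2\<close>, that
  is, Ito's measure of the lengths of Brownian excursions.
\<close>
definition levy_density :: "real \<Rightarrow> real" where
  "levy_density y = 1 / (y * sqrt y)"

lemma exc_eq_levy:
  assumes "d \<ge> 1"
  shows "exc d = levy_density d / sqrt (2 * pi)"
proof -
  have "sqrt (real d) > 0" using assms by simp
  have "real d powr (- 3 / 2) = 1 / (d * sqrt d)"
    using assms powr_add[of "real d" 1 "1 / 2"] by (simp add: powr_minus_divide powr_half_sqrt)
  then show ?thesis using exc_eq[OF assms] by (simp add: levy_density_def)
qed

text \<open>
  The weight of a pair of excursion lengths in the second moment of a window of length \<open>\<kappa>\<close> whose complement
  has length \<open>\<iota>\<close>.  The maxima with \<open>0\<close> make each term vanish outside its summation range in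
  \<open>sum_window_mean2\<close>, so that all pairs can be treated alike.
\<close>
definition pair_weight :: "real \<Rightarrow> real \<Rightarrow> real \<Rightarrow> real \<Rightarrow> real" where
  "pair_weight \<kappa> \<iota> c d = \<kappa> / 2 * max 0 (min \<kappa> c + min \<kappa> d - \<kappa>)
     - max 0 (c + d - \<iota>) / 2 * max 0 (min \<iota> c + min \<iota> d - \<iota>)
     + d * min (max 0 (\<kappa> - d)) c - max 0 (d - \<iota>) * c"

text \<open>
  Averaging \<open>exc_mean_eq\<close> with its image under \<open>l \<mapsto> s - l\<close> makes all weights nonnegative.
\<close>
lemma exc_mean_symmetric:
  assumes "k < s"
  shows "exc_mean k s = (\<Sum>l\<in>{1..s - 1}. max 0 (min (real k) l + min (real k) (real (s - l)) - k) / 2 * (exc l * exc (s - l)))"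
proof -
  have sw: "(\<Sum>l\<in>{1..s - 1}. min (real k) l * (exc l * exc (s - l))) = (\<Sum>l\<in>{1..s - 1}. min (real k) (real (s - l)) * (exc l * exc (s - l)))"
    by (intro sum.reindex_bij_witness[where i="\<lambda>l. s - l" and j="\<lambda>l. s - l"]) (auto simp: mult.commute)
  have "exc_mean k s = (\<Sum>l\<in>{1..s - 1}. min (real k) l * (exc l * exc (s - l))) - (\<Sum>l\<in>{1..s - 1}. k / 2 * (exc l * exc (s - l)))"
    unfolding exc_mean_eq[OF assms] sum_subtractf[symmetric] by (intro sum.cong refl) (simp add: of_nat_min algebra_simps)
  also have "(\<Sum>l\<in>{1..s - 1}. min (real k) l * (exc l * exc (s - l)))
    = ((\<Sum>l\<in>{1..s - 1}. min (real k) l * (exc l * exc (s - l))) + (\<Sum>l\<in>{1..s - 1}. min (real k) (real (s - l)) * (exc l * exc (s - l)))) / 2"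
    using sw by simp
  also have "\<dots> - (\<Sum>l\<in>{1..s - 1}. k / 2 * (exc l * exc (s - l)))
    = (\<Sum>l\<in>{1..s - 1}. (min (real k) l + min (real k) (real (s - l)) - k) / 2 * (exc l * exc (s - l)))"
    unfolding sum.distrib[symmetric] sum_divide_distrib sum_subtractf[symmetric]
    by (intro sum.cong refl) (simp add: field_simps)
  also have "\<dots> = (\<Sum>l\<in>{1..s - 1}. max 0 (min (real k) l + min (real k) (real (s - l)) - k) / 2 * (exc l * exc (s - l)))"
  proof (intro sum.cong refl)
    fix l assume "l \<in> {1..s - 1}"
    then have "real (s - l) = real s - real l" by (auto simp: of_nat_diff)
    then have "0 \<le> min (real k) l + min (real k) (real (s - l)) - k"
      using assms by (auto simp: min_def)
    then show "(min (real k) l + min (real k) (real (s - l)) - k) / 2 * (exc l * exc (s - l))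
      = max 0 (min (real k) l + min (real k) (real (s - l)) - k) / 2 * (exc l * exc (s - l))" by (simp only: max_absorb2)
  qed
  finally show ?thesis .
qed

lemma sum_exc_mean:
  assumes "\<And>s. g s \<ge> 0"
  shows "(\<Sum>s\<in>{1..n}. if k < s then g s * exc_mean k s else 0)
    = (\<Sum>d\<in>{1..n}. \<Sum>c\<in>{1..n - d}. g (c + d) / 2 * max 0 (min (real k) c + min (real k) d - k) * (exc c * exc d))"
proof -
  let ?G = "\<lambda>c d. g (c + d) / 2 * max 0 (min (real k) c + min (real k) d - k) * (exc c * exc d)"
  have "(if k < s then g s * exc_mean k s else 0) = (\<Sum>d\<in>{1..s - 1}. ?G (s - d) d)" if "s \<in> {1..n}" for s
  proof (cases "k < s")
    case True
    have "g s * exc_mean k s = (\<Sum>d\<in>{1..s - 1}. g s * (max 0 (min (real k) d + min (real k) (real (s - d)) - k) / 2 * (exc d * exc (s - d))))"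
      unfolding exc_mean_symmetric[OF True] sum_distrib_left ..
    also have "\<dots> = (\<Sum>d\<in>{1..s - 1}. ?G (s - d) d)"
      by (intro sum.cong refl) (auto simp: add.commute mult_ac)
    finally show ?thesis using True by simp
  next
    case False
    have "max 0 (min (real k) (real (s - d)) + min (real k) d - k) = 0" if "d \<in> {1..s - 1}" for d
    proof -
      have "real (s - d) = real s - real d" using that by (auto simp: of_nat_diff)
      then show ?thesis using False that by (auto simp: min_def)
    qed
    then have "(\<Sum>d\<in>{1..s - 1}. ?G (s - d) d) = 0" by (intro sum.neutral) auto
    then show ?thesis using False by simp
  qed
  then have "(\<Sum>s\<in>{1..n}. if k < s then g s * exc_mean k s else 0) = (\<Sum>s\<in>{1..n}. \<Sum>d\<in>{1..s - 1}. ?G (s - d) d)"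
    by (intro sum.cong) auto
  also have "\<dots> = (\<Sum>(s, d)\<in>Sigma {1..n} (\<lambda>s. {1..s - 1}). ?G (s - d) d)"
    by (simp add: sum.Sigma)
  also have "\<dots> = (\<Sum>(d, c)\<in>Sigma {1..n} (\<lambda>d. {1..n - d}). ?G c d)"
    by (rule sum.reindex_bij_witness[where i="\<lambda>(d, c). (c + d, d)" and j="\<lambda>(s, d). (d, s - d)"]) auto
  also have "\<dots> = (\<Sum>d\<in>{1..n}. \<Sum>c\<in>{1..n - d}. ?G c d)"
    by (simp add: sum.Sigma)
  finally show ?thesis .
qed

lemma sum_window_mean2_pairs:
  assumes k: "k \<le> n"
  shows "(\<Sum>i\<le>n. window_mean2 n k i)
    = k + (\<Sum>d\<in>{1..n}. \<Sum>c\<in>{1..n - d}. pair_weight k (real n - k) c d * (exc c * exc d))"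
proof -
  let ?j = "n - k"
  have j: "real ?j = real n - real k" using k by simp
  have r: "real (m - l) = max 0 (real m - real l)" for m l :: nat by (auto simp: of_nat_diff max_def)
  have 1: "(\<Sum>s\<in>{1..n}. if k < s then real k * exc_mean k s else 0)
    = (\<Sum>d\<in>{1..n}. \<Sum>c\<in>{1..n - d}. real k / 2 * max 0 (min (real k) c + min (real k) d - k) * (exc c * exc d))"
    by (rule sum_exc_mean[where g="\<lambda>_. real k"]) simp
  have 2: "(\<Sum>s\<in>{1..n}. if ?j < s then real (s - ?j) * exc_mean ?j s else 0)
    = (\<Sum>d\<in>{1..n}. \<Sum>c\<in>{1..n - d}. real (c + d - ?j) / 2 * max 0 (min (real ?j) c + min (real ?j) d - ?j) * (exc c * exc d))"
    by (rule sum_exc_mean[where g="\<lambda>s. real (s - ?j)"]) simp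
  have "(\<Sum>i\<le>n. window_mean2 n k i) = k + (\<Sum>d\<in>{1..n}. \<Sum>c\<in>{1..n - d}.
      real k / 2 * max 0 (min (real k) c + min (real k) d - k) * (exc c * exc d)
      - real (c + d - ?j) / 2 * max 0 (min (real ?j) c + min (real ?j) d - ?j) * (exc c * exc d)
      + (if d \<le> k then real d * real (min (k - d) c) else 0) * (exc c * exc d)
      - real (d - ?j) * real c * (exc c * exc d))"
    unfolding sum_window_mean2[OF k] 1 2 by (simp only: sum.distrib sum_subtractf add_diff_eq add.assoc diff_add_eq)
  also have "\<dots> = k + (\<Sum>d\<in>{1..n}. \<Sum>c\<in>{1..n - d}. pair_weight k (real n - k) c d * (exc c * exc d))"
  proof (intro arg_cong2[where f="(+)"] refl sum.cong)
    fix d c assume "d \<in> {1..n}" "c \<in> {1..n - d}"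
    have a: "(if d \<le> k then real d * real (min (k - d) c) else 0) = real d * min (max 0 (real k - d)) c"
      by (auto simp: of_nat_min r max_def min_def)
    have b: "real (c + d - ?j) = max 0 (real c + d - (real n - k))" using r[of "c + d" ?j] j by simp
    show "real k / 2 * max 0 (min (real k) c + min (real k) d - k) * (exc c * exc d)
      - real (c + d - ?j) / 2 * max 0 (min (real ?j) c + min (real ?j) d - ?j) * (exc c * exc d)
      + (if d \<le> k then real d * real (min (k - d) c) else 0) * (exc c * exc d)
      - real (d - ?j) * real c * (exc c * exc d) = pair_weight k (real n - k) c d * (exc c * exc d)"
      unfolding a b j r[of d] pair_weight_def by (simp only: left_diff_distrib distrib_right)
  qed
  finally show ?thesis .
qed

lemma max_mult_scale: "(0::real) \<le> a \<Longrightarrow> max 0 (a * x) = a * max 0 x"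
  by (auto simp: max_def mult_le_0_iff zero_le_mult_iff)

lemma min_mult_scale: "(0::real) \<le> a \<Longrightarrow> min (a * x) (a * y) = a * min x y"
  by (simp add: min_mult_distrib_left)

lemma pair_weight_scale:
  assumes a: "0 \<le> a"
  shows "pair_weight (a * \<kappa>) (a * \<iota>) (a * c) (a * d) = a\<^sup>2 * pair_weight \<kappa> \<iota> c d"
proof -
  have 1: "min (a * z) (a * w) = a * min z w" "max 0 (a * z) = a * max 0 z" for z w
    using a by (rule min_mult_scale, rule max_mult_scale)
  have 2: "a * z + a * w = a * (z + w)" "a * z - a * w = a * (z - w)" for z w
    by (simp_all add: algebra_simps)
  show ?thesis unfolding pair_weight_def 1 2 by (simp add: power2_eq_square algebra_simps)
qed

text \<open>
  The factor \<open>c * d\<close> makes the weights integrable against the two singular densities, since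
  \<open>c * levy_density c\<close> is \<open>1 / sqrt c\<close>.
\<close>
lemma abs_pair_weight_le:
  assumes "0 \<le> \<kappa>" "0 \<le> \<iota>" "0 \<le> c" "0 \<le> d"
  shows "\<bar>pair_weight \<kappa> \<iota> c d\<bar> \<le> 4 * (c * d)"
proof -
  have half: "(c + d) / 2 * min c d \<le> c * d"
    using mult_right_mono[of "(c + d) / 2" "max c d" "min c d"] assms
    by (auto simp: min_def max_def mult.commute split: if_splits)
  have 0: "a / 2 * max 0 (min \<rho> c + min \<rho> d - \<rho>) \<le> c * d" if "0 \<le> a" "a \<le> c + d \<or> \<not> \<rho> < c + d" "0 \<le> \<rho>" for a \<rho>
  proof (cases "\<rho> < c + d")
    case True
    have "max 0 (min \<rho> c + min \<rho> d - \<rho>) \<le> min c d" using assms that by (auto simp: min_def max_def)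
    moreover have "a / 2 \<le> (c + d) / 2" using that True by simp
    ultimately have "a / 2 * max 0 (min \<rho> c + min \<rho> d - \<rho>) \<le> (c + d) / 2 * min c d"
      using that by (intro mult_mono) (auto simp: assms)
    with half show ?thesis by simp
  next
    case False
    then have "max 0 (min \<rho> c + min \<rho> d - \<rho>) = 0" using assms by (auto simp: min_def max_def)
    then show ?thesis using assms by simp
  qed
  have 1: "\<kappa> / 2 * max 0 (min \<kappa> c + min \<kappa> d - \<kappa>) \<le> c * d" by (rule 0) (use assms in auto)
  have 2: "max 0 (c + d - \<iota>) / 2 * max 0 (min \<iota> c + min \<iota> d - \<iota>) \<le> c * d"
    by (rule 0) (use assms in \<open>auto simp: max_def\<close>)
  have 3: "d * min (max 0 (\<kappa> - d)) c \<le> c * d"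
    using mult_left_mono[of "min (max 0 (\<kappa> - d)) c" c d] assms by (simp add: mult.commute)
  have 4: "max 0 (d - \<iota>) * c \<le> c * d"
    using mult_right_mono[of "max 0 (d - \<iota>)" d c] assms by (simp add: mult.commute)
  have "0 \<le> \<kappa> / 2 * max 0 (min \<kappa> c + min \<kappa> d - \<kappa>)" "0 \<le> max 0 (c + d - \<iota>) / 2 * max 0 (min \<iota> c + min \<iota> d - \<iota>)"
    "0 \<le> d * min (max 0 (\<kappa> - d)) c" "0 \<le> max 0 (d - \<iota>) * c"
    using assms by (auto intro!: mult_nonneg_nonneg)
  moreover have "\<bar>x1 - x2 + x3 - x4\<bar> \<le> 4 * b" if "0 \<le> x1" "0 \<le> x2" "0 \<le> x3" "0 \<le> x4" "x1 \<le> b" "x2 \<le> b" "x3 \<le> b" "x4 \<le> b"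
    for x1 x2 x3 x4 b :: real using that by linarith
  ultimately show ?thesis unfolding pair_weight_def using 1 2 3 4 by blast
qed

section \<open>Scaling limits of the moments\<close>

text \<open>
  Rounding up to the grid turns a Riemann sum into the integral of a step function, so that dominated
  convergence can be used; rounding up, and not down, keeps the monotone majorant \<open>1 / sqrt x\<close> valid.
\<close>
definition grid_up :: "nat \<Rightarrow> real \<Rightarrow> real" where
  "grid_up n x = real (nat \<lceil>n * x\<rceil>) / n"

lemma grid_up_ge: "n > 0 \<Longrightarrow> x \<le> grid_up n x"
  unfolding grid_up_def by (simp add: field_simps) linarith

lemma grid_up_le: "0 \<le> x \<Longrightarrow> grid_up n x \<le> x + 1 / n"
proof (cases "n = 0")
  case False
  assume "0 \<le> x"
  then have "real (nat \<lceil>n * x\<rceil>) \<le> n * x + 1" by (simp add: of_nat_nat)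
  then show ?thesis using False unfolding grid_up_def by (simp add: field_simps)
qed (simp add: grid_up_def)

lemma grid_up_tendsto: "0 \<le> x \<Longrightarrow> (\<lambda>n. grid_up n x) \<longlonglongrightarrow> x"
proof (rule tendsto_sandwich)
  assume x: "0 \<le> x"
  show "\<forall>\<^sub>F n in sequentially. x \<le> grid_up n x"
    using eventually_gt_at_top[of 0] by eventually_elim (rule grid_up_ge)
  show "\<forall>\<^sub>F n in sequentially. grid_up n x \<le> x + 1 / n"
    using x by (intro always_eventually allI grid_up_le)
  have "(\<lambda>n. x + 1 / real n) \<longlonglongrightarrow> x + 0"
    by (intro tendsto_intros lim_1_over_n)
  then show "(\<lambda>n. x + 1 / real n) \<longlonglongrightarrow> x" by simp
qed auto

lemma integral_grid:
  assumes "n > 0"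
  shows "has_bochner_integral lborel (\<lambda>x. indicator {0<..1} x * F (nat \<lceil>n * x\<rceil>)) ((\<Sum>c\<in>{1..n}. F c) / n :: real)"
proof -
  let ?J = "\<lambda>c::nat. {(real c - 1) / n <.. real c / n}"
  have eq: "indicator {0<..1} x * F (nat \<lceil>n * x\<rceil>) = (\<Sum>c\<in>{1..n}. F c * indicator (?J c) x)" for x :: real
  proof -
    have iff: "x \<in> ?J c \<longleftrightarrow> nat \<lceil>n * x\<rceil> = c" if "c \<ge> 1" for c :: nat
    proof -
      have "x \<in> ?J c \<longleftrightarrow> real c - 1 < n * x \<and> n * x \<le> real c"
        using assms by (simp add: pos_divide_less_eq pos_le_divide_eq mult.commute)
      also have "\<dots> \<longleftrightarrow> \<lceil>n * x\<rceil> = int c" by (simp add: ceiling_eq_iff)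
      also have "\<dots> \<longleftrightarrow> nat \<lceil>n * x\<rceil> = c" using that by auto
      finally show ?thesis .
    qed
    have "(\<Sum>c\<in>{1..n}. F c * indicator (?J c) x) = (\<Sum>c\<in>{1..n}. if c = nat \<lceil>n * x\<rceil> then F c else 0)"
      by (intro sum.cong refl) (use iff in \<open>auto simp: indicator_def\<close>)
    also have "\<dots> = (if nat \<lceil>n * x\<rceil> \<in> {1..n} then F (nat \<lceil>n * x\<rceil>) else 0)"
      by simp
    also have "nat \<lceil>n * x\<rceil> \<in> {1..n} \<longleftrightarrow> x \<in> {0<..1}"
    proof -
      have "nat \<lceil>n * x\<rceil> \<in> {1..n} \<longleftrightarrow> 0 < n * x \<and> n * x \<le> n"
        by (auto simp: ceiling_le_iff nat_le_iff Suc_le_eq)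
      then show ?thesis using assms by (auto simp: zero_less_mult_iff)
    qed
    finally show ?thesis by (simp add: indicator_def)
  qed
  have "has_bochner_integral lborel (indicator (?J c) :: real \<Rightarrow> real) (1 / n)" if "c \<ge> 1" for c
  proof -
    have "(real c - 1) / n \<le> real c / n" by (intro divide_right_mono) auto
    then have "measure lborel (?J c) = 1 / n" "emeasure lborel (?J c) < \<infinity>"
      by (simp_all add: diff_divide_distrib)
    then show ?thesis using has_bochner_integral_real_indicator[of "?J c" lborel] by simp
  qed
  then have "has_bochner_integral lborel (\<lambda>x. \<Sum>c\<in>{1..n}. F c * indicator (?J c) x) (\<Sum>c\<in>{1..n}. F c * (1 / n))"
    by (intro has_bochner_integral_sum has_bochner_integral_mult_right) auto
  then show ?thesis unfolding eq by (simp add: sum_divide_distrib)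
qed

lemma nn_integral_FTC_Ioc:
  fixes f F :: "real \<Rightarrow> real"
  assumes "a \<le> b" "finite S" "continuous_on {a..b} F"
    and D: "\<And>x. x \<in> {a<..<b} - S \<Longrightarrow> (F has_real_derivative f x) (at x)"
    and nn: "\<And>x. x \<in> {a<..<b} \<Longrightarrow> 0 \<le> f x"
  shows "(\<integral>\<^sup>+x. ennreal (f x) * indicator {a<..b} x \<partial>lborel) = ennreal (F b - F a)"
proof -
  have "(f has_integral (F b - F a)) {a..b}"
    by (rule fundamental_theorem_of_calculus_interior_strong[OF assms(2,1)])
      (use D assms(3) in \<open>auto simp: has_real_derivative_iff_has_vector_derivative\<close>)
  then have "(f has_integral (F b - F a)) {a<..<b}"
    by (simp add: has_integral_Icc_iff_Ioo)
  then have "(\<integral>\<^sup>+x. ennreal (f x) * indicator {a<..<b} x \<partial>lborel) = ennreal (F b - F a)"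
    by (intro nn_integral_has_integral_lebesgue' nn)
  moreover have "(\<integral>\<^sup>+x. ennreal (f x) * indicator {a<..b} x \<partial>lborel) = (\<integral>\<^sup>+x. ennreal (f x) * indicator {a<..<b} x \<partial>lborel)"
  proof (rule nn_integral_cong_AE)
    show "AE x in lborel. ennreal (f x) * indicator {a<..b} x = ennreal (f x) * indicator {a<..<b} x"
      using AE_lborel_singleton[of b] by eventually_elim (auto simp: indicator_def)
  qed
  ultimately show ?thesis by simp
qed

lemma integral_FTC_Ioc:
  fixes f F :: "real \<Rightarrow> real"
  assumes "a \<le> b" "finite S" "continuous_on {a..b} F"
    and D: "\<And>x. x \<in> {a<..<b} - S \<Longrightarrow> (F has_real_derivative f x) (at x)"
    and nn: "\<And>x. x \<in> {a<..b} \<Longrightarrow> 0 \<le> f x"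
    and [measurable]: "f \<in> borel_measurable borel"
  shows "has_bochner_integral lborel (\<lambda>x. indicator {a<..b} x * f x) (F b - F a)"
proof -
  have e: "(\<integral>\<^sup>+x. ennreal (indicator {a<..b} x * f x) \<partial>lborel) = ennreal (F b - F a)"
  proof -
    have "(\<integral>\<^sup>+x. ennreal (indicator {a<..b} x * f x) \<partial>lborel) = (\<integral>\<^sup>+x. ennreal (f x) * indicator {a<..b} x \<partial>lborel)"
      by (intro nn_integral_cong) (auto simp: indicator_def)
    also have "\<dots> = ennreal (F b - F a)"
      by (rule nn_integral_FTC_Ioc[OF assms(1-3) D]) (use nn in auto)
    finally show ?thesis .
  qed
  have "(f has_integral (F b - F a)) {a..b}"
    by (rule fundamental_theorem_of_calculus_interior_strong[OF assms(2,1)])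
      (use D assms(3) in \<open>auto simp: has_real_derivative_iff_has_vector_derivative\<close>)
  then have "(f has_integral (F b - F a)) {a<..<b}"
    by (simp add: has_integral_Icc_iff_Ioo)
  then have "0 \<le> F b - F a" by (rule has_integral_nonneg) (use nn in auto)
  then show ?thesis
  proof (rule has_bochner_integral_nn_integral[OF _ _ _ e, rotated 2])
    show "(\<lambda>x. indicator {a<..b} x * f x) \<in> borel_measurable lborel" by measurable
    show "AE x in lborel. 0 \<le> indicator {a<..b} x * f x"
      by (intro AE_I2) (use nn in \<open>auto simp: indicator_def\<close>)
  qed
qed

lemma integral_inv_sqrt:
  assumes "0 \<le> b"
  shows "has_bochner_integral lborel (\<lambda>x. indicator {0<..b} x * (1 / sqrt x)) (2 * sqrt b)"
proof -
  have "has_bochner_integral lborel (\<lambda>x. indicator {0<..b} x * (1 / sqrt x)) (2 * sqrt b - 2 * sqrt 0)"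
  proof (rule integral_FTC_Ioc[OF assms finite.emptyI])
    show "continuous_on {0..b} (\<lambda>x. 2 * sqrt x)" by (intro continuous_intros)
    fix x assume "x \<in> {0<..<b} - {}"
    then show "((\<lambda>x. 2 * sqrt x) has_real_derivative 1 / sqrt x) (at x)"
      by (auto intro!: derivative_eq_intros simp: field_simps)
  qed auto
  then show ?thesis by simp
qed

lemma integral_min_levy:
  assumes "0 \<le> \<tau>" "\<tau> \<le> b" "0 < b"
  shows "has_bochner_integral lborel (\<lambda>x. indicator {0<..b} x * (min \<tau> x * levy_density x)) (4 * sqrt \<tau> - 2 * \<tau> / sqrt b)"
proof (cases "\<tau> = 0")
  case True
  have "(\<lambda>x. indicator {0<..b} x * (min \<tau> x * levy_density x)) = (\<lambda>x. 0)"
    using True by (auto simp: indicator_def fun_eq_iff)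
  then show ?thesis using True by (simp only:) (simp add: has_bochner_integral_zero)
next
  case False
  with assms have tau: "0 < \<tau>" by simp
  let ?F = "\<lambda>x. if x \<le> \<tau> then 2 * sqrt x else 4 * sqrt \<tau> - 2 * \<tau> / sqrt x"
  have st: "\<tau> / sqrt \<tau> = sqrt \<tau>" using tau by (simp add: real_div_sqrt)
  have st2: "\<tau> * 2 / sqrt \<tau> = sqrt \<tau> * 2" using tau by (simp add: field_simps)
  have "has_bochner_integral lborel (\<lambda>x. indicator {0<..b} x * (min \<tau> x * levy_density x)) (?F b - ?F 0)"
  proof (rule integral_FTC_Ioc[where S="{\<tau>}"])
    show "0 \<le> b" "finite {\<tau>}" using assms by auto
    show "continuous_on {0..b} ?F"
    proof (rule continuous_on_subset)
      show "continuous_on ({0..\<tau>} \<union> {\<tau>..}) ?F"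
      proof (rule continuous_on_If)
        show "closed {0..\<tau>}" "closed {\<tau>..}" by auto
        show "continuous_on {0..\<tau>} (\<lambda>x. 2 * sqrt x)" by (intro continuous_intros)
        show "continuous_on {\<tau>..} (\<lambda>x. 4 * sqrt \<tau> - 2 * \<tau> / sqrt x)"
          using tau by (intro continuous_intros) auto
      qed (use st st2 in \<open>auto simp: algebra_simps\<close>)
    qed auto
    show "0 \<le> min \<tau> x * levy_density x" if "x \<in> {0<..b}" for x
      using that tau by (auto simp: levy_density_def)
    show "(\<lambda>x. min \<tau> x * levy_density x) \<in> borel_measurable borel"
      unfolding levy_density_def by measurable
    fix x assume x: "x \<in> {0<..<b} - {\<tau>}"
    show "(?F has_real_derivative min \<tau> x * levy_density x) (at x)"
    proof (cases "x < \<tau>")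
      case True
      have "((\<lambda>x. 2 * sqrt x) has_real_derivative min \<tau> x * levy_density x) (at x)"
        using x True by (auto intro!: derivative_eq_intros simp: levy_density_def field_simps)
      then show ?thesis
        by (rule has_field_derivative_transform_within_open[of _ _ _ "{..<\<tau>}"]) (use True in auto)
    next
      case False
      then have xt: "\<tau> < x" using x by auto
      have "((\<lambda>x. 4 * sqrt \<tau> - 2 * \<tau> / sqrt x) has_real_derivative min \<tau> x * levy_density x) (at x)"
        using x xt tau by (auto intro!: derivative_eq_intros simp: levy_density_def field_simps)
      then show ?thesis
        by (rule has_field_derivative_transform_within_open[of _ _ _ "{\<tau><..}"]) (use xt in auto)
    qed
  qed
  moreover have "?F b - ?F 0 = 4 * sqrt \<tau> - 2 * \<tau> / sqrt b"
    using tau assms st by (auto simp: field_simps)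
  ultimately show ?thesis by simp
qed

lemma integral_excess_levy:
  assumes "0 \<le> u" "u \<le> 1"
  shows "has_bochner_integral lborel (\<lambda>x. indicator {0<..1} x * (max 0 (x - u) * levy_density x)) (2 + 2 * u - 4 * sqrt u)"
proof -
  have "has_bochner_integral lborel (\<lambda>x. indicator {0<..1} x * (1 / sqrt x) - indicator {0<..1} x * (min u x * levy_density x))
    (2 * sqrt 1 - (4 * sqrt u - 2 * u / sqrt 1))"
    using assms by (intro has_bochner_integral_diff integral_inv_sqrt integral_min_levy) auto
  moreover have "indicator {0<..1} x * (1 / sqrt x) - indicator {0<..1} x * (min u x * levy_density x)
    = indicator {0<..1} x * (max 0 (x - u) * levy_density x)" for x :: real
  proof (cases "x \<in> {0<..1}")
    case True
    then have q: "1 / sqrt x = x * levy_density x" by (auto simp: levy_density_def)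
    have m: "max 0 (x - u) = x - min u x" by auto
    show ?thesis unfolding q m by (simp only: left_diff_distrib right_diff_distrib)
  qed auto
  moreover have "2 * sqrt 1 - (4 * sqrt u - 2 * u / sqrt 1) = 2 + 2 * u - 4 * sqrt u" by simp
  ultimately show ?thesis by (simp only:)
qed

lemma levy_density_mult: "0 \<le> a \<Longrightarrow> 0 \<le> b \<Longrightarrow> levy_density (a * b) = levy_density a * levy_density b"
  by (simp add: levy_density_def real_sqrt_mult)

lemma levy_density_nonneg: "0 \<le> x \<Longrightarrow> 0 \<le> levy_density x"
  by (simp add: levy_density_def)

lemma levy_density_measurable[measurable]: "levy_density \<in> borel_measurable borel"
  unfolding levy_density_def[abs_def] by measurable

lemma mult_levy: "0 < x \<Longrightarrow> x * levy_density x = 1 / sqrt x"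
  by (simp add: levy_density_def)

lemma grid_up_pos: "0 < n \<Longrightarrow> 0 < x \<Longrightarrow> 0 < grid_up n x"
  using grid_up_ge[of n x] by linarith

lemma grid_up_measurable[measurable]: "grid_up n \<in> borel_measurable borel"
  unfolding grid_up_def[abs_def] by measurable

lemma inv_sqrt_grid_up_le: "0 < x \<Longrightarrow> 0 < n \<Longrightarrow> 1 / sqrt (grid_up n x) \<le> 1 / sqrt x"
  using grid_up_ge[of n x] by (intro divide_left_mono) (auto intro!: mult_pos_pos grid_up_pos)

lemma levy_grid_tendsto:
  assumes "0 < x" shows "(\<lambda>n. levy_density (grid_up n x)) \<longlonglongrightarrow> levy_density x"
  unfolding levy_density_def using assms
  by (intro tendsto_intros grid_up_tendsto) auto

text \<open>
  With \<open>d = n * x\<close> the weight scales like \<open>n\<close> and \<open>exc d\<close> like \<open>levy_density n\<close>, so that the sum of \<open>n\<close> terms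
  has order \<open>sqrt n\<close>.
\<close>
lemma walk_mean_limit:
  assumes t: "0 \<le> t" "t \<le> 1" and k: "\<And>n. k n \<le> n" and lim: "(\<lambda>n. real (k n) / n) \<longlonglongrightarrow> t"
  shows "(\<lambda>n. (\<Sum>i\<le>n. window_mean n (k n) i) / sqrt n) \<longlonglongrightarrow> sqrt (8 / pi) * (sqrt t + sqrt (1 - t) - 1)"
proof -
  define \<kappa> where "\<kappa> n = real (k n) / n" for n
  (* the weight of exc d in sum_window_mean, with all lengths divided by n *)
  define w where "w \<kappa> y = min \<kappa> y - max 0 (y - (1 - \<kappa>))" for \<kappa> y :: real
  have w_bound: "\<bar>w \<kappa> y\<bar> \<le> y" if "0 \<le> \<kappa>" "\<kappa> \<le> 1" "0 \<le> y" for \<kappa> y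
    using that by (auto simp: w_def min_def max_def)
  have [measurable]: "w \<kappa> \<in> borel_measurable borel" for \<kappa> unfolding w_def[abs_def] by measurable
  have kap: "0 \<le> \<kappa> n" "\<kappa> n \<le> 1" for n using k[of n] by (auto simp: \<kappa>_def divide_le_eq)
  let ?f = "\<lambda>n x. indicator {0<..1} x * (w (\<kappa> n) (grid_up n x) * levy_density (grid_up n x))"
  let ?g = "\<lambda>x. indicator {0<..1} x * (w t x * levy_density x)"
  have sum_eq: "(\<Sum>i\<le>n. window_mean n (k n) i) / sqrt n = (\<integral>x. ?f n x \<partial>lborel) / sqrt (2 * pi)" if n: "n > 0" for n
  proof -
    have "has_bochner_integral lborel (\<lambda>x. indicator {0<..1} x * (w (\<kappa> n) (nat \<lceil>n * x\<rceil> / n) * levy_density (nat \<lceil>n * x\<rceil> / n)))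
      ((\<Sum>d\<in>{1..n}. w (\<kappa> n) (d / n) * levy_density (d / n)) / n)"
      by (rule integral_grid[OF n])
    then have I: "(\<integral>x. ?f n x \<partial>lborel) = (\<Sum>d\<in>{1..n}. w (\<kappa> n) (d / n) * levy_density (d / n)) / n"
      unfolding grid_up_def by (rule has_bochner_integral_integral_eq)
    have "(\<Sum>i\<le>n. window_mean n (k n) i) = (\<Sum>d\<in>{1..n}. (min (real (k n)) d - real (d - (n - k n))) * exc d)"
      unfolding sum_window_mean[OF k] by (simp add: sum_subtractf left_diff_distrib of_nat_min)
    also have "\<dots> = (\<Sum>d\<in>{1..n}. (w (\<kappa> n) (d / n) * levy_density (d / n)) * (n * levy_density n / sqrt (2 * pi)))"
    proof (intro sum.cong refl)
      fix d assume d: "d \<in> {1..n}"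
      have "real (d - (n - k n)) = max 0 (real d - (real n - real (k n)))"
        using k[of n] by (auto simp: max_def of_nat_diff)
      then have "min (real (k n)) d - real (d - (n - k n)) = min (n * \<kappa> n) (n * (d / n)) - max 0 (n * (d / n - (1 - \<kappa> n)))"
        using n by (simp add: \<kappa>_def algebra_simps)
      also have "\<dots> = n * w (\<kappa> n) (d / n)"
        unfolding w_def by (subst min_mult_scale, simp, subst max_mult_scale, simp) (simp add: algebra_simps)
      finally have 1: "min (real (k n)) d - real (d - (n - k n)) = n * w (\<kappa> n) (d / n)" .
      have 2: "exc d = levy_density n * levy_density (d / n) / sqrt (2 * pi)"
        using d n levy_density_mult[of n "d / n"] by (simp add: exc_eq_levy)
      show "(min (real (k n)) d - real (d - (n - k n))) * exc d
        = (w (\<kappa> n) (d / n) * levy_density (d / n)) * (n * levy_density n / sqrt (2 * pi))"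
        unfolding 1 2 by simp
    qed
    also have "\<dots> = (\<integral>x. ?f n x \<partial>lborel) * n * (n * levy_density n / sqrt (2 * pi))"
      unfolding I sum_distrib_right[symmetric] using n by simp
    also have "\<dots> = (\<integral>x. ?f n x \<partial>lborel) / sqrt (2 * pi) * (real n * (real n * levy_density n))"
      by (simp only: times_divide_eq_left times_divide_eq_right mult_ac)
    also have "real n * (real n * levy_density n) = sqrt n"
      using n mult_levy[of "real n"] by (simp add: real_div_sqrt)
    finally show ?thesis using n by simp
  qed
  have "(\<lambda>n. \<integral>x. ?f n x \<partial>lborel) \<longlonglongrightarrow> (\<integral>x. ?g x \<partial>lborel)"
  proof (rule integral_dominated_convergence[where w="\<lambda>x. indicator {0<..1} x * (1 / sqrt x)"])
    show "integrable lborel (\<lambda>x::real. indicator {0<..1} x * (1 / sqrt x))"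
      using integral_inv_sqrt[of 1] by (simp add: has_bochner_integral_iff)
    show "AE x in lborel. (\<lambda>n. ?f n x) \<longlonglongrightarrow> ?g x"
    proof (rule AE_I2)
      fix x :: real
      show "(\<lambda>n. ?f n x) \<longlonglongrightarrow> ?g x"
      proof (cases "x \<in> {0<..1}")
        case True
        have "(\<lambda>n. w (\<kappa> n) (grid_up n x) * levy_density (grid_up n x)) \<longlonglongrightarrow> w t x * levy_density x"
          unfolding w_def using True lim by (intro tendsto_intros levy_grid_tendsto grid_up_tendsto) (auto simp: \<kappa>_def)
        then show ?thesis using True by simp
      qed auto
    qed
    show "AE x in lborel. norm (?f n x) \<le> indicator {0<..1} x * (1 / sqrt x)" for n
    proof (rule AE_I2)
      fix x :: real
      show "norm (?f n x) \<le> indicator {0<..1} x * (1 / sqrt x)"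
      proof (cases "x \<in> {0<..1} \<and> n > 0")
        case True
        then have g: "0 < grid_up n x" by (intro grid_up_pos) auto
        have "\<bar>w (\<kappa> n) (grid_up n x) * levy_density (grid_up n x)\<bar> \<le> grid_up n x * levy_density (grid_up n x)"
          unfolding abs_mult using g kap by (intro mult_mono w_bound) (auto simp: levy_density_nonneg abs_of_nonneg)
        also have "\<dots> = 1 / sqrt (grid_up n x)" using g by (rule mult_levy)
        also have "\<dots> \<le> 1 / sqrt x" using True by (intro inv_sqrt_grid_up_le) auto
        finally show ?thesis using True by simp
      next
        case False
        then consider "x \<notin> {0<..1}" | "n = 0" "x \<in> {0<..1}" by blast
        then show ?thesis by cases (auto simp: grid_up_def levy_density_def)
      qed
    qed
  qed auto
  then have "(\<lambda>n. (\<integral>x. ?f n x \<partial>lborel) / sqrt (2 * pi)) \<longlonglongrightarrow> (\<integral>x. ?g x \<partial>lborel) / sqrt (2 * pi)"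
    by (intro tendsto_intros) auto
  moreover have "\<forall>\<^sub>F n in sequentially. (\<integral>x. ?f n x \<partial>lborel) / sqrt (2 * pi) = (\<Sum>i\<le>n. window_mean n (k n) i) / sqrt n"
    using eventually_gt_at_top[of 0] by eventually_elim (simp only: sum_eq)
  ultimately have L: "(\<lambda>n. (\<Sum>i\<le>n. window_mean n (k n) i) / sqrt n) \<longlonglongrightarrow> (\<integral>x. ?g x \<partial>lborel) / sqrt (2 * pi)"
    by (rule Lim_transform_eventually)
  have "has_bochner_integral lborel (\<lambda>x. indicator {0<..1} x * (min t x * levy_density x) - indicator {0<..1} x * (max 0 (x - (1 - t)) * levy_density x))
      ((4 * sqrt t - 2 * t / sqrt 1) - (2 + 2 * (1 - t) - 4 * sqrt (1 - t)))"
    using t by (intro has_bochner_integral_diff integral_min_levy integral_excess_levy) auto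
  moreover have "indicator {0<..1} x * (min t x * levy_density x) - indicator {0<..1} x * (max 0 (x - (1 - t)) * levy_density x) = ?g x" for x
    by (simp add: w_def algebra_simps)
  ultimately have A: "(\<integral>x. ?g x \<partial>lborel) = 4 * (sqrt t + sqrt (1 - t) - 1)"
    by (subst has_bochner_integral_integral_eq[symmetric]) (auto simp: algebra_simps)
  have "4 / sqrt (2 * pi) = sqrt (8 / pi)"
    by (rule real_sqrt_unique[symmetric]) (auto simp: power_divide)
  moreover have "(\<integral>x. ?g x \<partial>lborel) / sqrt (2 * pi) = 4 / sqrt (2 * pi) * (sqrt t + sqrt (1 - t) - 1)"
    unfolding A by simp
  ultimately show ?thesis using L by (simp only:)
qed

text \<open>
  The condition \<open>c + d \<le> 1\<close> comes from the summation range of \<open>sum_window_mean2_pairs\<close>.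
\<close>
definition pair_integrand :: "real \<Rightarrow> real \<Rightarrow> real \<Rightarrow> real" where
  "pair_integrand \<kappa> c d = of_bool (c + d \<le> 1) * (pair_weight \<kappa> (1 - \<kappa>) c d * (levy_density c * levy_density d))"

lemma measurable_pair_weight[measurable]:
  assumes [measurable]: "f \<in> borel_measurable M" "g \<in> borel_measurable M"
  shows "(\<lambda>x. pair_weight \<kappa> \<iota> (f x) (g x)) \<in> borel_measurable M"
  unfolding pair_weight_def by measurable

lemma measurable_pair_integrand[measurable]:
  assumes [measurable]: "f \<in> borel_measurable M" "g \<in> borel_measurable M"
  shows "(\<lambda>x. pair_integrand \<kappa> (f x) (g x)) \<in> borel_measurable M"
  unfolding pair_integrand_def by measurable

lemma abs_pair_integrand_le:
  assumes "0 \<le> \<kappa>" "\<kappa> \<le> 1" "0 < c" "0 < d"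
  shows "\<bar>pair_integrand \<kappa> c d\<bar> \<le> 4 * (1 / sqrt c) * (1 / sqrt d)"
proof -
  have "\<bar>pair_integrand \<kappa> c d\<bar> \<le> 1 * ((4 * (c * d)) * (levy_density c * levy_density d))"
    unfolding pair_integrand_def abs_mult using assms
    by (intro mult_mono abs_pair_weight_le) (auto simp: levy_density_nonneg abs_of_nonneg of_bool_def)
  also have "\<dots> = 4 * (c * levy_density c) * (d * levy_density d)" by simp
  finally show ?thesis using assms by (simp add: mult_levy)
qed

lemma abs_pair_integrand_grid_le:
  assumes "0 \<le> \<kappa>" "\<kappa> \<le> 1" "0 < c" "0 < d"
  shows "\<bar>pair_integrand \<kappa> (grid_up n c) (grid_up n d)\<bar> \<le> 4 * (1 / sqrt c) * (1 / sqrt d)"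
proof (cases "n = 0")
  case True
  then show ?thesis using assms by (simp add: pair_integrand_def levy_density_def grid_up_def)
next
  case False
  then have n: "0 < n" by simp
  have "\<bar>pair_integrand \<kappa> (grid_up n c) (grid_up n d)\<bar> \<le> 4 * (1 / sqrt (grid_up n c)) * (1 / sqrt (grid_up n d))"
    using assms n by (intro abs_pair_integrand_le grid_up_pos)
  also have "\<dots> \<le> 4 * (1 / sqrt c) * (1 / sqrt d)"
    using assms n by (intro mult_mono inv_sqrt_grid_up_le mult_left_mono) (auto intro!: less_imp_le[OF grid_up_pos])
  finally show ?thesis .
qed

text \<open>
  The indicator is discontinuous on the line \<open>c + d = 1\<close>, a null set.
\<close>
lemma pair_integrand_grid_tendsto:
  assumes "0 < c" "0 < d" "c + d \<noteq> 1" and \<kappa>: "\<kappa> \<longlonglongrightarrow> t"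
  shows "(\<lambda>n. pair_integrand (\<kappa> n) (grid_up n c) (grid_up n d)) \<longlonglongrightarrow> pair_integrand t c d"
proof -
  have s: "(\<lambda>n. grid_up n c + grid_up n d) \<longlonglongrightarrow> c + d"
    using assms by (intro tendsto_intros grid_up_tendsto) auto
  have "(\<lambda>n. of_bool (grid_up n c + grid_up n d \<le> 1) :: real) \<longlonglongrightarrow> of_bool (c + d \<le> 1)"
  proof (cases "c + d < 1")
    case True
    with order_tendstoD(2)[OF s] have "\<forall>\<^sub>F n in sequentially. grid_up n c + grid_up n d < 1" by blast
    then have "\<forall>\<^sub>F n in sequentially. of_bool (grid_up n c + grid_up n d \<le> 1) = (of_bool (c + d \<le> 1) :: real)"
      by eventually_elim (use True in auto)
    then show ?thesis by (rule tendsto_eventually)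
  next
    case False
    with assms have "1 < c + d" by simp
    with order_tendstoD(1)[OF s] have "\<forall>\<^sub>F n in sequentially. 1 < grid_up n c + grid_up n d" by blast
    then have "\<forall>\<^sub>F n in sequentially. of_bool (grid_up n c + grid_up n d \<le> 1) = (of_bool (c + d \<le> 1) :: real)"
      by eventually_elim (use \<open>1 < c + d\<close> in auto)
    then show ?thesis by (rule tendsto_eventually)
  qed
  moreover have "(\<lambda>n. pair_weight (\<kappa> n) (1 - \<kappa> n) (grid_up n c) (grid_up n d)) \<longlonglongrightarrow> pair_weight t (1 - t) c d"
    unfolding pair_weight_def using assms
    by (intro tendsto_add tendsto_diff tendsto_mult tendsto_divide tendsto_max tendsto_min tendsto_const grid_up_tendsto) auto
  ultimately show ?thesis
    unfolding pair_integrand_def using assms by (intro tendsto_mult levy_grid_tendsto)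
qed

text \<open>
  Two nested applications of dominated convergence, with majorants \<open>4 / (sqrt c * sqrt d)\<close> and
  \<open>8 / sqrt d\<close>.
\<close>
lemma walk_second_moment_limit:
  assumes t: "0 \<le> t" "t \<le> 1" and k: "\<And>n. k n \<le> n" and lim: "(\<lambda>n. real (k n) / n) \<longlonglongrightarrow> t"
  shows "(\<lambda>n. (\<Sum>i\<le>n. window_mean2 n (k n) i) / n) \<longlonglongrightarrow>
    t + (\<integral>d. indicator {0<..1} d * (\<integral>c. indicator {0<..1} c * pair_integrand t c d \<partial>lborel) \<partial>lborel) / (2 * pi)"
proof -
  define \<kappa> where "\<kappa> n = real (k n) / n" for n
  have kap: "0 \<le> \<kappa> n" "\<kappa> n \<le> 1" for n using k[of n] by (auto simp: \<kappa>_def divide_le_eq)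
  have kl: "\<kappa> \<longlonglongrightarrow> t" using lim unfolding \<kappa>_def[abs_def] .
  let ?f = "\<lambda>n c d. indicator {0<..1} c * pair_integrand (\<kappa> n) (grid_up n c) (grid_up n d)"
  let ?g = "\<lambda>c d. indicator {0<..1} c * pair_integrand t c d"
  let ?H = "\<lambda>n d. \<integral>c. ?f n c d \<partial>lborel"
  let ?w = "\<lambda>d c. indicator {0<..1} c * (4 * (1 / sqrt c) * (1 / sqrt d)) :: real"
  have w_eq: "?w d = (\<lambda>c. 4 * (1 / sqrt d) * (indicator {0<..1} c * (1 / sqrt c)))" for d by (intro ext) (simp only: mult_ac times_divide_eq_left times_divide_eq_right mult_1)
  have w: "has_bochner_integral lborel (?w d) (4 * (1 / sqrt d) * (2 * sqrt 1))" for d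
    unfolding w_eq by (intro has_bochner_integral_mult_right integral_inv_sqrt) simp
  have f_le: "\<bar>?f n c d\<bar> \<le> ?w d c" if "0 < d" for n c d
    using abs_pair_integrand_grid_le[OF kap, of c d n] that by (auto simp: indicator_def)
  have [measurable]: "(\<lambda>d. ?H n d) \<in> borel_measurable borel" for n by measurable
  have inner: "(\<lambda>n. ?H n d) \<longlonglongrightarrow> (\<integral>c. ?g c d \<partial>lborel)" if d: "0 < d" for d
  proof (rule integral_dominated_convergence[where w="?w d"])
    show "integrable lborel (?w d)" using w[of d] by (simp add: has_bochner_integral_iff)
    show "AE c in lborel. norm (?f n c d) \<le> ?w d c" for n
      using f_le[OF d] by (intro AE_I2) simp
    show "AE c in lborel. (\<lambda>n. ?f n c d) \<longlonglongrightarrow> ?g c d"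
      using AE_lborel_singleton[of "1 - d"]
    proof eventually_elim
      case (elim c)
      show ?case
      proof (cases "c \<in> {0<..1}")
        case True
        then show ?thesis using elim d by (intro tendsto_mult tendsto_const pair_integrand_grid_tendsto kl) auto
      qed auto
    qed
  qed auto
  have H_le: "\<bar>?H n d\<bar> \<le> 8 * (1 / sqrt d)" if d: "0 < d" for n d
  proof -
    have "\<bar>?H n d\<bar> \<le> (\<integral>c. \<bar>?f n c d\<bar> \<partial>lborel)" by (rule integral_abs_bound)
    also have "\<dots> \<le> (\<integral>c. ?w d c \<partial>lborel)"
    proof (rule integral_mono)
      show "integrable lborel (?w d)" using w[of d] by (simp add: has_bochner_integral_iff)
      then show "integrable lborel (\<lambda>c. \<bar>?f n c d\<bar>)"
      proof (rule Bochner_Integration.integrable_bound)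
        show "AE c in lborel. norm \<bar>?f n c d\<bar> \<le> norm (?w d c)"
          using order_trans[OF f_le[OF d] abs_ge_self] by (intro AE_I2) (simp only: real_norm_def abs_abs)
      qed auto
    qed (use f_le[OF d] in auto)
    finally show ?thesis using has_bochner_integral_integral_eq[OF w[of d]] by simp
  qed
  have outer: "(\<lambda>n. \<integral>d. indicator {0<..1} d * ?H n d \<partial>lborel) \<longlonglongrightarrow> (\<integral>d. indicator {0<..1} d * (\<integral>c. ?g c d \<partial>lborel) \<partial>lborel)"
  proof (rule integral_dominated_convergence[where w="\<lambda>d. 8 * (indicator {0<..1} d * (1 / sqrt d))"])
    show "integrable lborel (\<lambda>d::real. 8 * (indicator {0<..1} d * (1 / sqrt d)))"
      using has_bochner_integral_mult_right[OF integral_inv_sqrt[of 1], of 8] by (simp add: has_bochner_integral_iff)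
    show "AE d in lborel. norm (indicator {0<..1} d * ?H n d) \<le> 8 * (indicator {0<..1} d * (1 / sqrt d))" for n
      using H_le by (intro AE_I2) (auto simp: indicator_def)
    show "AE d in lborel. (\<lambda>n. indicator {0<..1} d * ?H n d) \<longlonglongrightarrow> indicator {0<..1} d * (\<integral>c. ?g c d \<partial>lborel)"
      using inner by (intro AE_I2) (auto simp: indicator_def)
  qed auto
  have sum_eq: "(\<Sum>i\<le>n. window_mean2 n (k n) i) / n = \<kappa> n + (\<integral>d. indicator {0<..1} d * ?H n d \<partial>lborel) / (2 * pi)"
    if n: "n > 0" for n
  proof -
    let ?G = "\<lambda>c d. pair_integrand (\<kappa> n) (real c / n) (real d / n)"
    have H_eq: "?H n d = (\<Sum>c\<in>{1..n}. ?G c (nat \<lceil>n * d\<rceil>)) / n" for d :: real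
      unfolding grid_up_def
      by (rule has_bochner_integral_integral_eq[OF integral_grid[OF n, where F="\<lambda>c. ?G c (nat \<lceil>n * d\<rceil>)"]])
    have I: "(\<integral>d. indicator {0<..1} d * ?H n d \<partial>lborel) = (\<Sum>d\<in>{1..n}. (\<Sum>c\<in>{1..n}. ?G c d) / n) / n"
      unfolding H_eq by (rule has_bochner_integral_integral_eq[OF integral_grid[OF n, where F="\<lambda>d. (\<Sum>c\<in>{1..n}. ?G c d) / n"]])
    have "(\<Sum>d\<in>{1..n}. \<Sum>c\<in>{1..n - d}. pair_weight (k n) (real n - k n) c d * (exc c * exc d))
      = (\<Sum>d\<in>{1..n}. \<Sum>c\<in>{1..n}. ?G c d / (n * (2 * pi)))"
    proof (rule sum.cong[OF refl])
      fix d assume d: "d \<in> {1..n}"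
      show "(\<Sum>c\<in>{1..n - d}. pair_weight (k n) (real n - k n) c d * (exc c * exc d)) = (\<Sum>c\<in>{1..n}. ?G c d / (n * (2 * pi)))"
      proof (rule sum.mono_neutral_cong_left)
        show "\<forall>c\<in>{1..n} - {1..n - d}. ?G c d / (n * (2 * pi)) = 0"
        proof
          fix c assume "c \<in> {1..n} - {1..n - d}"
          then have "real n < real c + real d" by auto
          then have "1 < real c / n + real d / n" using n by (simp add: field_simps)
          then show "?G c d / (n * (2 * pi)) = 0" by (simp add: pair_integrand_def)
        qed
        fix c assume c: "c \<in> {1..n - d}"
        then have "real c + real d \<le> n" using d by auto
        then have le: "real c / n + real d / n \<le> 1" using n by (simp add: field_simps)
        have pw: "pair_weight (k n) (real n - k n) c d = (real n)\<^sup>2 * pair_weight (\<kappa> n) (1 - \<kappa> n) (c / n) (d / n)"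
          using pair_weight_scale[of "real n" "\<kappa> n" "1 - \<kappa> n" "c / n" "d / n"] n by (simp add: \<kappa>_def right_diff_distrib)
        have e: "exc m = levy_density n * levy_density (m / n) / sqrt (2 * pi)" if "m \<ge> 1" for m
          using that n levy_density_mult[of n "m / n"] by (simp add: exc_eq_levy)
        have q: "(real n)\<^sup>2 * (levy_density n * levy_density n) = 1 / n"
          using n by (simp add: levy_density_def power2_eq_square)
        have "pair_weight (k n) (real n - k n) c d * (exc c * exc d)
          = ((real n)\<^sup>2 * (levy_density n * levy_density n)) * (pair_weight (\<kappa> n) (1 - \<kappa> n) (c / n) (d / n)
            * (levy_density (c / n) * levy_density (d / n))) / (sqrt (2 * pi) * sqrt (2 * pi))"
          unfolding pw using c d by (simp add: e)
        also have "sqrt (2 * pi) * sqrt (2 * pi) = 2 * pi" by simp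
        also have "(real n)\<^sup>2 * (levy_density n * levy_density n) = 1 / n" by (rule q)
        finally show "pair_weight (k n) (real n - k n) c d * (exc c * exc d) = ?G c d / (n * (2 * pi))"
          using le by (simp add: pair_integrand_def)
      qed auto
    qed
    also have "\<dots> = n * ((\<integral>d. indicator {0<..1} d * ?H n d \<partial>lborel) / (2 * pi))"
      unfolding I using n by (simp add: sum_divide_distrib[symmetric])
    finally show ?thesis
      unfolding sum_window_mean2_pairs[OF k] \<kappa>_def using n by (simp add: add_divide_distrib)
  qed
  have "(\<lambda>n. \<kappa> n + (\<integral>d. indicator {0<..1} d * ?H n d \<partial>lborel) / (2 * pi)) \<longlonglongrightarrow>
    t + (\<integral>d. indicator {0<..1} d * (\<integral>c. ?g c d \<partial>lborel) \<partial>lborel) / (2 * pi)"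
    by (intro tendsto_add tendsto_divide kl outer tendsto_const) auto
  moreover have "\<forall>\<^sub>F n in sequentially. \<kappa> n + (\<integral>d. indicator {0<..1} d * ?H n d \<partial>lborel) / (2 * pi)
      = (\<Sum>i\<le>n. window_mean2 n (k n) i) / n"
    using eventually_gt_at_top[of 0] by eventually_elim (simp only: sum_eq)
  ultimately show ?thesis by (rule Lim_transform_eventually)
qed

section \<open>Evaluation of the limit of the second moment\<close>

lemma DERIV_sqrt_comp:
  assumes "(f has_real_derivative f') (at x)" "0 < f x"
  shows "((\<lambda>x. sqrt (f x)) has_real_derivative f' / (2 * sqrt (f x))) (at x)"
  using DERIV_chain2[OF DERIV_real_sqrt assms(1)] assms(2) by (simp add: field_simps)

text \<open>
  Substituting squares makes the verification of antiderivatives a matter of rational functions.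
\<close>
lemma sqrt_parts:
  assumes "0 < d" "d < s"
  obtains a b where "0 < a" "0 < b" "d = a * a" "s = a * a + b * b" "sqrt d = a" "sqrt (s - d) = b" "s - d = b * b"
  using assms by (intro that[of "sqrt d" "sqrt (s - d)"]) auto

lemma DERIV_diff_const: "((\<lambda>d. s - d) has_real_derivative - 1) (at d)"
  "((\<lambda>d. d - s) has_real_derivative 1) (at d)"
  by (auto intro!: derivative_eq_intros)

lemma DERIV_ratio_sqrt:
  assumes "0 < d" "d < s"
  shows "((\<lambda>d. sqrt d / sqrt (s - d) / s) has_real_derivative d / 2 * (levy_density (s - d) * levy_density d)) (at d)"
proof -
  obtain a b where ab: "0 < a" "0 < b" "d = a * a" "s = a * a + b * b" "sqrt d = a" "sqrt (s - d) = b" "s - d = b * b"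
    using assms by (rule sqrt_parts)
  have D1: "(sqrt has_real_derivative 1 / (2 * a)) (at d)"
    using DERIV_sqrt_comp[OF DERIV_ident assms(1)] unfolding ab(5) .
  have D2: "((\<lambda>d. sqrt (s - d)) has_real_derivative - 1 / (2 * b)) (at d)"
    using DERIV_sqrt_comp[OF DERIV_diff_const(1)[of s d]] assms ab by simp
  have ne: "sqrt (s - d) \<noteq> 0" using ab by simp
  have s1: "s \<noteq> 0" using assms by simp
  have "((\<lambda>d. sqrt d / sqrt (s - d) / s) has_real_derivative
      ((1 / (2 * a)) * b - a * (- 1 / (2 * b))) / (b * b) / s) (at d)"
    using DERIV_cdivide[OF DERIV_divide[OF D1 D2 ne], of s] unfolding ab(5,6) .
  moreover have "((1 / (2 * a)) * b - a * (- 1 / (2 * b))) / (b * b) / s = (s / (2 * a * b)) / (b * b) / s"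
    unfolding ab(4) using ab(1,2) by (simp add: field_simps)
  moreover have "(s / (2 * a * b)) / (b * b) / s = d / 2 * (levy_density (s - d) * levy_density d)"
    unfolding levy_density_def ab(5,6) unfolding ab(7) unfolding ab(3)
    using s1 ab(1,2) by (simp add: field_simps)
  ultimately show ?thesis by (simp only:)
qed

lemma DERIV_inv_levy:
  assumes "0 < d" "d < s"
  shows "((\<lambda>d. (2 * d - s) / (sqrt d * sqrt (s - d)) / s\<^sup>2) has_real_derivative 1 / 2 * (levy_density (s - d) * levy_density d)) (at d)"
proof -
  obtain a b where ab: "0 < a" "0 < b" "d = a * a" "s = a * a + b * b" "sqrt d = a" "sqrt (s - d) = b" "s - d = b * b"
    using assms by (rule sqrt_parts)
  have D1: "(sqrt has_real_derivative 1 / (2 * a)) (at d)"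
    using DERIV_sqrt_comp[OF DERIV_ident assms(1)] unfolding ab(5) .
  have D2: "((\<lambda>d. sqrt (s - d)) has_real_derivative - 1 / (2 * b)) (at d)"
    using DERIV_sqrt_comp[OF DERIV_diff_const(1)[of s d]] assms ab by simp
  have D3: "((\<lambda>d. 2 * d - s) has_real_derivative 2) (at d)" by (auto intro!: derivative_eq_intros)
  have ne: "sqrt d * sqrt (s - d) \<noteq> 0" using ab by simp
  have s1: "s \<noteq> 0" using assms by simp
  have m: "2 * d - s = a * a - b * b" using ab by simp
  have "((\<lambda>d. (2 * d - s) / (sqrt d * sqrt (s - d)) / s\<^sup>2) has_real_derivative
      (2 * (a * b) - (a * a - b * b) * (1 / (2 * a) * b + - 1 / (2 * b) * a)) / (a * b * (a * b)) / s\<^sup>2) (at d)"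
    using DERIV_cdivide[OF DERIV_divide[OF D3 DERIV_mult[OF D1 D2] ne], of "s\<^sup>2"] unfolding ab(5,6) m .
  moreover have "2 * (a * b) - (a * a - b * b) * (1 / (2 * a) * b + - 1 / (2 * b) * a) = s\<^sup>2 / (2 * (a * b))"
    unfolding ab(4) using ab(1,2) by (simp add: field_simps power2_eq_square)
  moreover have "s\<^sup>2 / (2 * (a * b)) / (a * b * (a * b)) / s\<^sup>2 = 1 / 2 * (levy_density (s - d) * levy_density d)"
    unfolding levy_density_def ab(5,6) unfolding ab(7) unfolding ab(3)
    using s1 ab(1,2) by (simp add: field_simps)
  ultimately show ?thesis by (simp only:)
qed

text \<open>
  Up to a constant this is the mean at time \<open>\<kappa>\<close> of a Brownian excursion of length \<open>s\<close>, times the density of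
  the length \<open>s\<close>.  The weight \<open>max 0 (min \<kappa> (s - d) + min \<kappa> d - \<kappa>)\<close> rises linearly from \<open>0\<close> to
  \<open>r = min \<kappa> (s - \<kappa>)\<close>, is constant, and falls again, which gives three elementary integrals.
\<close>
lemma nn_integral_excursion_mean:
  assumes "0 < \<kappa>" "\<kappa> < s"
  shows "(\<integral>\<^sup>+d. ennreal (max 0 (min \<kappa> (s - d) + min \<kappa> d - \<kappa>) / 2 * (levy_density (s - d) * levy_density d)) * indicator {0<..s} d \<partial>lborel)
    = ennreal (4 * (sqrt \<kappa> * sqrt (s - \<kappa>)) / s\<^sup>2)"
proof -
  define r where "r = min \<kappa> (s - \<kappa>)"
  have r: "0 < r" "r \<le> s - r" "r < s" "s - r < s" "0 < s" using assms by (auto simp: r_def min_def)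
  let ?q = "\<lambda>d. levy_density (s - d) * levy_density d"
  let ?h = "\<lambda>d. max 0 (min \<kappa> (s - d) + min \<kappa> d - \<kappa>)"
  have h: "?h d = min r (min d (s - d))" if "0 < d" "d \<le> s" for d
    using that assms by (auto simp: r_def min_def max_def)
  have qn: "0 \<le> ?q d" if "0 < d" "d \<le> s" for d
    using that by (auto intro!: mult_nonneg_nonneg levy_density_nonneg)
  have I1: "(\<integral>\<^sup>+d. ennreal (d / 2 * ?q d) * indicator {0<..r} d \<partial>lborel) = ennreal (sqrt r / sqrt (s - r) / s - sqrt 0 / sqrt (s - 0) / s)"
  proof (rule nn_integral_FTC_Ioc[OF _ finite.emptyI])
    show "0 \<le> r" using r by simp
    show "continuous_on {0..r} (\<lambda>d. sqrt d / sqrt (s - d) / s)" using r by (intro continuous_intros) auto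
    show "((\<lambda>d. sqrt d / sqrt (s - d) / s) has_real_derivative d / 2 * ?q d) (at d)" if "d \<in> {0<..<r} - {}" for d
      using that r by (intro DERIV_ratio_sqrt) auto
    show "0 \<le> d / 2 * ?q d" if "d \<in> {0<..<r}" for d using that r qn[of d] by simp
  qed
  (* the falling part is the mirror image of the rising part *)
  have I3: "(\<integral>\<^sup>+d. ennreal ((s - d) / 2 * ?q d) * indicator {s - r<..s} d \<partial>lborel) = ennreal (sqrt r / sqrt (s - r) / s - sqrt 0 / sqrt (s - 0) / s)"
  proof -
    have "(\<integral>\<^sup>+d. ennreal ((s - d) / 2 * ?q d) * indicator {s - r<..s} d \<partial>lborel)
      = (\<integral>\<^sup>+d. ennreal ((s - (s + - 1 * d)) / 2 * ?q (s + - 1 * d)) * indicator {s - r<..s} (s + - 1 * d) \<partial>lborel)"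
      by (subst nn_integral_real_affine[where c="-1" and t=s]) auto
    also have "\<dots> = (\<integral>\<^sup>+d. ennreal (d / 2 * ?q d) * indicator {0<..r} d \<partial>lborel)"
    proof (rule nn_integral_cong_AE)
      show "AE d in lborel. ennreal ((s - (s + - 1 * d)) / 2 * ?q (s + - 1 * d)) * indicator {s - r<..s} (s + - 1 * d)
        = ennreal (d / 2 * ?q d) * indicator {0<..r} d"
        using AE_lborel_singleton[of 0] AE_lborel_singleton[of r]
        by eventually_elim (auto simp: indicator_def mult.commute)
    qed
    finally show ?thesis using I1 by simp
  qed
  have I2: "(\<integral>\<^sup>+d. ennreal (r * (1 / 2 * ?q d)) * indicator {r<..s - r} d \<partial>lborel)
    = ennreal (r * ((2 * (s - r) - s) / (sqrt (s - r) * sqrt (s - (s - r))) / s\<^sup>2) - r * ((2 * r - s) / (sqrt r * sqrt (s - r)) / s\<^sup>2))"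
  proof (rule nn_integral_FTC_Ioc[OF _ finite.emptyI])
    show "r \<le> s - r" using r by simp
    show "continuous_on {r..s - r} (\<lambda>d. r * ((2 * d - s) / (sqrt d * sqrt (s - d)) / s\<^sup>2))"
      using r by (intro continuous_intros) auto
    show "((\<lambda>d. r * ((2 * d - s) / (sqrt d * sqrt (s - d)) / s\<^sup>2)) has_real_derivative r * (1 / 2 * ?q d)) (at d)" if "d \<in> {r<..<s - r} - {}" for d
      using that r by (intro DERIV_cmult DERIV_inv_levy) auto
    show "0 \<le> r * (1 / 2 * ?q d)" if "d \<in> {r<..<s - r}" for d using that r qn[of d] by simp
  qed
  have "(\<integral>\<^sup>+d. ennreal (?h d / 2 * ?q d) * indicator {0<..s} d \<partial>lborel)
    = (\<integral>\<^sup>+d. ennreal (d / 2 * ?q d) * indicator {0<..r} d + ennreal (r * (1 / 2 * ?q d)) * indicator {r<..s - r} d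
        + ennreal ((s - d) / 2 * ?q d) * indicator {s - r<..s} d \<partial>lborel)"
  proof (intro nn_integral_cong)
    fix d :: real
    consider "d \<le> 0 \<or> s < d" | "0 < d" "d \<le> r" | "r < d" "d \<le> s - r" | "s - r < d" "d \<le> s" by linarith
    then show "ennreal (?h d / 2 * ?q d) * indicator {0<..s} d
      = ennreal (d / 2 * ?q d) * indicator {0<..r} d + ennreal (r * (1 / 2 * ?q d)) * indicator {r<..s - r} d
        + ennreal ((s - d) / 2 * ?q d) * indicator {s - r<..s} d"
    proof cases
      case 1
      then show ?thesis using r by (auto simp: indicator_def)
    next
      case 2
      then have "?h d = d" using h[of d] r by auto
      then show ?thesis using 2 r by (auto simp: indicator_def)
    next
      case 3
      then have "?h d = r" using h[of d] r by auto
      then show ?thesis using 3 r by (auto simp: indicator_def)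
    next
      case 4
      then have "?h d = s - d" using h[of d] r by auto
      then show ?thesis using 4 r by (auto simp: indicator_def)
    qed
  qed
  also have "\<dots> = ennreal (sqrt r / sqrt (s - r) / s - sqrt 0 / sqrt (s - 0) / s)
    + ennreal (r * ((2 * (s - r) - s) / (sqrt (s - r) * sqrt (s - (s - r))) / s\<^sup>2) - r * ((2 * r - s) / (sqrt r * sqrt (s - r)) / s\<^sup>2))
    + ennreal (sqrt r / sqrt (s - r) / s - sqrt 0 / sqrt (s - 0) / s)"
    by (subst nn_integral_add, measurable, subst nn_integral_add, measurable, simp only: I1 I2 I3)
  also have "\<dots> = ennreal (4 * (sqrt r * sqrt (s - r)) / s\<^sup>2)"
  proof -
    obtain a b where ab: "0 < a" "0 < b" "r = a * a" "s = a * a + b * b" "sqrt r = a" "sqrt (s - r) = b" "s - r = b * b"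
      using r(1,3) by (rule sqrt_parts)
    have s0: "a * a + b * b \<noteq> 0" using ab by (metis add_pos_pos mult_pos_pos less_irrefl)
    have A: "sqrt r / sqrt (s - r) / s - sqrt 0 / sqrt (s - 0) / s = a / b / s" using ab by simp
    have B: "r * ((2 * (s - r) - s) / (sqrt (s - r) * sqrt (s - (s - r))) / s\<^sup>2) - r * ((2 * r - s) / (sqrt r * sqrt (s - r)) / s\<^sup>2)
      = 2 * (a * (b * b - a * a)) / (b * s\<^sup>2)"
    proof -
      have E: "s - (s - r) = r" "2 * (s - r) - s = b * b - a * a" "2 * r - s = - (b * b - a * a)" using ab by simp_all
      have X: "a * a * (X / (b * a) / s\<^sup>2) - a * a * (- X / (a * b) / s\<^sup>2) = 2 * (a * X) / (b * s\<^sup>2)" for X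
        using ab(1,2) r(5) by (simp add: field_simps)
      show ?thesis unfolding E ab(5,6) unfolding ab(3) by (rule X)
    qed
    have "0 \<le> b * b - a * a" using r(2) ab by simp
    then have nn: "0 \<le> 2 * (a * (b * b - a * a)) / (b * s\<^sup>2)" "0 \<le> a / b / s" using ab r by auto
    have S: "a / b / s + 2 * (a * (b * b - a * a)) / (b * s\<^sup>2) + a / b / s = 4 * (a * b) / s\<^sup>2"
    proof -
      have "a / b / s = a * s / (b * s\<^sup>2)" using r(5) by (simp add: power2_eq_square)
      then have "a / b / s + 2 * (a * (b * b - a * a)) / (b * s\<^sup>2) + a / b / s = (2 * a * s + 2 * (a * (b * b - a * a))) / (b * s\<^sup>2)"
        by (simp add: add_divide_distrib)
      also have "2 * a * s + 2 * (a * (b * b - a * a)) = 4 * (a * b) * b" unfolding ab(4) by (simp add: algebra_simps)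
      also have "4 * (a * b) * b / (b * s\<^sup>2) = 4 * (a * b) / s\<^sup>2" using ab(2) by simp
      finally show ?thesis .
    qed
    have "ennreal x + ennreal y + ennreal x = ennreal (x + y + x)" if "0 \<le> y" "0 \<le> x" for x y
      using that ennreal_plus[of x y] ennreal_plus[of "x + y" x] by (simp only: add_nonneg_nonneg)
    from this[OF nn] show ?thesis unfolding A B S unfolding ab(5,6) .
  qed
  also have "sqrt r * sqrt (s - r) = sqrt \<kappa> * sqrt (s - \<kappa>)"
    by (cases "\<kappa> \<le> s - \<kappa>") (auto simp: r_def min_def mult.commute)
  finally show ?thesis .
qed

lemma DERIV_arctan_ratio:
  assumes "0 < \<kappa>" "\<kappa> < s"
  shows "((\<lambda>s. arctan (sqrt (s - \<kappa>) / sqrt \<kappa>)) has_real_derivative sqrt \<kappa> / (2 * sqrt (s - \<kappa>) * s)) (at s)"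
proof -
  obtain a b where ab: "0 < a" "0 < b" "\<kappa> = a * a" "s = a * a + b * b" "sqrt \<kappa> = a" "sqrt (s - \<kappa>) = b" "s - \<kappa> = b * b"
    using assms by (rule sqrt_parts)
  have s0: "a * a + b * b \<noteq> 0" using ab by (metis add_pos_pos mult_pos_pos less_irrefl)
  have D2: "((\<lambda>s. sqrt (s - \<kappa>)) has_real_derivative 1 / (2 * b)) (at s)"
    using DERIV_sqrt_comp[OF DERIV_diff_const(2)[of \<kappa> s]] assms ab by simp
  have "((\<lambda>s. arctan (sqrt (s - \<kappa>) / sqrt \<kappa>)) has_real_derivative inverse (1 + (b / a)\<^sup>2) * (1 / (2 * b) / a)) (at s)"
    using DERIV_chain2[OF DERIV_arctan DERIV_cdivide[OF D2, of a]] unfolding ab(5,6) .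
  moreover have "inverse (1 + (b / a)\<^sup>2) * (1 / (2 * b) / a) = a / (2 * b * (a * a + b * b))"
    using ab(1,2) s0 by (simp add: field_simps power2_eq_square)
  ultimately show ?thesis unfolding ab(5,6) ab(4)[symmetric] by simp
qed

lemma nn_integral_FTC_Ioc_nonneg:
  fixes f F :: "real \<Rightarrow> real"
  assumes "a \<le> b" "continuous_on {a..b} F"
    and D: "\<And>x. x \<in> {a<..<b} \<Longrightarrow> (F has_real_derivative f x) (at x)"
    and nn: "\<And>x. x \<in> {a<..<b} \<Longrightarrow> 0 \<le> f x"
  shows "(\<integral>\<^sup>+x. ennreal (f x) * indicator {a<..b} x \<partial>lborel) = ennreal (F b - F a) \<and> 0 \<le> F b - F a"
proof
  show "(\<integral>\<^sup>+x. ennreal (f x) * indicator {a<..b} x \<partial>lborel) = ennreal (F b - F a)"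
    by (rule nn_integral_FTC_Ioc[OF assms(1) finite.emptyI assms(2)]) (use D nn in auto)
  have "F a \<le> F b"
    by (rule DERIV_nonneg_imp_increasing_open[OF assms(1) _ assms(2)]) (use D nn in fastforce)
  then show "0 \<le> F b - F a" by simp
qed

text \<open>
  The antiderivative combines an arctangent with \<open>sqrt (s - \<kappa>) / s\<close>.
\<close>
lemma nn_integral_excursion_const:
  assumes "0 < \<kappa>" "\<kappa> < 1"
  shows "(\<integral>\<^sup>+s. ennreal (\<kappa> * (4 * (sqrt \<kappa> * sqrt (s - \<kappa>)) / s\<^sup>2)) * indicator {\<kappa><..1} s \<partial>lborel)
    = ennreal (4 * \<kappa> * (arctan (sqrt (1 - \<kappa>) / sqrt \<kappa>) - sqrt \<kappa> * sqrt (1 - \<kappa>)))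
    \<and> 0 \<le> 4 * \<kappa> * (arctan (sqrt (1 - \<kappa>) / sqrt \<kappa>) - sqrt \<kappa> * sqrt (1 - \<kappa>))"
proof -
  let ?F = "\<lambda>s. 4 * \<kappa> * (arctan (sqrt (s - \<kappa>) / sqrt \<kappa>) - sqrt \<kappa> * (sqrt (s - \<kappa>) / s))"
  have "(\<integral>\<^sup>+s. ennreal (\<kappa> * (4 * (sqrt \<kappa> * sqrt (s - \<kappa>)) / s\<^sup>2)) * indicator {\<kappa><..1} s \<partial>lborel) = ennreal (?F 1 - ?F \<kappa>) \<and> 0 \<le> ?F 1 - ?F \<kappa>"
  proof (rule nn_integral_FTC_Ioc_nonneg)
    show "\<kappa> \<le> 1" using assms by simp
    show "continuous_on {\<kappa>..1} ?F" using assms by (intro continuous_intros) auto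
    show "0 \<le> \<kappa> * (4 * (sqrt \<kappa> * sqrt (s - \<kappa>)) / s\<^sup>2)" if "s \<in> {\<kappa><..<1}" for s using that assms by simp
    fix s assume "s \<in> {\<kappa><..<1}"
    then have s: "\<kappa> < s" by auto
    obtain a b where ab: "0 < a" "0 < b" "\<kappa> = a * a" "s = a * a + b * b" "sqrt \<kappa> = a" "sqrt (s - \<kappa>) = b" "s - \<kappa> = b * b"
      using assms(1) s by (rule sqrt_parts)
    have s0: "s \<noteq> 0" using assms s by simp
    have D2: "((\<lambda>s. sqrt (s - \<kappa>)) has_real_derivative 1 / (2 * b)) (at s)"
      using DERIV_sqrt_comp[OF DERIV_diff_const(2)[of \<kappa> s]] s ab by simp
    have "(?F has_real_derivative 4 * \<kappa> * (a / (2 * b * s) - a * ((1 / (2 * b) * s - b * 1) / (s * s)))) (at s)"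
      using DERIV_cmult[OF DERIV_diff[OF DERIV_arctan_ratio[OF assms(1) s] DERIV_cmult[OF DERIV_divide[OF D2 DERIV_ident s0], of "sqrt \<kappa>"]], of "4 * \<kappa>"]
      unfolding ab(5,6) .
    moreover have "4 * \<kappa> * (a / (2 * b * s) - a * ((1 / (2 * b) * s - b * 1) / (s * s))) = \<kappa> * (4 * (a * b) / s\<^sup>2)"
      using ab(1,2) s0 by (simp add: field_simps power2_eq_square)
    ultimately show "(?F has_real_derivative \<kappa> * (4 * (sqrt \<kappa> * sqrt (s - \<kappa>)) / s\<^sup>2)) (at s)"
      unfolding ab(5,6) by simp
  qed
  then show ?thesis by simp
qed

lemma nn_integral_excursion_linear:
  assumes "0 < \<kappa>" "\<kappa> < 1"
  shows "(\<integral>\<^sup>+s. ennreal (max 0 (s - \<kappa>) * (4 * (sqrt \<kappa> * sqrt (s - \<kappa>)) / s\<^sup>2)) * indicator {\<kappa><..1} s \<partial>lborel)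
    = ennreal (4 * sqrt \<kappa> * ((2 + \<kappa>) * sqrt (1 - \<kappa>)) - 12 * \<kappa> * arctan (sqrt (1 - \<kappa>) / sqrt \<kappa>))
    \<and> 0 \<le> 4 * sqrt \<kappa> * ((2 + \<kappa>) * sqrt (1 - \<kappa>)) - 12 * \<kappa> * arctan (sqrt (1 - \<kappa>) / sqrt \<kappa>)"
proof -
  let ?F = "\<lambda>s. 4 * sqrt \<kappa> * (3 * sqrt (s - \<kappa>) - 3 * sqrt \<kappa> * arctan (sqrt (s - \<kappa>) / sqrt \<kappa>) - (s - \<kappa>) * sqrt (s - \<kappa>) / s)"
  have "(\<integral>\<^sup>+s. ennreal (max 0 (s - \<kappa>) * (4 * (sqrt \<kappa> * sqrt (s - \<kappa>)) / s\<^sup>2)) * indicator {\<kappa><..1} s \<partial>lborel) = ennreal (?F 1 - ?F \<kappa>) \<and> 0 \<le> ?F 1 - ?F \<kappa>"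
  proof (rule nn_integral_FTC_Ioc_nonneg)
    show "\<kappa> \<le> 1" using assms by simp
    show "continuous_on {\<kappa>..1} ?F" using assms by (intro continuous_intros) auto
    show "0 \<le> max 0 (s - \<kappa>) * (4 * (sqrt \<kappa> * sqrt (s - \<kappa>)) / s\<^sup>2)" if "s \<in> {\<kappa><..<1}" for s using that assms by simp
    fix s assume "s \<in> {\<kappa><..<1}"
    then have s: "\<kappa> < s" by auto
    obtain a b where ab: "0 < a" "0 < b" "\<kappa> = a * a" "s = a * a + b * b" "sqrt \<kappa> = a" "sqrt (s - \<kappa>) = b" "s - \<kappa> = b * b"
      using assms(1) s by (rule sqrt_parts)
    have s0: "s \<noteq> 0" using assms s by simp
    have D2: "((\<lambda>s. sqrt (s - \<kappa>)) has_real_derivative 1 / (2 * b)) (at s)"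
      using DERIV_sqrt_comp[OF DERIV_diff_const(2)[of \<kappa> s]] s ab by simp
    have "(?F has_real_derivative 4 * a * (3 * (1 / (2 * b)) - 3 * a * (a / (2 * b * s))
        - ((1 * b + 1 / (2 * b) * (b * b)) * s - b * b * b * 1) / (s * s))) (at s)"
      using DERIV_cmult[OF DERIV_diff[OF DERIV_diff[OF DERIV_cmult[OF D2, of 3] DERIV_cmult[OF DERIV_arctan_ratio[OF assms(1) s], of "3 * sqrt \<kappa>"]]
        DERIV_divide[OF DERIV_mult[OF DERIV_diff_const(2)[of \<kappa> s] D2] DERIV_ident s0]], of "4 * sqrt \<kappa>"]
      unfolding ab(5,6) unfolding ab(7) .
    moreover have "4 * a * (3 * (1 / (2 * b)) - 3 * a * (a / (2 * b * s))
        - ((1 * b + 1 / (2 * b) * (b * b)) * s - b * b * b * 1) / (s * s)) = (b * b) * (4 * (a * b) / s\<^sup>2)"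
    proof -
      have "3 * (1 / (2 * b)) - 3 * a * (a / (2 * b * s)) = 3 * (s - a * a) / (2 * b * s)"
        using ab(2) s0 by (simp add: field_simps)
      also have "s - a * a = b * b" using ab by simp
      also have "3 * (b * b) / (2 * b * s) = 3 * b / 2 * s / (s * s)" using ab(2) s0 by simp
      finally have 1: "3 * (1 / (2 * b)) - 3 * a * (a / (2 * b * s)) = 3 * b / 2 * s / (s * s)" .
      have 2: "(1 * b + 1 / (2 * b) * (b * b)) * s = 3 * b / 2 * s" using ab(2) by (simp add: field_simps)
      show ?thesis unfolding 1 2 diff_divide_distrib by (simp add: power2_eq_square)
    qed
    moreover have "max 0 (s - \<kappa>) = b * b" using ab s by simp
    ultimately show "(?F has_real_derivative max 0 (s - \<kappa>) * (4 * (sqrt \<kappa> * sqrt (s - \<kappa>)) / s\<^sup>2)) (at s)"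
      unfolding ab(5,6) by simp
  qed
  moreover have "?F 1 - ?F \<kappa> = 4 * sqrt \<kappa> * ((2 + \<kappa>) * sqrt (1 - \<kappa>)) - 12 * (sqrt \<kappa> * sqrt \<kappa>) * arctan (sqrt (1 - \<kappa>) / sqrt \<kappa>)"
    by (simp add: algebra_simps)
  moreover have "sqrt \<kappa> * sqrt \<kappa> = \<kappa>" using assms by simp
  ultimately show ?thesis by (simp only:)
qed

lemma arctan_ratio_arcsin:
  assumes "0 < t" "t < 1"
  shows "arctan (sqrt t / sqrt (1 - t)) = arcsin (sqrt t)"
    and "arctan (sqrt (1 - t) / sqrt t) = pi / 2 - arcsin (sqrt t)"
    and "arcsin (sqrt (1 - t)) = pi / 2 - arcsin (sqrt t)"
proof -
  let ?\<theta> = "arcsin (sqrt t)"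
  have b: "- 1 \<le> sqrt t" "sqrt t \<le> 1" "- 1 < sqrt t" "sqrt t < 1" "0 < sqrt t"
    using assms by (auto intro: order_trans[of _ 0] order_less_le_trans[of _ 0])
  have sc: "sin ?\<theta> = sqrt t" "cos ?\<theta> = sqrt (1 - t)" using sin_arcsin[OF b(1,2)] cos_arcsin[OF b(1,2)] assms by simp_all
  have \<theta>: "0 < ?\<theta>" "?\<theta> < pi / 2" using b arcsin_less_arcsin[of 0 "sqrt t"] arcsin_lt_bounded[OF b(3,4)] by auto
  show "arctan (sqrt t / sqrt (1 - t)) = ?\<theta>"
    using \<theta> by (intro arctan_unique) (auto simp: tan_def sc)
  show "arctan (sqrt (1 - t) / sqrt t) = pi / 2 - ?\<theta>"
    using \<theta> by (intro arctan_unique) (auto simp: tan_def sin_diff cos_diff sc)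
  show "arcsin (sqrt (1 - t)) = pi / 2 - ?\<theta>"
    using \<theta> by (intro arcsin_unique) (auto simp: sin_diff sc)
qed

lemma DERIV_arcsin_sqrt:
  assumes "0 < d" "d < t"
  shows "((\<lambda>d. arcsin (sqrt d / sqrt t)) has_real_derivative 1 / (2 * sqrt d * sqrt (t - d))) (at d)"
proof -
  have t: "0 < t" using assms by simp
  have lt: "sqrt d / sqrt t < 1" using assms t by simp
  have gt: "- 1 < sqrt d / sqrt t"
  proof -
    have "0 \<le> sqrt d / sqrt t" using assms t by simp
    then show ?thesis by linarith
  qed
  have D1: "(sqrt has_real_derivative 1 / (2 * sqrt d)) (at d)"
    using DERIV_sqrt_comp[OF DERIV_ident assms(1)] .
  have "((\<lambda>d. arcsin (sqrt d / sqrt t)) has_real_derivative inverse (sqrt (1 - (sqrt d / sqrt t)\<^sup>2)) * (1 / (2 * sqrt d) / sqrt t)) (at d)"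
    using DERIV_chain2[OF DERIV_arcsin[OF gt lt] DERIV_cdivide[OF D1, of "sqrt t"]] .
  moreover have "sqrt (1 - (sqrt d / sqrt t)\<^sup>2) = sqrt (t - d) / sqrt t"
  proof -
    have "1 - (sqrt d / sqrt t)\<^sup>2 = (t - d) / t"
      using assms t by (simp add: power_divide diff_divide_distrib)
    then show ?thesis by (simp only: real_sqrt_divide)
  qed
  moreover have "inverse (sqrt (t - d) / sqrt t) * (1 / (2 * sqrt d) / sqrt t) = 1 / (2 * sqrt d * sqrt (t - d))"
    using t by simp
  ultimately show ?thesis by (simp only:)
qed

lemma integral_sqrt_ratio:
  assumes "0 < t"
  shows "has_bochner_integral lborel (\<lambda>d. indicator {0<..t} d * (sqrt (t - d) / sqrt d)) (t * pi / 2)"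
proof -
  let ?F = "\<lambda>d. sqrt d * sqrt (t - d) + t * arcsin (sqrt d / sqrt t)"
  have "has_bochner_integral lborel (\<lambda>d. indicator {0<..t} d * (sqrt (t - d) / sqrt d)) (?F t - ?F 0)"
  proof (rule integral_FTC_Ioc[OF _ finite.emptyI])
    show "0 \<le> t" using assms by simp
    have "- 1 \<le> sqrt d / sqrt t \<and> sqrt d / sqrt t \<le> 1" if "d \<in> {0..t}" for d
      using that assms by (auto intro: order_trans[of _ 0])
    then show "continuous_on {0..t} ?F" using assms by (intro continuous_intros ballI) auto
    show "0 \<le> sqrt (t - d) / sqrt d" if "d \<in> {0<..t}" for d using that by auto
    fix d assume d: "d \<in> {0<..<t} - {}"
    then have "0 < d" "d < t" by auto
    then obtain a b where ab: "0 < a" "0 < b" "d = a * a" "t = a * a + b * b" "sqrt d = a" "sqrt (t - d) = b" "t - d = b * b"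
      by (rule sqrt_parts)
    have D1: "(sqrt has_real_derivative 1 / (2 * a)) (at d)"
      using DERIV_sqrt_comp[OF DERIV_ident \<open>0 < d\<close>] unfolding ab(5) .
    have D2: "((\<lambda>d. sqrt (t - d)) has_real_derivative - 1 / (2 * b)) (at d)"
      using DERIV_sqrt_comp[OF DERIV_diff_const(1)[of t d]] d ab by simp
    have "(?F has_real_derivative (1 / (2 * a) * b + - 1 / (2 * b) * a) + t * (1 / (2 * a * b))) (at d)"
      using DERIV_add[OF DERIV_mult[OF D1 D2] DERIV_cmult[OF DERIV_arcsin_sqrt[OF \<open>0 < d\<close> \<open>d < t\<close>], of t]]
      unfolding ab(5,6) .
    moreover have "(1 / (2 * a) * b + - 1 / (2 * b) * a) + t * (1 / (2 * a * b)) = b / a"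
      unfolding ab(4) using ab(1,2) by (simp add: field_simps)
    ultimately show "(?F has_real_derivative sqrt (t - d) / sqrt d) (at d)" unfolding ab(5,6) by simp
  qed measurable
  moreover have "?F t - ?F 0 = t * pi / 2" using assms by simp
  ultimately show ?thesis by (simp only:)
qed

lemma integral_linear_arcsine:
  assumes "0 < t" "t < 1"
  shows "has_bochner_integral lborel (\<lambda>d. indicator {0<..t} d * ((t - d) / (sqrt d * sqrt (1 - d))))
    ((2 * t - 1) * arcsin (sqrt t) + sqrt t * sqrt (1 - t))"
proof -
  let ?F = "\<lambda>d. (2 * t - 1) * arcsin (sqrt d / sqrt 1) + sqrt d * sqrt (1 - d)"
  have "has_bochner_integral lborel (\<lambda>d. indicator {0<..t} d * ((t - d) / (sqrt d * sqrt (1 - d)))) (?F t - ?F 0)"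
  proof (rule integral_FTC_Ioc[OF _ finite.emptyI])
    show "0 \<le> t" using assms by simp
    have "- 1 \<le> sqrt d / sqrt 1 \<and> sqrt d / sqrt 1 \<le> 1" if "d \<in> {0..t}" for d
      using that assms by (auto intro: order_trans[of _ 0])
    then show "continuous_on {0..t} ?F" using assms by (intro continuous_intros ballI) auto
    show "0 \<le> (t - d) / (sqrt d * sqrt (1 - d))" if "d \<in> {0<..t}" for d using that assms by auto
    fix d assume d: "d \<in> {0<..<t} - {}"
    then have d1: "0 < d" "d < 1" using assms by auto
    then obtain a b where ab: "0 < a" "0 < b" "d = a * a" "1 = a * a + b * b" "sqrt d = a" "sqrt (1 - d) = b" "1 - d = b * b"
      by (rule sqrt_parts)
    have D1: "(sqrt has_real_derivative 1 / (2 * a)) (at d)"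
      using DERIV_sqrt_comp[OF DERIV_ident d1(1)] unfolding ab(5) .
    have D2: "((\<lambda>d. sqrt (1 - d)) has_real_derivative - 1 / (2 * b)) (at d)"
      using DERIV_sqrt_comp[OF DERIV_diff_const(1)[of 1 d]] d1 ab(6) by simp
    have "(?F has_real_derivative (2 * t - 1) * (1 / (2 * a * b)) + (1 / (2 * a) * b + - 1 / (2 * b) * a)) (at d)"
      using DERIV_add[OF DERIV_cmult[OF DERIV_arcsin_sqrt[OF d1], of "2 * t - 1"] DERIV_mult[OF D1 D2]]
      unfolding ab(5,6) .
    moreover have "(2 * t - 1) * (1 / (2 * a * b)) + (1 / (2 * a) * b + - 1 / (2 * b) * a) = (t - d) / (a * b)"
    proof -
      have "(2 * t - 1) * (1 / (2 * a * b)) + (1 / (2 * a) * b + - 1 / (2 * b) * a) = ((2 * t - 1) + b * b - a * a) / (2 * (a * b))"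
        using ab(1,2) by (simp add: field_simps)
      also have "(2 * t - 1) + b * b - a * a = 2 * (t - d)" using ab(3,7) by simp
      also have "2 * (t - d) / (2 * (a * b)) = (t - d) / (a * b)" by (rule mult_divide_mult_cancel_left) simp
      finally show ?thesis .
    qed
    ultimately show "(?F has_real_derivative (t - d) / (sqrt d * sqrt (1 - d))) (at d)" unfolding ab(5,6) by simp
  qed measurable
  then show ?thesis by simp
qed

lemma integral_excess_tail:
  assumes "0 < u" "u < 1"
  shows "has_bochner_integral lborel (\<lambda>d. indicator {u<..1} d * ((d - u) * levy_density d * (2 * sqrt (1 - d))))
    (2 * ((1 + 2 * u) * (pi / 2 - arcsin (sqrt u)) - 3 * (sqrt u * sqrt (1 - u))))"
proof -
  let ?F = "\<lambda>d. 2 * (sqrt d * sqrt (1 - d) + (1 + 2 * u) * arcsin (sqrt d / sqrt 1) + 2 * u * (sqrt (1 - d) / sqrt d))"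
  have "has_bochner_integral lborel (\<lambda>d. indicator {u<..1} d * ((d - u) * levy_density d * (2 * sqrt (1 - d)))) (?F 1 - ?F u)"
  proof (rule integral_FTC_Ioc[OF _ finite.emptyI])
    show "u \<le> 1" using assms by simp
    have "- 1 \<le> sqrt d / sqrt 1 \<and> sqrt d / sqrt 1 \<le> 1" if "d \<in> {u..1}" for d
      using that assms by (auto intro: order_trans[of _ 0])
    then show "continuous_on {u..1} ?F" using assms by (intro continuous_intros ballI) auto
    show "0 \<le> (d - u) * levy_density d * (2 * sqrt (1 - d))" if "d \<in> {u<..1}" for d
      using that assms by (auto intro!: mult_nonneg_nonneg levy_density_nonneg)
    fix d assume d: "d \<in> {u<..<1} - {}"
    then have d1: "0 < d" "d < 1" using assms by auto
    then obtain a b where ab: "0 < a" "0 < b" "d = a * a" "1 = a * a + b * b" "sqrt d = a" "sqrt (1 - d) = b" "1 - d = b * b"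
      by (rule sqrt_parts)
    have D1: "(sqrt has_real_derivative 1 / (2 * a)) (at d)"
      using DERIV_sqrt_comp[OF DERIV_ident d1(1)] unfolding ab(5) .
    have D2: "((\<lambda>d. sqrt (1 - d)) has_real_derivative - 1 / (2 * b)) (at d)"
      using DERIV_sqrt_comp[OF DERIV_diff_const(1)[of 1 d]] d1 ab(6) by simp
    have ne: "sqrt d \<noteq> 0" using d1 by simp
    have "(?F has_real_derivative 2 * ((1 / (2 * a) * b + - 1 / (2 * b) * a) + (1 + 2 * u) * (1 / (2 * a * b))
        + 2 * u * ((- 1 / (2 * b) * a - b * (1 / (2 * a))) / (a * a)))) (at d)"
      using DERIV_cmult[OF DERIV_add[OF DERIV_add[OF DERIV_mult[OF D1 D2] DERIV_cmult[OF DERIV_arcsin_sqrt[OF d1], of "1 + 2 * u"]]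
        DERIV_cmult[OF DERIV_divide[OF D2 D1 ne], of "2 * u"]], of 2]
      unfolding ab(5,6) .
    moreover have "2 * ((1 / (2 * a) * b + - 1 / (2 * b) * a) + (1 + 2 * u) * (1 / (2 * a * b))
        + 2 * u * ((- 1 / (2 * b) * a - b * (1 / (2 * a))) / (a * a))) = (d - u) * (1 / (d * a)) * (2 * b)"
    proof -
      have e1: "1 / (2 * a) * b + - 1 / (2 * b) * a = (b * b - a * a) / (2 * (a * b))"
        using ab(1,2) by (simp add: field_simps)
      have "- 1 / (2 * b) * a - b * (1 / (2 * a)) = - ((a * a + b * b) / (2 * (a * b)))"
        using ab(1,2) by (simp add: field_simps)
      then have e2: "- 1 / (2 * b) * a - b * (1 / (2 * a)) = - (1 / (2 * (a * b)))"
        by (simp only: ab(4)[symmetric])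
      have e3: "a * a - 1 = - (b * b)" "b * b - a * a + (1 + 2 * u) = 2 * (b * b + u)" using ab(4) by simp_all
      have "2 * ((1 / (2 * a) * b + - 1 / (2 * b) * a) + (1 + 2 * u) * (1 / (2 * a * b))
        + 2 * u * ((- 1 / (2 * b) * a - b * (1 / (2 * a))) / (a * a)))
        = (b * b - a * a + (1 + 2 * u)) / (a * b) - 2 * u / (a * b * (a * a))"
        unfolding e1 e2 using ab(1,2) by (simp add: field_simps)
      also have "\<dots> = 2 * (b * b * (a * a) + u * (a * a - 1)) / (a * b * (a * a))"
        unfolding e3(2) using ab(1,2) by (simp add: field_simps)
      also have "b * b * (a * a) + u * (a * a - 1) = b * b * (a * a - u)"
        unfolding e3(1) by (simp add: algebra_simps)
      also have "2 * (b * b * (a * a - u)) / (a * b * (a * a)) = (a * a - u) * (1 / (a * a * a)) * (2 * b)"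
        using ab(1,2) by (simp add: field_simps)
      finally show ?thesis unfolding ab(3) .
    qed
    ultimately show "(?F has_real_derivative (d - u) * levy_density d * (2 * sqrt (1 - d))) (at d)"
      unfolding levy_density_def ab(5,6) by simp
  qed measurable
  moreover have "?F 1 - ?F u = 2 * ((1 + 2 * u) * (pi / 2 - arcsin (sqrt u)) - 3 * (sqrt u * sqrt (1 - u)))"
  proof -
    have "u * (sqrt (1 - u) / sqrt u) = sqrt u * sqrt (1 - u)"
      using assms by (metis real_div_sqrt less_imp_le times_divide_eq_right times_divide_eq_left)
    then have e: "2 * u * (sqrt (1 - u) / sqrt u) = 2 * (sqrt u * sqrt (1 - u))" by (simp only: mult.assoc)
    show ?thesis unfolding e by (simp add: algebra_simps)
  qed
  ultimately show ?thesis by (simp only:)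
qed

text \<open>
  Change of variables \<open>s = c + d\<close> and Tonelli; the integral over \<open>d\<close> for fixed \<open>s\<close> is
  \<open>nn_integral_excursion_mean\<close>, and the weight vanishes for \<open>s \<le> \<kappa>\<close>.
\<close>
lemma nn_integral_excursion_pairs:
  assumes \<kappa>: "0 < \<kappa>" "\<kappa> < 1" and g: "g \<in> borel_measurable borel" "\<And>s. 0 \<le> g s"
  shows "(\<integral>\<^sup>+d. \<integral>\<^sup>+c. ennreal (indicator {0<..1} d * (indicator {0<..1} c *
        (of_bool (c + d \<le> 1) * (g (c + d) * max 0 (min \<kappa> c + min \<kappa> d - \<kappa>) / 2 * (levy_density c * levy_density d))))) \<partial>lborel \<partial>lborel)
    = (\<integral>\<^sup>+s. ennreal (g s * (4 * (sqrt \<kappa> * sqrt (s - \<kappa>)) / s\<^sup>2)) * indicator {\<kappa><..1} s \<partial>lborel)"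
proof -
  note [measurable] = g(1)
  let ?P = "\<lambda>c d. ennreal (indicator {0<..1} d * (indicator {0<..1} c *
        (of_bool (c + d \<le> 1) * (g (c + d) * max 0 (min \<kappa> c + min \<kappa> d - \<kappa>) / 2 * (levy_density c * levy_density d)))))"
  have "(\<integral>\<^sup>+d. \<integral>\<^sup>+c. ?P c d \<partial>lborel \<partial>lborel) = (\<integral>\<^sup>+d. \<integral>\<^sup>+s. ?P (- d + 1 * s) d \<partial>lborel \<partial>lborel)"
  proof (rule nn_integral_cong)
    fix d :: real
    show "(\<integral>\<^sup>+c. ?P c d \<partial>lborel) = (\<integral>\<^sup>+s. ?P (- d + 1 * s) d \<partial>lborel)"
      by (subst nn_integral_real_affine[where c=1 and t="-d"]) auto
  qed
  also have "\<dots> = (\<integral>\<^sup>+s. \<integral>\<^sup>+d. ?P (- d + 1 * s) d \<partial>lborel \<partial>lborel)"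
    by (rule lborel_pair.Fubini') measurable
  also have "\<dots> = (\<integral>\<^sup>+s. ennreal (g s * (4 * (sqrt \<kappa> * sqrt (s - \<kappa>)) / s\<^sup>2)) * indicator {\<kappa><..1} s \<partial>lborel)"
  proof (intro nn_integral_cong)
    fix s :: real
    show "(\<integral>\<^sup>+d. ?P (- d + 1 * s) d \<partial>lborel) = ennreal (g s * (4 * (sqrt \<kappa> * sqrt (s - \<kappa>)) / s\<^sup>2)) * indicator {\<kappa><..1} s"
    proof (cases "\<kappa> < s \<and> s \<le> 1")
      case True
      have "(\<integral>\<^sup>+d. ?P (- d + 1 * s) d \<partial>lborel)
        = (\<integral>\<^sup>+d. ennreal (g s) * (ennreal (max 0 (min \<kappa> (s - d) + min \<kappa> d - \<kappa>) / 2 * (levy_density (s - d) * levy_density d)) * indicator {0<..s} d) \<partial>lborel)"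
      proof (rule nn_integral_cong_AE)
        show "AE d in lborel. ?P (- d + 1 * s) d
          = ennreal (g s) * (ennreal (max 0 (min \<kappa> (s - d) + min \<kappa> d - \<kappa>) / 2 * (levy_density (s - d) * levy_density d)) * indicator {0<..s} d)"
          using AE_lborel_singleton[of s]
        proof eventually_elim
          case (elim d)
          show ?case
          proof (cases "0 < d \<and> d < s")
            case d: True
            then have "0 \<le> max 0 (min \<kappa> (s - d) + min \<kappa> d - \<kappa>) / 2 * (levy_density (s - d) * levy_density d)"
              by (auto intro!: mult_nonneg_nonneg levy_density_nonneg)
            then show ?thesis using d True g(2)[of s] by (simp add: ennreal_mult[symmetric] mult.assoc)
          next
            case False
            with elim have "d \<le> 0 \<or> s < d" by auto
            then show ?thesis by (auto simp: indicator_def)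
          qed
        qed
      qed
      also have "\<dots> = ennreal (g s) * ennreal (4 * (sqrt \<kappa> * sqrt (s - \<kappa>)) / s\<^sup>2)"
        by (subst nn_integral_cmult, measurable) (simp only: nn_integral_excursion_mean[OF \<kappa>(1) True[THEN conjunct1]])
      finally show ?thesis using True g(2)[of s] \<kappa> by (simp add: ennreal_mult[symmetric])
    next
      case False
      have "?P (- d + 1 * s) d = 0" for d
      proof (cases "0 < d \<and> 0 < s - d \<and> s \<le> 1")
        case d: True
        with False have "s \<le> \<kappa>" by auto
        with d have "max 0 (min \<kappa> (- d + 1 * s) + min \<kappa> d - \<kappa>) = 0" by (auto simp: min_def max_def)
        then show ?thesis by simp
      qed (auto simp: indicator_def)
      then show ?thesis using False by (simp only:) auto
    qed
  qed
  finally show ?thesis .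
qed

text \<open>
  From iterated integrals of nonnegative functions, where the order of integration is free, to iterated
  integrals of integrable functions, which can be subtracted.
\<close>
lemma iterated_integral_eqI:
  fixes P :: "real \<Rightarrow> real \<Rightarrow> real"
  assumes m: "(\<lambda>(c, d). P c d) \<in> borel_measurable (borel \<Otimes>\<^sub>M borel)"
    and nn: "\<And>c d. 0 < c \<Longrightarrow> 0 < d \<Longrightarrow> 0 \<le> P c d"
    and int: "\<And>d. 0 < d \<Longrightarrow> integrable lborel (\<lambda>c. indicator {0<..1} c * P c d)"
    and I: "(\<integral>\<^sup>+d. \<integral>\<^sup>+c. ennreal (indicator {0<..1} d * (indicator {0<..1} c * P c d)) \<partial>lborel \<partial>lborel) = ennreal v"
    and v: "0 \<le> v"
  shows "has_bochner_integral lborel (\<lambda>d. indicator {0<..1} d * (\<integral>c. indicator {0<..1} c * P c d \<partial>lborel)) v"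
proof (rule has_bochner_integral_nn_integral)
  have [measurable]: "(\<lambda>x. P (f x) (g x)) \<in> borel_measurable M" if "f \<in> borel_measurable M" "g \<in> borel_measurable M" for f g and M :: "'b measure"
    using measurable_compose[OF measurable_Pair[OF that] m] by simp
  show "(\<lambda>d. indicator {0<..1} d * (\<integral>c. indicator {0<..1} c * P c d \<partial>lborel)) \<in> borel_measurable lborel"
    by measurable
  show "AE d in lborel. 0 \<le> indicator {0<..1} d * (\<integral>c. indicator {0<..1} c * P c d \<partial>lborel)"
  proof (rule AE_I2)
    fix d :: real
    show "0 \<le> indicator {0<..1} d * (\<integral>c. indicator {0<..1} c * P c d \<partial>lborel)"
      by (cases "d \<in> {0<..1}") (auto intro!: Bochner_Integration.integral_nonneg simp: indicator_def nn)
  qed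
  have "(\<integral>\<^sup>+d. ennreal (indicator {0<..1} d * (\<integral>c. indicator {0<..1} c * P c d \<partial>lborel)) \<partial>lborel)
    = (\<integral>\<^sup>+d. \<integral>\<^sup>+c. ennreal (indicator {0<..1} d * (indicator {0<..1} c * P c d)) \<partial>lborel \<partial>lborel)"
  proof (intro nn_integral_cong)
    fix d :: real
    show "ennreal (indicator {0<..1} d * (\<integral>c. indicator {0<..1} c * P c d \<partial>lborel))
      = (\<integral>\<^sup>+c. ennreal (indicator {0<..1} d * (indicator {0<..1} c * P c d)) \<partial>lborel)"
    proof (cases "d \<in> {0<..1}")
      case True
      then have "(\<integral>\<^sup>+c. ennreal (indicator {0<..1} c * P c d) \<partial>lborel) = ennreal (\<integral>c. indicator {0<..1} c * P c d \<partial>lborel)"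
        by (intro nn_integral_eq_integral int AE_I2) (auto simp: indicator_def nn)
      then show ?thesis using True by simp
    qed auto
  qed
  then show "(\<integral>\<^sup>+d. ennreal (indicator {0<..1} d * (\<integral>c. indicator {0<..1} c * P c d \<partial>lborel)) \<partial>lborel) = ennreal v"
    using I by simp
qed (rule v)

lemma integrable_inner:
  fixes P :: "real \<Rightarrow> real"
  assumes "P \<in> borel_measurable borel" "\<And>c. 0 < c \<Longrightarrow> \<bar>P c\<bar> \<le> K * (1 / sqrt c)"
  shows "integrable lborel (\<lambda>c. indicator {0<..1} c * P c)"
proof (rule Bochner_Integration.integrable_bound)
  show "integrable lborel (\<lambda>c::real. K * (indicator {0<..1} c * (1 / sqrt c)))"
    using has_bochner_integral_mult_right[OF integral_inv_sqrt[of 1], of K] by (simp add: has_bochner_integral_iff)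
  show "AE c in lborel. norm (indicator {0<..1} c * P c) \<le> norm (K * (indicator {0<..1} c * (1 / sqrt c)))"
  proof (rule AE_I2)
    fix c :: real
    show "norm (indicator {0<..1} c * P c) \<le> norm (K * (indicator {0<..1} c * (1 / sqrt c)))"
      using order_trans[OF assms(2)[of c] abs_ge_self] by (cases "c \<in> {0<..1}") auto
  qed
qed (use assms(1) in measurable)

text \<open>
  The four terms of \<open>pair_weight\<close> are integrated separately.  The first two contain, apart from a function of
  \<open>c + d\<close>, the weight in \<open>nn_integral_excursion_pairs\<close>; for the last two the integral over \<open>c\<close> is done
  first.  All results are combinations of \<open>t\<close>, \<open>arcsin (sqrt t)\<close> and \<open>sqrt t * sqrt (1 - t)\<close>.
\<close>
lemma pair_integrand_integral:
  assumes t: "0 < t" "t < 1"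
  shows "(\<integral>d. indicator {0<..1} d * (\<integral>c. indicator {0<..1} c * pair_integrand t c d \<partial>lborel) \<partial>lborel)
    = 4 * pi * t + 8 * (1 - 2 * t) * arcsin (sqrt t) - 8 * (sqrt t * sqrt (1 - t))"
proof -
  define u where "u = 1 - t"
  have u: "0 < u" "u < 1" "1 - u = t" "1 - t = u" using t by (auto simp: u_def)
  define \<theta> where "\<theta> = arcsin (sqrt t)"
  define w where "w = sqrt t * sqrt u"
  have w': "sqrt u * sqrt t = w" by (simp add: w_def)
  have arc: "arctan (sqrt t / sqrt u) = \<theta>" "arctan (sqrt u / sqrt t) = pi / 2 - \<theta>" "arcsin (sqrt u) = pi / 2 - \<theta>"
    using arctan_ratio_arcsin[OF t] unfolding u_def \<theta>_def by auto
  let ?q = "\<lambda>c d. levy_density c * levy_density d"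
  let ?E = "\<lambda>g \<kappa> c d. of_bool (c + d \<le> 1) * (g (c + d) * max 0 (min \<kappa> c + min \<kappa> d - \<kappa>) / 2 * ?q c d)"
  let ?A = "?E (\<lambda>_. t) t" and ?B = "?E (\<lambda>s. max 0 (s - u)) u"
  let ?C = "\<lambda>c d. of_bool (c + d \<le> 1) * (d * min (max 0 (t - d)) c * ?q c d)"
  let ?D = "\<lambda>c d. of_bool (c + d \<le> 1) * (max 0 (d - u) * c * ?q c d)"
  have q_eq: "c * d * ?q c d = 1 / sqrt d * (1 / sqrt c)" if "0 < c" "0 < d" for c d
  proof -
    have "c * d * ?q c d = (c * levy_density c) * (d * levy_density d)" by simp
    then show ?thesis using that by (simp add: mult_levy)
  qed
  have bound: "\<bar>of_bool (c + d \<le> 1) * (x * ?q c d)\<bar> \<le> K / sqrt d * (1 / sqrt c)"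
    if "0 < c" "0 < d" "c + d \<le> 1 \<Longrightarrow> \<bar>x\<bar> \<le> K * (c * d)" "0 \<le> K" for c d x K
  proof -
    have q0: "0 \<le> ?q c d" using that by (intro mult_nonneg_nonneg levy_density_nonneg) auto
    have "\<bar>x * ?q c d\<bar> = \<bar>x\<bar> * ?q c d" by (simp only: abs_mult[of x] abs_of_nonneg[OF q0])
    then have "\<bar>of_bool (c + d \<le> 1) * (x * ?q c d)\<bar> \<le> K * (c * d) * ?q c d"
      using that q0 by (cases "c + d \<le> 1") (auto intro!: mult_right_mono mult_nonneg_nonneg simp del: abs_mult)
    also have "\<dots> = K / sqrt d * (1 / sqrt c)" using q_eq[OF that(1,2)] by (simp add: mult.assoc)
    finally show ?thesis .
  qed
  have half: "\<bar>a * max 0 (min \<rho> c + min \<rho> d - \<rho>) / 2\<bar> \<le> 1 * (c * d)"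
    if "0 \<le> a" "a \<le> c + d \<or> \<not> \<rho> < c + d" "0 \<le> \<rho>" "0 < c" "0 < d" for a \<rho> c d :: real
  proof (cases "\<rho> < c + d")
    case True
    have m: "max 0 (min \<rho> c + min \<rho> d - \<rho>) \<le> min c d" using that by (auto simp: min_def max_def)
    have "a * max 0 (min \<rho> c + min \<rho> d - \<rho>) \<le> (c + d) * min c d"
      using that True m by (intro mult_mono) auto
    also have "\<dots> \<le> (2 * max c d) * min c d" using that by (intro mult_right_mono) auto
    also have "\<dots> = 2 * (c * d)" by (auto simp: min_def max_def)
    finally have "a * max 0 (min \<rho> c + min \<rho> d - \<rho>) / 2 \<le> c * d" by simp
    moreover have "0 \<le> a * max 0 (min \<rho> c + min \<rho> d - \<rho>)" using that by simp
    ultimately show ?thesis by simp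
  next
    case False
    then have "max 0 (min \<rho> c + min \<rho> d - \<rho>) = 0" using that by (auto simp: min_def max_def)
    then show ?thesis using that by simp
  qed
  have intA: "integrable lborel (\<lambda>c. indicator {0<..1} c * ?A c d)" if d: "0 < d" for d
    by (rule integrable_inner[where K="1 / sqrt d"], measurable)
      (rule bound[OF _ d], assumption, rule half, use t d in auto)
  have intB: "integrable lborel (\<lambda>c. indicator {0<..1} c * ?B c d)" if d: "0 < d" for d
    by (rule integrable_inner[where K="1 / sqrt d"], measurable)
      (rule bound[OF _ d], assumption, rule half, use u d in auto)
  have A: "has_bochner_integral lborel (\<lambda>d. indicator {0<..1} d * (\<integral>c. indicator {0<..1} c * ?A c d \<partial>lborel))
      (4 * t * ((pi / 2 - \<theta>) - w))"
  proof (rule iterated_integral_eqI[OF _ _ intA])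
    have "(\<integral>\<^sup>+d. \<integral>\<^sup>+c. ennreal (indicator {0<..1} d * (indicator {0<..1} c * ?A c d)) \<partial>lborel \<partial>lborel)
      = (\<integral>\<^sup>+s. ennreal (t * (4 * (sqrt t * sqrt (s - t)) / s\<^sup>2)) * indicator {t<..1} s \<partial>lborel)"
      by (rule nn_integral_excursion_pairs) (use t in auto)
    then show "(\<integral>\<^sup>+d. \<integral>\<^sup>+c. ennreal (indicator {0<..1} d * (indicator {0<..1} c * ?A c d)) \<partial>lborel \<partial>lborel)
      = ennreal (4 * t * ((pi / 2 - \<theta>) - w))"
      unfolding nn_integral_excursion_const[OF t, THEN conjunct1] u(4) arc w_def[symmetric] .
    show "0 \<le> 4 * t * ((pi / 2 - \<theta>) - w)"
      using nn_integral_excursion_const[OF t, THEN conjunct2] unfolding u(4) arc w_def[symmetric] .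
  qed (use t in \<open>auto intro!: mult_nonneg_nonneg levy_density_nonneg\<close>)
  have B: "has_bochner_integral lborel (\<lambda>d. indicator {0<..1} d * (\<integral>c. indicator {0<..1} c * ?B c d \<partial>lborel))
      (4 * ((2 + u) * w) - 12 * u * \<theta>)"
  proof (rule iterated_integral_eqI[OF _ _ intB])
    have "(\<integral>\<^sup>+d. \<integral>\<^sup>+c. ennreal (indicator {0<..1} d * (indicator {0<..1} c * ?B c d)) \<partial>lborel \<partial>lborel)
      = (\<integral>\<^sup>+s. ennreal (max 0 (s - u) * (4 * (sqrt u * sqrt (s - u)) / s\<^sup>2)) * indicator {u<..1} s \<partial>lborel)"
      by (rule nn_integral_excursion_pairs) (use u in auto)
    also have "\<dots> = ennreal (4 * sqrt u * ((2 + u) * sqrt t) - 12 * u * \<theta>)"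
      unfolding nn_integral_excursion_linear[OF u(1,2), THEN conjunct1] u(3) arc ..
    also have w4: "4 * sqrt u * ((2 + u) * sqrt t) = 4 * ((2 + u) * w)" by (simp add: w_def)
    finally show "(\<integral>\<^sup>+d. \<integral>\<^sup>+c. ennreal (indicator {0<..1} d * (indicator {0<..1} c * ?B c d)) \<partial>lborel \<partial>lborel)
      = ennreal (4 * ((2 + u) * w) - 12 * u * \<theta>)" .
    show "0 \<le> 4 * ((2 + u) * w) - 12 * u * \<theta>"
      using nn_integral_excursion_linear[OF u(1,2), THEN conjunct2] unfolding u(3) arc w4 .
  qed (use u in \<open>auto intro!: mult_nonneg_nonneg levy_density_nonneg\<close>)
  have innerC: "has_bochner_integral lborel (\<lambda>c. indicator {0<..1} c * ?C c d)
      (indicator {0<..t} d * (4 * (sqrt (t - d) / sqrt d) - 2 * ((t - d) / (sqrt d * sqrt (1 - d)))))" if d: "0 < d" for d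
  proof (cases "d \<le> t")
    case True
    have d1: "0 < 1 - d" using True t by simp
    have "has_bochner_integral lborel (\<lambda>c. 1 / sqrt d * (indicator {0<..1 - d} c * (min (t - d) c * levy_density c)))
       (1 / sqrt d * (4 * sqrt (t - d) - 2 * (t - d) / sqrt (1 - d)))"
      using True t d by (intro has_bochner_integral_mult_right integral_min_levy) auto
    moreover have "1 / sqrt d * (indicator {0<..1 - d} c * (min (t - d) c * levy_density c)) = indicator {0<..1} c * ?C c d" for c
    proof (cases "c \<in> {0<..1 - d}")
      case c: True
      then show ?thesis using True d unfolding mult_levy[OF d, symmetric] by (simp add: max_absorb2 mult_ac)
    next
      case False
      then show ?thesis by (auto simp: indicator_def)
    qed
    moreover have "1 / sqrt d * (4 * sqrt (t - d) - 2 * (t - d) / sqrt (1 - d)) = indicator {0<..t} d * (4 * (sqrt (t - d) / sqrt d) - 2 * ((t - d) / (sqrt d * sqrt (1 - d))))"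
    proof -
      have "1 / s * (4 * a - 2 * b / c) = 4 * (a / s) - 2 * (b / (s * c))" for s a b c :: real
        by (simp add: diff_divide_distrib)
      then show ?thesis using True d by (simp only:) simp
    qed
    ultimately show ?thesis by (simp only:)
  next
    case False
    then have "indicator {0<..1} c * ?C c d = 0" for c by (auto simp: indicator_def)
    then show ?thesis using False by (simp only:) (simp add: has_bochner_integral_zero)
  qed
  have innerD: "has_bochner_integral lborel (\<lambda>c. indicator {0<..1} c * ?D c d)
      (indicator {u<..1} d * ((d - u) * levy_density d * (2 * sqrt (1 - d))))" if d: "0 < d" for d
  proof (cases "u < d \<and> d \<le> 1")
    case True
    have "has_bochner_integral lborel (\<lambda>c. (d - u) * levy_density d * (indicator {0<..1 - d} c * (1 / sqrt c)))
       ((d - u) * levy_density d * (2 * sqrt (1 - d)))"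
      using True by (intro has_bochner_integral_mult_right integral_inv_sqrt) auto
    moreover have "(d - u) * levy_density d * (indicator {0<..1 - d} c * (1 / sqrt c)) = indicator {0<..1} c * ?D c d" for c
    proof (cases "c \<in> {0<..1 - d}")
      case c: True
      then have "1 / sqrt c = c * levy_density c" using mult_levy[of c] by simp
      then show ?thesis using True d c by (simp only:) (simp add: mult_ac)
    next
      case False
      then show ?thesis by (auto simp: indicator_def)
    qed
    ultimately show ?thesis using True by simp
  next
    case False
    then have "indicator {0<..1} c * ?D c d = 0" for c using d by (auto simp: indicator_def)
    then show ?thesis using False by (simp only:) (simp add: has_bochner_integral_zero)
  qed
  have C: "has_bochner_integral lborel (\<lambda>d. indicator {0<..1} d * (\<integral>c. indicator {0<..1} c * ?C c d \<partial>lborel))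
      (4 * (t * pi / 2) - 2 * ((2 * t - 1) * \<theta> + w))"
  proof -
    have "has_bochner_integral lborel (\<lambda>d. 4 * (indicator {0<..t} d * (sqrt (t - d) / sqrt d))
        - 2 * (indicator {0<..t} d * ((t - d) / (sqrt d * sqrt (1 - d))))) (4 * (t * pi / 2) - 2 * ((2 * t - 1) * \<theta> + w))"
      unfolding \<theta>_def w_def u_def
      by (intro has_bochner_integral_diff has_bochner_integral_mult_right integral_sqrt_ratio integral_linear_arcsine t)
    moreover have "4 * (indicator {0<..t} d * (sqrt (t - d) / sqrt d))
        - 2 * (indicator {0<..t} d * ((t - d) / (sqrt d * sqrt (1 - d)))) = indicator {0<..1} d * (\<integral>c. indicator {0<..1} c * ?C c d \<partial>lborel)" for d
    proof (cases "d \<in> {0<..1}")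
      case True
      then have "(\<integral>c. indicator {0<..1} c * ?C c d \<partial>lborel) = indicator {0<..t} d * (4 * (sqrt (t - d) / sqrt d) - 2 * ((t - d) / (sqrt d * sqrt (1 - d))))"
        by (intro has_bochner_integral_integral_eq innerC) auto
      then show ?thesis using True by (cases "d \<le> t") simp_all
    qed (use t in auto)
    ultimately show ?thesis by (simp only:)
  qed
  have D: "has_bochner_integral lborel (\<lambda>d. indicator {0<..1} d * (\<integral>c. indicator {0<..1} c * ?D c d \<partial>lborel))
      (2 * ((1 + 2 * u) * \<theta> - 3 * w))"
  proof -
    have "has_bochner_integral lborel (\<lambda>d. indicator {u<..1} d * ((d - u) * levy_density d * (2 * sqrt (1 - d)))) (2 * ((1 + 2 * u) * \<theta> - 3 * w))"
      using integral_excess_tail[OF u(1,2)] unfolding arc u(3) w' by simp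
    moreover have "indicator {u<..1} d * ((d - u) * levy_density d * (2 * sqrt (1 - d))) = indicator {0<..1} d * (\<integral>c. indicator {0<..1} c * ?D c d \<partial>lborel)" for d
    proof (cases "d \<in> {0<..1}")
      case True
      then have "(\<integral>c. indicator {0<..1} c * ?D c d \<partial>lborel) = indicator {u<..1} d * ((d - u) * levy_density d * (2 * sqrt (1 - d)))"
        by (intro has_bochner_integral_integral_eq innerD) auto
      then show ?thesis using True by simp
    qed (use u in auto)
    ultimately show ?thesis by (simp only:)
  qed
  have split: "indicator {0<..1} d * (\<integral>c. indicator {0<..1} c * pair_integrand t c d \<partial>lborel)
    = indicator {0<..1} d * (\<integral>c. indicator {0<..1} c * ?A c d \<partial>lborel) - indicator {0<..1} d * (\<integral>c. indicator {0<..1} c * ?B c d \<partial>lborel)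
    + indicator {0<..1} d * (\<integral>c. indicator {0<..1} c * ?C c d \<partial>lborel) - indicator {0<..1} d * (\<integral>c. indicator {0<..1} c * ?D c d \<partial>lborel)" for d
  proof (cases "d \<in> {0<..1}")
    case True
    then have d: "0 < d" by simp
    have intC: "integrable lborel (\<lambda>c. indicator {0<..1} c * ?C c d)" and intD: "integrable lborel (\<lambda>c. indicator {0<..1} c * ?D c d)"
      using innerC[OF d] innerD[OF d] by (simp_all only: has_bochner_integral_iff)
    have "(\<integral>c. indicator {0<..1} c * pair_integrand t c d \<partial>lborel)
      = (\<integral>c. indicator {0<..1} c * ?A c d - indicator {0<..1} c * ?B c d + indicator {0<..1} c * ?C c d - indicator {0<..1} c * ?D c d \<partial>lborel)"
    proof (intro Bochner_Integration.integral_cong refl)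
      fix c
      show "indicator {0<..1} c * pair_integrand t c d
        = indicator {0<..1} c * ?A c d - indicator {0<..1} c * ?B c d + indicator {0<..1} c * ?C c d - indicator {0<..1} c * ?D c d"
        unfolding pair_integrand_def pair_weight_def u_def by (cases "c + d \<le> 1") (auto simp: algebra_simps)
    qed
    also have "\<dots> = (\<integral>c. indicator {0<..1} c * ?A c d \<partial>lborel) - (\<integral>c. indicator {0<..1} c * ?B c d \<partial>lborel)
      + (\<integral>c. indicator {0<..1} c * ?C c d \<partial>lborel) - (\<integral>c. indicator {0<..1} c * ?D c d \<partial>lborel)"
      by (simp only: Bochner_Integration.integral_diff Bochner_Integration.integral_add Bochner_Integration.integrable_diff Bochner_Integration.integrable_add intA[OF d] intB[OF d] intC intD)
    finally show ?thesis by (simp only: right_diff_distrib distrib_left)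
  qed auto
  have "has_bochner_integral lborel (\<lambda>d. indicator {0<..1} d * (\<integral>c. indicator {0<..1} c * pair_integrand t c d \<partial>lborel))
    (4 * t * ((pi / 2 - \<theta>) - w) - (4 * ((2 + u) * w) - 12 * u * \<theta>) + (4 * (t * pi / 2) - 2 * ((2 * t - 1) * \<theta> + w)) - 2 * ((1 + 2 * u) * \<theta> - 3 * w))"
    unfolding split by (intro has_bochner_integral_add has_bochner_integral_diff A B C D)
  then have "(\<integral>d. indicator {0<..1} d * (\<integral>c. indicator {0<..1} c * pair_integrand t c d \<partial>lborel) \<partial>lborel)
    = 4 * t * ((pi / 2 - \<theta>) - w) - (4 * ((2 + u) * w) - 12 * u * \<theta>) + (4 * (t * pi / 2) - 2 * ((2 * t - 1) * \<theta> + w)) - 2 * ((1 + 2 * u) * \<theta> - 3 * w)"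
    by (rule has_bochner_integral_integral_eq)
  also have "\<dots> = 4 * pi * t + 8 * (1 - 2 * t) * \<theta> - 8 * w"
    unfolding u_def by (simp add: algebra_simps)
  finally show ?thesis unfolding \<theta>_def w_def u_def .
qed

section \<open>The Vervaat transform of a path as a limit\<close>

definition is_argmin_on :: "(real \<Rightarrow> real) \<Rightarrow> real set \<Rightarrow> real \<Rightarrow> bool" where
  "is_argmin_on f S t \<longleftrightarrow> t \<in> S \<and> (\<forall>s\<in>S. f t \<le> f s)"

lemma first_argmin:
  assumes f: "continuous_on {0..1} f"
  shows "is_argmin_on f {0..1} (first_argmin f)"
    and "is_argmin_on f {0..1} t \<Longrightarrow> first_argmin f \<le> t"
proof -
  obtain x0 where x0: "x0 \<in> {0..1}" "\<And>s. s \<in> {0..1} \<Longrightarrow> f x0 \<le> f s"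
    using continuous_attains_inf[OF compact_Icc _ f] by auto
  define S where "S = {t \<in> {0..1}. f t = f x0}"
  have S_eq: "is_argmin_on f {0..1} t \<longleftrightarrow> t \<in> S" for t
    using x0 by (auto simp: S_def is_argmin_on_def intro: order_antisym)
  have "closed S"
    unfolding S_def by (rule continuous_closed_preimage_constant[OF f]) simp
  then have "compact (S \<inter> {0..1})" by (intro closed_Int_compact) auto
  moreover have "S \<inter> {0..1} = S" by (auto simp: S_def)
  ultimately have "compact S" by simp
  then obtain l where l: "l \<in> S" "\<And>t. t \<in> S \<Longrightarrow> l \<le> t"
    using compact_attains_inf[of S] x0 by (auto simp: S_def)
  have "first_argmin f = l"
    unfolding first_argmin_def
    by (rule Least_equality) (use l S_eq in \<open>auto simp: is_argmin_on_def\<close>)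
  then show "is_argmin_on f {0..1} (first_argmin f)" "is_argmin_on f {0..1} t \<Longrightarrow> first_argmin f \<le> t"
    using l S_eq by auto
qed

lemma floor_grid_tendsto:
  assumes "0 \<le> t"
  shows "(\<lambda>n. real (nat \<lfloor>real n * t\<rfloor>) / n) \<longlonglongrightarrow> t"
proof (rule tendsto_sandwich)
  have fl: "real (nat \<lfloor>real n * t\<rfloor>) = real_of_int \<lfloor>real n * t\<rfloor>" for n
    using assms by simp
  show "\<forall>\<^sub>F n in sequentially. t - 1 / n \<le> real (nat \<lfloor>real n * t\<rfloor>) / n"
    using eventually_gt_at_top[of 0]
  proof eventually_elim
    case (elim n)
    have "real n * t - 1 \<le> real_of_int \<lfloor>real n * t\<rfloor>" by linarith
    then have "(real n * t - 1) / n \<le> real_of_int \<lfloor>real n * t\<rfloor> / n" by (intro divide_right_mono) auto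
    then show ?case using elim unfolding fl by (simp add: diff_divide_distrib)
  qed
  show "\<forall>\<^sub>F n in sequentially. real (nat \<lfloor>real n * t\<rfloor>) / n \<le> t"
    using eventually_gt_at_top[of 0]
  proof eventually_elim
    case (elim n)
    have "real_of_int \<lfloor>real n * t\<rfloor> \<le> real n * t" by linarith
    then show ?case using elim unfolding fl by (simp add: field_simps)
  qed
  have "(\<lambda>n. t - 1 / real n) \<longlonglongrightarrow> t - 0" by (intro tendsto_intros lim_1_over_n)
  then show "(\<lambda>n. t - 1 / real n) \<longlonglongrightarrow> t" by simp
qed auto

lemma floor_grid_le: "t \<le> 1 \<Longrightarrow> nat \<lfloor>real n * t\<rfloor> \<le> n"
  using mult_left_mono[of t 1 "real n"] by (simp add: nat_le_iff floor_le_iff)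

lemma grid_in_unit: "i \<le> n \<Longrightarrow> real i / n \<in> {0..1}"
  by (auto simp: divide_le_eq_1)

lemma continuous_on_tendsto_seq:
  fixes f :: "real \<Rightarrow> real"
  assumes "continuous_on S f" "\<forall>\<^sub>F n in sequentially. x n \<in> S" "x \<longlonglongrightarrow> l" "l \<in> S"
  shows "(\<lambda>n. f (x n)) \<longlonglongrightarrow> f l"
  using continuous_on_tendsto_compose[OF assms(1,3,4,2)] .

lemma grid_min_tendsto:
  assumes ab: "a \<le> b" and f: "continuous_on {a..b} f" and x0: "is_argmin_on f {a..b} x0"
  shows "(\<lambda>n. Min ((\<lambda>i. f (a + (b - a) * (real i / n))) ` {..n})) \<longlonglongrightarrow> f x0"
proof -
  have grid: "a + (b - a) * (real i / n) \<in> {a..b}" if "i \<le> n" for i n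
  proof -
    have "0 \<le> real i / n" "real i / n \<le> 1" using that by (auto simp: divide_le_eq_1)
    then show ?thesis using ab mult_left_mono[of "real i / n" 1 "b - a"] by auto
  qed
  define \<theta> where "\<theta> = (if a = b then 0 else (x0 - a) / (b - a))"
  have x0_in: "a \<le> x0" "x0 \<le> b" using x0 by (auto simp: is_argmin_on_def)
  have \<theta>: "0 \<le> \<theta>" "\<theta> \<le> 1" "a + (b - a) * \<theta> = x0"
    using x0_in ab by (auto simp: \<theta>_def divide_le_eq_1)
  let ?i = "\<lambda>n. nat \<lfloor>real n * \<theta>\<rfloor>"
  show ?thesis
  proof (rule tendsto_sandwich)
    show "\<forall>\<^sub>F n in sequentially. f x0 \<le> Min ((\<lambda>i. f (a + (b - a) * (real i / n))) ` {..n})"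
      using x0 grid by (intro always_eventually allI) (auto simp: is_argmin_on_def)
    show "\<forall>\<^sub>F n in sequentially. Min ((\<lambda>i. f (a + (b - a) * (real i / n))) ` {..n}) \<le> f (a + (b - a) * (real (?i n) / n))"
      using floor_grid_le[OF \<theta>(2)] by (intro always_eventually allI Min_le) auto
    have "(\<lambda>n. a + (b - a) * (real (?i n) / n)) \<longlonglongrightarrow> a + (b - a) * \<theta>"
      by (intro tendsto_intros floor_grid_tendsto \<theta>)
    then show "(\<lambda>n. f (a + (b - a) * (real (?i n) / n))) \<longlonglongrightarrow> f x0"
      unfolding \<theta>(3)
      by (rule continuous_on_tendsto_seq[OF f, rotated]) (use grid floor_grid_le[OF \<theta>(2)] x0 in \<open>auto simp: is_argmin_on_def\<close>)
  qed auto
qed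

text \<open>
  Outside a neighbourhood of the unique minimiser the path is bounded away from its minimum by compactness,
  while the grid contains points near the minimiser with values close to the minimum.
\<close>
lemma grid_argmin_tendsto:
  assumes f: "continuous_on {0..1} f" and \<tau>: "is_argmin_on f {0..1} \<tau>"
    and uniq: "\<And>s. is_argmin_on f {0..1} s \<Longrightarrow> s = \<tau>"
    and i: "\<And>n. i n \<le> n" "\<And>n r. n > 0 \<Longrightarrow> r \<le> n \<Longrightarrow> f (real (i n) / n) \<le> f (real r / n)"
  shows "(\<lambda>n. real (i n) / n) \<longlonglongrightarrow> \<tau>"
proof (rule LIMSEQ_I)
  fix e :: real assume e: "0 < e"
  have tau: "0 \<le> \<tau>" "\<tau> \<le> 1" "\<And>s. 0 \<le> s \<Longrightarrow> s \<le> 1 \<Longrightarrow> f \<tau> \<le> f s" using \<tau> by (auto simp: is_argmin_on_def)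
  define K where "K = {0..1} - ball \<tau> e"
  have K: "compact K" unfolding K_def by (intro compact_diff) auto
  have in_grid: "real (i n) / n \<in> {0..1}" for n using i(1)[of n] by (auto simp: divide_le_eq_1)
  show "\<exists>N. \<forall>n\<ge>N. norm (real (i n) / n - \<tau>) < e"
  proof (cases "K = {}")
    case True
    then have "real (i n) / n \<in> ball \<tau> e" for n using in_grid[of n] unfolding K_def by blast
    then show ?thesis by (auto simp: dist_real_def abs_minus_commute)
  next
    case False
    obtain y where y: "y \<in> K" "\<And>s. s \<in> K \<Longrightarrow> f y \<le> f s"
      using continuous_attains_inf[OF K False] f continuous_on_subset[OF f, of K] unfolding K_def by blast
    have "f \<tau> < f y"
    proof (rule ccontr)
      assume "\<not> f \<tau> < f y"
      then have "is_argmin_on f {0..1} y" using tau y(1) unfolding is_argmin_on_def K_def by force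
      then have "y = \<tau>" by (rule uniq)
      then show False using y(1) e unfolding K_def by simp
    qed
    have "(\<lambda>n. f (real (nat \<lfloor>real n * \<tau>\<rfloor>) / n)) \<longlonglongrightarrow> f \<tau>"
      by (rule continuous_on_tendsto_seq[OF f _ floor_grid_tendsto])
        (use tau grid_in_unit[OF floor_grid_le[OF tau(2)]] in auto)
    with \<open>f \<tau> < f y\<close> have "\<forall>\<^sub>F n in sequentially. f (real (nat \<lfloor>real n * \<tau>\<rfloor>) / n) < f y"
      by (intro order_tendstoD(2))
    then obtain N where N: "\<And>n. n \<ge> N \<Longrightarrow> f (real (nat \<lfloor>real n * \<tau>\<rfloor>) / n) < f y"
      unfolding eventually_sequentially by blast
    have "norm (real (i n) / n - \<tau>) < e" if n: "n \<ge> Suc N" for n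
    proof -
      have "f (real (i n) / n) \<le> f (real (nat \<lfloor>real n * \<tau>\<rfloor>) / n)"
        using n floor_grid_le[OF tau(2)] by (intro i(2)) auto
      also have "\<dots> < f y" using n by (intro N) auto
      finally have "real (i n) / n \<notin> K" using y(2) by force
      then have "real (i n) / n \<in> ball \<tau> e" using in_grid[of n] unfolding K_def by blast
      then show ?thesis by (auto simp: dist_real_def abs_minus_commute)
    qed
    then show ?thesis by blast
  qed
qed

text \<open>
  The path followed by a copy of itself that starts at its end point.  It is continuous because the path
  starts at \<open>0\<close>, in contrast to the two summands in the definition of \<open>vervaat\<close>.
\<close>
definition unrolled :: "(real \<Rightarrow> real) \<Rightarrow> real \<Rightarrow> real" where
  "unrolled f z = (if z \<le> 1 then f z else f (z - 1) + f 1)"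

lemma continuous_on_unrolled:
  assumes f: "continuous_on {0..1} f" and "f 0 = 0"
  shows "continuous_on {0..2} (unrolled f)"
proof (rule continuous_on_subset)
  show "continuous_on ({0..1} \<union> {1..2}) (unrolled f)"
    unfolding unrolled_def
  proof (rule continuous_on_If)
    show "continuous_on {1..2} (\<lambda>z. f (z - 1) + f 1)"
      by (intro continuous_intros continuous_on_compose2[OF f]) auto
  qed (use assms in auto)
qed auto

lemma vervaat_eq_unrolled:
  assumes "f 0 = 0" "0 \<le> first_argmin f" "0 \<le> t" "first_argmin f + t < 2"
  shows "vervaat f t = unrolled f (first_argmin f + t) - f (first_argmin f)"
proof -
  let ?z = "first_argmin f + t"
  consider "?z < 1" | "?z = 1" | "1 < ?z" by linarith
  then show ?thesis
  proof cases
    case 1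
    then have "frac ?z = ?z" using assms by (simp add: frac_eq)
    then show ?thesis using 1 by (simp add: vervaat_def unrolled_def add.commute)
  next
    case 2
    then show ?thesis using assms by (simp add: vervaat_def unrolled_def add.commute)
  next
    case 3
    then have "\<lfloor>?z\<rfloor> = 1" using assms by (simp add: floor_eq_iff)
    then have "frac ?z = ?z - 1" by (simp add: frac_def)
    then show ?thesis using 3 by (simp add: vervaat_def unrolled_def add.commute)
  qed
qed

text \<open>
  The condition \<open>first_argmin f + t < 2\<close> leaves out the one case \<open>t = 1\<close>, \<open>first_argmin f = 1\<close>, in which
  \<open>frac\<close> jumps.
\<close>
lemma walk_vervaat_tendsto:
  fixes t :: real
  defines "k \<equiv> \<lambda>n. nat \<lfloor>real n * t\<rfloor>"
  assumes f: "continuous_on {0..1} f" and f0: "f 0 = 0"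
    and uniq: "\<And>s. is_argmin_on f {0..1} s \<Longrightarrow> s = first_argmin f"
    and t: "0 \<le> t" "t \<le> 1" "first_argmin f + t < 2"
    and S: "\<And>n i. n > 0 \<Longrightarrow> i \<le> n \<Longrightarrow> psum (x n) i = sqrt n * f (real i / n)"
    and uniq_n: "\<And>n. n > 0 \<Longrightarrow> \<exists>i\<le>n. \<forall>i'\<le>n. is_min n (x n) i' \<longleftrightarrow> i' = i"
  shows "(\<lambda>n. walk_vervaat n (k n) (x n) / sqrt n) \<longlonglongrightarrow> vervaat f t"
proof -
  let ?\<tau> = "first_argmin f"
  have "\<exists>i. i \<le> n \<and> (n > 0 \<longrightarrow> (\<forall>i'\<le>n. is_min n (x n) i' \<longleftrightarrow> i' = i))" for n
    using uniq_n[of n] by (cases "n > 0") auto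
  then obtain i where i: "\<And>n. i n \<le> n" "\<And>n. n > 0 \<Longrightarrow> \<forall>i'\<le>n. is_min n (x n) i' \<longleftrightarrow> i' = i n" by metis
  have kn: "k n \<le> n" for n unfolding k_def using t by (intro floor_grid_le)
  have klim: "(\<lambda>n. real (k n) / n) \<longlonglongrightarrow> t" unfolding k_def by (rule floor_grid_tendsto[OF t(1)])
  have \<tau>: "is_argmin_on f {0..1} ?\<tau>" by (rule first_argmin[OF f])
  then have tau: "0 \<le> ?\<tau>" "?\<tau> \<le> 1" by (auto simp: is_argmin_on_def)
  have ilim: "(\<lambda>n. real (i n) / n) \<longlonglongrightarrow> ?\<tau>"
  proof (rule grid_argmin_tendsto[OF f \<tau> uniq i(1)])
    fix n r :: nat assume n: "n > 0" "r \<le> n"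
    have "is_min n (x n) (i n)" using i n by blast
    then have "psum (x n) (i n) \<le> psum (x n) r" using n by (simp add: is_min_def)
    then show "f (real (i n) / n) \<le> f (real r / n)" using n i(1)[of n] by (simp add: S)
  qed
  have w: "walk_vervaat n (k n) (x n) / sqrt n = unrolled f (real (i n) / n + real (k n) / n) - f (real (i n) / n)" if n: "n > 0" for n
  proof -
    have "walk_vervaat n (k n) (x n) = window n (k n) (i n) (x n)"
      unfolding walk_vervaat_def using sum_is_min[OF i(1) i(2)[OF n]] .
    also have "\<dots> = sqrt n * (unrolled f (real (i n) / n + real (k n) / n) - f (real (i n) / n))"
    proof (cases "i n + k n \<le> n")
      case True
      then have "real (i n) + real (k n) \<le> n" by simp
      then have "real (i n) / n + real (k n) / n \<le> 1" using n by (simp add: field_simps)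
      then show ?thesis using True n i(1)[of n]
        by (simp add: window_def unrolled_def S right_diff_distrib add_divide_distrib)
    next
      case False
      then have gt: "real n < real (i n) + real (k n)" by simp
      then have gt1: "1 < real (i n) / n + real (k n) / n" using n by (simp add: field_simps)
      have le: "i n + k n - n \<le> n" using i(1)[of n] kn[of n] by simp
      have eq: "real (i n + k n - n) / n = real (i n) / n + real (k n) / n - 1"
        using False n by (simp add: of_nat_diff field_simps)
      have "psum (x n) (i n + k n - n) = sqrt n * f (real (i n) / n + real (k n) / n - 1)"
        using S[OF n le] unfolding eq .
      then show ?thesis using gt1 False n i(1)[of n]
        by (simp add: window_def unrolled_def S algebra_simps)
    qed
    finally show ?thesis using n by simp
  qed
  have "(\<lambda>n. unrolled f (real (i n) / n + real (k n) / n) - f (real (i n) / n)) \<longlonglongrightarrow> unrolled f (?\<tau> + t) - f ?\<tau>"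
  proof (rule tendsto_diff)
    have bi: "0 \<le> real (i n) / n" "real (i n) / n \<le> 1" "0 \<le> real (k n) / n" "real (k n) / n \<le> 1" for n
      using i(1)[of n] kn[of n] by (auto simp: divide_le_eq_1)
    have "real (i n) / n + real (k n) / n \<in> {0..2}" for n using bi[of n] by (auto intro: add_nonneg_nonneg)
    then show "(\<lambda>n. unrolled f (real (i n) / n + real (k n) / n)) \<longlonglongrightarrow> unrolled f (?\<tau> + t)"
      using tau t by (intro continuous_on_tendsto_seq[OF continuous_on_unrolled[OF f f0]] tendsto_add ilim klim) auto
    show "(\<lambda>n. f (real (i n) / n)) \<longlonglongrightarrow> f ?\<tau>"
      using tau bi by (intro continuous_on_tendsto_seq[OF f] ilim) auto
  qed
  moreover have "\<forall>\<^sub>F n in sequentially. unrolled f (real (i n) / n + real (k n) / n) - f (real (i n) / n) = walk_vervaat n (k n) (x n) / sqrt n"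
    using eventually_gt_at_top[of 0] by eventually_elim (simp only: w)
  ultimately show ?thesis
    unfolding vervaat_eq_unrolled[OF f0 tau(1) t(1,3)] by (rule Lim_transform_eventually)
qed

section \<open>Bounds for the walk\<close>

lemma sum_inv_sqrt_le:
  fixes n :: nat
  shows "(\<Sum>d\<in>{1..n}. 1 / sqrt (real d)) \<le> 2 * sqrt (real n)"
proof (induction n)
  case (Suc n)
  let ?a = "sqrt (Suc n)" and ?b = "sqrt n"
  have a: "0 < ?a" "?b \<le> ?a" "?a * ?a = ?b * ?b + 1" by auto
  have "?a * ?b \<le> (?a * ?a + ?b * ?b) / 2"
    using zero_le_power2[of "?a - ?b"] by (simp only: power2_eq_square left_diff_distrib right_diff_distrib) (simp add: mult.commute)
  then have "1 + 2 * (?a * ?b) \<le> 2 * (?a * ?a)" using a(3) by (simp add: field_simps)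
  then have "1 / ?a \<le> 2 * (?a - ?b)"
  proof -
    have "2 * (a - b) * a = 2 * (a * a) - 2 * (a * b)" for a b :: real by (simp add: algebra_simps)
    then have "1 \<le> 2 * (?a - ?b) * ?a"
      using \<open>1 + 2 * (?a * ?b) \<le> 2 * (?a * ?a)\<close> by (simp only:)
    then show ?thesis using a(1) by (simp only: pos_divide_le_eq)
  qed
  with Suc show ?case by simp
qed simp

lemma sum_exc_le:
  fixes n :: nat
  shows "(\<Sum>d\<in>{1..n}. real d * exc d) \<le> sqrt (real n)"
proof -
  have "(\<Sum>d\<in>{1..n}. d * exc d) = (\<Sum>d\<in>{1..n}. 1 / sqrt d) / sqrt (2 * pi)"
    unfolding sum_divide_distrib by (intro sum.cong refl) (simp add: exc_eq_levy levy_density_def)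
  also have "\<dots> \<le> (2 * sqrt n) / sqrt (2 * pi)"
    by (intro divide_right_mono sum_inv_sqrt_le) simp
  also have "\<dots> \<le> (2 * sqrt n) / 2"
  proof (intro divide_left_mono)
    have "sqrt 4 \<le> sqrt (2 * pi)" using pi_gt3 by (intro real_sqrt_le_mono) simp
    then show "2 \<le> sqrt (2 * pi)" by simp
  qed auto
  finally show ?thesis by simp
qed

lemma exc_nonneg: "0 \<le> exc d"
  unfolding exc_def by (rule iter_nonneg) auto

lemma surv_nonneg: "0 \<le> surv n"
  unfolding surv_def by (rule iter_nonneg) auto

lemma mean1_nonneg: "0 \<le> mean1 k p"
  unfolding mean1_def by (rule iter_nonneg) (auto intro!: mult_nonneg_nonneg iter_nonneg)

lemma depth_square_integral:
  "has_bochner_integral (gauss n) (\<lambda>x. (depth n x)\<^sup>2) (\<Sum>i\<le>n. surv (n - i) * mean2 i i)"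
proof -
  have "has_bochner_integral (gauss n) (\<lambda>x. of_bool (is_min n x i) * ((- psum x i) * (- psum x i))) (surv (n - i) * mean2 i i)"
    if i: "i \<le> n" for i
    using cone_integral[OF i, of 0 i "\<lambda>_. 1" "\<lambda>_. 1" "\<lambda>_. 1" "\<lambda>y. y * y"] nonneg_test_intros
    by (simp add: surv_def mean2_def mult.assoc mult.commute)
  then have h: "has_bochner_integral (gauss n) (\<lambda>x. \<Sum>i\<le>n. of_bool (is_min n x i) * ((- psum x i) * (- psum x i))) (\<Sum>i\<le>n. surv (n - i) * mean2 i i)"
    by (intro has_bochner_integral_sum) auto
  have [measurable]: "depth n \<in> borel_measurable (gauss n)" by (rule measurable_depth) simp
  have "AE x in gauss n. (\<Sum>i\<le>n. of_bool (is_min n x i) * ((- psum x i) * (- psum x i))) = (depth n x)\<^sup>2"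
    using AE_unique_min[of n]
  proof eventually_elim
    case (elim x)
    then obtain i where i: "i \<le> n" "\<forall>i'\<le>n. is_min n x i' \<longleftrightarrow> i' = i" by blast
    then have "is_min n x i" by blast
    then have "depth n x = - psum x i" using i(1) by (intro depth_eqI) (auto simp: is_min_def)
    then show ?case using sum_is_min[OF i, of "\<lambda>i. (- psum x i) * (- psum x i)"] by (simp only: power2_eq_square)
  qed
  with h show ?thesis
    by (subst has_bochner_integral_cong_AE[symmetric]) (auto dest: borel_measurable_has_bochner_integral)
qed

text \<open>
  \<open>mean2_eq\<close> with \<open>k = p\<close> and summation over the position of the minimum: the first part is at most the
  variance \<open>n\<close>; the second consists of expected depths of shorter walks, each at most \<open>sqrt n\<close>, with weights
  \<open>d * exc d\<close> of total mass at most \<open>sqrt n\<close>.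
\<close>
lemma sum_depth_square_le: "(\<Sum>i\<le>n. surv (n - i) * mean2 i i) \<le> 2 * n"
proof -
  define mu where "mu N = (\<Sum>i\<le>N. surv i * mean1 (N - i) (N - i))" for N
  have mu: "mu N = (\<Sum>c\<in>{1..N}. c * exc c)" for N
  proof -
    have "mu N = (\<Sum>c\<in>{1..N}. min N c * exc c)"
      using sum_surv_mean1[of N N] by (simp add: mu_def min_absorb2)
    then show ?thesis by (simp add: min_absorb2)
  qed
  have mu0: "0 \<le> mu N" for N unfolding mu_def by (intro sum_nonneg mult_nonneg_nonneg surv_nonneg mean1_nonneg)
  have "mean2 i i = i * surv i + (\<Sum>d\<in>{1..i}. d * exc d * mean1 (i - d) (i - d))" for i
    unfolding mean2_eq[OF order_refl] by simp
  then have "(\<Sum>i\<le>n. surv (n - i) * mean2 i i) = (\<Sum>i\<le>n. i * (surv i * surv (n - i)))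
    + (\<Sum>i\<le>n. surv (n - i) * (\<Sum>d\<in>{1..i}. d * exc d * mean1 (i - d) (i - d)))"
    by (simp add: distrib_left sum.distrib mult_ac)
  also have "(\<Sum>i\<le>n. i * (surv i * surv (n - i))) \<le> (\<Sum>i\<le>n. n * (surv i * surv (n - i)))"
    by (intro sum_mono mult_right_mono mult_nonneg_nonneg surv_nonneg) auto
  also have "\<dots> = n" unfolding sum_distrib_left[symmetric] sum_surv by simp
  also have "(\<Sum>i\<le>n. surv (n - i) * (\<Sum>d\<in>{1..i}. d * exc d * mean1 (i - d) (i - d)))
    = (\<Sum>i\<le>n. surv i * (\<Sum>d\<in>{1..n - i}. d * exc d * mean1 (n - i - d) (n - i - d)))"
    by (subst sum_reverse) (intro sum.cong, auto)
  also have "\<dots> = (\<Sum>d\<in>{1..n}. \<Sum>i\<le>n - d. surv i * (d * exc d * mean1 (n - i - d) (n - i - d)))"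
    unfolding sum_distrib_left by (rule sum_triangle)
  also have "\<dots> = (\<Sum>d\<in>{1..n}. d * exc d * mu (n - d))"
    unfolding mu_def sum_distrib_left by (intro sum.cong refl) (simp add: diff_commute mult_ac add.commute)
  also have "\<dots> \<le> (\<Sum>d\<in>{1..n}. d * exc d * sqrt n)"
  proof (intro sum_mono mult_left_mono)
    fix d
    have "mu (n - d) \<le> sqrt (real (n - d))" unfolding mu by (rule sum_exc_le)
    also have "\<dots> \<le> sqrt n" by simp
    finally show "mu (n - d) \<le> sqrt n" .
  qed (auto intro!: mult_nonneg_nonneg exc_nonneg)
  also have "\<dots> = (\<Sum>d\<in>{1..n}. d * exc d) * sqrt n" by (rule sum_distrib_right[symmetric])
  also have "\<dots> \<le> sqrt n * sqrt n" by (intro mult_right_mono sum_exc_le) auto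
  finally show ?thesis by simp
qed

lemma half_step_mono:
  assumes "exp_growth f" "exp_growth g" "\<And>y. y \<ge> 0 \<Longrightarrow> f y \<le> g y"
  shows "half_step f x \<le> half_step g x"
  unfolding half_step_def
  by (intro integral_mono integrable_half_step assms(1,2))
    (auto simp: indicator_def intro!: mult_left_mono assms(3))

lemma iter_mono:
  assumes "exp_growth f" "exp_growth g" "\<And>y. y \<ge> 0 \<Longrightarrow> f y \<le> g y" "x \<ge> 0"
  shows "(half_step ^^ k) f x \<le> (half_step ^^ k) g x"
  using assms(4)
proof (induction k arbitrary: x)
  case (Suc k)
  then show ?case by (auto intro!: half_step_mono exp_growth_iter assms(1,2))
qed (use assms(3) in simp)

lemma surv_Suc_le: "surv (Suc n) \<le> surv n"
proof -
  have "half_step (\<lambda>_. 1) y \<le> 1" for y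
  proof -
    have "half_step (\<lambda>_. 1) y \<le> (\<integral>z. normal_density y 1 z \<partial>lborel)"
      unfolding half_step_def
    proof (rule integral_mono)
      show "integrable lborel (\<lambda>z. indicator {0..} z * (std_normal_density (z - y) * 1))"
        by (rule integrable_half_step) simp
      show "integrable lborel (normal_density y 1)" by simp
    qed (auto simp: indicator_def normal_density_def)
    then show ?thesis by simp
  qed
  then have "(half_step ^^ n) (half_step (\<lambda>_. 1)) 0 \<le> (half_step ^^ n) (\<lambda>_. 1) 0"
    by (intro iter_mono) auto
  then show ?thesis unfolding surv_def by (simp only: funpow_Suc_right o_apply)
qed

text \<open>
  The numbers \<open>surv i\<close> decrease, so each of the \<open>Suc n\<close> terms in \<open>sum_surv\<close> is at least \<open>surv n\<close> squared.
\<close>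
lemma surv_le: "surv n \<le> 1 / sqrt (Suc n)"
proof -
  have anti: "surv n \<le> surv i" if "i \<le> n" for i
    using lift_Suc_antimono_le[of surv, OF surv_Suc_le that] .
  have "real (Suc n) * (surv n * surv n) = (\<Sum>i\<le>n. surv n * surv n)" by simp
  also have "\<dots> \<le> (\<Sum>i\<le>n. surv i * surv (n - i))"
    by (intro sum_mono mult_mono anti surv_nonneg) auto
  also have "\<dots> = 1" by (rule sum_surv)
  finally have "surv n * surv n \<le> 1 / Suc n" by (simp add: field_simps)
  then have "sqrt (surv n * surv n) \<le> sqrt (1 / Suc n)" by (rule real_sqrt_le_mono)
  then show ?thesis using surv_nonneg[of n] by (simp add: real_sqrt_divide)
qed

lemma window_square_le:
  assumes W: "\<And>j. j \<le> n \<Longrightarrow> (psum x j)\<^sup>2 \<le> W" and i: "i \<le> n" and k: "k \<le> n"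
  shows "(window n k i x)\<^sup>2 \<le> 9 * W"
proof -
  have abs: "\<bar>psum x j\<bar> \<le> sqrt W" if "j \<le> n" for j
    using W[OF that] by (intro real_le_rsqrt) simp
  have W0: "0 \<le> W" using W[of 0] by simp
  have "\<bar>window n k i x\<bar> \<le> 3 * sqrt W"
  proof (cases "i + k \<le> n")
    case True
    then show ?thesis using abs[of "i + k"] abs[OF i] W0 by (simp add: window_def)
  next
    case False
    have "\<bar>psum x (i + k - n)\<bar> \<le> sqrt W" using i k by (intro abs) linarith
    then show ?thesis using False abs[OF i] abs[of n] unfolding window_def by simp
  qed
  then have "\<bar>window n k i x\<bar>\<^sup>2 \<le> (3 * sqrt W)\<^sup>2" by (intro power_mono) auto
  then show ?thesis using W0 by (simp add: power_mult_distrib)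
qed

definition max_abs :: "nat \<Rightarrow> (nat \<Rightarrow> real) \<Rightarrow> real" where
  "max_abs n x = Max ((\<lambda>i. \<bar>psum x i\<bar>) ` {..n})"

lemma measurable_max_abs[measurable]: "max_abs n \<in> borel_measurable (gauss n)"
  unfolding max_abs_def[abs_def]
  by (intro borel_measurable_Max borel_measurable_abs measurable_psum) auto

text \<open>
  The maximum of \<open>\<bar>S\<bar>\<close> is the depth of the walk or of the walk with all signs reversed, which has the same
  law.
\<close>
lemma nn_integral_max_abs_le: "(\<integral>\<^sup>+x. ennreal ((max_abs n x)\<^sup>2) \<partial>gauss n) \<le> ennreal (4 * n)"
proof -
  let ?T = "\<lambda>x. \<lambda>l\<in>{..<n}. - 1 * x l"
  have T: "distr (gauss n) (gauss n) ?T = gauss n" "?T \<in> measurable (gauss n) (gauss n)"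
    using distr_gauss_permute[of "\<lambda>l. l" n "-1"] by (auto simp: bij_betw_def)
  let ?v = "\<Sum>i\<le>n. surv (n - i) * mean2 i i"
  have [measurable]: "depth n \<in> borel_measurable (gauss n)" by (rule measurable_depth) simp
  have d2: "has_bochner_integral (gauss n) (\<lambda>x. (depth n x)\<^sup>2 + (depth n (?T x))\<^sup>2) (?v + ?v)"
    by (intro has_bochner_integral_add depth_square_integral
      has_bochner_integral_measure_preserving[OF T, where f="\<lambda>x. (depth n x)\<^sup>2"])
  have ps: "psum (?T x) i = - psum x i" if "i \<le> n" for x i
    unfolding psum_def sum_negf[symmetric] using that by (intro sum.cong) auto
  have "(max_abs n x)\<^sup>2 \<le> (depth n x)\<^sup>2 + (depth n (?T x))\<^sup>2" for x
  proof -
    have "max_abs n x \<in> (\<lambda>i. \<bar>psum x i\<bar>) ` {..n}" unfolding max_abs_def by (intro Max_in) auto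
    then obtain i where i: "i \<le> n" "max_abs n x = \<bar>psum x i\<bar>" by auto
    have "- psum x i \<le> depth n x" "psum x i \<le> depth n (?T x)"
      using depth_ge[OF i(1), of x] depth_ge[OF i(1), of "?T x"] ps[OF i(1)] by auto
    then have "\<bar>psum x i\<bar> \<le> depth n x \<or> \<bar>psum x i\<bar> \<le> depth n (?T x)" by linarith
    then show ?thesis unfolding i(2)
    proof
      assume "\<bar>psum x i\<bar> \<le> depth n x"
      then have "\<bar>psum x i\<bar>\<^sup>2 \<le> (depth n x)\<^sup>2" by (intro power_mono) auto
      then show "\<bar>psum x i\<bar>\<^sup>2 \<le> (depth n x)\<^sup>2 + (depth n (?T x))\<^sup>2" using zero_le_power2[of "depth n (?T x)"] by linarith
    next
      assume "\<bar>psum x i\<bar> \<le> depth n (?T x)"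
      then have "\<bar>psum x i\<bar>\<^sup>2 \<le> (depth n (?T x))\<^sup>2" by (intro power_mono) auto
      then show "\<bar>psum x i\<bar>\<^sup>2 \<le> (depth n x)\<^sup>2 + (depth n (?T x))\<^sup>2" using zero_le_power2[of "depth n x"] by linarith
    qed
  qed
  then have "(\<integral>\<^sup>+x. ennreal ((max_abs n x)\<^sup>2) \<partial>gauss n) \<le> (\<integral>\<^sup>+x. ennreal ((depth n x)\<^sup>2 + (depth n (?T x))\<^sup>2) \<partial>gauss n)"
    by (intro nn_integral_mono ennreal_leI)
  also have "\<dots> = ennreal (?v + ?v)"
    using d2 by (subst nn_integral_eq_integral) (auto simp: has_bochner_integral_iff)
  also have "\<dots> \<le> ennreal (4 * n)" using sum_depth_square_le[of n] by (intro ennreal_leI) linarith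
  finally show ?thesis .
qed

section \<open>Sampling a Brownian path\<close>

text \<open>
  A Gaussian variable has a bounded density, hence comes within \<open>e\<close> of an independent variable with
  probability \<open>O(e)\<close>, uniformly in that variable.
\<close>
lemma (in prob_space) AE_not_tendsto_independent_normal:
  fixes G :: "'a \<Rightarrow> real" and h :: "nat \<Rightarrow> 'a \<Rightarrow> real"
  assumes G: "distributed M lborel G (normal_density 0 \<sigma>)" and \<sigma>: "0 < \<sigma>"
    and ind: "\<And>N. indep_var borel (h N) borel G"
  shows "AE \<omega> in M. \<not> (\<lambda>N. h N \<omega> - G \<omega>) \<longlonglongrightarrow> 0"
proof -
  define C where "C = 1 / sqrt (2 * pi * \<sigma>\<^sup>2)"
  have C: "normal_density 0 \<sigma> x \<le> C" for x
    using \<sigma> by (auto simp: normal_density_def C_def intro!: divide_right_mono)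
  have [measurable]: "G \<in> borel_measurable M" using G by (auto simp: distributed_def)
  have [measurable]: "h N \<in> borel_measurable M" for N using indep_var_rv1[OF ind] .
  have C0: "0 \<le> C" using C[of 0] normal_density_nonneg[of 0 \<sigma> 0] by linarith
  have slice: "emeasure (distr M borel G) {g. \<bar>y - g\<bar> < e} \<le> ennreal (C * (2 * e))" if "0 < e" for e y
  proof -
    have eq: "distr M borel G = density lborel (\<lambda>x. ennreal (normal_density 0 \<sigma> x))"
      using G unfolding distributed_def by (simp cong: distr_cong)
    have set: "{g. \<bar>y - g\<bar> < e} = {y - e<..<y + e}" by auto
    have "emeasure (distr M borel G) {g. \<bar>y - g\<bar> < e} = (\<integral>\<^sup>+x. ennreal (normal_density 0 \<sigma> x) * indicator {y - e<..<y + e} x \<partial>lborel)"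
      unfolding eq set by (subst emeasure_density) auto
    also have "\<dots> \<le> (\<integral>\<^sup>+x. ennreal C * indicator {y - e<..<y + e} x \<partial>lborel)"
      by (intro nn_integral_mono mult_right_mono ennreal_leI C) auto
    also have "\<dots> = ennreal C * ennreal (2 * e)"
      using that by (subst nn_integral_cmult_indicator) auto
    finally show ?thesis using C0 that by (simp add: ennreal_mult)
  qed
  have near: "emeasure M {\<omega> \<in> space M. \<bar>h N \<omega> - G \<omega>\<bar> < e} \<le> ennreal (C * (2 * e))" if e: "0 < e" for N e
  proof -
    interpret DG: prob_space "distr M borel G" by (rule prob_space_distr) simp
    interpret DH: prob_space "distr M borel (h N)" by (rule prob_space_distr) simp
    let ?A = "{z. \<bar>fst z - snd z\<bar> < e} :: (real \<times> real) set"
    have A[measurable]: "?A \<in> sets (borel \<Otimes>\<^sub>M borel)"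
      unfolding borel_prod by (intro borel_open open_Collect_less continuous_intros)
    have "emeasure M {\<omega> \<in> space M. \<bar>h N \<omega> - G \<omega>\<bar> < e} = emeasure (distr M (borel \<Otimes>\<^sub>M borel) (\<lambda>\<omega>. (h N \<omega>, G \<omega>))) ?A"
      by (subst emeasure_distr) (auto intro!: arg_cong[where f="emeasure M"])
    also have "distr M (borel \<Otimes>\<^sub>M borel) (\<lambda>\<omega>. (h N \<omega>, G \<omega>)) = distr M borel (h N) \<Otimes>\<^sub>M distr M borel G"
      using ind[of N] unfolding indep_var_distribution_eq by simp
    also have "emeasure \<dots> ?A = (\<integral>\<^sup>+y. emeasure (distr M borel G) (Pair y -` ?A) \<partial>distr M borel (h N))"
      using A by (intro DG.emeasure_pair_measure_alt) (simp only: sets_pair_measure_cong[OF sets_distr sets_distr])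
    also have "\<dots> \<le> (\<integral>\<^sup>+y. ennreal (C * (2 * e)) \<partial>distr M borel (h N))"
      using slice[OF e] by (intro nn_integral_mono) (simp add: vimage_def)
    also have "\<dots> = ennreal (C * (2 * e))" using DH.emeasure_space_1 by simp
    finally show ?thesis .
  qed
  define Z where "Z e = (\<Union>N0. {\<omega> \<in> space M. \<forall>N\<ge>N0. \<bar>h N \<omega> - G \<omega>\<bar> < e})" for e
  have Zm[measurable]: "Z e \<in> sets M" for e unfolding Z_def by measurable
  have Z: "emeasure M (Z e) \<le> ennreal (C * (2 * e))" if e: "0 < e" for e
  proof -
    have "emeasure M (Z e) = (SUP N0. emeasure M {\<omega> \<in> space M. \<forall>N\<ge>N0. \<bar>h N \<omega> - G \<omega>\<bar> < e})"
      unfolding Z_def by (rule SUP_emeasure_incseq[symmetric]) (auto simp: incseq_def)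
    also have "\<dots> \<le> ennreal (C * (2 * e))"
    proof (rule SUP_least)
      fix N0
      have "emeasure M {\<omega> \<in> space M. \<forall>N\<ge>N0. \<bar>h N \<omega> - G \<omega>\<bar> < e} \<le> emeasure M {\<omega> \<in> space M. \<bar>h N0 \<omega> - G \<omega>\<bar> < e}"
        by (rule emeasure_mono) auto
      also have "\<dots> \<le> ennreal (C * (2 * e))" by (rule near[OF e])
      finally show "emeasure M {\<omega> \<in> space M. \<forall>N\<ge>N0. \<bar>h N \<omega> - G \<omega>\<bar> < e} \<le> ennreal (C * (2 * e))" .
    qed
    finally show ?thesis .
  qed
  define Z0 where "Z0 = (\<Inter>k. Z (1 / real (Suc k)))"
  have Z0m: "Z0 \<in> sets M" unfolding Z0_def by measurable
  have "emeasure M Z0 \<le> ennreal (C * (2 * (1 / real (Suc k))))" for k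
  proof -
    have "emeasure M Z0 \<le> emeasure M (Z (1 / real (Suc k)))" unfolding Z0_def by (intro emeasure_mono) auto
    also have "\<dots> \<le> ennreal (C * (2 * (1 / real (Suc k))))" by (rule Z) simp
    finally show ?thesis .
  qed
  moreover have "(\<lambda>k. ennreal (C * (2 * (1 / real (Suc k))))) \<longlonglongrightarrow> ennreal (C * (2 * 0))"
    by (intro tendsto_ennrealI tendsto_intros LIMSEQ_Suc[OF lim_1_over_n])
  ultimately have "emeasure M Z0 \<le> ennreal (C * (2 * 0))"
    by (intro LIMSEQ_le_const) auto
  then have "Z0 \<in> null_sets M" using Z0m by auto
  then show ?thesis
  proof (rule AE_I')
    show "{\<omega> \<in> space M. \<not> \<not> (\<lambda>N. h N \<omega> - G \<omega>) \<longlonglongrightarrow> 0} \<subseteq> Z0"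
    proof (rule subsetI)
      fix \<omega> assume "\<omega> \<in> {\<omega> \<in> space M. \<not> \<not> (\<lambda>N. h N \<omega> - G \<omega>) \<longlonglongrightarrow> 0}"
      then have w: "\<omega> \<in> space M" "(\<lambda>N. h N \<omega> - G \<omega>) \<longlonglongrightarrow> 0" by auto
      show "\<omega> \<in> Z0" unfolding Z0_def
      proof
        fix k
        have "0 < 1 / real (Suc k)" by simp
        from LIMSEQ_D[OF w(2) this] w(1) show "\<omega> \<in> Z (1 / real (Suc k))"
          unfolding Z_def by auto
      qed
    qed
  qed
qed

context standard_brownian_motion begin

definition scaled_increments :: "nat \<Rightarrow> 'a \<Rightarrow> nat \<Rightarrow> real" where
  "scaled_increments n \<omega> = (\<lambda>l\<in>{..<n}. sqrt n * (B (real (Suc l) / n) \<omega> - B (real l / n) \<omega>))"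

lemma psum_scaled_increments:
  assumes "i \<le> n" "\<omega> \<in> space M"
  shows "psum (scaled_increments n \<omega>) i = sqrt n * B (real i / n) \<omega>"
proof -
  have "psum (scaled_increments n \<omega>) i = (\<Sum>l<i. sqrt n * B (real (Suc l) / n) \<omega> - sqrt n * B (real l / n) \<omega>)"
    unfolding psum_def scaled_increments_def
    using assms(1) by (intro sum.cong) (auto simp: right_diff_distrib)
  also have "\<dots> = sqrt n * B (real i / n) \<omega> - sqrt n * B (real 0 / n) \<omega>"
    by (rule sum_lessThan_telescope)
  finally show ?thesis using start_at_0[OF assms(2)] by simp
qed

lemma distr_scaled_increments:
  assumes n: "0 < n"
  shows "scaled_increments n \<in> measurable M (gauss n)"
    and "distr M (gauss n) (scaled_increments n) = gauss n"
proof -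
  let ?X = "\<lambda>l \<omega>. sqrt n * (B (real (Suc l) / n) \<omega> - B (real l / n) \<omega>)"
  have "indep_vars (\<lambda>_. borel) (\<lambda>i \<omega>. B (real (Suc i) / n) \<omega> - B (real i / n) \<omega>) {..<n}"
    by (rule independent_increments) (auto simp: divide_le_eq_1 intro!: mono_onI divide_right_mono)
  then have ind: "indep_vars (\<lambda>_. std_normal) ?X {..<n}"
    by (rule indep_vars_compose2) simp
  then have rv: "?X l \<in> measurable M std_normal" if "l < n" for l
    using that by (auto simp: indep_vars_def)
  have law: "distr M std_normal (?X l) = std_normal" if l: "l < n" for l
  proof -
    have "distributed M lborel (\<lambda>\<omega>. B (real (Suc l) / n) \<omega> - B (real l / n) \<omega>)
      (normal_density 0 (sqrt (real (Suc l) / n - real l / n)))"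
      using l n by (intro normal_increments) (auto simp: divide_strict_right_mono divide_le_eq_1)
    moreover have "real (Suc l) / n - real l / n = 1 / n" by (simp add: diff_divide_distrib[symmetric])
    ultimately have "distributed M lborel (\<lambda>\<omega>. B (real (Suc l) / n) \<omega> - B (real l / n) \<omega>) (normal_density 0 (1 / sqrt n))"
      by (simp only: real_sqrt_divide real_sqrt_one)
    then have "distributed M lborel (\<lambda>\<omega>. 0 + sqrt n * (B (real (Suc l) / n) \<omega> - B (real l / n) \<omega>))
      (normal_density (0 + sqrt n * 0) (\<bar>sqrt n\<bar> * (1 / sqrt n)))"
      using n by (intro normal_density_affine) auto
    then have "distributed M lborel (?X l) std_normal_density" using n by simp
    then have "distr M lborel (?X l) = std_normal" unfolding std_normal_def distributed_def by blast
    then show ?thesis by (simp cong: distr_cong)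
  qed
  show m: "scaled_increments n \<in> measurable M (gauss n)"
    unfolding scaled_increments_def[abs_def] gauss_def using rv by (intro measurable_restrict) auto
  have "distr M (PiM {..<n} (\<lambda>_. std_normal)) (\<lambda>\<omega>. \<lambda>l\<in>{..<n}. ?X l \<omega>) = PiM {..<n} (\<lambda>l. distr M std_normal (?X l))"
    using indep_vars_iff_distr_eq_PiM'[where I="{..<n}" and M'="\<lambda>_. std_normal" and X="?X"] rv ind n by auto
  also have "\<dots> = PiM {..<n} (\<lambda>_. std_normal)" by (rule PiM_cong[OF refl]) (rule law, simp)
  finally show "distr M (gauss n) (scaled_increments n) = gauss n"
    unfolding gauss_def scaled_increments_def[abs_def] .
qed

lemma AE_scaled_increments:
  assumes "0 < n" "AE x in gauss n. P x"
  shows "AE \<omega> in M. P (scaled_increments n \<omega>)"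
  using assms(2) distr_scaled_increments[OF assms(1)]
  by (metis AE_distrD)

lemma has_bochner_integral_scaled_increments:
  fixes f :: "(nat \<Rightarrow> real) \<Rightarrow> real"
  assumes "0 < n" "has_bochner_integral (gauss n) f v"
  shows "has_bochner_integral M (\<lambda>\<omega>. f (scaled_increments n \<omega>)) v"
proof -
  have f: "f \<in> borel_measurable (gauss n)" using assms(2) by (rule borel_measurable_has_bochner_integral)
  have "has_bochner_integral (distr M (gauss n) (scaled_increments n)) f v"
    using assms distr_scaled_increments by simp
  then show ?thesis
    using integrable_distr_eq[OF distr_scaled_increments(1)[OF assms(1)] f]
      integral_distr[OF distr_scaled_increments(1)[OF assms(1)] f]
    by (simp add: has_bochner_integral_iff)
qed

text \<open>
  On the grid, the difference of the two minima is the difference between a function of the increments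
  outside \<open>[q, r]\<close> and the increment over \<open>[q, r]\<close>, which are independent.  If the two minima were equal,
  this difference would tend to \<open>0\<close> as the grids are refined.
\<close>
lemma AE_separated_minima:
  assumes q: "0 < q" and qr: "q < r" and r: "r < 1"
  shows "AE \<omega> in M. \<forall>s s'. is_argmin_on (\<lambda>t. B t \<omega>) {0..q} s \<longrightarrow> is_argmin_on (\<lambda>t. B t \<omega>) {r..1} s' \<longrightarrow> B s \<omega> \<noteq> B s' \<omega>"
proof -
  let ?G = "\<lambda>\<omega>. B r \<omega> - B q \<omega>"
  (* n + 1 grid points of [0, q], then n + 1 grid points of [r, 1]; step n goes from q to r *)
  define u where "u n i = (if i \<le> n then 0 + (q - 0) * (real i / n) else r + (1 - r) * (real (i - Suc n) / n))" for n i :: nat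
  define minl where "minl n \<omega> = Min ((\<lambda>i. B (0 + (q - 0) * (real i / n)) \<omega>) ` {..n})" for n :: nat and \<omega>
  define minr where "minr n \<omega> = Min ((\<lambda>i. B (r + (1 - r) * (real i / n)) \<omega>) ` {..n})" for n :: nat and \<omega>
  have frac: "0 \<le> real i / n" "real i / n \<le> 1" if "i \<le> n" for i n :: nat using that by (auto simp: divide_le_eq_1)
  have left: "0 \<le> (q - 0) * (real i / n)" "(q - 0) * (real i / n) \<le> q" if "i \<le> n" for i n :: nat
    using frac[OF that] q mult_left_mono[of "real i / n" 1 q] by auto
  have right: "0 \<le> (1 - r) * (real i / n)" "(1 - r) * (real i / n) \<le> 1 - r" if "i \<le> n" for i n :: nat
    using frac[OF that] r mult_left_mono[of "real i / n" 1 "1 - r"] by auto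
  have "indep_var borel (\<lambda>\<omega>. (minl n \<omega> - B q \<omega>) - (minr n \<omega> - B r \<omega>)) borel ?G" if n: "0 < n" for n
  proof -
    let ?X = "\<lambda>l \<omega>. B (u n (Suc l)) \<omega> - B (u n l) \<omega>"
    let ?K = "Suc (2 * n)"
    let ?A = "{..<?K} - {n}"
    have un: "u n n = q" "u n (Suc n) = r" using n by (auto simp: u_def)
    have X: "indep_vars (\<lambda>_. borel) ?X {..<?K}"
    proof (rule independent_increments)
      show "u n ` {..?K} \<subseteq> {0..1}"
      proof safe
        fix i assume "i \<le> ?K"
        then have "i \<le> n \<or> i - Suc n \<le> n" by auto
        then show "u n i \<in> {0..1}"
          using left[of i n] right[of "i - Suc n" n] q qr r unfolding u_def by auto
      qed
      show "mono_on {..?K} (u n)"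
      proof (rule mono_onI)
        fix i j assume "i \<in> {..?K}" "j \<in> {..?K}" and ij: "i \<le> j"
        then have jk: "j - Suc n \<le> n" by auto
        consider "j \<le> n" | "i \<le> n" "n < j" | "n < i" using ij by linarith
        then show "u n i \<le> u n j"
        proof cases
          case 1 with ij q show ?thesis unfolding u_def by (auto intro!: mult_left_mono divide_right_mono)
        next
          case 2 with left[of i n] right[OF jk] qr show ?thesis unfolding u_def by auto
        next
          case 3 with ij r show ?thesis unfolding u_def by (auto intro!: mult_left_mono divide_right_mono)
        qed
      qed
    qed
    have tele: "(\<Sum>l\<in>{a..<b}. ?X l \<omega>) = B (u n b) \<omega> - B (u n a) \<omega>" if "a \<le> b" for a b \<omega>
      using sum_Suc_diff'[OF that, of "\<lambda>l. B (u n l) \<omega>"] .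
    define Y where "Y x = Min ((\<lambda>i. - (\<Sum>l\<in>{i..<n}. x l)) ` {..n}) - Min ((\<lambda>i. \<Sum>l\<in>{Suc n..<Suc n + i}. x l) ` {..n})" for x :: "nat \<Rightarrow> real"
    have Y: "Y \<in> borel_measurable (PiM ?A (\<lambda>_. borel))"
      unfolding Y_def[abs_def]
      by (intro borel_measurable_diff borel_measurable_Min borel_measurable_uminus borel_measurable_sum measurable_component_singleton) auto
    have "indep_var (PiM ?A (\<lambda>_. borel)) (\<lambda>\<omega>. restrict (\<lambda>l. ?X l \<omega>) ?A) (PiM {n} (\<lambda>_. borel)) (\<lambda>\<omega>. restrict (\<lambda>l. ?X l \<omega>) {n})"
      by (rule indep_var_restrict[OF X]) auto
    then have "indep_var borel (Y \<circ> (\<lambda>\<omega>. restrict (\<lambda>l. ?X l \<omega>) ?A)) borel ((\<lambda>x. x n) \<circ> (\<lambda>\<omega>. restrict (\<lambda>l. ?X l \<omega>) {n}))"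
      by (rule indep_var_compose[OF _ Y]) (auto intro!: measurable_component_singleton)
    moreover have "(\<lambda>x. x n) \<circ> (\<lambda>\<omega>. restrict (\<lambda>l. ?X l \<omega>) {n}) = ?G"
      by (auto simp: un)
    moreover have "Y \<circ> (\<lambda>\<omega>. restrict (\<lambda>l. ?X l \<omega>) ?A) = (\<lambda>\<omega>. (minl n \<omega> - B q \<omega>) - (minr n \<omega> - B r \<omega>))"
    proof
      fix \<omega>
      have shift: "Min ((\<lambda>i. f i - c) ` {..n}) = Min (f ` {..n}) - c" for f :: "nat \<Rightarrow> real" and c
        using Min_add_commute[of "{..n}" f "- c"] by simp
      have "- (\<Sum>l\<in>{i..<n}. restrict (\<lambda>l. ?X l \<omega>) ?A l) = B (0 + (q - 0) * (real i / n)) \<omega> - B q \<omega>" if i: "i \<le> n" for i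
      proof -
        have "(\<Sum>l\<in>{i..<n}. restrict (\<lambda>l. ?X l \<omega>) ?A l) = (\<Sum>l\<in>{i..<n}. ?X l \<omega>)"
          by (rule sum.cong[OF refl]) auto
        also have "\<dots> = B q \<omega> - B (u n i) \<omega>" unfolding tele[OF i] un ..
        finally show ?thesis using i by (simp add: u_def)
      qed
      then have l: "(\<lambda>i. - (\<Sum>l\<in>{i..<n}. restrict (\<lambda>l. ?X l \<omega>) ?A l)) ` {..n} = (\<lambda>i. B (0 + (q - 0) * (real i / n)) \<omega> - B q \<omega>) ` {..n}"
        by (intro image_cong) auto
      have "(\<Sum>l\<in>{Suc n..<Suc n + i}. restrict (\<lambda>l. ?X l \<omega>) ?A l) = B (r + (1 - r) * (real i / n)) \<omega> - B r \<omega>" if i: "i \<le> n" for i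
      proof -
        have "(\<Sum>l\<in>{Suc n..<Suc n + i}. restrict (\<lambda>l. ?X l \<omega>) ?A l) = (\<Sum>l\<in>{Suc n..<Suc n + i}. ?X l \<omega>)"
          using i by (intro sum.cong[OF refl]) auto
        also have "\<dots> = B (u n (Suc n + i)) \<omega> - B r \<omega>" using tele[of "Suc n" "Suc n + i" \<omega>] by (simp only: le_add1 un)
        finally show ?thesis by (simp add: u_def)
      qed
      then have r: "(\<lambda>i. \<Sum>l\<in>{Suc n..<Suc n + i}. restrict (\<lambda>l. ?X l \<omega>) ?A l) ` {..n} = (\<lambda>i. B (r + (1 - r) * (real i / n)) \<omega> - B r \<omega>) ` {..n}"
        by (intro image_cong) auto
      show "(Y \<circ> (\<lambda>\<omega>. restrict (\<lambda>l. ?X l \<omega>) ?A)) \<omega> = (minl n \<omega> - B q \<omega>) - (minr n \<omega> - B r \<omega>)"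
        unfolding o_apply Y_def l r shift minl_def minr_def ..
    qed
    ultimately show ?thesis by (simp only:)
  qed
  then have ind: "indep_var borel (\<lambda>\<omega>. (minl (Suc n) \<omega> - B q \<omega>) - (minr (Suc n) \<omega> - B r \<omega>)) borel ?G" for n by simp
  have "distributed M lborel ?G (normal_density 0 (sqrt (r - q)))"
    using q qr r by (intro normal_increments) auto
  moreover have "0 < sqrt (r - q)" using qr by simp
  ultimately have "AE \<omega> in M. \<not> (\<lambda>n. (minl (Suc n) \<omega> - B q \<omega>) - (minr (Suc n) \<omega> - B r \<omega>) - ?G \<omega>) \<longlonglongrightarrow> 0"
    by (rule AE_not_tendsto_independent_normal[OF _ _ ind])
  then show ?thesis
  proof (rule AE_mp, intro AE_I2 impI allI notI)
    fix \<omega> s s'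
    assume w: "\<omega> \<in> space M" and nl: "\<not> (\<lambda>n. (minl (Suc n) \<omega> - B q \<omega>) - (minr (Suc n) \<omega> - B r \<omega>) - ?G \<omega>) \<longlonglongrightarrow> 0"
      and s: "is_argmin_on (\<lambda>t. B t \<omega>) {0..q} s" and s': "is_argmin_on (\<lambda>t. B t \<omega>) {r..1} s'" and eq: "B s \<omega> = B s' \<omega>"
    have c: "continuous_on {0..q} (\<lambda>t. B t \<omega>)" "continuous_on {r..1} (\<lambda>t. B t \<omega>)"
      using continuous_on_subset[OF continuous_paths[OF w]] q qr r by auto
    have "(\<lambda>n. minl n \<omega> - minr n \<omega>) \<longlonglongrightarrow> B s \<omega> - B s' \<omega>"
      unfolding minl_def minr_def
      using q r by (intro tendsto_diff grid_min_tendsto[OF _ c(1) s] grid_min_tendsto[OF _ c(2) s']) auto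
    then have "(\<lambda>n. minl (Suc n) \<omega> - minr (Suc n) \<omega>) \<longlonglongrightarrow> 0"
      unfolding eq by (intro LIMSEQ_Suc) simp
    moreover have "(minl (Suc n) \<omega> - B q \<omega>) - (minr (Suc n) \<omega> - B r \<omega>) - ?G \<omega> = minl (Suc n) \<omega> - minr (Suc n) \<omega>" for n by simp
    ultimately show False using nl by simp
  qed
qed

text \<open>
  Two minimisers are separated by two rational numbers, and there are countably many pairs of these.
\<close>
lemma AE_unique_argmin:
  "AE \<omega> in M. \<forall>s. is_argmin_on (\<lambda>t. B t \<omega>) {0..1} s \<longrightarrow> s = first_argmin (\<lambda>t. B t \<omega>)"
proof -
  let ?P = "\<lambda>\<omega> q r. \<forall>s s'. is_argmin_on (\<lambda>t. B t \<omega>) {0..q} s \<longrightarrow> is_argmin_on (\<lambda>t. B t \<omega>) {r..1} s' \<longrightarrow> B s \<omega> \<noteq> B s' \<omega>"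
  have "AE \<omega> in M. \<forall>q r :: rat. 0 < real_of_rat q \<longrightarrow> real_of_rat q < real_of_rat r \<longrightarrow> real_of_rat r < 1 \<longrightarrow> ?P \<omega> (real_of_rat q) (real_of_rat r)"
    unfolding AE_all_countable using AE_separated_minima by auto
  then show ?thesis
  proof (rule AE_mp, intro AE_I2 impI allI)
    fix \<omega> s
    let ?f = "\<lambda>t. B t \<omega>"
    assume w: "\<omega> \<in> space M" and sep: "\<forall>q r :: rat. 0 < real_of_rat q \<longrightarrow> real_of_rat q < real_of_rat r \<longrightarrow> real_of_rat r < 1 \<longrightarrow> ?P \<omega> (real_of_rat q) (real_of_rat r)"
      and s: "is_argmin_on ?f {0..1} s"
    note \<tau> = first_argmin(1)[OF continuous_paths[OF w]]
    have le: "first_argmin ?f \<le> s" using s by (rule first_argmin(2)[OF continuous_paths[OF w]])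
    show "s = first_argmin ?f"
    proof (rule ccontr)
      assume "s \<noteq> first_argmin ?f"
      with le have lt: "first_argmin ?f < s" by simp
      obtain q where q: "first_argmin ?f < real_of_rat q" "real_of_rat q < s" using of_rat_dense[OF lt] by auto
      obtain r where r: "real_of_rat q < real_of_rat r" "real_of_rat r < s" using of_rat_dense[OF q(2)] by auto
      have "is_argmin_on ?f {0..real_of_rat q} (first_argmin ?f)" "is_argmin_on ?f {real_of_rat r..1} s"
        using \<tau> s q r by (auto simp: is_argmin_on_def)
      moreover have "?f (first_argmin ?f) = ?f s" using \<tau> s by (auto simp: is_argmin_on_def intro: order_antisym)
      moreover have "0 \<le> first_argmin ?f" "s \<le> 1" using \<tau> s by (auto simp: is_argmin_on_def)
      then have "(0::real) < real_of_rat q" "real_of_rat r < (1::real)" using q r by linarith+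
      ultimately show False using sep r(1) by blast
    qed
  qed
qed

abbreviation argmin :: "'a \<Rightarrow> real" where
  "argmin \<omega> \<equiv> first_argmin (\<lambda>t. B t \<omega>)"

section \<open>Measurability and domination\<close>

text \<open>
  Rounding the random time down to a grid gives a finite sum over deterministic times; continuity of the
  paths does the rest.
\<close>
lemma measurable_at_random_time:
  assumes S[measurable]: "S \<in> borel_measurable M" and S01: "\<And>\<omega>. \<omega> \<in> space M \<Longrightarrow> S \<omega> \<in> {0..1}"
  shows "(\<lambda>\<omega>. B (S \<omega>) \<omega>) \<in> borel_measurable M"
proof (rule borel_measurable_LIMSEQ_real)
  let ?i = "\<lambda>n \<omega>. nat \<lfloor>real n * S \<omega>\<rfloor>"
  fix n
  have "(\<lambda>\<omega>. \<Sum>i\<le>n. of_bool (real_of_int \<lfloor>real n * S \<omega>\<rfloor> = real i) * B (real i / n) \<omega>) \<in> borel_measurable M"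
  proof (intro borel_measurable_sum borel_measurable_times random_variable_B)
    fix i
    show "(\<lambda>\<omega>. of_bool (real_of_int \<lfloor>real n * S \<omega>\<rfloor> = real i) :: real) \<in> borel_measurable M" by measurable
  qed (auto simp: divide_le_eq_1)
  moreover have "(\<Sum>i\<le>n. of_bool (real_of_int \<lfloor>real n * S \<omega>\<rfloor> = real i) * B (real i / n) \<omega>) = B (real (?i n \<omega>) / n) \<omega>"
    if w: "\<omega> \<in> space M" for \<omega>
  proof -
    have "?i n \<omega> \<le> n" using S01[OF w] by (intro floor_grid_le) auto
    have "real_of_int \<lfloor>real n * S \<omega>\<rfloor> = real (?i n \<omega>)" using S01[OF w] by simp
    then have "(\<Sum>i\<le>n. of_bool (real_of_int \<lfloor>real n * S \<omega>\<rfloor> = real i) * B (real i / n) \<omega>)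
      = (\<Sum>i\<le>n. if i = ?i n \<omega> then B (real i / n) \<omega> else 0)"
      by (intro sum.cong[OF refl]) auto
    then show ?thesis using \<open>?i n \<omega> \<le> n\<close> by simp
  qed
  ultimately show "(\<lambda>\<omega>. B (real (?i n \<omega>) / n) \<omega>) \<in> borel_measurable M"
    by (simp cong: measurable_cong)
next
  fix \<omega> assume w: "\<omega> \<in> space M"
  note S01[OF w]
  then show "(\<lambda>n. B (real (nat \<lfloor>real n * S \<omega>\<rfloor>) / n) \<omega>) \<longlonglongrightarrow> B (S \<omega>) \<omega>"
    using grid_in_unit[OF floor_grid_le[of "S \<omega>"]]
    by (intro continuous_on_tendsto_seq[OF continuous_paths[OF w]] floor_grid_tendsto) auto
qed

lemma some_argmin_on:
  assumes w: "\<omega> \<in> space M" and b: "0 \<le> b" "b \<le> 1"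
  shows "is_argmin_on (\<lambda>t. B t \<omega>) {0..b} (SOME s. is_argmin_on (\<lambda>t. B t \<omega>) {0..b} s)"
proof -
  have "continuous_on {0..b} (\<lambda>t. B t \<omega>)"
    using b by (intro continuous_on_subset[OF continuous_paths[OF w]]) auto
  from continuous_attains_inf[OF compact_Icc _ this] b
  obtain s where "s \<in> {0..b}" "\<forall>s'\<in>{0..b}. B s \<omega> \<le> B s' \<omega>" by auto
  then have "is_argmin_on (\<lambda>t. B t \<omega>) {0..b} s" by (simp add: is_argmin_on_def)
  then show ?thesis by (rule someI)
qed

lemma measurable_path_minimum:
  assumes b: "0 \<le> b" "b \<le> 1"
  shows "(\<lambda>\<omega>. B (SOME s. is_argmin_on (\<lambda>t. B t \<omega>) {0..b} s) \<omega>) \<in> borel_measurable M"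
proof (rule borel_measurable_LIMSEQ_real)
  fix n :: nat
  show "(\<lambda>\<omega>. Min ((\<lambda>i. B (0 + (b - 0) * (real i / n)) \<omega>) ` {..n})) \<in> borel_measurable M"
  proof (intro borel_measurable_Min random_variable_B)
    fix i assume "i \<in> {..n}"
    then have h: "0 \<le> real i / n" "real i / n \<le> 1" by (auto simp: divide_le_eq_1)
    have "0 \<le> b * (real i / n)" using b(1) h(1) by (rule mult_nonneg_nonneg)
    moreover have "b * (real i / n) \<le> 1 * 1" by (rule mult_mono[OF b(2) h(2) _ h(1)]) simp
    ultimately show "0 + (b - 0) * (real i / n) \<in> {0..1}" by simp
  qed auto
next
  fix \<omega> assume w: "\<omega> \<in> space M"
  have c: "continuous_on {0..b} (\<lambda>t. B t \<omega>)"
    using b by (intro continuous_on_subset[OF continuous_paths[OF w]]) auto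
  show "(\<lambda>n. Min ((\<lambda>i. B (0 + (b - 0) * (real i / n)) \<omega>) ` {..n})) \<longlonglongrightarrow> B (SOME s. is_argmin_on (\<lambda>t. B t \<omega>) {0..b} s) \<omega>"
    using b by (intro grid_min_tendsto[OF _ c] some_argmin_on w) auto
qed

lemma argmin_bounds:
  assumes w: "\<omega> \<in> space M"
  shows "0 \<le> argmin \<omega>" "argmin \<omega> \<le> 1" "\<And>s. 0 \<le> s \<Longrightarrow> s \<le> 1 \<Longrightarrow> B (argmin \<omega>) \<omega> \<le> B s \<omega>"
  using first_argmin(1)[OF continuous_paths[OF w]] by (auto simp: is_argmin_on_def)

text \<open>
  The first minimiser is at most \<open>y\<close> if and only if the minimum over \<open>[0, y]\<close> is not larger than the minimum
  over \<open>[0, 1]\<close>.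
\<close>
lemma measurable_argmin: "argmin \<in> borel_measurable M"
proof (rule borel_measurableI_le)
  fix y :: real
  let ?m = "\<lambda>b \<omega>. B (SOME s. is_argmin_on (\<lambda>t. B t \<omega>) {0..b} s) \<omega>"
  consider "y < 0" | "1 \<le> y" | "0 \<le> y" "y < 1" by linarith
  then show "{\<omega> \<in> space M. argmin \<omega> \<le> y} \<in> sets M"
  proof cases
    case 1
    then have "{\<omega> \<in> space M. argmin \<omega> \<le> y} = {}" using argmin_bounds(1) by force
    then show ?thesis by (simp only: sets.empty_sets)
  next
    case 2
    then have "{\<omega> \<in> space M. argmin \<omega> \<le> y} = space M" using argmin_bounds(2) by force
    then show ?thesis by (simp only: sets.top)
  next
    case 3
    have "argmin \<omega> \<le> y \<longleftrightarrow> ?m y \<omega> \<le> ?m 1 \<omega>" if w: "\<omega> \<in> space M" for \<omega>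
    proof -
      let ?f = "\<lambda>t. B t \<omega>"
      define sy where "sy = (SOME s. is_argmin_on ?f {0..y} s)"
      define s1 where "s1 = (SOME s. is_argmin_on ?f {0..1} s)"
      have sy: "is_argmin_on ?f {0..y} sy" unfolding sy_def using 3 by (intro some_argmin_on w) auto
      have s1: "is_argmin_on ?f {0..1} s1" unfolding s1_def by (intro some_argmin_on w) auto
      have "argmin \<omega> \<le> y \<longleftrightarrow> B sy \<omega> \<le> B s1 \<omega>"
      proof
        assume "argmin \<omega> \<le> y"
        then have "B sy \<omega> \<le> B (argmin \<omega>) \<omega>" using sy argmin_bounds(1)[OF w] by (simp add: is_argmin_on_def)
        also have "\<dots> \<le> B s1 \<omega>" using s1 by (intro argmin_bounds(3)[OF w]) (simp_all add: is_argmin_on_def)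
        finally show "B sy \<omega> \<le> B s1 \<omega>" .
      next
        assume le: "B sy \<omega> \<le> B s1 \<omega>"
        have sy0: "0 \<le> sy" "sy \<le> y" using sy by (simp_all add: is_argmin_on_def)
        have "B sy \<omega> \<le> B s \<omega>" if "s \<in> {0..1}" for s
        proof -
          have "B s1 \<omega> \<le> B s \<omega>" using s1 that by (simp add: is_argmin_on_def)
          with le show ?thesis by simp
        qed
        moreover have "sy \<in> {0..1}" using sy0 3 by simp
        ultimately have "is_argmin_on ?f {0..1} sy" unfolding is_argmin_on_def by blast
        then have "argmin \<omega> \<le> sy" by (rule first_argmin(2)[OF continuous_paths[OF w]])
        also have "sy \<le> y" by (rule sy0)
        finally show "argmin \<omega> \<le> y" .
      qed
      then show ?thesis unfolding sy_def s1_def .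
    qed
    then have "{\<omega> \<in> space M. argmin \<omega> \<le> y} = {\<omega> \<in> space M. ?m y \<omega> \<le> ?m 1 \<omega>}" by auto
    also have "\<dots> \<in> sets M" using 3 by (intro borel_measurable_le measurable_path_minimum) auto
    finally show ?thesis .
  qed
qed

lemma measurable_vervaat: "(\<lambda>\<omega>. vervaat (\<lambda>s. B s \<omega>) t) \<in> borel_measurable M"
proof -
  note measurable_argmin[measurable]
  have [measurable]: "(\<lambda>\<omega>. B (frac (argmin \<omega> + t)) \<omega>) \<in> borel_measurable M"
  proof (rule measurable_at_random_time)
    show "(\<lambda>\<omega>. frac (argmin \<omega> + t)) \<in> borel_measurable M" unfolding frac_def by measurable
  qed (auto intro: less_imp_le[OF frac_lt_1])
  have [measurable]: "(\<lambda>\<omega>. B (argmin \<omega>) \<omega>) \<in> borel_measurable M"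
    by (rule measurable_at_random_time) (auto intro: argmin_bounds measurable_argmin)
  have [measurable]: "B 1 \<in> borel_measurable M" by (rule random_variable_B) simp
  show ?thesis unfolding vervaat_def by measurable
qed

text \<open>
  The maximum of the squares of the path over the grid of mesh \<open>1 / n\<close>.
\<close>
definition grid_square :: "nat \<Rightarrow> 'a \<Rightarrow> real" where
  "grid_square n \<omega> = (max_abs n (scaled_increments n \<omega>))\<^sup>2 / n"

lemma grid_square:
  assumes n: "0 < n" and w: "\<omega> \<in> space M"
  shows "i \<le> n \<Longrightarrow> (B (real i / n) \<omega>)\<^sup>2 \<le> grid_square n \<omega>"
    and "\<exists>i\<le>n. grid_square n \<omega> = (B (real i / n) \<omega>)\<^sup>2"
proof -
  let ?x = "scaled_increments n \<omega>"
  have sq: "\<bar>psum ?x i\<bar>\<^sup>2 / n = (B (real i / n) \<omega>)\<^sup>2" if "i \<le> n" for i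
    using n by (simp add: psum_scaled_increments[OF that w] power_mult_distrib)
  show "(B (real i / n) \<omega>)\<^sup>2 \<le> grid_square n \<omega>" if i: "i \<le> n"
  proof -
    have "\<bar>psum ?x i\<bar> \<le> max_abs n ?x" unfolding max_abs_def using i by (intro Max_ge) auto
    then have "\<bar>psum ?x i\<bar>\<^sup>2 / n \<le> (max_abs n ?x)\<^sup>2 / n"
      by (intro divide_right_mono power_mono) auto
    then show ?thesis unfolding sq[OF i] grid_square_def .
  qed
  have "max_abs n ?x \<in> (\<lambda>i. \<bar>psum ?x i\<bar>) ` {..n}" unfolding max_abs_def by (intro Max_in) auto
  then obtain i where i: "i \<le> n" "max_abs n ?x = \<bar>psum ?x i\<bar>" by auto
  then show "\<exists>i\<le>n. grid_square n \<omega> = (B (real i / n) \<omega>)\<^sup>2"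
    unfolding grid_square_def using sq[OF i(1)] by auto
qed

lemma measurable_grid_square:
  assumes "0 < n" shows "grid_square n \<in> borel_measurable M"
proof -
  have "(\<lambda>\<omega>. max_abs n (scaled_increments n \<omega>)) \<in> borel_measurable M"
    by (rule measurable_compose[OF distr_scaled_increments(1)[OF assms] measurable_max_abs])
  then show ?thesis unfolding grid_square_def[abs_def] by measurable
qed

lemma nn_integral_grid_square:
  assumes n: "0 < n" shows "(\<integral>\<^sup>+\<omega>. ennreal (grid_square n \<omega>) \<partial>M) \<le> 4"
proof -
  have "(\<integral>\<^sup>+\<omega>. ennreal (grid_square n \<omega>) \<partial>M) = (\<integral>\<^sup>+\<omega>. ennreal ((max_abs n (scaled_increments n \<omega>))\<^sup>2 / n) \<partial>M)"
    unfolding grid_square_def ..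
  also have "\<dots> = (\<integral>\<^sup>+x. ennreal ((max_abs n x)\<^sup>2 / n) \<partial>distr M (gauss n) (scaled_increments n))"
    by (subst nn_integral_distr[OF distr_scaled_increments(1)[OF n]]) simp_all
  also have "\<dots> = (\<integral>\<^sup>+x. ennreal (1 / n) * ennreal ((max_abs n x)\<^sup>2) \<partial>gauss n)"
    unfolding distr_scaled_increments(2)[OF n]
    by (rule nn_integral_cong) (simp add: ennreal_mult[symmetric])
  also have "\<dots> = ennreal (1 / n) * (\<integral>\<^sup>+x. ennreal ((max_abs n x)\<^sup>2) \<partial>gauss n)"
    by (rule nn_integral_cmult) simp
  also have "\<dots> \<le> ennreal (1 / n) * ennreal (4 * n)"
    by (rule mult_left_mono[OF nn_integral_max_abs_le]) simp
  also have "\<dots> = 4" using n by (simp add: ennreal_mult[symmetric])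
  finally show ?thesis .
qed

text \<open>
  Dyadic grids are nested, so the maxima over them increase and monotone convergence turns the uniform
  bound for the walk into one for their supremum.  By continuity this dominates the whole path.
\<close>
lemma dominating_square:
  obtains w where "integrable M w"
    and "AE \<omega> in M. \<forall>s\<in>{0..1}. (B s \<omega>)\<^sup>2 \<le> w \<omega>"
proof
  define S where "S \<omega> = (SUP m. ennreal (grid_square (2 ^ m) \<omega>))" for \<omega>
  let ?w = "\<lambda>\<omega>. enn2real (S \<omega>)"
  note measurable_grid_square[measurable]
  have meas: "(\<lambda>\<omega>. ennreal (grid_square (2 ^ m) \<omega>)) \<in> borel_measurable M" for m by measurable
  then have [measurable]: "S \<in> borel_measurable M" unfolding S_def[abs_def] by measurable
  have "(\<integral>\<^sup>+\<omega>. S \<omega> \<partial>M) = (SUP m. \<integral>\<^sup>+\<omega>. ennreal (grid_square (2 ^ m) \<omega>) \<partial>M)"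
    unfolding S_def
  proof (rule nn_integral_monotone_convergence_SUP_AE[OF _ meas])
    fix m
    show "AE \<omega> in M. ennreal (grid_square (2 ^ m) \<omega>) \<le> ennreal (grid_square (2 ^ Suc m) \<omega>)"
    proof (intro AE_I2 ennreal_leI)
      fix \<omega> assume w: "\<omega> \<in> space M"
      obtain i where i: "i \<le> 2 ^ m" "grid_square (2 ^ m) \<omega> = (B (real i / real (2 ^ m)) \<omega>)\<^sup>2"
        using grid_square(2)[OF _ w, of "2 ^ m"] by auto
      have "real (2 * i) / real (2 ^ Suc m) = real i / real (2 ^ m)" by simp
      then show "grid_square (2 ^ m) \<omega> \<le> grid_square (2 ^ Suc m) \<omega>"
        using grid_square(1)[OF _ w, of "2 ^ Suc m" "2 * i"] i by simp
    qed
  qed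
  also have "\<dots> \<le> 4" by (intro SUP_least nn_integral_grid_square) simp
  finally have fin: "(\<integral>\<^sup>+\<omega>. S \<omega> \<partial>M) \<le> 4" .
  then have "(\<integral>\<^sup>+\<omega>. S \<omega> \<partial>M) \<noteq> \<infinity>" by (auto simp: top_unique)
  then have AEfin: "AE \<omega> in M. S \<omega> \<noteq> \<infinity>" by (intro nn_integral_PInf_AE) auto
  show "integrable M ?w"
  proof (rule integrableI_nonneg)
    have "(\<integral>\<^sup>+\<omega>. ennreal (?w \<omega>) \<partial>M) \<le> (\<integral>\<^sup>+\<omega>. S \<omega> \<partial>M)"
      by (intro nn_integral_mono) (simp add: ennreal_enn2real_if)
    also have "\<dots> \<le> 4" by (rule fin)
    also have "\<dots> < \<infinity>" by simp
    finally show "(\<integral>\<^sup>+\<omega>. ennreal (?w \<omega>) \<partial>M) < \<infinity>" .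
  qed auto
  show "AE \<omega> in M. \<forall>s\<in>{0..1}. (B s \<omega>)\<^sup>2 \<le> ?w \<omega>"
    using AEfin AE_space
  proof eventually_elim
    case (elim \<omega>)
    show ?case
    proof
      fix s :: real assume s: "s \<in> {0..1}"
      have le: "grid_square (2 ^ m) \<omega> \<le> ?w \<omega>" for m
      proof -
        have "ennreal (grid_square (2 ^ m) \<omega>) \<le> S \<omega>" unfolding S_def by (rule SUP_upper) simp
        also have "\<dots> = ennreal (?w \<omega>)" using elim by (simp add: ennreal_enn2real_if)
        finally show ?thesis by (simp add: ennreal_le_iff)
      qed
      let ?a = "\<lambda>n. real (nat \<lfloor>real n * s\<rfloor>) / n"
      have "(\<lambda>n. (B (?a n) \<omega>)\<^sup>2) \<longlonglongrightarrow> (B s \<omega>)\<^sup>2"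
        using s grid_in_unit[OF floor_grid_le[of s]] elim
        by (intro tendsto_power continuous_on_tendsto_seq[OF continuous_paths] floor_grid_tendsto) auto
      then have "((\<lambda>n. (B (?a n) \<omega>)\<^sup>2) \<circ> (\<lambda>m. 2 ^ m)) \<longlonglongrightarrow> (B s \<omega>)\<^sup>2"
        by (rule LIMSEQ_subseq_LIMSEQ) (simp add: strict_mono_def)
      moreover have "((\<lambda>n. (B (?a n) \<omega>)\<^sup>2) \<circ> (\<lambda>m. 2 ^ m)) m \<le> ?w \<omega>" for m
      proof -
        have "(B (?a (2 ^ m)) \<omega>)\<^sup>2 \<le> grid_square (2 ^ m) \<omega>"
          using s elim by (intro grid_square(1) floor_grid_le) auto
        also have "\<dots> \<le> ?w \<omega>" by (rule le)
        finally show ?thesis by simp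
      qed
      ultimately show "(B s \<omega>)\<^sup>2 \<le> ?w \<omega>" by (intro LIMSEQ_le_const2) auto
    qed
  qed
qed

text \<open>
  If the path has its first minimum at \<open>1\<close>, every walk sampled from it has a minimum at its last time, an
  event of probability at most \<open>surv n\<close>.
\<close>
lemma AE_argmin_less_1: "AE \<omega> in M. argmin \<omega> < 1"
proof -
  let ?E = "{\<omega> \<in> space M. argmin \<omega> = 1}"
  have E: "?E \<in> sets M" using measurable_argmin by measurable
  have bound: "prob ?E \<le> 1 / sqrt (real (Suc n))" if n: "0 < n" for n
  proof -
    have h: "has_bochner_integral M (\<lambda>\<omega>. of_bool (is_min n (scaled_increments n \<omega>) n)) (surv n * surv (n - n))"
      by (rule has_bochner_integral_scaled_increments[OF n surv_cone]) simp
    have "?E \<inter> space M = ?E" by auto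
    then have "prob ?E = (\<integral>\<omega>. indicator ?E \<omega> \<partial>M)" by (simp only: Bochner_Integration.integral_indicator)
    also have "\<dots> \<le> (\<integral>\<omega>. of_bool (is_min n (scaled_increments n \<omega>) n) \<partial>M)"
    proof (rule integral_mono)
      fix \<omega> assume w: "\<omega> \<in> space M"
      have "is_min n (scaled_increments n \<omega>) n" if "argmin \<omega> = 1"
        unfolding is_min_def
      proof (intro allI impI)
        fix r assume r: "r \<le> n"
        have "B 1 \<omega> \<le> B (real r / n) \<omega>" using argmin_bounds(3)[OF w, of "real r / n"] that r grid_in_unit[OF r] by simp
        then show "psum (scaled_increments n \<omega>) n \<le> psum (scaled_increments n \<omega>) r"
          using n r by (simp add: psum_scaled_increments[OF _ w])
      qed
      then show "indicator ?E \<omega> \<le> (of_bool (is_min n (scaled_increments n \<omega>) n) :: real)"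
        by (auto simp: indicator_def)
    qed (use h E in \<open>auto simp: has_bochner_integral_iff emeasure_eq_measure\<close>)
    also have "\<dots> = surv n * surv 0" using has_bochner_integral_integral_eq[OF h] by simp
    also have "\<dots> \<le> surv n * 1" using surv_le[of 0] by (intro mult_left_mono surv_nonneg) simp
    also have "\<dots> \<le> 1 / sqrt (real (Suc n))" using surv_le[of n] by simp
    finally show ?thesis .
  qed
  have "(\<lambda>n. 1 / sqrt (real (Suc n))) \<longlonglongrightarrow> 0"
    by real_asymp
  then have "prob ?E \<le> 0"
    by (rule LIMSEQ_le_const) (use bound in \<open>auto intro!: exI[of _ 1]\<close>)
  then have "AE \<omega> in M. \<omega> \<notin> ?E" using E by (intro AE_not_in) (auto simp: null_sets_def emeasure_eq_measure measure_le_0_iff)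
  then show ?thesis using AE_space
    by eventually_elim (use argmin_bounds(2) in force)
qed

section \<open>The moments of the Vervaat transform\<close>

text \<open>
  Dominated convergence along the sampled walks.  A window is a combination of three values of the walk, so
  nine times the majorant of \<open>dominating_square\<close> bounds its square after rescaling.
\<close>
lemma vervaat_moments_interior:
  fixes t :: real
  assumes t: "0 < t" "t < 1"
  defines "V \<equiv> \<lambda>\<omega>. vervaat (\<lambda>s. B s \<omega>) t"
  shows "integrable M V" and "expectation V = sqrt (8 / pi) * (sqrt t + sqrt (1 - t) - 1)"
    and "integrable M (\<lambda>\<omega>. (V \<omega>)\<^sup>2)"
    and "expectation (\<lambda>\<omega>. (V \<omega>)\<^sup>2) = 3 * t + (4 - 8 * t) / pi * arcsin (sqrt t) - 4 / pi * sqrt (t * (1 - t))"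
proof -
  define k where "k n = nat \<lfloor>real n * t\<rfloor>" for n
  define v where "v n \<omega> = walk_vervaat n (k n) (scaled_increments n \<omega>) / sqrt n" for n \<omega>
  have k: "k n \<le> n" for n unfolding k_def using t by (intro floor_grid_le) simp
  have klim: "(\<lambda>n. real (k n) / n) \<longlonglongrightarrow> t" unfolding k_def using t by (intro floor_grid_tendsto) simp
  have v1: "has_bochner_integral M (v n) ((\<Sum>i\<le>n. window_mean n (k n) i) / sqrt n)" if "0 < n" for n
    unfolding v_def
    by (intro has_bochner_integral_divide has_bochner_integral_scaled_increments[OF that] walk_vervaat_integral k)
  have v2: "has_bochner_integral M (\<lambda>\<omega>. (v n \<omega>)\<^sup>2) ((\<Sum>i\<le>n. window_mean2 n (k n) i) / n)" if n: "0 < n" for n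
  proof -
    have "has_bochner_integral M (\<lambda>\<omega>. (walk_vervaat n (k n) (scaled_increments n \<omega>))\<^sup>2 / n) ((\<Sum>i\<le>n. window_mean2 n (k n) i) / n)"
      by (intro has_bochner_integral_divide has_bochner_integral_scaled_increments[OF n walk_vervaat_integral2] k)
    then show ?thesis by (simp add: v_def power_divide)
  qed
  obtain w where w: "integrable M w" "AE \<omega> in M. \<forall>s\<in>{0..1}. (B s \<omega>)\<^sup>2 \<le> w \<omega>" by (rule dominating_square)
  have uniq: "AE \<omega> in M. \<forall>n. \<exists>i\<le>Suc n. \<forall>i'\<le>Suc n. is_min (Suc n) (scaled_increments (Suc n) \<omega>) i' \<longleftrightarrow> i' = i"
    unfolding AE_all_countable by (intro allI AE_scaled_increments AE_unique_min) simp
  have lim: "AE \<omega> in M. (\<lambda>n. v (Suc n) \<omega>) \<longlonglongrightarrow> V \<omega>"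
    using AE_unique_argmin uniq AE_space
  proof eventually_elim
    case (elim \<omega>)
    have "(\<lambda>n. walk_vervaat n (k n) (scaled_increments n \<omega>) / sqrt n) \<longlonglongrightarrow> vervaat (\<lambda>s. B s \<omega>) t"
      unfolding k_def
    proof (rule walk_vervaat_tendsto)
      show "argmin \<omega> + t < 2" using argmin_bounds(2)[OF elim(3)] t by simp
      show "\<exists>i\<le>n. \<forall>i'\<le>n. is_min n (scaled_increments n \<omega>) i' \<longleftrightarrow> i' = i" if "0 < n" for n
        using elim(2)[rule_format, of "n - 1"] that by simp
    qed (use elim t in \<open>auto intro!: continuous_paths start_at_0 psum_scaled_increments\<close>)
    then show ?case unfolding v_def V_def by (rule LIMSEQ_Suc)
  qed
  have bound: "AE \<omega> in M. (v (Suc n) \<omega>)\<^sup>2 \<le> 9 * w \<omega>" for n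
    using uniq w(2) AE_space
  proof eventually_elim
    case (elim \<omega>)
    let ?x = "scaled_increments (Suc n) \<omega>"
    obtain i where i: "i \<le> Suc n" "\<forall>i'\<le>Suc n. is_min (Suc n) ?x i' \<longleftrightarrow> i' = i" using elim(1) by blast
    have "walk_vervaat (Suc n) (k (Suc n)) ?x = window (Suc n) (k (Suc n)) i ?x"
      unfolding walk_vervaat_def using sum_is_min[OF i] .
    moreover have "(window (Suc n) (k (Suc n)) i ?x)\<^sup>2 \<le> 9 * (real (Suc n) * w \<omega>)"
    proof (rule window_square_le[OF _ i(1) k])
      fix j assume j: "j \<le> Suc n"
      have "(psum ?x j)\<^sup>2 = real (Suc n) * (B (real j / Suc n) \<omega>)\<^sup>2"
        by (simp only: psum_scaled_increments[OF j elim(3)] power_mult_distrib) simp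
      also have "\<dots> \<le> real (Suc n) * w \<omega>"
        using elim(2) grid_in_unit[OF j] by (intro mult_left_mono) auto
      finally show "(psum ?x j)\<^sup>2 \<le> real (Suc n) * w \<omega>" .
    qed
    ultimately have "(walk_vervaat (Suc n) (k (Suc n)) ?x)\<^sup>2 / real (Suc n) \<le> 9 * (real (Suc n) * w \<omega>) / real (Suc n)"
      by (intro divide_right_mono) (simp_all only: of_nat_0_le_iff)
    moreover have "(v (Suc n) \<omega>)\<^sup>2 = (walk_vervaat (Suc n) (k (Suc n)) ?x)\<^sup>2 / real (Suc n)"
      unfolding v_def power_divide by simp
    moreover have "9 * (real (Suc n) * w \<omega>) / real (Suc n) = 9 * w \<omega>" by (simp del: of_nat_Suc)
    ultimately show ?case by (simp only:)
  qed
  have le_sq: "\<bar>y\<bar> \<le> 1 + y\<^sup>2" for y :: real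
    using zero_le_power2[of "\<bar>y\<bar> - 1"] by (simp add: power2_eq_square algebra_simps)
  have bound1: "AE \<omega> in M. norm (v (Suc n) \<omega>) \<le> 1 + 9 * w \<omega>" for n
    using bound[of n]
  proof eventually_elim
    case (elim \<omega>)
    with le_sq[of "v (Suc n) \<omega>"] show ?case by simp
  qed
  have bound2: "AE \<omega> in M. norm ((v (Suc n) \<omega>)\<^sup>2) \<le> 9 * w \<omega>" for n
    using bound[of n] by simp
  have lim2: "AE \<omega> in M. (\<lambda>n. (v (Suc n) \<omega>)\<^sup>2) \<longlonglongrightarrow> (V \<omega>)\<^sup>2"
    using lim by eventually_elim (rule tendsto_power)
  have Vm[measurable]: "V \<in> borel_measurable M" unfolding V_def by (rule measurable_vervaat)
  have vm: "v (Suc n) \<in> borel_measurable M" for n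
    by (rule borel_measurable_has_bochner_integral[OF v1]) simp
  have vm2: "(\<lambda>\<omega>. (v (Suc n) \<omega>)\<^sup>2) \<in> borel_measurable M" for n
    by (rule borel_measurable_has_bochner_integral[OF v2]) simp
  have wi: "integrable M (\<lambda>\<omega>. 1 + 9 * w \<omega>)" "integrable M (\<lambda>\<omega>. 9 * w \<omega>)" using w(1) by auto
  show "integrable M V"
    by (rule integrable_dominated_convergence[OF Vm vm wi(1) lim bound1])
  have V2m: "(\<lambda>\<omega>. (V \<omega>)\<^sup>2) \<in> borel_measurable M" by measurable
  show "integrable M (\<lambda>\<omega>. (V \<omega>)\<^sup>2)"
    by (rule integrable_dominated_convergence[OF V2m vm2 wi(2) lim2 bound2])
  have "(\<lambda>n. expectation (v (Suc n))) \<longlonglongrightarrow> expectation V"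
    by (rule integral_dominated_convergence[OF Vm vm wi(1) lim bound1])
  moreover have "expectation (v (Suc n)) = (\<Sum>i\<le>Suc n. window_mean (Suc n) (k (Suc n)) i) / sqrt (Suc n)" for n
    by (rule has_bochner_integral_integral_eq[OF v1]) simp
  moreover have "(\<lambda>n. (\<Sum>i\<le>Suc n. window_mean (Suc n) (k (Suc n)) i) / sqrt (Suc n)) \<longlonglongrightarrow> sqrt (8 / pi) * (sqrt t + sqrt (1 - t) - 1)"
    by (rule LIMSEQ_Suc[OF walk_mean_limit[OF _ _ k klim]]) (use t in auto)
  ultimately show "expectation V = sqrt (8 / pi) * (sqrt t + sqrt (1 - t) - 1)"
    by (simp only:) (rule LIMSEQ_unique)
  let ?J = "4 * pi * t + 8 * (1 - 2 * t) * arcsin (sqrt t) - 8 * (sqrt t * sqrt (1 - t))"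
  have "(\<lambda>n. expectation (\<lambda>\<omega>. (v (Suc n) \<omega>)\<^sup>2)) \<longlonglongrightarrow> expectation (\<lambda>\<omega>. (V \<omega>)\<^sup>2)"
    by (rule integral_dominated_convergence[OF V2m vm2 wi(2) lim2 bound2])
  moreover have "expectation (\<lambda>\<omega>. (v (Suc n) \<omega>)\<^sup>2) = (\<Sum>i\<le>Suc n. window_mean2 (Suc n) (k (Suc n)) i) / real (Suc n)" for n
    by (rule has_bochner_integral_integral_eq[OF v2]) simp
  moreover have "(\<lambda>n. (\<Sum>i\<le>Suc n. window_mean2 (Suc n) (k (Suc n)) i) / real (Suc n)) \<longlonglongrightarrow> t + ?J / (2 * pi)"
    unfolding pair_integrand_integral[OF t, symmetric]
    by (rule LIMSEQ_Suc[OF walk_second_moment_limit[OF _ _ k klim]]) (use t in auto)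
  ultimately have "expectation (\<lambda>\<omega>. (V \<omega>)\<^sup>2) = t + ?J / (2 * pi)"
    by (simp only:) (rule LIMSEQ_unique)
  also have "\<dots> = 3 * t + (4 - 8 * t) / pi * arcsin (sqrt t) - 4 / pi * sqrt (t * (1 - t))"
    unfolding real_sqrt_mult by (simp add: field_simps)
  finally show "expectation (\<lambda>\<omega>. (V \<omega>)\<^sup>2) = 3 * t + (4 - 8 * t) / pi * arcsin (sqrt t) - 4 / pi * sqrt (t * (1 - t))" .
qed

lemma vervaat_at_0:
  assumes "\<omega> \<in> space M" shows "vervaat (\<lambda>s. B s \<omega>) 0 = 0"
proof (cases "argmin \<omega> = 1")
  case True
  then show ?thesis using start_at_0[OF assms] by (simp add: vervaat_def)
next
  case False
  then have "argmin \<omega> < 1" using argmin_bounds(2)[OF assms] by simp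
  then show ?thesis using argmin_bounds(1)[OF assms] by (simp add: vervaat_def frac_eq)
qed

lemma vervaat_at_1: "AE \<omega> in M. vervaat (\<lambda>s. B s \<omega>) 1 = B 1 \<omega>"
  using AE_argmin_less_1 AE_space
proof eventually_elim
  case (elim \<omega>)
  have "frac (argmin \<omega> + 1) = argmin \<omega>"
    using elim argmin_bounds(1)[OF elim(2)] by (simp add: frac_1_eq frac_eq)
  then show ?case using argmin_bounds(1)[OF elim(2)] by (simp add: vervaat_def)
qed

lemma end_value_moments:
  "has_bochner_integral M (B 1) 0" "has_bochner_integral M (\<lambda>\<omega>. (B 1 \<omega>)\<^sup>2) 1"
proof -
  have D: "distributed M lborel (\<lambda>\<omega>. B 1 \<omega> - B 0 \<omega>) std_normal_density"
    using normal_increments[of 0 1] by simp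
  have m[measurable]: "B 1 \<in> borel_measurable M" by (rule random_variable_B) simp
  have nn: "\<And>x::real. x \<in> space lborel \<Longrightarrow> 0 \<le> std_normal_density x" by simp
  have eq: "B 1 \<omega> - B 0 \<omega> = B 1 \<omega>" if "\<omega> \<in> space M" for \<omega> using start_at_0[OF that] by simp
  have "integrable M (\<lambda>\<omega>. (B 1 \<omega> - B 0 \<omega>) ^ j)" for j
    using distributed_integrable[OF D, of "\<lambda>x. x ^ j"] integrable_std_normal_moment[of j] by simp
  then have i: "integrable M (\<lambda>\<omega>. (B 1 \<omega>) ^ j)" for j
    by (simp add: eq cong: Bochner_Integration.integrable_cong)
  have e: "expectation (B 1) = 0"
    using standard_normal_distributed_expectation[OF D] by (simp add: eq cong: Bochner_Integration.integral_cong)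
  show "has_bochner_integral M (B 1) 0" using i[of 1] e by (simp add: has_bochner_integral_iff)
  have "expectation (\<lambda>\<omega>. (B 1 \<omega> - B 0 \<omega>)\<^sup>2) = 1"
    using standard_normal_distributed_variance[OF D] standard_normal_distributed_expectation[OF D] by simp
  then have "expectation (\<lambda>\<omega>. (B 1 \<omega>)\<^sup>2) = 1" by (simp add: eq cong: Bochner_Integration.integral_cong)
  then show "has_bochner_integral M (\<lambda>\<omega>. (B 1 \<omega>)\<^sup>2) 1" using i[of 2] by (simp add: has_bochner_integral_iff)
qed

end

theorem proposition4p12:
  fixes M :: "'a measure" and B :: "real \<Rightarrow> 'a \<Rightarrow> real" and t :: real
  assumes "standard_brownian_motion M B"
    and "t \<in> {0..1}"
  shows "integrable M (\<lambda>\<omega>. vervaat (\<lambda>s. B s \<omega>) t)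
    \<and> prob_space.expectation M (\<lambda>\<omega>. vervaat (\<lambda>s. B s \<omega>) t)
        = sqrt (8 / pi) * (sqrt t + sqrt (1 - t) - 1)
    \<and> integrable M (\<lambda>\<omega>. (vervaat (\<lambda>s. B s \<omega>) t)\<^sup>2)
    \<and> prob_space.expectation M (\<lambda>\<omega>. (vervaat (\<lambda>s. B s \<omega>) t)\<^sup>2)
        = 3 * t + (4 - 8 * t) / pi * arcsin (sqrt t) - 4 / pi * sqrt (t * (1 - t))"
proof -
  interpret standard_brownian_motion M B by fact
  consider "0 < t" "t < 1" | "t = 0" | "t = 1" using assms(2) by force
  then show ?thesis
  proof cases
    case 1
    then show ?thesis using vervaat_moments_interior[of t] by blast
  next
    case 2
    have "integrable M (\<lambda>\<omega>. vervaat (\<lambda>s. B s \<omega>) 0)" "integrable M (\<lambda>\<omega>. (vervaat (\<lambda>s. B s \<omega>) 0)\<^sup>2)"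
      by (simp_all add: vervaat_at_0 cong: Bochner_Integration.integrable_cong)
    moreover have "expectation (\<lambda>\<omega>. vervaat (\<lambda>s. B s \<omega>) 0) = 0" "expectation (\<lambda>\<omega>. (vervaat (\<lambda>s. B s \<omega>) 0)\<^sup>2) = 0"
      by (simp_all add: vervaat_at_0 cong: Bochner_Integration.integral_cong)
    ultimately show ?thesis unfolding 2 by simp
  next
    case 3
    have m: "B 1 \<in> borel_measurable M" "(\<lambda>\<omega>. vervaat (\<lambda>s. B s \<omega>) 1) \<in> borel_measurable M"
      by (auto intro: random_variable_B measurable_vervaat)
    have m2: "(\<lambda>\<omega>. (B 1 \<omega>)\<^sup>2) \<in> borel_measurable M" "(\<lambda>\<omega>. (vervaat (\<lambda>s. B s \<omega>) 1)\<^sup>2) \<in> borel_measurable M"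
      using m by auto
    have e2: "AE \<omega> in M. (vervaat (\<lambda>s. B s \<omega>) 1)\<^sup>2 = (B 1 \<omega>)\<^sup>2"
      using vervaat_at_1 by eventually_elim simp
    have "has_bochner_integral M (\<lambda>\<omega>. vervaat (\<lambda>s. B s \<omega>) 1) 0"
      using has_bochner_integral_cong_AE[OF m(2,1) vervaat_at_1] end_value_moments(1) by simp
    moreover have "has_bochner_integral M (\<lambda>\<omega>. (vervaat (\<lambda>s. B s \<omega>) 1)\<^sup>2) 1"
      using has_bochner_integral_cong_AE[OF m2(2,1) e2] end_value_moments(2) by simp
    ultimately show ?thesis unfolding 3 by (simp add: has_bochner_integral_iff)
  qed
qed

end
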